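(* Let $p\ge1$, let $\Gamma\subset\mathbb{R}^m$ be a convex closed cone and $\widehat{\Gamma}=\{t\in\mathbb{R}^m:\langle t,y\rangle\ge 0\ \forall y\in\Gamma\}$ its conjugate cone. Let $f(x)$ be an almost periodic function by Stepanoff (of order $p$) on $\mathbb{R}^m$ with Fourier series $\sum_{n=0}^{\infty}a_n e^{i\langle x,\lambda_n\rangle}$, where all the exponents $\lambda_n$ belong to $\Gamma$. Then there exists a function $F(z)$ on the tube set $T_{\widehat{\Gamma}}$ that is almost periodic by Stepanoff on $T_{\widehat{\Gamma}}$, has Fourier series $\sum_{n=0}^\infty a_n e^{i\langle z,\lambda_n\rangle}$, and satisfies $F(x)=f(x)$ for $x\in\mathbb{R}^m$. The function $F$ is holomorphic and almost periodic by Bohr on every domain $T_{\widehat{\Gamma}+b}$ with $b$ in the interior of $\widehat{\Gamma}$. Moreover, for every cone $\Gamma'\subset\subset\widehat{\Gamma}$, $\lim_{\|y\|\to\infty}F(z)=a_0$ uniformly with respect to $z=x+iy\in T_{\Gamma'}$, where $a_0$ is the Fourier coefficient for the exponent $\lambda=0$ (with $a_0=0$ if $0\notin\operatorname{sp} f$). If $\operatorname{sp} f$ is contained in the interior of $\Gamma$, then this limit holds uniformly with respect to $z\in T_{\widehat{\Gamma}+b}$ for every $b$ in the interior of $\widehat{\Gamma}$.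
   Context: For $K\subset\mathbb{R}^m$, $T_K=\{z=x+iy: x\in\mathbb{R}^m, y\in K\}$. For functions $f,g$ locally integrable on every real plane $\{x+iy_0:x\in\mathbb{R}^m\}$, $y_0\in K$, the Stepanoff distance of order $p\ge1$ is $S_{p,T_K}(f,g)=\sup_{z\in T_K}\big(\int_{[0,1]^m}|f(z+u)-g(z+u)|^p du\big)^{1/p}$. A function $f$ on $T_K$ is almost periodic by Stepanoff if for every $\varepsilon>0$ there is $l>0$ such that every $m$-dimensional cube of side $l$ in $\mathbb{R}^m$ contains a $\tau$ with $S_{p,T_K}(f(z),f(z+\tau))<\varepsilon$. A continuous $f$ on $T_K$ is almost periodic by Bohr if for every $\varepsilon>0$ there is $l$ such that every cube of side $l$ contains $\tau$ with $\sup_{z\in T_K}|f(z+\tau)-f(z)|<\varepsilon$. Fourier coefficients: $a(\lambda,y)=\lim_{N\to\infty}(2N)^{-m}\int_{[-N,N]^m}f(x+x'+iy)e^{-i\langle x+x',\lambda\rangle}dx$ (uniform in $x'$, independent of $x'$); the spectrum $\operatorname{sp} f$ is the set of $\lambda$ with $a(\lambda,\cdot)\not\equiv0$, enumerated as $\lambda_n$, $a_n=a(\lambda_n,\cdot)$; the Fourier series is $\sum_n a(\lambda_n,y)e^{i\langle x,\lambda_n\rangle}$. For cones, $\Gamma'\subset\subset\widehat{\Gamma}$ means the intersection of $\Gamma'$ with the unit sphere lies in the interior of the intersection of $\widehat{\Gamma}$ with the unit sphere.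
   Formalization: Γ'⊂⊂Γ̂ is taken with the closure of Γ'∩sphere in the interior (else false: Γ the quadrant, f=e^{ix₁}, Γ' the open quadrant); F(x)=f(x) is asserted for almost every x (pointwise fails for Γ={0}, f the indicator of a point); functions are Borel measurable. *)

theory Defs
  imports "HOL-Analysis.Analysis"
begin

definition cvec :: "real ^ 'm \<Rightarrow> real ^ 'm \<Rightarrow> complex ^ 'm" where
  "cvec x y = (\<chi> i. Complex (x $ i) (y $ i))"

definition Im_v :: "complex ^ 'm \<Rightarrow> real ^ 'm" where
  "Im_v z = (\<chi> i. Im (z $ i))"

definition tube :: "(real ^ 'm) set \<Rightarrow> (complex ^ 'm) set" where
  "tube K = {z. Im_v z \<in> K}"

definition cinner :: "complex ^ 'm \<Rightarrow> real ^ 'm \<Rightarrow> complex" where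
  "cinner z l = (\<Sum>i\<in>UNIV. z $ i * complex_of_real (l $ i))"

definition cube :: "real ^ 'm \<Rightarrow> real \<Rightarrow> (real ^ 'm) set" where
  "cube a l = cbox a (\<chi> i. a $ i + l)"

definition stepanoff_dist ::
  "real \<Rightarrow> (real ^ 'm) set \<Rightarrow> (complex ^ 'm \<Rightarrow> complex) \<Rightarrow> (complex ^ 'm \<Rightarrow> complex) \<Rightarrow> ennreal" where
  "stepanoff_dist p K f g =
     (let S = (SUP z\<in>tube K. \<integral>\<^sup>+ u\<in>cbox 0 (\<chi> i. 1).
                 ennreal (norm (f (z + cvec u 0) - g (z + cvec u 0)) powr p) \<partial>lborel)
      in if S = top then top else ennreal (enn2real S powr (1 / p)))"

definition loc_int_planes :: "(real ^ 'm) set \<Rightarrow> (complex ^ 'm \<Rightarrow> complex) \<Rightarrow> bool" where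
  "loc_int_planes K f \<longleftrightarrow>
     (\<forall>y\<in>K. \<forall>C. compact C \<longrightarrow> set_integrable lborel C (\<lambda>x. f (cvec x y)))"

definition stepanoff_ap :: "real \<Rightarrow> (real ^ 'm) set \<Rightarrow> (complex ^ 'm \<Rightarrow> complex) \<Rightarrow> bool" where
  "stepanoff_ap p K f \<longleftrightarrow> loc_int_planes K f \<and>
     (\<forall>\<epsilon>>0. \<exists>l>0. \<forall>a. \<exists>\<tau>\<in>cube a l.
        stepanoff_dist p K f (\<lambda>z. f (z + cvec \<tau> 0)) < ennreal \<epsilon>)"

definition bohr_ap :: "(real ^ 'm) set \<Rightarrow> (complex ^ 'm \<Rightarrow> complex) \<Rightarrow> bool" where
  "bohr_ap K f \<longleftrightarrow> continuous_on (tube K) f \<and>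
     (\<forall>\<epsilon>>0. \<exists>l>0. \<forall>a. \<exists>\<tau>\<in>cube a l.
        (SUP z\<in>tube K. ereal (norm (f (z + cvec \<tau> 0) - f z))) < ereal \<epsilon>)"

definition holo_on :: "(complex ^ 'm \<Rightarrow> complex) \<Rightarrow> (complex ^ 'm) set \<Rightarrow> bool" where
  "holo_on f S \<longleftrightarrow>
     (\<forall>z\<in>S. \<exists>c :: complex ^ 'm. (f has_derivative (\<lambda>h. \<Sum>i\<in>UNIV. c $ i * h $ i)) (at z))"

definition has_fcoef ::
  "(complex ^ 'm \<Rightarrow> complex) \<Rightarrow> real ^ 'm \<Rightarrow> real ^ 'm \<Rightarrow> complex \<Rightarrow> bool" where
  "has_fcoef f l y c \<longleftrightarrow>
     (\<forall>\<epsilon>>0. \<exists>N0. \<forall>N\<ge>N0. \<forall>x'.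
        norm (complex_of_real (inverse ((2 * N) ^ CARD('m))) *
              (LINT x : cbox (\<chi> i. - N) (\<chi> i. N) | lborel.
                 f (cvec (x + x') y) * exp (- \<i> * cinner (cvec (x + x') 0) l)) - c) < \<epsilon>)"

definition fcoef :: "(complex ^ 'm \<Rightarrow> complex) \<Rightarrow> real ^ 'm \<Rightarrow> real ^ 'm \<Rightarrow> complex" where
  "fcoef f l y = (THE c. has_fcoef f l y c)"

text \<open>A function on R^m viewed on the tube T_{0}.\<close>
definition real_ext :: "(real ^ 'm \<Rightarrow> complex) \<Rightarrow> complex ^ 'm \<Rightarrow> complex" where
  "real_ext f z = f (\<chi> i. Re (z $ i))"

definition dual_cone :: "(real ^ 'm) set \<Rightarrow> (real ^ 'm) set" where
  "dual_cone G = {t. \<forall>y\<in>G. t \<bullet> y \<ge> 0}"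

definition cone_cc :: "(real ^ 'm) set \<Rightarrow> (real ^ 'm) set \<Rightarrow> bool" where
  "cone_cc G' G \<longleftrightarrow>
     closure (G' \<inter> sphere 0 1) \<subseteq> (top_of_set (sphere 0 1)) interior_of (G \<inter> sphere 0 1)"

end

theory Submission
  imports Defs "HOL-Probability.Sinc_Integral" "HOL-Complex_Analysis.Complex_Analysis" "HOL-Real_Asymp.Real_Asymp"
begin

text \<open>On the plane with imaginary part \<open>y\<close> put \<open>F(x + iy) = \<integral> f(x + ty) dt / (\<pi>(1 + t\<^sup>2))\<close>.
  For a trigonometric polynomial with exponents in \<open>\<Gamma>\<close> and \<open>y\<close> in the dual cone this is its holomorphic
  continuation, and by Jensen the integral does not increase Stepanoff distances. It therefore suffices
  to approximate \<open>f\<close>, in the Stepanoff norm of order 1, by trigonometric polynomials whose exponents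
  lie in the spectrum of \<open>f\<close>.

  These are obtained by averaging \<open>f(x + t)\<close> over \<open>t\<close> with the weight \<open>max 0 (1 - D(t)/\<epsilon>)\<close>, where
  \<open>D(t)\<close> is the Stepanoff distance of \<open>f\<close> and its translate by \<open>t\<close>, once the weight is replaced by one
  of its Fourier partial sums. That this replacement is possible is Parseval's identity for the
  weight, proved by testing the residual against windowed correlations.

  In the interior of the tube a product of one-dimensional Poisson integrals over a basis of the dual cone
  and Harnack's inequality bound a polynomial uniformly by its Stepanoff norm on the real plane. So the
  polynomials converge uniformly there, which gives holomorphy, Bohr almost periodicity and
  the limits at infinity.\<close>

text \<open>The distance D(t) is itself a bounded Bohr almost periodic function of t, even when f is
  unbounded, so Bessel and Parseval are only needed for a bounded, uniformly continuous weight. The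
  obstacle is completeness: a residual r of the weight whose Fourier coefficients are all small must
  be small in mean square. Since r is orthogonal to the subtracted partial sum, its mean square is
  its correlation with the weight phi. For the t with D(t) small, a set of positive mean weight,
  phi(x) is nearly phi(x + t); averaging over them turns the correlation into a triple one, which in
  frequency is a product of three window transforms. One is bounded uniformly by the windowed
  coefficients of r, the other two are controlled in mean square. Frequencies are averaged against a
  product Cauchy law, so that the transform of the Cauchy density is the only one ever computed; the
  same law later gives the Poisson integrals. The exponents must stay in the spectrum because the
  Poisson integral of an exponential is its holomorphic continuation only if exponent and direction
  pair nonnegatively.\<close>

section \<open>The Cauchy density and its Fourier transform\<close>

definition cauchy_density :: "real \<Rightarrow> real" where
  "cauchy_density t = 1 / (pi * (1 + t\<^sup>2))"

lemma cauchy_density_pos: "cauchy_density t > 0"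
  unfolding cauchy_density_def by (intro divide_pos_pos mult_pos_pos) (auto intro: add_pos_nonneg)

lemma cauchy_density_nonneg [simp]: "0 \<le> cauchy_density t"
  using cauchy_density_pos[of t] by simp

lemma borel_measurable_cauchy_density [measurable]: "cauchy_density \<in> borel_measurable borel"
  unfolding cauchy_density_def[abs_def] by measurable

lemma has_bochner_integral_cauchy_density: "has_bochner_integral lborel cauchy_density 1"
proof -
  have 1: "integrable lborel (\<lambda>x::real. inverse (1 + x\<^sup>2))"
    using integrable_inverse_1_plus_square by (simp add: set_integrable_def)
  have 2: "(LINT x|lborel. inverse (1 + x\<^sup>2)) = pi"
    using LBINT_inverse_1_plus_square
    by (simp add: interval_lebesgue_integral_def set_lebesgue_integral_def)
  have "has_bochner_integral lborel (\<lambda>x::real. inverse pi * inverse (1 + x\<^sup>2)) (inverse pi * pi)"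
    by (rule has_bochner_integral_mult_right) (use has_bochner_integral_integrable[OF 1] 2 in simp)
  thus ?thesis by (simp add: cauchy_density_def[abs_def] field_simps)
qed

text \<open>Subtracting the constant \<open>exp (- s)\<close>, the value of the exponential at
  \<open>\<i>\<close>, removes the pole in the upper half plane. What remains is holomorphic on a
  convex set, so Cauchy's theorem applies and no residue has to be computed.\<close>

lemma upper_half_plane_quotient_holomorphic:
  fixes s :: real
  defines "S \<equiv> {z. Im z > - 1/2}"
  obtains F where "F holomorphic_on S"
    "\<And>z. z \<in> S \<Longrightarrow> z \<noteq> \<i> \<Longrightarrow> F z = (exp (\<i> * s * z) - exp (- of_real s)) / (z\<^sup>2 + 1)"
proof -
  \<comment> \<open>\<open>G\<close> is the difference quotient of the exponential at
    \<open>\<i>\<close>, completed by the derivative. The other root \<open>- \<i>\<close> of the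
    denominator lies below the line bounding \<open>S\<close>.\<close>
  define G where "G = (\<lambda>z. if z = \<i> then deriv (\<lambda>z. exp (\<i> * s * z)) \<i> 
       else (exp (\<i> * s * z) - exp (\<i> * s * \<i>)) / (z - \<i>))"
  have S: "open S" unfolding S_def by (rule open_halfspace_Im_gt)
  have "(\<lambda>z. exp (\<i> * s * z)) holomorphic_on S" by (intro holomorphic_intros)
  hence G: "G holomorphic_on S" unfolding G_def by (rule pole_lemma_open) (rule S)
  have ne: "z + \<i> \<noteq> 0" if "z \<in> S" for z
    using that by (auto simp: S_def complex_eq_iff)
  show ?thesis
  proof (rule that[of "\<lambda>z. G z / (z + \<i>)"])
    show "(\<lambda>z. G z / (z + \<i>)) holomorphic_on S" using G ne by (intro holomorphic_intros) auto
  next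
    fix z assume z: "z \<in> S" "z \<noteq> \<i>"
    have "z\<^sup>2 + 1 = (z - \<i>) * (z + \<i>)" by (simp add: power2_eq_square algebra_simps)
    moreover have "exp (\<i> * s * \<i>) = exp (- of_real s :: complex)"
      by (rule arg_cong[of _ _ exp]) (simp add: algebra_simps power2_eq_square)
    ultimately show "G z / (z + \<i>) = (exp (\<i> * s * z) - exp (- of_real s)) / (z\<^sup>2 + 1)"
      using z ne[OF z(1)] by (simp add: G_def)
  qed
qed

text \<open>The segment is closed by the upper semicircle. There \<open>s \<ge> 0\<close> bounds the
  exponential by 1, hence the numerator by 2, while the denominator is at least
  \<open>R\<^sup>2 - 1\<close> and the arc has length \<open>R * pi\<close>.\<close>

lemma cauchy_density_fourier_partial_bound:
  fixes s R :: real
  assumes s: "s \<ge> 0" and R: "R > 1"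
  shows "norm (integral {-R..R} (\<lambda>t. (exp (\<i> * s * of_real t) - exp (- of_real s)) / ((of_real t)\<^sup>2 + 1) :: complex))
     \<le> 2 / (R\<^sup>2 - 1) * R * pi"
proof -
  define S where "S = {z. Im z > - 1/2}"
  obtain F where F: "F holomorphic_on S"
    "\<And>z. z \<in> S \<Longrightarrow> z \<noteq> \<i> \<Longrightarrow> F z = (exp (\<i> * s * z) - exp (- of_real s)) / (z\<^sup>2 + 1)"
    using upper_half_plane_quotient_holomorphic[of s] unfolding S_def by metis
  have S: "open S" "convex S" unfolding S_def
    by (rule open_halfspace_Im_gt) (simp add: convex_halfspace_Im_gt)
  let ?g = "part_circlepath 0 R 0 pi" and ?l = "linepath (- of_real R) (of_real R :: complex)"
  have arc: "Im z \<ge> 0" "norm z = R" if "z \<in> path_image ?g" for z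
  proof -
    from that obtain t where t: "t \<in> {0..pi}" "z = R * exp (\<i> * t)" 
      using R by (auto simp: path_image_part_circlepath)
    have "sin t \<ge> 0" using t by (intro sin_ge_zero) auto
    thus "Im z \<ge> 0" using t R by (simp add: Im_exp)
    show "norm z = R" using t R by (simp add: norm_mult)
  qed
  have lin: "Im z = 0" if "z \<in> path_image ?l" for z
    using that by (auto simp: closed_segment_def)
  have sub: "path_image ?g \<subseteq> S" "path_image ?l \<subseteq> S"
    using arc lin by (force simp: S_def)+
  have cont: "continuous_on S F" using F(1) by (rule holomorphic_on_imp_continuous_on)
  have I: "F contour_integrable_on ?g" "F contour_integrable_on ?l"
    using sub cont by (auto intro!: contour_integrable_continuous_part_circlepath 
       contour_integrable_continuous_linepath intro: continuous_on_subset)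
  have j: "pathfinish ?l = pathstart ?g" by simp
  have "(F has_contour_integral 0) (?l +++ ?g)"
    by (rule Cauchy_theorem_convex_simple[OF F(1) S(2)])
       (use sub R in \<open>auto simp: path_image_join exp_Euler\<close>)
  hence "contour_integral ?l F + contour_integral ?g F = 0"
    using I by (subst contour_integral_join[symmetric]) (auto simp: contour_integral_unique)
  hence eq: "contour_integral ?l F = - contour_integral ?g F" by (simp add: add_eq_0_iff2)
  have "norm (contour_integral ?g F) \<le> 2 / (R\<^sup>2 - 1) * R * \<bar>pi - 0\<bar>"
  proof (rule contour_integral_bound_part_circlepath[OF I(1)])
    have R2: "R\<^sup>2 > 1" using R by (simp add: one_less_power)
    show "0 \<le> 2 / (R\<^sup>2 - 1)" "0 \<le> R" using R R2 by auto
    fix z assume z: "z \<in> path_image ?g"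
    have "z \<noteq> \<i>" using arc(2)[OF z] R by auto
    hence "F z = (exp (\<i> * s * z) - exp (- of_real s)) / (z\<^sup>2 + 1)" using F(2) z sub by blast
    moreover have "norm (exp (\<i> * s * z) - exp (- of_real s)) \<le> 1 + 1"
      using s arc(1)[OF z] by (intro order_trans[OF norm_triangle_ineq4] add_mono) auto
    moreover have "R\<^sup>2 - 1 \<le> norm (z\<^sup>2 + 1)"
      using norm_diff_ineq[of "z\<^sup>2" 1] arc(2)[OF z] by (simp add: norm_power)
    ultimately show "norm (F z) \<le> 2 / (R\<^sup>2 - 1)"
      using R2 by (simp add: norm_divide frac_le)
  qed
  moreover have "contour_integral ?l F = integral {-R..R} (\<lambda>x. F (of_real x))"
    using contour_integral_linepath_Reals_eq[of "- of_real R" "of_real R" F] R by simp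
  moreover have "integral {-R..R} (\<lambda>x. F (of_real x)) = 
      integral {-R..R} (\<lambda>t. (exp (\<i> * s * of_real t) - exp (- of_real s)) / ((of_real t)\<^sup>2 + 1))"
    by (rule integral_cong, rule F(2)) (auto simp: S_def complex_eq_iff)
  ultimately have "integral {-R..R} (\<lambda>t. (exp (\<i> * s * of_real t) - exp (- of_real s)) / ((of_real t)\<^sup>2 + 1))
     = - contour_integral ?g F" using eq by metis
  thus ?thesis using \<open>norm (contour_integral ?g F) \<le> _\<close> by (simp only: norm_minus_cancel) simp
qed

text \<open>The truncated integrals of the difference are of order \<open>1 / n\<close> and tend to
  0; as the density has mass 1, the transform equals the subtracted constant.\<close>

lemma cauchy_density_fourier_nonneg:
  fixes s :: real
  assumes s: "s \<ge> 0"
  shows "(LINT t|lborel. exp (\<i> * s * of_real t) * cauchy_density t) = exp (- of_real s)"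
proof -
  define h where "h = (\<lambda>t::real. (exp (\<i> * s * of_real t) - exp (- of_real s)) * cauchy_density t)"
  have iP: "integrable lborel (\<lambda>t. complex_of_real (cauchy_density t))"
    using has_bochner_integral_cauchy_density by (simp add: has_bochner_integral_iff)
  have i1: "integrable lborel (\<lambda>t. exp (\<i> * s * of_real t) * cauchy_density t)"
    by (rule Bochner_Integration.integrable_bound[OF iP]) (auto simp: norm_mult)
  have i2: "integrable lborel h" unfolding h_def left_diff_distrib
    by (intro Bochner_Integration.integrable_diff i1 integrable_mult_right iP)
  have lim: "(\<lambda>n. LINT t|lborel. indicator {- real n..real n} t *\<^sub>R h t) \<longlonglongrightarrow> (LINT t|lborel. h t)"
  proof (rule integral_dominated_convergence[where w="\<lambda>t. norm (h t)"])
    show "AE x in lborel. (\<lambda>n. indicat_real {- real n..real n} x *\<^sub>R h x) \<longlonglongrightarrow> h x"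
    proof (rule AE_I2)
      fix x :: real
      obtain n0 where "real n0 \<ge> \<bar>x\<bar>" using real_arch_simple by blast
      hence "\<forall>n\<ge>n0. indicat_real {- real n..real n} x *\<^sub>R h x = h x" by (auto simp: indicator_def)
      thus "(\<lambda>n. indicat_real {- real n..real n} x *\<^sub>R h x) \<longlonglongrightarrow> h x"
        by (intro tendsto_eventually) (auto simp: eventually_sequentially)
    qed
  qed (use i2 in \<open>auto simp: indicator_def\<close>)
  have bd: "norm (LINT t|lborel. indicator {- real n..real n} t *\<^sub>R h t) \<le> 2 / ((real n)\<^sup>2 - 1) * real n"
    if "n \<ge> 2" for n :: nat
  proof -
    have "(LINT t|lborel. indicator {- real n..real n} t *\<^sub>R h t) = integral {-real n..real n} h"
      using set_borel_integral_eq_integral(2)[of "{-real n..real n}" h] i2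
      by (simp add: set_integrable_def set_lebesgue_integral_def integrable_mult_indicator)
    moreover have "h = (\<lambda>t. of_real (inverse pi) * ((exp (\<i> * s * of_real t) - exp (- of_real s)) / ((of_real t)\<^sup>2 + 1)))"
      by (auto simp: h_def cauchy_density_def divide_simps add.commute fun_eq_iff)
    hence "integral {-real n..real n} h = of_real (inverse pi) * 
      integral {-real n..real n} (\<lambda>t. (exp (\<i> * s * of_real t) - exp (- of_real s)) / ((of_real t)\<^sup>2 + 1))"
      by (simp only:) (rule integral_mult_right)
    ultimately have "norm (LINT t|lborel. indicator {- real n..real n} t *\<^sub>R h t)
      \<le> inverse pi * (2 / ((real n)\<^sup>2 - 1) * real n * pi)"
      using cauchy_density_fourier_partial_bound[OF s, of "real n"] that
      by (simp only: norm_mult, intro mult_mono) (auto simp: norm_inverse)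
    also have "\<dots> = 2 / ((real n)\<^sup>2 - 1) * real n" by (simp add: divide_simps)
    finally show ?thesis .
  qed
  have "(\<lambda>n. LINT t|lborel. indicator {- real n..real n} t *\<^sub>R h t) \<longlonglongrightarrow> 0"
  proof (rule Lim_null_comparison)
    show "\<forall>\<^sub>F n in sequentially. norm (LINT t|lborel. indicator {- real n..real n} t *\<^sub>R h t) \<le> 2 / ((real n)\<^sup>2 - 1) * real n"
      using bd by (auto simp: eventually_sequentially)
    show "(\<lambda>n. 2 / ((real n)\<^sup>2 - 1) * real n) \<longlonglongrightarrow> 0" by real_asymp
  qed
  with lim have "(LINT t|lborel. h t) = 0" using LIMSEQ_unique by blast
  moreover have "(LINT t|lborel. h t) = (LINT t|lborel. exp (\<i> * s * of_real t) * cauchy_density t)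
      - (LINT t|lborel. exp (- of_real s) * of_real (cauchy_density t))"
    unfolding h_def left_diff_distrib
    by (intro Bochner_Integration.integral_diff i1 integrable_mult_right iP)
  moreover have "(LINT t|lborel. complex_of_real (cauchy_density t)) = 1"
    using has_bochner_integral_cauchy_density by (simp add: has_bochner_integral_iff)
  ultimately show ?thesis by simp
qed

lemma integral_exp_cauchy_density:
  fixes s :: real
  shows "(LINT t|lborel. exp (\<i> * of_real (s * t)) * cauchy_density t) = exp (- of_real \<bar>s\<bar>)"
proof (cases "s \<ge> 0")
  case True thus ?thesis using cauchy_density_fourier_nonneg[of s] by (simp add: mult.assoc)
next
  case False
  have "(LINT t|lborel. exp (\<i> * of_real (s * t)) * cauchy_density t)
     = \<bar>-1\<bar> *\<^sub>R (LINT t|lborel. exp (\<i> * of_real (s * (0 + (-1) * t))) * cauchy_density (0 + (-1) * t))"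
    by (rule lborel_integral_real_affine) simp
  also have "\<dots> = (LINT t|lborel. exp (\<i> * (-s) * of_real t) * cauchy_density t)"
    by (simp add: cauchy_density_def mult.assoc)
  also have "\<dots> = exp (- of_real (-s))" using False by (intro cauchy_density_fourier_nonneg) auto
  finally show ?thesis using False by simp
qed

section \<open>Product integrals and the product Cauchy law\<close>

lemma axis_reindex:
  fixes x :: "(real ^ 'm) \<Rightarrow> real"
  shows "(\<Sum>b\<in>(Basis :: (real ^ 'm) set). x b *\<^sub>R b) $ i = x (axis i 1)"
proof -
  have B: "(Basis :: (real ^ 'm) set) = range (\<lambda>i. axis i 1)"
    by (auto simp: Basis_vec_def)
  have "(\<Sum>b\<in>(Basis :: (real ^ 'm) set). x b *\<^sub>R b) = (\<Sum>i\<in>UNIV. x (axis i 1) *\<^sub>R axis i 1)"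
    unfolding B by (subst sum.reindex) (auto simp: inj_on_def axis_eq_axis)
  thus ?thesis by (simp add: axis_def if_distrib cong: if_cong)
qed

text \<open>Lebesgue measure on vectors is the image of a product measure indexed by
  \<open>Basis\<close>, while coordinates are indexed by the type \<open>'m\<close>;
  \<open>k\<close> passes from one index set to the other.\<close>

lemma
  fixes g :: "'m::finite \<Rightarrow> real \<Rightarrow> 'a::{real_normed_field,banach,second_countable_topology}"
  assumes g: "\<And>i. integrable lborel (g i)"
  shows integrable_prod_vec: "integrable lborel (\<lambda>x::real^'m. \<Prod>i\<in>UNIV. g i (x $ i))"
    and integral_prod_vec: "(LINT x|lborel. (\<Prod>i\<in>UNIV. g i ((x::real^'m) $ i))) = (\<Prod>i\<in>UNIV. (LINT t|lborel. g i t))"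
proof -
  interpret product_sigma_finite "\<lambda>b::real^'m. lborel :: real measure" by standard
  define k where "k = (\<lambda>i::'m. axis i (1::real))"
  have inj: "inj k" by (auto simp: inj_on_def axis_eq_axis k_def)
  have B: "(Basis :: (real ^ 'm) set) = range k" by (auto simp: Basis_vec_def k_def)
  have gm [measurable]: "g i \<in> borel_measurable borel" for i using borel_measurable_integrable[OF g[of i]] by simp
  let ?T = "\<lambda>f. \<Sum>b\<in>(Basis :: (real ^ 'm) set). f b *\<^sub>R b"
  have T: "(\<Prod>i\<in>UNIV. g i (?T f $ i)) = (\<Prod>b\<in>Basis. g (inv k b) (f b))" for f
  proof -
    have "(\<Prod>b\<in>Basis. g (inv k b) (f b)) = (\<Prod>i\<in>UNIV. g i (f (k i)))"
      unfolding B by (subst prod.reindex) (auto simp: inj)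
    thus ?thesis by (simp only: axis_reindex k_def)
  qed
  have 1: "integrable (\<Pi>\<^sub>M b\<in>(Basis :: (real ^ 'm) set). lborel) (\<lambda>f. \<Prod>b\<in>Basis. g (inv k b) (f b))"
    by (rule product_integrable_prod) (auto intro: g)
  have 2: "(LINT f|(\<Pi>\<^sub>M b\<in>(Basis :: (real ^ 'm) set). lborel). (\<Prod>b\<in>Basis. g (inv k b) (f b)))
     = (\<Prod>b\<in>Basis. (LINT t|lborel. g (inv k b) t))"
    by (rule product_integral_prod) (auto intro: g)
  have "\<dots> = (\<Prod>i\<in>UNIV. (LINT t|lborel. g i t))"
    unfolding B by (subst prod.reindex) (auto simp: inj)
  moreover have m: "(\<lambda>x::real^'m. \<Prod>i\<in>UNIV. g i (x $ i)) \<in> borel_measurable borel" by measurable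
  moreover have m2: "?T \<in> (\<Pi>\<^sub>M b\<in>(Basis :: (real ^ 'm) set). lborel) \<rightarrow>\<^sub>M borel"
    by (intro borel_measurable_sum borel_measurable_scaleR measurable_component_singleton) auto
  ultimately show "(LINT x|lborel. (\<Prod>i\<in>UNIV. g i ((x::real^'m) $ i))) = (\<Prod>i\<in>UNIV. (LINT t|lborel. g i t))"
    using 2 by (subst lborel_eq, subst integral_distr) (simp_all add: T del: sum_component)
  show "integrable lborel (\<lambda>x::real^'m. \<Prod>i\<in>UNIV. g i (x $ i))"
    by (subst lborel_eq, subst integrable_distr_eq[OF m2 m]) (simp add: T 1 del: sum_component)
qed

definition cauchy_prod :: "real ^ 'm \<Rightarrow> real" where
  "cauchy_prod x = (\<Prod>i\<in>UNIV. cauchy_density (x $ i))"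

lemma cauchy_prod_nonneg [simp]: "0 \<le> cauchy_prod x"
  unfolding cauchy_prod_def by (intro prod_nonneg) simp

lemma borel_measurable_cauchy_prod [measurable]: "cauchy_prod \<in> borel_measurable borel"
  unfolding cauchy_prod_def[abs_def] by measurable

definition cauchy1 :: "real measure" where
  "cauchy1 = density lborel (\<lambda>t. ennreal (cauchy_density t))"

definition cauchyn :: "(real ^ 'm) measure" where
  "cauchyn = density lborel (\<lambda>t. ennreal (cauchy_prod t))"

lemma sets_cauchy1 [simp, measurable_cong]: "sets cauchy1 = sets borel" 
  and sets_cauchyn [simp, measurable_cong]: "sets cauchyn = sets borel"
  and space_cauchy1 [simp]: "space cauchy1 = UNIV" and space_cauchyn [simp]: "space cauchyn = UNIV"
  by (auto simp: cauchy1_def cauchyn_def)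

lemma prob_space_cauchy1: "prob_space cauchy1"
proof
  have "emeasure cauchy1 (space cauchy1) = (\<integral>\<^sup>+t. ennreal (cauchy_density t) \<partial>lborel)"
    by (simp add: cauchy1_def emeasure_density)
  also have "\<dots> = 1" using has_bochner_integral_cauchy_density
    by (subst nn_integral_eq_integral) (auto simp: has_bochner_integral_iff)
  finally show "emeasure cauchy1 (space cauchy1) = 1" .
qed

lemma
  shows integrable_cauchy_prod: "integrable lborel (cauchy_prod :: real^'m \<Rightarrow> real)"
  and integral_cauchy_prod: "integral\<^sup>L lborel (cauchy_prod :: real^'m \<Rightarrow> real) = 1"
  using integrable_prod_vec[of "\<lambda>i::'m. cauchy_density"] integral_prod_vec[of "\<lambda>i::'m. cauchy_density"]
    has_bochner_integral_cauchy_density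
  by (simp_all add: cauchy_prod_def[abs_def] has_bochner_integral_iff)

lemma prob_space_cauchyn: "prob_space (cauchyn :: (real ^ 'm) measure)"
proof
  have "emeasure (cauchyn :: (real ^ 'm) measure) (space cauchyn) = (\<integral>\<^sup>+t. ennreal (cauchy_prod (t::real^'m)) \<partial>lborel)"
    by (simp add: cauchyn_def emeasure_density)
  also have "\<dots> = 1"
    by (subst nn_integral_eq_integral) (auto simp: integrable_cauchy_prod integral_cauchy_prod)
  finally show "emeasure (cauchyn :: (real ^ 'm) measure) (space cauchyn) = 1" .
qed

lemma integral_exp_cauchy1:
  "(LINT t|cauchy1. exp (\<i> * of_real (s * t))) = exp (- of_real \<bar>s\<bar>)"
  unfolding cauchy1_def using integral_exp_cauchy_density[of s]
  by (subst integral_density) (auto simp: scaleR_conv_of_real mult.commute)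

lemma integral_exp_cauchyn:
  fixes s :: "real ^ 'm"
  shows "(LINT t|cauchyn. exp (\<i> * of_real (s \<bullet> t))) = exp (- of_real (\<Sum>i\<in>UNIV. \<bar>s $ i\<bar>))"
proof -
  have "(LINT t|cauchyn. exp (\<i> * of_real (s \<bullet> t))) 
     = (LINT t|lborel. (\<Prod>i\<in>UNIV. exp (\<i> * of_real (s $ i * t $ i)) * cauchy_density (t $ i)))"
    unfolding cauchyn_def
    by (subst integral_density)
      (auto simp: inner_vec_def exp_sum sum_distrib_left scaleR_conv_of_real prod.distrib cauchy_prod_def prod_nonneg
         intro!: Bochner_Integration.integral_cong)
  also have "\<dots> = (\<Prod>i\<in>UNIV. (LINT t|lborel. exp (\<i> * of_real (s $ i * t)) * cauchy_density t))"
  proof (rule integral_prod_vec)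
    fix i
    have "integrable lborel (\<lambda>t. complex_of_real (cauchy_density t))"
      using has_bochner_integral_cauchy_density by (simp add: has_bochner_integral_iff)
    thus "integrable lborel (\<lambda>t. exp (\<i> * of_real (s $ i * t)) * cauchy_density t)"
      by (rule Bochner_Integration.integrable_bound) (auto simp: norm_mult)
  qed
  also have "\<dots> = (\<Prod>i\<in>UNIV. exp (- of_real \<bar>s $ i\<bar>))" by (simp only: integral_exp_cauchy_density)
  also have "\<dots> = exp (- of_real (\<Sum>i\<in>UNIV. \<bar>s $ i\<bar>))"
    by (simp add: exp_sum[symmetric] sum_negf)
  finally show ?thesis .
qed

text \<open>The constant comes from
  \<open>(t - s)\<^sup>2 \<le> 2 * t\<^sup>2 + 2 * s\<^sup>2\<close>. A bounded displacement changes
  the heavy-tailed kernel only by a bounded factor, which later permits averaging over a unit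
  cube.\<close>

lemma cauchy_density_harnack:
  assumes "\<bar>s\<bar> \<le> M"
  shows "cauchy_density t \<le> (2 + 2 * M\<^sup>2) * cauchy_density (t - s)"
proof -
  have "s\<^sup>2 \<le> M\<^sup>2" using assms by (metis abs_ge_zero power2_abs power_mono)
  moreover have "(t - s)\<^sup>2 \<le> 2 * t\<^sup>2 + 2 * s\<^sup>2" using zero_le_power2[of "t + s"]
    by (simp add: power2_eq_square algebra_simps)
  moreover have "0 \<le> M\<^sup>2 * t\<^sup>2" by simp
  ultimately have "1 + (t - s)\<^sup>2 \<le> (2 + 2 * M\<^sup>2) * (1 + t\<^sup>2)"
    unfolding distrib_left distrib_right mult.assoc by linarith
  moreover have "1 + (t-s)\<^sup>2 > 0" "1 + t\<^sup>2 > 0" by (auto intro: add_pos_nonneg)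
  ultimately show ?thesis by (simp add: cauchy_density_def divide_simps mult.commute)
qed

lemma cauchy_prod_harnack:
  fixes s t :: "real ^ 'm"
  assumes "\<And>i. \<bar>s $ i\<bar> \<le> M"
  shows "cauchy_prod t \<le> (2 + 2 * M\<^sup>2) ^ CARD('m) * cauchy_prod (t - s)"
proof -
  have "cauchy_prod t \<le> (\<Prod>i\<in>UNIV. (2 + 2 * M\<^sup>2) * cauchy_density (t $ i - s $ i))"
    unfolding cauchy_prod_def by (intro prod_mono conjI cauchy_density_harnack assms) auto
  thus ?thesis by (simp add: prod.distrib cauchy_prod_def)
qed

section \<open>Translation, cubes and the Stepanoff norm of order 1\<close>

lemma nn_integral_lborel_shift:
  fixes f :: "'a::euclidean_space \<Rightarrow> ennreal"
  assumes [measurable]: "f \<in> borel_measurable borel"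
  shows "(\<integral>\<^sup>+x. f (x + a) \<partial>lborel) = (\<integral>\<^sup>+x. f x \<partial>lborel)"
proof -
  have "(\<integral>\<^sup>+x. f x \<partial>lborel) = (\<integral>\<^sup>+x. f x \<partial>distr lborel borel ((+) a))"
    by (simp add: lborel_distr_plus)
  also have "\<dots> = (\<integral>\<^sup>+x. f (a + x) \<partial>lborel)" by (subst nn_integral_distr) auto
  finally show ?thesis by (simp add: add.commute)
qed

lemma integral_lborel_shift:
  fixes f :: "'a::euclidean_space \<Rightarrow> 'b::{banach,second_countable_topology}"
  assumes [measurable]: "f \<in> borel_measurable borel"
  shows "(LINT x|lborel. f (x + a)) = (LINT x|lborel. f x)"
proof -
  have "(LINT x|lborel. f x) = (LINT x|distr lborel borel ((+) a). f x)"
    by (simp add: lborel_distr_plus)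
  also have "\<dots> = (LINT x|lborel. f (a + x))" by (subst integral_distr) auto
  finally show ?thesis by (simp add: add.commute)
qed

abbreviation ucube :: "(real ^ 'm) set" where "ucube \<equiv> cbox 0 (\<chi> i. 1)"

abbreviation cbx :: "real \<Rightarrow> (real ^ 'm) set" where "cbx N \<equiv> cbox (\<chi> i. - N) (\<chi> i. N)"

lemma mem_cbx: "x \<in> cbx N \<longleftrightarrow> (\<forall>i. \<bar>x $ i\<bar> \<le> N)"
  by (auto simp: mem_box_cart abs_le_iff minus_le_iff)

lemma emeasure_cbx:
  assumes "0 \<le> N" shows "emeasure lborel (cbx N :: (real^'m) set) = ennreal ((2 * N) ^ CARD('m))"
proof -
  have "cbx N \<noteq> ({} :: (real^'m) set)" using assms by (auto simp: interval_eq_empty_cart not_less)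
  hence "measure lborel (cbx N :: (real^'m) set) = (\<Prod>i\<in>(UNIV::'m set). N - (- N))"
    by (subst content_cbox_cart) auto
  thus ?thesis by (subst emeasure_eq_ennreal_measure) (use emeasure_lborel_cbox_finite in \<open>auto simp: less_top\<close>)
qed

lemma emeasure_open_cbx:
  assumes "0 \<le> N" shows "emeasure lborel (box (\<chi> i. - N) (\<chi> i. N) :: (real^'m) set) = ennreal ((2 * N) ^ CARD('m))"
  using emeasure_cbx[OF assms, where 'm='m] by (simp add: emeasure_lborel_box_eq emeasure_lborel_cbox_eq)

lemma emeasure_ucube [simp]: "emeasure lborel (ucube :: (real^'m) set) = 1"
proof -
  have "ucube \<noteq> ({} :: (real^'m) set)" by (auto simp: interval_eq_empty_cart not_less)
  hence "measure lborel (ucube :: (real^'m) set) = 1"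
    by (subst content_cbox_cart) auto
  thus ?thesis by (subst emeasure_eq_ennreal_measure) (use emeasure_lborel_cbox_finite in \<open>auto simp: less_top\<close>)
qed

text \<open>Values in \<open>ennreal\<close> let the norm be manipulated before it is known to be
  finite, and order 1 keeps it subadditive without roots.\<close>

definition snorm :: "(real ^ 'm \<Rightarrow> complex) \<Rightarrow> ennreal" where
  "snorm g = (SUP x. \<integral>\<^sup>+u\<in>ucube. ennreal (norm (g (x + u))) \<partial>lborel)"

lemma snorm_upper: "(\<integral>\<^sup>+u\<in>ucube. ennreal (norm (g (x + u))) \<partial>lborel) \<le> snorm g"
  unfolding snorm_def by (rule SUP_upper) simp

lemma snorm_least: "(\<And>x. (\<integral>\<^sup>+u\<in>ucube. ennreal (norm (g (x + u))) \<partial>lborel) \<le> B) \<Longrightarrow> snorm g \<le> B"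
  unfolding snorm_def by (rule SUP_least) simp

lemma snorm_mono:
  assumes "\<And>x. norm (f x) \<le> norm (g x)" shows "snorm f \<le> snorm g"
  unfolding snorm_def using assms by (intro SUP_mono' nn_integral_mono mult_right_mono ennreal_leI) auto

lemma snorm_triangle:
  assumes [measurable]: "f \<in> borel_measurable borel" "g \<in> borel_measurable borel"
  shows "snorm (\<lambda>x. f x + g x) \<le> snorm f + snorm g"
proof (rule snorm_least)
  fix x
  have "(\<integral>\<^sup>+u\<in>ucube. ennreal (norm (f (x + u) + g (x + u))) \<partial>lborel)
    \<le> (\<integral>\<^sup>+u. ennreal (norm (f (x + u))) * indicator ucube u + ennreal (norm (g (x + u))) * indicator ucube u \<partial>lborel)"
    by (intro nn_integral_mono)
      (auto simp: indicator_def ennreal_plus[symmetric] norm_triangle_ineq simp del: ennreal_plus intro!: ennreal_leI)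
  also have "\<dots> = (\<integral>\<^sup>+u\<in>ucube. ennreal (norm (f (x + u))) \<partial>lborel) + (\<integral>\<^sup>+u\<in>ucube. ennreal (norm (g (x + u))) \<partial>lborel)"
    by (rule nn_integral_add) auto
  also have "\<dots> \<le> snorm f + snorm g" by (intro add_mono snorm_upper)
  finally show "(\<integral>\<^sup>+u\<in>ucube. ennreal (norm (f (x + u) + g (x + u))) \<partial>lborel) \<le> snorm f + snorm g" .
qed

lemma snorm_minus: "snorm (\<lambda>x. f x - g x) = snorm (\<lambda>x. g x - f x)"
  by (simp add: snorm_def norm_minus_commute)

lemma snorm_shift: "snorm (\<lambda>x. g (x + t)) = snorm g"
proof -
  have "range (\<lambda>x. \<integral>\<^sup>+u\<in>ucube. ennreal (norm (g (x + u + t))) \<partial>lborel) = 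
        range (\<lambda>x. \<integral>\<^sup>+u\<in>ucube. ennreal (norm (g (x + u))) \<partial>lborel)"
  proof -
    have "(\<lambda>x. \<integral>\<^sup>+u\<in>ucube. ennreal (norm (g (x + u + t))) \<partial>lborel) = 
       (\<lambda>x. \<integral>\<^sup>+u\<in>ucube. ennreal (norm (g (x + u))) \<partial>lborel) \<circ> (\<lambda>x. x + t)"
      by (auto simp: fun_eq_iff add_ac)
    moreover have "range (\<lambda>x. x + t) = UNIV" by (metis surj_def diff_add_cancel)
    ultimately show ?thesis by (metis fun.set_map)
  qed
  thus ?thesis by (simp add: snorm_def)
qed

lemma snorm_bounded:
  fixes f :: "real ^ 'm \<Rightarrow> complex"
  assumes "\<And>x. norm (f x) \<le> B" shows "snorm f \<le> ennreal B"
proof (rule snorm_least)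
  fix x
  have "(\<integral>\<^sup>+u\<in>ucube. ennreal (norm (f (x + u))) \<partial>lborel) \<le> (\<integral>\<^sup>+u\<in>(ucube :: (real^'m) set). ennreal B \<partial>lborel)"
    by (intro nn_integral_mono mult_right_mono ennreal_leI assms) auto
  also have "\<dots> = ennreal B" by (simp add: nn_integral_cmult_indicator)
  finally show "(\<integral>\<^sup>+u\<in>ucube. ennreal (norm (f (x + u))) \<partial>lborel) \<le> ennreal B" .
qed

lemma snorm_cmult:
  assumes [measurable]: "f \<in> borel_measurable borel"
  shows "snorm (\<lambda>x. c * f x) \<le> ennreal (norm c) * snorm f"
proof (rule snorm_least)
  fix x
  have "(\<integral>\<^sup>+u\<in>ucube. ennreal (norm (c * f (x + u))) \<partial>lborel) = ennreal (norm c) * (\<integral>\<^sup>+u\<in>ucube. ennreal (norm (f (x + u))) \<partial>lborel)"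
    by (subst nn_integral_cmult[symmetric]) (auto simp: norm_mult ennreal_mult mult.assoc)
  also have "\<dots> \<le> ennreal (norm c) * snorm f" by (intro mult_left_mono snorm_upper) auto
  finally show "(\<integral>\<^sup>+u\<in>ucube. ennreal (norm (c * f (x + u))) \<partial>lborel) \<le> ennreal (norm c) * snorm f" .
qed

text \<open>Minkowski's integral inequality, by Tonelli. Where \<open>h\<close> fails to be
  integrable in \<open>t\<close>, the Bochner integral is 0 by convention and the bound is
  trivial.\<close>

lemma snorm_integral:
  fixes h :: "'b \<Rightarrow> real ^ 'm \<Rightarrow> complex"
  assumes "sigma_finite_measure M"
  assumes m[measurable]: "case_prod h \<in> borel_measurable (M \<Otimes>\<^sub>M borel)"
  shows "snorm (\<lambda>x. \<integral>t. h t x \<partial>M) \<le> (\<integral>\<^sup>+t. snorm (h t) \<partial>M)"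
proof (rule snorm_least)
  interpret sigma_finite_measure M by fact
  interpret pair_sigma_finite M lborel by standard
  fix x
  have [measurable]: "(\<lambda>z. h (snd z) (x + fst z)) \<in> borel_measurable (borel \<Otimes>\<^sub>M M)"
    by measurable
  have [measurable]: "(\<lambda>z. h (fst z) (x + snd z)) \<in> borel_measurable (M \<Otimes>\<^sub>M borel)"
    by measurable
  have "(\<integral>\<^sup>+u\<in>ucube. ennreal (norm (\<integral>t. h t (x+u) \<partial>M)) \<partial>lborel)
    \<le> (\<integral>\<^sup>+u. (\<integral>\<^sup>+t. ennreal (norm (h t (x+u))) * indicator ucube u \<partial>M) \<partial>lborel)"
  proof (intro nn_integral_mono)
    fix u
    have "ennreal (norm (\<integral>t. h t (x+u) \<partial>M)) \<le> (\<integral>\<^sup>+t. ennreal (norm (h t (x+u))) \<partial>M)"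
    proof (cases "integrable M (\<lambda>t. h t (x+u))")
      case True thus ?thesis by (rule integral_norm_bound_ennreal)
    qed (simp add: not_integrable_integral_eq)
    thus "ennreal (norm (\<integral>t. h t (x+u) \<partial>M)) * indicator ucube u \<le> (\<integral>\<^sup>+t. ennreal (norm (h t (x+u))) * indicator ucube u \<partial>M)"
      by (auto simp: indicator_def)
  qed
  also have "\<dots> = (\<integral>\<^sup>+t. (\<integral>\<^sup>+u. ennreal (norm (h t (x+u))) * indicator ucube u \<partial>lborel) \<partial>M)"
    by (rule Fubini') measurable
  also have "\<dots> \<le> (\<integral>\<^sup>+t. snorm (h t) \<partial>M)" by (intro nn_integral_mono snorm_upper)
  finally show "(\<integral>\<^sup>+u\<in>ucube. ennreal (norm (\<integral>t. h t (x+u) \<partial>M)) \<partial>lborel) \<le> (\<integral>\<^sup>+t. snorm (h t) \<partial>M)" .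
qed

text \<open>Averaging the unit-cube bound over all cubes that meet \<open>A\<close>.\<close>

lemma nn_integral_le_snorm:
  fixes g :: "real ^ 'm \<Rightarrow> complex"
  assumes [measurable]: "g \<in> borel_measurable borel" "A \<in> sets borel" "B \<in> sets borel"
    and AB: "\<And>a u. a \<in> A \<Longrightarrow> u \<in> ucube \<Longrightarrow> a - u \<in> B"
  shows "(\<integral>\<^sup>+a\<in>A. ennreal (norm (g a)) \<partial>lborel) \<le> snorm g * emeasure lborel B"
proof -
  have "(\<integral>\<^sup>+a\<in>A. ennreal (norm (g a)) \<partial>lborel) = 
    (\<integral>\<^sup>+u. indicator ucube u * (\<integral>\<^sup>+a\<in>A. ennreal (norm (g a)) \<partial>lborel) \<partial>(lborel :: (real^'m) measure))"
    by (subst nn_integral_multc) auto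
  also have "\<dots> = (\<integral>\<^sup>+u. indicator ucube u * (\<integral>\<^sup>+y. ennreal (norm (g (y+u))) * indicator A (y+u) \<partial>lborel) \<partial>(lborel :: (real^'m) measure))"
    by (subst nn_integral_lborel_shift[where f="\<lambda>y. ennreal (norm (g y)) * indicator A y"]) auto
  also have "\<dots> = (\<integral>\<^sup>+u. (\<integral>\<^sup>+y. indicator ucube u * (ennreal (norm (g (y+u))) * indicator A (y+u)) \<partial>lborel) \<partial>lborel)"
    by (subst nn_integral_cmult) auto
  also have "\<dots> \<le> (\<integral>\<^sup>+u. (\<integral>\<^sup>+y. indicator B y * (ennreal (norm (g (y+u))) * indicator ucube u) \<partial>lborel) \<partial>lborel)"
    using AB by (intro nn_integral_mono) (force simp: indicator_def)
  also have "\<dots> = (\<integral>\<^sup>+y. (\<integral>\<^sup>+u. indicator B y * (ennreal (norm (g (y+u))) * indicator ucube u) \<partial>lborel) \<partial>lborel)"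
    by (rule lborel_pair.Fubini') measurable
  also have "\<dots> = (\<integral>\<^sup>+y. indicator B y * (\<integral>\<^sup>+u. ennreal (norm (g (y+u))) * indicator ucube u \<partial>lborel) \<partial>lborel)"
    by (subst nn_integral_cmult) auto
  also have "\<dots> \<le> (\<integral>\<^sup>+y. snorm g * indicator B y \<partial>lborel)"
    by (subst mult.commute, intro nn_integral_mono mult_right_mono snorm_upper) auto
  also have "\<dots> = snorm g * emeasure lborel B" by (rule nn_integral_cmult_indicator) simp
  finally show ?thesis .
qed

lemma ucube_diff_cbx:
  fixes a u :: "real ^ 'm"
  assumes "a \<in> cbx N" "u \<in> ucube" shows "a - u \<in> cbx (N + 1)"
  unfolding mem_cbx
proof
  fix i
  have "\<bar>a $ i\<bar> \<le> N" "0 \<le> u $ i" "u $ i \<le> 1" using assms by (auto simp: mem_cbx) (auto simp: mem_box_cart)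
  thus "\<bar>(a - u) $ i\<bar> \<le> N + 1" by auto
qed

text \<open>Unit cubes that meet \<open>cbx N\<close> have their corner in
  \<open>cbx (N + 1)\<close>, whence the enlarged volume.\<close>

lemma nn_integral_cbx_le_snorm:
  fixes g :: "real ^ 'm \<Rightarrow> complex"
  assumes [measurable]: "g \<in> borel_measurable borel" and N: "N \<ge> 0"
  shows "(\<integral>\<^sup>+u\<in>cbx N. ennreal (norm (g (u + x))) \<partial>lborel) \<le> snorm g * ennreal ((2 * (N + 1)) ^ CARD('m))"
proof -
  have "(\<integral>\<^sup>+u\<in>cbx N. ennreal (norm (g (u + x))) \<partial>lborel) \<le> snorm (\<lambda>u. g (u + x)) * emeasure lborel (cbx (N+1) :: (real^'m) set)"
  proof (rule nn_integral_le_snorm)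
    show "a - u \<in> cbx (N + 1)" if "a \<in> cbx N" "u \<in> ucube" for a u :: "real^'m"
      using that by (rule ucube_diff_cbx)
  qed auto
  also have "emeasure lborel (cbx (N+1) :: (real^'m) set) = ennreal ((2 * (N + 1)) ^ CARD('m))"
    by (rule emeasure_cbx) (use N in simp)
  finally show ?thesis by (simp only: snorm_shift)
qed

lemma set_integrable_cbx:
  fixes g :: "real ^ 'm \<Rightarrow> complex"
  assumes [measurable]: "g \<in> borel_measurable borel" and "snorm g < top"
  shows "set_integrable lborel (cbx N) (\<lambda>u. g (u + x))"
proof (cases "N \<ge> 0")
  case True
  have "(\<integral>\<^sup>+u. ennreal (norm (indicator (cbx N) u *\<^sub>R g (u + x))) \<partial>lborel) = (\<integral>\<^sup>+u\<in>cbx N. ennreal (norm (g (u + x))) \<partial>lborel)"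
    by (intro nn_integral_cong) (auto simp: indicator_def)
  also have "\<dots> \<le> snorm g * ennreal ((2 * (N + 1)) ^ CARD('m))" by (rule nn_integral_cbx_le_snorm) (use True in auto)
  also have "\<dots> < top" using assms by (simp add: ennreal_mult_less_top)
  finally show ?thesis unfolding set_integrable_def by (intro integrableI_bounded) auto
next
  case False
  hence "cbx N = ({} :: (real^'m) set)" by (simp add: interval_eq_empty_cart)
  thus ?thesis by simp
qed

section \<open>Means over cubes\<close>

text \<open>The centre \<open>x\<close> is kept as a parameter because Fourier coefficients require
  convergence uniform in it, as \<open>has_mean\<close> then expresses.\<close>

definition mean :: "real \<Rightarrow> real ^ 'm \<Rightarrow> (real ^ 'm \<Rightarrow> complex) \<Rightarrow> complex" where
  "mean N x g = complex_of_real (inverse ((2 * N) ^ CARD('m))) * (LINT u:cbx N|lborel. g (u + x))"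

definition has_mean :: "(real ^ 'm \<Rightarrow> complex) \<Rightarrow> complex \<Rightarrow> bool" where
  "has_mean g c \<longleftrightarrow> (\<forall>\<epsilon>>0. \<exists>N0. \<forall>N\<ge>N0. \<forall>x. norm (mean N x g - c) < \<epsilon>)"

text \<open>For \<open>N \<ge> 1\<close> the enlarged side \<open>2 * (N + 1)\<close> is at most
  twice the side of the window, which gives the factor \<open>2 ^ m\<close>. Means are thus
  continuous in the Stepanoff norm, uniformly in window and centre.\<close>

lemma norm_mean_le:
  fixes g :: "real ^ 'm \<Rightarrow> complex"
  assumes [measurable]: "g \<in> borel_measurable borel" and N: "N \<ge> 1"
  shows "ennreal (norm (mean N x g)) \<le> 2 ^ CARD('m) * snorm g"
proof (cases "snorm g = top")
  case True thus ?thesis by (simp add: ennreal_mult_top)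
next
  case False
  hence fin: "snorm g < top" by (simp add: less_top)
  let ?V = "(2 * N) ^ CARD('m)"
  have V: "?V > 0" using N by simp
  have "ennreal (norm (LINT u:cbx N|lborel. g (u + x))) \<le> (\<integral>\<^sup>+u. ennreal (norm (indicator (cbx N) u *\<^sub>R g (u + x))) \<partial>lborel)"
    unfolding set_lebesgue_integral_def
    using set_integrable_cbx[of g N x] fin by (intro integral_norm_bound_ennreal) (auto simp: set_integrable_def)
  also have "\<dots> = (\<integral>\<^sup>+u\<in>cbx N. ennreal (norm (g (u + x))) \<partial>lborel)"
    by (intro nn_integral_cong) (auto simp: indicator_def)
  also have "\<dots> \<le> snorm g * ennreal ((2 * (N + 1)) ^ CARD('m))" by (rule nn_integral_cbx_le_snorm) (use N in auto)
  also have "\<dots> \<le> snorm g * ennreal (2 ^ CARD('m) * ?V)"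
  proof (intro mult_left_mono ennreal_leI)
    have "(2 * (N + 1)) ^ CARD('m) \<le> (2 * (2 * N)) ^ CARD('m)" using N by (intro power_mono) auto
    thus "(2 * (N + 1)) ^ CARD('m) \<le> 2 ^ CARD('m) * ?V" by (simp only: power_mult_distrib)
  qed simp
  finally have *: "ennreal (norm (LINT u:cbx N|lborel. g (u + x))) \<le> snorm g * ennreal (2 ^ CARD('m) * ?V)" .
  have "ennreal (norm (mean N x g)) = ennreal (inverse ?V) * ennreal (norm (LINT u:cbx N|lborel. g (u + x)))"
    using N by (simp add: mean_def norm_mult ennreal_mult norm_power norm_inverse)
  also have "\<dots> \<le> ennreal (inverse ?V) * (snorm g * ennreal (2 ^ CARD('m) * ?V))"
    by (intro mult_left_mono *) auto
  also have "\<dots> = snorm g * (ennreal (inverse ?V) * ennreal (2 ^ CARD('m) * ?V))" by (simp add: mult_ac)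
  also have "ennreal (inverse ?V) * ennreal (2 ^ CARD('m) * ?V) = ennreal (inverse ?V * (2 ^ CARD('m) * ?V))"
    using N by (intro ennreal_mult[symmetric]) auto
  also have "inverse ?V * (2 ^ CARD('m) * ?V) = 2 ^ CARD('m)" using N by (simp add: field_simps)
  finally show ?thesis by (simp add: ennreal_power mult.commute flip: ennreal_numeral)
qed

text \<open>Volume, relative to \<open>cbx N\<close>, of the shell around its boundary that a
  displacement of size \<open>L\<close> can reach. The extra 1 on both sides pays for averaging over
  unit cubes.\<close>

definition edge :: "nat \<Rightarrow> real \<Rightarrow> real \<Rightarrow> real" where
  "edge m L N = ((2 * (N + L + 1)) ^ m - (2 * (N - L - 1)) ^ m) / (2 * N) ^ m"

lemma edge_tendsto: "((\<lambda>N. edge m L N) \<longlongrightarrow> 0) at_top"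
proof -
  have "((\<lambda>N. (1 + (L + 1) / N) ^ m - (1 - (L + 1) / N) ^ m) \<longlongrightarrow> (1 + 0) ^ m - (1 - 0) ^ m) at_top"
    by (intro tendsto_intros real_tendsto_divide_at_top[OF tendsto_const filterlim_ident])
  moreover have "\<forall>\<^sub>F N in at_top. (1 + (L + 1) / N) ^ m - (1 - (L + 1) / N) ^ m = edge m L N"
    using eventually_gt_at_top[of 0]
  proof eventually_elim
    case (elim N)
    have "2 * (N + L + 1) / (2 * N) = 1 + (L + 1) / N" "2 * (N - L - 1) / (2 * N) = 1 - (L + 1) / N"
      using elim by (auto simp: field_simps)
    thus ?case unfolding edge_def diff_divide_distrib power_divide[symmetric] by simp
  qed
  ultimately have "(edge m L \<longlongrightarrow> (1 + 0) ^ m - (1 - 0) ^ m) at_top"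
    by (rule tendsto_cong[THEN iffD1, rotated])
  thus ?thesis by simp
qed

lemma mean_shift: "mean N x (\<lambda>y. g (y + t)) = mean N (x + t) g"
  by (simp add: mean_def add.assoc)

text \<open>The windows centred at \<open>x\<close> and \<open>x + h\<close> differ only inside the
  shell \<open>A\<close> of thickness \<open>L\<close> about the boundary. \<open>B\<close> is
  \<open>A\<close> widened by a unit cube, as the comparison with \<open>snorm\<close> demands, and
  its relative volume is \<open>edge\<close>.\<close>

lemma mean_shift_bound:
  fixes g :: "real ^ 'm \<Rightarrow> complex" and h :: "real ^ 'm"
  assumes [measurable]: "g \<in> borel_measurable borel" and fin: "snorm g < top"
    and h: "\<And>i. \<bar>h $ i\<bar> \<le> L" and N: "N \<ge> L + 1"
  shows "ennreal (norm (mean N (x + h) g - mean N x g)) \<le> snorm g * ennreal (edge CARD('m) L N)"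
proof -
  let ?m = "CARD('m)"
  let ?V = "(2 * N) ^ ?m"
  let ?c = "cbx N :: (real^'m) set"
  let ?o = "\<lambda>r. box (\<chi> i. - r) (\<chi> i. r) :: (real^'m) set"
  have L: "L \<ge> 0" using h[of undefined] by linarith
  have V: "?V > 0" using N L by simp
  define A where "A = cbx (N + L) - ?o (N - L)"
  define B where "B = cbx (N + L + 1) - ?o (N - L - 1)"
  have int: "integrable lborel (\<lambda>v. indicator ?c v *\<^sub>R g (v + y))" for y
    using set_integrable_cbx[of g N y] fin by (simp add: set_integrable_def)
  have "integrable (distr lborel borel ((+) (-h))) (\<lambda>v. indicator ?c v *\<^sub>R g (v + (x + h)))"
    unfolding lborel_distr_plus by (rule int)
  hence int2: "integrable lborel (\<lambda>v. indicator ?c (v - h) *\<^sub>R g (v + x))"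
    by (subst (asm) integrable_distr_eq) (auto simp: algebra_simps)
  have "(LINT u:?c|lborel. g (u + (x + h))) = (LINT v|lborel. indicator ?c (v - h) *\<^sub>R g (v + x))"
    unfolding set_lebesgue_integral_def
    by (subst integral_lborel_shift[where a=h, symmetric]) (simp_all add: add_ac)
  hence "(LINT u:?c|lborel. g (u + (x + h))) - (LINT u:?c|lborel. g (u + x)) =
     (LINT v|lborel. (indicator ?c (v - h) - indicator ?c v) *\<^sub>R g (v + x))"
    using int2 int by (simp add: set_lebesgue_integral_def scaleR_diff_left)
  also have "ennreal (norm \<dots>) \<le> (\<integral>\<^sup>+v. norm ((indicator ?c (v - h) - indicator ?c v) *\<^sub>R g (v + x)) \<partial>lborel)"
    using int2 int by (intro integral_norm_bound_ennreal) (auto simp: scaleR_diff_left)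
  also have "\<dots> \<le> (\<integral>\<^sup>+v\<in>A. norm (g (v + x)) \<partial>lborel)"
  proof (intro nn_integral_mono)
    fix v
    have "v \<in> A" if "(v - h \<in> ?c) \<noteq> (v \<in> ?c)"
    proof -
      have "\<bar>v $ i\<bar> \<le> N + L" for i
        using that h[of i] L by (auto simp: mem_cbx dest!: spec[of _ i])
      hence "v \<in> cbx (N + L)" unfolding mem_cbx by blast
      moreover have "v \<notin> ?o (N - L)"
      proof
        assume *: "v \<in> ?o (N - L)"
        have "\<bar>v $ i\<bar> \<le> N \<and> \<bar>(v - h) $ i\<bar> \<le> N" for i
        proof -
          have "- (N - L) < v $ i" "v $ i < N - L" using * by (auto simp: mem_box_cart)
          thus ?thesis using h[of i] L by auto
        qed
        thus False using that by (auto simp: mem_cbx)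
      qed
      ultimately show ?thesis unfolding A_def by (rule DiffI)
    qed
    thus "ennreal (norm ((indicator ?c (v - h) - indicator ?c v) *\<^sub>R g (v + x))) \<le> ennreal (norm (g (v + x))) * indicator A v"
      by (auto simp: indicator_def split: if_splits)
  qed
  also have "\<dots> \<le> snorm (\<lambda>v. g (v + x)) * emeasure lborel B"
  proof (rule nn_integral_le_snorm)
    fix a u :: "real^'m" assume a: "a \<in> A" and u: "u \<in> ucube"
    have u': "0 \<le> u $ i" "u $ i \<le> 1" for i using u by (auto simp: mem_box_cart)
    have "a - u \<in> cbx (N + L + 1)" by (rule ucube_diff_cbx[OF DiffD1[OF a[unfolded A_def]] u])
    moreover have "a - u \<notin> ?o (N - L - 1)"
    proof
      assume *: "a - u \<in> ?o (N - L - 1)"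
      have "- (N - L) < a $ i \<and> a $ i < N - L" for i
      proof -
        have "- (N - L - 1) < (a - u) $ i" "(a - u) $ i < N - L - 1" using * by (auto simp: mem_box_cart)
        thus ?thesis using u'[of i] by auto
      qed
      hence "a \<in> ?o (N - L)" by (auto simp: mem_box_cart)
      thus False using a by (simp add: A_def)
    qed
    ultimately show "a - u \<in> B" by (simp add: B_def)
  qed (auto simp: A_def B_def)
  also have "emeasure lborel B = emeasure lborel (cbx (N + L + 1) :: (real^'m) set) - emeasure lborel (?o (N - L - 1))"
    unfolding B_def
  proof (rule emeasure_Diff)
    show "emeasure lborel (?o (N - L - 1)) \<noteq> \<infinity>" using emeasure_lborel_box_finite by (auto simp: less_top)
    show "?o (N - L - 1) \<subseteq> cbx (N + L + 1)"
    proof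
      fix v assume v: "v \<in> ?o (N - L - 1)"
      have "\<bar>v $ i\<bar> \<le> N + L + 1" for i
      proof -
        have "- (N - L - 1) < v $ i" "v $ i < N - L - 1" using v by (auto simp: mem_box_cart)
        thus ?thesis using L by auto
      qed
      thus "v \<in> cbx (N + L + 1)" unfolding mem_cbx by blast
    qed
  qed auto
  also have "emeasure lborel (cbx (N + L + 1) :: (real^'m) set) = ennreal ((2 * (N + L + 1)) ^ ?m)"
    by (rule emeasure_cbx) (use N L in auto)
  also have "emeasure lborel (?o (N - L - 1)) = ennreal ((2 * (N - L - 1)) ^ ?m)"
    by (rule emeasure_open_cbx) (use N L in auto)
  also have "ennreal ((2 * (N + L + 1)) ^ ?m) - ennreal ((2 * (N - L - 1)) ^ ?m)
     = ennreal ((2 * (N + L + 1)) ^ ?m - (2 * (N - L - 1)) ^ ?m)"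
    by (rule ennreal_minus) (use N L in auto)
  also have "(2 * (N + L + 1)) ^ ?m - (2 * (N - L - 1)) ^ ?m = edge ?m L N * ?V"
    using N L by (simp add: edge_def)
  finally have *: "ennreal (norm ((LINT u:?c|lborel. g (u + (x + h))) - (LINT u:?c|lborel. g (u + x))))
      \<le> snorm g * ennreal (edge ?m L N * ?V)" by (simp add: snorm_shift)
  have e: "edge ?m L N \<ge> 0"
    unfolding edge_def using N L V by (intro divide_nonneg_pos) (auto intro!: power_mono)
  have "mean N (x + h) g - mean N x g = complex_of_real (inverse ?V) * ((LINT u:?c|lborel. g (u + (x + h))) - (LINT u:?c|lborel. g (u + x)))"
    by (simp add: mean_def right_diff_distrib)
  hence "norm (mean N (x + h) g - mean N x g) = 
     inverse ?V * norm ((LINT u:?c|lborel. g (u + (x + h))) - (LINT u:?c|lborel. g (u + x)))"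
    using V by (simp only: norm_mult norm_of_real abs_of_pos positive_imp_inverse_positive)
  hence "ennreal (norm (mean N (x + h) g - mean N x g)) = 
     ennreal (inverse ?V) * ennreal (norm ((LINT u:?c|lborel. g (u + (x + h))) - (LINT u:?c|lborel. g (u + x))))"
    using V by (simp only:) (intro ennreal_mult, use N L in auto)
  also have "\<dots> \<le> ennreal (inverse ?V) * (snorm g * ennreal (edge ?m L N * ?V))"
    by (intro mult_left_mono *) auto
  also have "\<dots> = snorm g * (ennreal (inverse ?V) * ennreal (edge ?m L N * ?V))" by (simp add: mult_ac)
  also have "ennreal (inverse ?V) * ennreal (edge ?m L N * ?V) = ennreal (inverse ?V * (edge ?m L N * ?V))"
    using N L e by (intro ennreal_mult[symmetric]) auto
  also have "inverse ?V * (edge ?m L N * ?V) = edge ?m L N" using N L by (simp add: field_simps)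
  finally show ?thesis .
qed

definition sbounded :: "(real ^ 'm \<Rightarrow> complex) \<Rightarrow> bool" where
  "sbounded g \<longleftrightarrow> g \<in> borel_measurable borel \<and> snorm g < top"

lemma sbounded_measurable [measurable_dest]: "sbounded g \<Longrightarrow> g \<in> borel_measurable borel"
  by (simp add: sbounded_def)

lemma sbounded_bounded:
  assumes "g \<in> borel_measurable borel" "\<And>x. norm (g x) \<le> B" shows "sbounded g"
  unfolding sbounded_def using assms(1) snorm_bounded[of g B] assms(2) le_less_trans ennreal_less_top by blast

lemma sbounded_add: "sbounded f \<Longrightarrow> sbounded g \<Longrightarrow> sbounded (\<lambda>x. f x + g x)"
  unfolding sbounded_def using snorm_triangle[of f g] by (auto intro: le_less_trans)

lemma sbounded_cmult: "sbounded f \<Longrightarrow> sbounded (\<lambda>x. c * f x)"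
  unfolding sbounded_def using snorm_cmult[of f c]
  by (auto intro!: borel_measurable_times intro: le_less_trans simp: ennreal_mult_less_top)

lemma sbounded_diff: "sbounded f \<Longrightarrow> sbounded g \<Longrightarrow> sbounded (\<lambda>x. f x - g x)"
  using sbounded_add[of f "\<lambda>x. (-1) * g x"] sbounded_cmult[of g "-1"] by simp

lemma sbounded_shift: "sbounded f \<Longrightarrow> sbounded (\<lambda>x. f (x + t))"
  unfolding sbounded_def by (auto simp: snorm_shift)

lemma sbounded_zero: "sbounded (\<lambda>x. 0)" by (rule sbounded_bounded[where B=0]) auto

lemma sbounded_sum: "(\<And>i. i \<in> I \<Longrightarrow> sbounded (f i)) \<Longrightarrow> sbounded (\<lambda>x. \<Sum>i\<in>I. f i x)"
  by (induction I rule: infinite_finite_induct) (auto simp: sbounded_zero intro: sbounded_add)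

lemma sbounded_mult:
  assumes "sbounded f" "h \<in> borel_measurable borel" "\<And>x. norm (h x) \<le> B"
  shows "sbounded (\<lambda>x. f x * h x)"
  unfolding sbounded_def
proof
  show "(\<lambda>x. f x * h x) \<in> borel_measurable borel" using assms by (auto dest: sbounded_measurable)
  have "snorm (\<lambda>x. f x * h x) \<le> snorm (\<lambda>x. of_real B * f x)"
    using assms(3) order_trans[OF norm_ge_zero assms(3)]
    by (intro snorm_mono) (auto simp: norm_mult mult.commute[of B] intro!: mult_left_mono)
  also have "\<dots> < top" using sbounded_cmult[OF assms(1)] by (simp add: sbounded_def)
  finally show "snorm (\<lambda>x. f x * h x) < top" .
qed

lemma sbounded_integrable: 
  "sbounded g \<Longrightarrow> integrable lborel (\<lambda>u. indicator (cbx N) u *\<^sub>R g (u + x))"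
  using set_integrable_cbx[of g N x] by (simp add: sbounded_def set_integrable_def)

lemma mean_add: "sbounded f \<Longrightarrow> sbounded g \<Longrightarrow> mean N x (\<lambda>x. f x + g x) = mean N x f + mean N x g"
  unfolding mean_def set_lebesgue_integral_def
  by (simp add: scaleR_add_right sbounded_integrable distrib_left)

lemma mean_cmult: "mean N x (\<lambda>x. c * f x) = c * mean N x f"
  unfolding mean_def set_lebesgue_integral_def by (simp add: mult.left_commute flip: mult_scaleR_right)

lemma mean_diff: "sbounded f \<Longrightarrow> sbounded g \<Longrightarrow> mean N x (\<lambda>x. f x - g x) = mean N x f - mean N x g"
  using mean_add[of f "\<lambda>x. (-1) * g x" N x] sbounded_cmult[of g "-1"] mean_cmult[of N x "-1" g] by simp

lemma mean_zero: "mean N x (\<lambda>x. 0) = 0" by (simp add: mean_def set_lebesgue_integral_def)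

lemma mean_sum: "(\<And>i. i \<in> I \<Longrightarrow> sbounded (f i)) \<Longrightarrow> mean N x (\<lambda>x. \<Sum>i\<in>I. f i x) = (\<Sum>i\<in>I. mean N x (f i))"
  by (induction I rule: infinite_finite_induct) (auto simp: mean_zero mean_add sbounded_sum)

lemma mean_const:
  assumes "N > 0" shows "mean N x (\<lambda>_. c) = c"
proof -
  have "(LINT u:(cbx N :: (real^'a) set)|lborel. c) = measure lborel (cbx N :: (real^'a) set) *\<^sub>R c"
    unfolding set_lebesgue_integral_def using emeasure_lborel_cbox_finite
    by (subst integral_scaleR_left) (auto simp: integrable_indicator_iff less_top)
  also have "measure lborel (cbx N :: (real^'a) set) = (2 * N) ^ CARD('a)"
    using emeasure_cbx[of N, where 'm='a] assms by (simp add: measure_def)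
  finally show ?thesis using assms by (simp add: mean_def scaleR_conv_of_real field_simps)
qed

lemma mean_of_real: 
  "mean N x (\<lambda>x. complex_of_real (r x)) = of_real (Re (mean N x (\<lambda>x. complex_of_real (r x))))"
proof -
  have *: "(LINT u:cbx N|lborel. complex_of_real (r (u + x))) = of_real (LINT u:cbx N|lborel. r (u + x))"
    unfolding set_lebesgue_integral_def by (simp add: scaleR_conv_of_real flip: of_real_mult)
  show ?thesis unfolding mean_def * by (simp flip: of_real_mult of_real_inverse)
qed

lemma norm_mean_le_mean:
  assumes g: "sbounded g" and r: "sbounded (\<lambda>x. complex_of_real (r x))" and le: "\<And>x. norm (g x) \<le> r x" and N: "N > 0"
  shows "norm (mean N x g) \<le> Re (mean N x (\<lambda>x. complex_of_real (r x)))"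
proof -
  let ?V = "inverse ((2 * N) ^ CARD('a))"
  have V: "?V > 0" using N by simp
  have i: "integrable lborel (\<lambda>u. indicator (cbx N) u *\<^sub>R r (u + x))"
    using integrable_Re[OF sbounded_integrable[OF r, of N x]] by simp
  have *: "(LINT u:cbx N|lborel. complex_of_real (r (u + x))) = of_real (LINT u:cbx N|lborel. r (u + x))"
    unfolding set_lebesgue_integral_def by (simp add: scaleR_conv_of_real flip: of_real_mult)
  have "norm (LINT u:cbx N|lborel. g (u + x)) \<le> (LINT u:cbx N|lborel. r (u + x))"
    unfolding set_lebesgue_integral_def using le
    by (intro Bochner_Integration.integral_norm_bound_integral[OF sbounded_integrable[OF g] i]) (auto simp: indicator_def)
  hence "?V * norm (LINT u:cbx N|lborel. g (u + x)) \<le> ?V * (LINT u:cbx N|lborel. r (u + x))"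
    using V by (intro mult_left_mono) auto
  moreover have "norm (mean N x g) = ?V * norm (LINT u:cbx N|lborel. g (u + x))"
    using N by (simp add: mean_def norm_mult norm_inverse norm_power)
  moreover have "Re (mean N x (\<lambda>x. complex_of_real (r x))) = ?V * (LINT u:cbx N|lborel. r (u + x))"
    unfolding mean_def * by (simp flip: of_real_mult)
  ultimately show ?thesis by simp
qed

lemma norm_mean_le_const:
  assumes "g \<in> borel_measurable borel" "\<And>x. norm (g x) \<le> B" "N > 0"
  shows "norm (mean N x g) \<le> B"
proof -
  have "B \<ge> 0" using order_trans[OF norm_ge_zero assms(2)] .
  hence "norm (mean N x g) \<le> Re (mean N x (\<lambda>x. complex_of_real B))"
    using assms by (intro norm_mean_le_mean) (auto intro!: sbounded_bounded[where B="\<bar>B\<bar>"] sbounded_bounded[where B=B])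
  thus ?thesis using assms by (simp add: mean_const)
qed

lemma integrable_prod_cbx:
  fixes g :: "real ^ 'm \<Rightarrow> complex"
  assumes g: "sbounded g"
  shows "integrable (lborel \<Otimes>\<^sub>M lborel)
     (\<lambda>(u, y). (indicator (cbx N) u * indicator (cbx N') y) *\<^sub>R g (u + y + x))"
proof (cases "N' \<ge> 0")
  case True
  have [measurable]: "g \<in> borel_measurable borel" and fin: "snorm g < top" using g by (auto simp: sbounded_def)
  have "(\<integral>\<^sup>+z. norm (case z of (u, y) \<Rightarrow> (indicator (cbx N) u * indicator (cbx N') y) *\<^sub>R g (u + y + x)) \<partial>(lborel \<Otimes>\<^sub>M lborel))
    = (\<integral>\<^sup>+u. \<integral>\<^sup>+y. ennreal (norm ((indicator (cbx N) u * indicator (cbx N') y) *\<^sub>R g (u + y + x))) \<partial>lborel \<partial>lborel)"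
    by (subst lborel.nn_integral_fst[symmetric]) (auto simp: case_prod_beta)
  also have "\<dots> = (\<integral>\<^sup>+u. indicator (cbx N) u * (\<integral>\<^sup>+y\<in>cbx N'. ennreal (norm (g (y + (u + x)))) \<partial>lborel) \<partial>lborel)"
    by (subst nn_integral_cmult[symmetric])
      (auto intro!: nn_integral_cong simp: indicator_def add_ac)
  also have "\<dots> \<le> (\<integral>\<^sup>+u. snorm g * ennreal ((2 * (N' + 1)) ^ CARD('m)) * indicator (cbx N :: (real^'m) set) u \<partial>lborel)"
    by (subst mult.commute, intro nn_integral_mono mult_right_mono nn_integral_cbx_le_snorm True) auto
  also have "\<dots> = snorm g * ennreal ((2 * (N' + 1)) ^ CARD('m)) * emeasure lborel (cbx N :: (real^'m) set)"
    by (rule nn_integral_cmult_indicator) simp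
  also have "\<dots> < top" using fin emeasure_lborel_cbox_finite by (auto simp: ennreal_mult_less_top)
  finally show ?thesis by (intro integrableI_bounded) (auto simp: case_prod_beta)
next
  case False
  hence "cbx N' = ({} :: (real^'m) set)" by (simp add: interval_eq_empty_cart)
  hence "(\<lambda>(u, y). (indicator (cbx N) u * indicator (cbx N') y) *\<^sub>R g (u + y + x)) = (\<lambda>z. 0)"
    by (auto simp: fun_eq_iff)
  thus ?thesis by simp
qed

lemma mean_mean_commute:
  fixes g :: "real ^ 'm \<Rightarrow> complex"
  assumes g: "sbounded g"
  shows "mean N x (\<lambda>z. mean N' z g) = mean N' x (\<lambda>z. mean N z g)"
proof -
  let ?I = "\<lambda>N N'. LINT u|lborel. (LINT y|lborel. (indicator (cbx N) u * indicator (cbx N') y) *\<^sub>R g (u + y + x))"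
  let ?V = "\<lambda>N::real. complex_of_real (inverse ((2 * N) ^ CARD('m)))"
  have eq: "mean N x (\<lambda>z. mean N' z g) = ?V N * ?V N' * ?I N N'" for N N'
    unfolding mean_def set_lebesgue_integral_def mult_scaleR_right[symmetric] integral_mult_right_zero 
      scaleR_scaleR[symmetric] integral_scaleR_right
    by (simp add: add_ac mult_ac)
  have "?I N' N = (LINT u|lborel. (LINT y|lborel. (indicator (cbx N) y * indicator (cbx N') u) *\<^sub>R g (y + u + x)))"
    by (simp add: add_ac mult_ac)
  also have "\<dots> = ?I N N'"
    by (rule lborel_pair.Fubini_integral) (use integrable_prod_cbx[OF g] in simp)
  finally show ?thesis unfolding eq by (simp add: mult_ac)
qed

lemma borel_measurable_mean [measurable]:
  assumes "sbounded g" shows "(\<lambda>x. mean N x g) \<in> borel_measurable borel"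
proof -
  have [measurable]: "g \<in> borel_measurable borel" using assms by (simp add: sbounded_def)
  show ?thesis unfolding mean_def set_lebesgue_integral_def by measurable
qed

section \<open>Gauges of almost periodicity\<close>

text \<open>A translation-subadditive modulus of almost periodicity: the finite nets in the last clause replace
  relatively dense sets of almost periods, and sums of gauges are again gauges.\<close>

definition ap_gauge :: "(real ^ 'm \<Rightarrow> real) \<Rightarrow> bool" where
  "ap_gauge D \<longleftrightarrow> D 0 = 0 \<and> (\<forall>t. 0 \<le> D t) \<and> (\<forall>t. D (- t) = D t) \<and> (\<forall>s t. D (s + t) \<le> D s + D t) \<and>
     (\<forall>\<epsilon>>0. \<exists>\<delta>>0. \<forall>t. norm t < \<delta> \<longrightarrow> D t < \<epsilon>) \<and>
     (\<forall>\<epsilon>>0. \<exists>T. finite T \<and> (\<forall>t. \<exists>s\<in>T. D (t - s) < \<epsilon>))"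

lemma ap_gaugeD:
  assumes "ap_gauge D"
  shows "D 0 = 0" "0 \<le> D t" "D (- t) = D t" "D (s + t) \<le> D s + D t"
    "\<epsilon> > 0 \<Longrightarrow> \<exists>\<delta>>0. \<forall>t. norm t < \<delta> \<longrightarrow> D t < \<epsilon>"
    "\<epsilon> > 0 \<Longrightarrow> \<exists>T. finite T \<and> (\<forall>t. \<exists>s\<in>T. D (t - s) < \<epsilon>)"
  using assms unfolding ap_gauge_def by blast+

lemma ap_gauge_minus_commute: "ap_gauge D \<Longrightarrow> D (s - t) = D (t - s)"
  using ap_gaugeD(3)[of D "s - t"] by simp

lemma ap_gauge_diff_le: "ap_gauge D \<Longrightarrow> \<bar>D s - D t\<bar> \<le> D (s - t)"
  using ap_gaugeD(4)[of D "s - t" t] ap_gaugeD(4)[of D "t - s" s] ap_gauge_minus_commute[of D s t] by simp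

lemma ap_gauge_continuous: 
  assumes D: "ap_gauge D" shows "continuous_on S D"
  unfolding continuous_on_iff
proof (intro ballI allI impI)
  fix x :: "real^'a" and e :: real assume "e > 0"
  then obtain d where d: "d > 0" "\<And>t. norm t < d \<Longrightarrow> D t < e" using ap_gaugeD(5)[OF D] by blast
  show "\<exists>d>0. \<forall>x'\<in>S. dist x' x < d \<longrightarrow> dist (D x') (D x) < e"
  proof (intro exI[of _ d] conjI ballI impI)
    fix x' assume "dist x' x < d"
    thus "dist (D x') (D x) < e" using d(2)[of "x' - x"] ap_gauge_diff_le[OF D, of x' x] by (simp add: dist_norm)
  qed fact
qed

lemma borel_measurable_ap_gauge: "ap_gauge D \<Longrightarrow> D \<in> borel_measurable borel"
  by (intro borel_measurable_continuous_onI ap_gauge_continuous)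

lemma ap_gauge_bounded:
  assumes D: "ap_gauge D" obtains B where "B \<ge> 0" "\<And>t. D t \<le> B"
proof -
  obtain T where T: "finite T" "\<And>t. \<exists>s\<in>T. D (t - s) < 1" using ap_gaugeD(6)[OF D, of 1] by auto
  have "D t \<le> 1 + (\<Sum>s\<in>T. D s)" for t
  proof -
    obtain s where s: "s \<in> T" "D (t - s) < 1" using T(2) by blast
    have "D t \<le> D (t - s) + D s" using ap_gaugeD(4)[OF D, of "t - s" s] by simp
    also have "D s \<le> (\<Sum>s\<in>T. D s)" using T(1) s(1) ap_gaugeD(2)[OF D] by (intro member_le_sum) auto
    finally show ?thesis using s by simp
  qed
  moreover have "0 \<le> 1 + (\<Sum>s\<in>T. D s)" using ap_gaugeD(2)[OF D] by (simp add: sum_nonneg add_nonneg_nonneg)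
  ultimately show ?thesis using that by blast
qed

text \<open>Relative density provides representatives in a fixed ball. The ball is totally bounded
  and \<open>D\<close> is small near 0, so by subadditivity finitely many centres serve all
  translates.\<close>

lemma ap_gaugeI_relatively_dense:
  assumes D: "D 0 = 0" "\<And>t. 0 \<le> D t" "\<And>t. D (- t) = D t" "\<And>s t. D (s + t) \<le> D s + D t"
    and cont: "\<And>\<epsilon>. \<epsilon> > 0 \<Longrightarrow> \<exists>\<delta>>0. \<forall>t. norm t < \<delta> \<longrightarrow> D t < \<epsilon>"
    and dense: "\<And>\<epsilon>. \<epsilon> > 0 \<Longrightarrow> \<exists>L. \<forall>t. \<exists>s. norm s \<le> L \<and> D (t - s) < \<epsilon>"
  shows "ap_gauge D"
  unfolding ap_gauge_def
proof (intro conjI allI impI)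
  fix \<epsilon> :: real assume e: "\<epsilon> > 0"
  from cont[of "\<epsilon>/2"] e obtain d where d: "d > 0" "\<And>t. norm t < d \<Longrightarrow> D t < \<epsilon>/2" by auto
  from dense[of "\<epsilon>/2"] e obtain L where L: "\<And>t. \<exists>s. norm s \<le> L \<and> D (t - s) < \<epsilon>/2" by auto
  have "compact (cball (0::real^'a) L)" by simp
  hence "\<exists>T. finite T \<and> cball (0::real^'a) L \<subseteq> (\<Union>x\<in>T. ball x d)"
    using d(1) unfolding compact_eq_totally_bounded by blast
  then obtain T where T: "finite T" "cball (0::real^'a) L \<subseteq> (\<Union>x\<in>T. ball x d)" by blast
  show "\<exists>T. finite T \<and> (\<forall>t. \<exists>s\<in>T. D (t - s) < \<epsilon>)"
  proof (intro exI[of _ T] conjI allI T(1))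
    fix t
    obtain s where s: "norm s \<le> L" "D (t - s) < \<epsilon>/2" using L by blast
    then obtain x where x: "x \<in> T" "norm (s - x) < d" using T(2) 
      by (fastforce simp: dist_norm norm_minus_commute subset_iff)
    have "D (t - x) \<le> D (t - s) + D (s - x)" using D(4)[of "t - s" "s - x"] by simp
    also have "\<dots> < \<epsilon>" using s d(2)[OF x(2)] by simp
    finally show "\<exists>s\<in>T. D (t - s) < \<epsilon>" using x by blast
  qed
qed (use D cont in auto)

text \<open>Two gauges have common almost periods: refine the two finite nets simultaneously.\<close>

lemma ap_gauge_add:
  assumes D: "ap_gauge D" and E: "ap_gauge E" shows "ap_gauge (\<lambda>t. D t + E t)"
  unfolding ap_gauge_def
proof (intro conjI allI impI)
  fix \<epsilon> :: real assume e: "\<epsilon> > 0"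
  obtain d where d: "d > 0" "\<And>t. norm t < d \<Longrightarrow> D t < \<epsilon>/2" using ap_gaugeD(5)[OF D, of "\<epsilon>/2"] e by auto
  obtain d' where d': "d' > 0" "\<And>t. norm t < d' \<Longrightarrow> E t < \<epsilon>/2" using ap_gaugeD(5)[OF E, of "\<epsilon>/2"] e by auto
  show "\<exists>\<delta>>0. \<forall>t. norm t < \<delta> \<longrightarrow> D t + E t < \<epsilon>"
  proof (intro exI[of _ "min d d'"] conjI allI impI)
    fix t :: "real^'a" assume "norm t < min d d'"
    thus "D t + E t < \<epsilon>" using d(2)[of t] d'(2)[of t] by simp
  qed (use d d' in auto)
next
  fix \<epsilon> :: real assume e: "\<epsilon> > 0"
  obtain S where S: "finite S" "\<And>t. \<exists>s\<in>S. D (t - s) < \<epsilon>/4" using ap_gaugeD(6)[OF D, of "\<epsilon>/4"] e by auto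
  obtain T where T: "finite T" "\<And>t. \<exists>s\<in>T. E (t - s) < \<epsilon>/4" using ap_gaugeD(6)[OF E, of "\<epsilon>/4"] e by auto
  define P where "P = (\<lambda>z u. D (u - fst z) < \<epsilon>/4 \<and> E (u - snd z) < \<epsilon>/4)"
  define r where "r = (\<lambda>z. SOME u. P z u)"
  show "\<exists>T. finite T \<and> (\<forall>t. \<exists>s\<in>T. D (t - s) + E (t - s) < \<epsilon>)"
  proof (intro exI[of _ "r ` (S \<times> T)"] conjI allI)
    fix t
    obtain a b where ab: "a \<in> S" "D (t - a) < \<epsilon>/4" "b \<in> T" "E (t - b) < \<epsilon>/4" using S T by meson
    hence "P (a, b) t" by (simp add: P_def)
    hence "P (a, b) (r (a, b))" unfolding r_def by (rule someI)
    hence r: "D (r (a, b) - a) < \<epsilon>/4" "E (r (a, b) - b) < \<epsilon>/4" by (auto simp: P_def)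
    have "D (t - r (a, b)) < \<epsilon>/2"
      using ap_gaugeD(4)[OF D, of "t - a" "a - r (a, b)"] ab r ap_gauge_minus_commute[OF D, of a "r (a, b)"] by simp
    moreover have "E (t - r (a, b)) < \<epsilon>/2"
      using ap_gaugeD(4)[OF E, of "t - b" "b - r (a, b)"] ab r ap_gauge_minus_commute[OF E, of b "r (a, b)"] by simp
    ultimately show "\<exists>s\<in>r ` (S \<times> T). D (t - s) + E (t - s) < \<epsilon>"
      using ab by (intro bexI[of _ "r (a, b)"]) auto
  qed (use S T in auto)
next
  fix s t show "D (s + t) + E (s + t) \<le> D s + E s + (D t + E t)"
    using ap_gaugeD(4)[OF D, of s t] ap_gaugeD(4)[OF E, of s t] by simp
qed (use ap_gaugeD[OF D] ap_gaugeD[OF E] in auto)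

lemma ap_gauge_cmult:
  assumes D: "ap_gauge D" and c: "c \<ge> 0" shows "ap_gauge (\<lambda>t. c * D t)"
proof (cases "c = 0")
  case True
  thus ?thesis by (auto simp: ap_gauge_def intro: exI[of _ 1] exI[of _ "{0}"])
next
  case False
  hence c: "c > 0" using c by simp
  show ?thesis unfolding ap_gauge_def
  proof (intro conjI allI impI)
    fix s t show "c * D (s + t) \<le> c * D s + c * D t"
      using c ap_gaugeD(4)[OF D, of s t] by (simp flip: distrib_left)
  next
    fix \<epsilon> :: real assume "\<epsilon> > 0"
    hence "\<epsilon> / c > 0" using c by simp
    from ap_gaugeD(5)[OF D this] show "\<exists>\<delta>>0. \<forall>t. norm t < \<delta> \<longrightarrow> c * D t < \<epsilon>"
      using c by (simp add: pos_less_divide_eq mult.commute)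
  next
    fix \<epsilon> :: real assume "\<epsilon> > 0"
    hence "\<epsilon> / c > 0" using c by simp
    from ap_gaugeD(6)[OF D this] show "\<exists>T. finite T \<and> (\<forall>t. \<exists>s\<in>T. c * D (t - s) < \<epsilon>)"
      using c by (simp add: pos_less_divide_eq mult.commute)
  qed (use ap_gaugeD[OF D] c in auto)
qed

lemma ap_gauge_zero: "ap_gauge (\<lambda>t. 0)"
  by (auto simp: ap_gauge_def intro: exI[of _ 1] exI[of _ "{0}"])

section \<open>Existence and calculus of uniform means\<close>

lemma mean_near_const:
  fixes k :: "real ^ 'm \<Rightarrow> complex"
  assumes [measurable]: "k \<in> borel_measurable borel" and le: "\<And>z. norm (k z - c) \<le> \<epsilon>" and N: "N > 0"
  shows "norm (mean N x k - c) \<le> \<epsilon>"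
proof -
  have "norm (k z) \<le> norm c + \<epsilon>" for z using le[of z] norm_triangle_sub[of "k z" c] by simp
  hence k: "sbounded k" by (intro sbounded_bounded[where B="norm c + \<epsilon>"]) auto
  have c: "sbounded (\<lambda>_::real^'m. c)" by (rule sbounded_bounded[where B="norm c"]) auto
  have "mean N x k - c = mean N x (\<lambda>z. k z - c)" using N by (simp add: mean_diff k c mean_const)
  also have "norm \<dots> \<le> \<epsilon>" using le N by (intro norm_mean_le_const) auto
  finally show ?thesis .
qed

text \<open>By Fubini the mean over a cube of side \<open>2N\<close> of means over cubes of side \<open>2N'\<close> is symmetric
  in \<open>N\<close> and \<open>N'\<close>; near-independence of the centre therefore makes the means a Cauchy family.\<close>

lemma has_mean_exists:
  fixes g :: "real ^ 'm \<Rightarrow> complex"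
  assumes g: "sbounded g" and D: "ap_gauge D"
    and gD: "\<And>t. snorm (\<lambda>x. g (x + t) - g x) \<le> ennreal (D t)"
  shows "\<exists>c. has_mean g c"
proof -
  have gm[measurable]: "g \<in> borel_measurable borel" and fin: "snorm g < top" using g by (auto simp: sbounded_def)
  have fin': "snorm g = ennreal (enn2real (snorm g))" using fin by simp
  define S where "S = enn2real (snorm g)"
  have S: "S \<ge> 0" "snorm g = ennreal S" using fin' by (auto simp: S_def)
  let ?m = "CARD('m)"
  have unif: "\<exists>N0. \<forall>N\<ge>N0. \<forall>x. norm (mean N x g - mean N 0 g) \<le> \<epsilon>" if e: "\<epsilon> > 0" for \<epsilon>
  proof -
    define \<delta> where "\<delta> = \<epsilon> / (2 * 2 ^ ?m)"
    have d: "\<delta> > 0" using e by (simp add: \<delta>_def)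
    obtain T where T: "finite T" "\<And>t. \<exists>s\<in>T. D (t - s) < \<delta>" using ap_gaugeD(6)[OF D d] by auto
    define L where "L = (\<Sum>s\<in>T. norm s)"
    have L: "\<bar>s $ i\<bar> \<le> L" if "s \<in> T" for s :: "real^'m" and i
      using component_le_norm_cart[of s i] member_le_sum[of s T norm] that T(1) by (simp add: L_def)
    have "((\<lambda>N. S * edge ?m L N) \<longlongrightarrow> S * 0) at_top" by (intro tendsto_intros edge_tendsto)
    hence "\<forall>\<^sub>F N in at_top. S * edge ?m L N < \<epsilon> / 2" using e by (intro order_tendstoD(2)[where y="S * 0"]) auto
    then obtain N1 where N1: "\<And>N. N \<ge> N1 \<Longrightarrow> S * edge ?m L N < \<epsilon> / 2" unfolding eventually_at_top_linorder by blast
    show ?thesis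
    proof (intro exI[of _ "max N1 (max 1 (L + 1))"] allI impI)
      fix N :: real and x :: "real^'m" assume N: "max N1 (max 1 (L + 1)) \<le> N"
      obtain s where s: "s \<in> T" "D (x - s) < \<delta>" using T by blast
      have "ennreal (norm (mean N (0 + s) g - mean N 0 g)) \<le> snorm g * ennreal (edge ?m L N)"
        by (rule mean_shift_bound) (use fin L[OF s(1)] N in auto)
      also have "\<dots> = ennreal (S * edge ?m L N)" using S by (simp add: ennreal_mult')
      finally have "norm (mean N s g - mean N 0 g) \<le> max 0 (S * edge ?m L N)"
        by (auto simp: ennreal_le_iff2 max_def)
      hence 1: "norm (mean N s g - mean N 0 g) < \<epsilon> / 2" using N1[of N] N e by auto
      have "mean N x g - mean N s g = mean N s (\<lambda>y. g (y + (x - s)) - g y)"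
        by (subst mean_diff) (auto simp: sbounded_shift g mean_shift)
      hence "ennreal (norm (mean N x g - mean N s g)) \<le> 2 ^ ?m * snorm (\<lambda>y. g (y + (x - s)) - g y)"
        by (simp only:) (rule norm_mean_le, use N in auto)
      also have "\<dots> \<le> 2 ^ ?m * ennreal (D (x - s))" by (intro mult_left_mono gD) auto
      also have "\<dots> = ennreal (2 ^ ?m * D (x - s))"
        using ap_gaugeD(2)[OF D] by (simp add: ennreal_mult ennreal_power flip: ennreal_numeral)
      finally have "norm (mean N x g - mean N s g) \<le> 2 ^ ?m * D (x - s)"
        using ap_gaugeD(2)[OF D, of "x - s"] by (subst (asm) ennreal_le_iff) auto
      also have "\<dots> \<le> 2 ^ ?m * \<delta>" using s by (intro mult_left_mono) auto
      also have "\<dots> = \<epsilon> / 2" by (simp add: \<delta>_def)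
      finally show "norm (mean N x g - mean N 0 g) \<le> \<epsilon>"
        using 1 norm_triangle_ineq[of "mean N x g - mean N s g" "mean N s g - mean N 0 g"] by simp
    qed
  qed
  have cauchy: "\<exists>N0. \<forall>N\<ge>N0. \<forall>N'\<ge>N0. norm (mean N 0 g - mean N' 0 g) \<le> 2 * \<epsilon>" if e: "\<epsilon> > 0" for \<epsilon>
  proof -
    obtain N0 where N0: "\<And>N x. N \<ge> N0 \<Longrightarrow> norm (mean N x g - mean N 0 g) \<le> \<epsilon>" using unif[OF e] by blast
    have near: "norm (mean N 0 (\<lambda>z. mean N' z g) - mean N' 0 g) \<le> \<epsilon>" if "N > 0" "N' \<ge> N0" for N N'
      by (rule mean_near_const) (use N0 that borel_measurable_mean[OF g] in auto)
    show ?thesis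
    proof (intro exI[of _ "max N0 1"] allI impI)
      fix N N' assume N: "max N0 1 \<le> N" "max N0 1 \<le> N'"
      have "norm (mean N 0 (\<lambda>z. mean N' z g) - mean N' 0 g) \<le> \<epsilon>" 
        "norm (mean N 0 (\<lambda>z. mean N' z g) - mean N 0 g) \<le> \<epsilon>"
        using near[of N N'] near[of N' N] N mean_mean_commute[OF g, of N' 0 N] by auto
      thus "norm (mean N 0 g - mean N' 0 g) \<le> 2 * \<epsilon>"
        using norm_triangle_ineq4[of "mean N 0 (\<lambda>z. mean N' z g) - mean N' 0 g" "mean N 0 (\<lambda>z. mean N' z g) - mean N 0 g"] by simp
    qed
  qed
  have "Cauchy (\<lambda>n. mean (real n) 0 g)"
  proof (rule metric_CauchyI)
    fix e :: real assume e: "e > 0"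
    obtain N0 where N0: "\<And>N N'. N \<ge> N0 \<Longrightarrow> N' \<ge> N0 \<Longrightarrow> norm (mean N 0 g - mean N' 0 g) \<le> 2 * (e / 4)"
      using cauchy[of "e/4"] e by auto
    obtain n0 where n0: "real n0 \<ge> N0" using real_arch_simple by blast
    show "\<exists>M. \<forall>m\<ge>M. \<forall>n\<ge>M. dist (mean (real m) 0 g) (mean (real n) 0 g) < e"
    proof (intro exI[of _ n0] allI impI)
      fix m n assume "m \<ge> n0" "n \<ge> n0"
      hence "real m \<ge> N0" "real n \<ge> N0" using n0 by auto
      thus "dist (mean (real m) 0 g) (mean (real n) 0 g) < e" using N0[of "real m" "real n"] e by (simp add: dist_norm)
    qed
  qed
  then obtain c where c: "(\<lambda>n. mean (real n) 0 g) \<longlonglongrightarrow> c" using Cauchy_convergent_iff convergent_def by blast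
  have "has_mean g c"
    unfolding has_mean_def
  proof (intro allI impI)
    fix \<epsilon> :: real assume e: "\<epsilon> > 0"
    obtain N1 where N1: "\<And>N x. N \<ge> N1 \<Longrightarrow> norm (mean N x g - mean N 0 g) \<le> \<epsilon> / 4" using unif[of "\<epsilon>/4"] e by auto
    obtain N2 where N2: "\<And>N N'. N \<ge> N2 \<Longrightarrow> N' \<ge> N2 \<Longrightarrow> norm (mean N 0 g - mean N' 0 g) \<le> 2 * (\<epsilon> / 8)"
      using cauchy[of "\<epsilon>/8"] e by auto
    obtain n0 where n0: "real n0 \<ge> N2" using real_arch_simple by blast
    have "\<forall>\<^sub>F n in sequentially. norm (mean (real n) 0 g - c) < \<epsilon> / 4"
      using tendstoD[OF c, of "\<epsilon> / 4"] e by (simp add: dist_norm)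
    hence "\<forall>\<^sub>F n in sequentially. norm (mean (real n) 0 g - c) < \<epsilon> / 4 \<and> n \<ge> n0"
      using eventually_ge_at_top[of n0] by eventually_elim auto
    then obtain n where n: "norm (mean (real n) 0 g - c) < \<epsilon> / 4" "n \<ge> n0"
      using eventually_happens'[OF sequentially_bot] by blast
    show "\<exists>N0. \<forall>N\<ge>N0. \<forall>x. norm (mean N x g - c) < \<epsilon>"
    proof (intro exI[of _ "max N1 N2"] allI impI)
      fix N x assume N: "max N1 N2 \<le> N"
      have "mean N x g - c = (mean N x g - mean N 0 g) + (mean N 0 g - mean (real n) 0 g) + (mean (real n) 0 g - c)" by simp
      also have "norm \<dots> \<le> norm (mean N x g - mean N 0 g) + norm (mean N 0 g - mean (real n) 0 g) + norm (mean (real n) 0 g - c)"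
        by (intro order_trans[OF norm_triangle_ineq] add_mono order_refl)
      also have "\<dots> < \<epsilon>" using N1[of N x] N2[of N "real n"] n n0 N e by (auto simp: algebra_simps)
      finally show "norm (mean N x g - c) < \<epsilon>" .
    qed
  qed
  thus ?thesis by blast
qed

lemma has_mean_tendsto: 
  assumes "has_mean g c" shows "((\<lambda>N. mean N x g) \<longlongrightarrow> c) at_top"
  unfolding tendsto_iff eventually_at_top_linorder dist_norm
  using assms unfolding has_mean_def by meson

lemma has_mean_unique: "has_mean g c \<Longrightarrow> has_mean g d \<Longrightarrow> c = d"
  using has_mean_tendsto tendsto_unique[OF trivial_limit_at_top_linorder] by blast

lemma has_mean_add:
  assumes "sbounded f" "sbounded g" "has_mean f c" "has_mean g d"
  shows "has_mean (\<lambda>x. f x + g x) (c + d)"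
  unfolding has_mean_def
proof (intro allI impI)
  fix \<epsilon> :: real assume e: "\<epsilon> > 0"
  obtain N1 where N1: "\<And>N x. N \<ge> N1 \<Longrightarrow> norm (mean N x f - c) < \<epsilon> / 2"
    using assms(3) e unfolding has_mean_def by (meson half_gt_zero)
  obtain N2 where N2: "\<And>N x. N \<ge> N2 \<Longrightarrow> norm (mean N x g - d) < \<epsilon> / 2"
    using assms(4) e unfolding has_mean_def by (meson half_gt_zero)
  have "norm (mean N x (\<lambda>x. f x + g x) - (c + d)) < \<epsilon>" if "N \<ge> max N1 N2" for N x
    using N1[of N x] N2[of N x] that norm_triangle_ineq[of "mean N x f - c" "mean N x g - d"]
    by (simp add: mean_add assms algebra_simps)
  thus "\<exists>N0. \<forall>N\<ge>N0. \<forall>x. norm (mean N x (\<lambda>x. f x + g x) - (c + d)) < \<epsilon>" by blast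
qed

lemma has_mean_cmult:
  assumes "has_mean f c" shows "has_mean (\<lambda>x. a * f x) (a * c)"
  unfolding has_mean_def
proof (intro allI impI)
  fix \<epsilon> :: real assume e: "\<epsilon> > 0"
  have pos: "norm a + 1 > 0" by (simp add: add_nonneg_pos)
  hence "\<epsilon> / (norm a + 1) > 0" using e by simp
  then obtain N1 where N1: "\<And>N x. N \<ge> N1 \<Longrightarrow> norm (mean N x f - c) < \<epsilon> / (norm a + 1)"
    using assms(1) unfolding has_mean_def by meson
  have "norm (mean N x (\<lambda>x. a * f x) - a * c) < \<epsilon>" if "N \<ge> N1" for N x
  proof -
    have "mean N x (\<lambda>x. a * f x) - a * c = a * (mean N x f - c)" by (simp add: mean_cmult algebra_simps)
    hence "norm (mean N x (\<lambda>x. a * f x) - a * c) = norm a * norm (mean N x f - c)" by (simp add: norm_mult)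
    also have "\<dots> \<le> (norm a + 1) * norm (mean N x f - c)" by (intro mult_right_mono) auto
    also have "\<dots> < (norm a + 1) * (\<epsilon> / (norm a + 1))" using N1[OF that] pos by (intro mult_strict_left_mono) auto
    finally show ?thesis using pos by simp
  qed
  thus "\<exists>N0. \<forall>N\<ge>N0. \<forall>x. norm (mean N x (\<lambda>x. a * f x) - a * c) < \<epsilon>" by blast
qed

lemma has_mean_diff:
  assumes "sbounded f" "sbounded g" "has_mean f c" "has_mean g d"
  shows "has_mean (\<lambda>x. f x - g x) (c - d)"
  using has_mean_add[OF assms(1) sbounded_cmult[OF assms(2), of "-1"] assms(3) has_mean_cmult[OF assms(4), of "-1"]]
  by simp

lemma has_mean_const: "has_mean (\<lambda>_. c) c"
  unfolding has_mean_def
  by (intro allI impI exI[of _ 1]) (simp add: mean_const)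

lemma has_mean_sum:
  assumes "\<And>i. i \<in> I \<Longrightarrow> sbounded (f i)" "\<And>i. i \<in> I \<Longrightarrow> has_mean (f i) (c i)"
  shows "has_mean (\<lambda>x. \<Sum>i\<in>I. f i x) (\<Sum>i\<in>I. c i)"
  using assms
  by (induction I rule: infinite_finite_induct) (auto intro!: has_mean_const has_mean_add sbounded_sum)

lemma has_mean_shift: "has_mean g c \<Longrightarrow> has_mean (\<lambda>x. g (x + t)) c"
  unfolding has_mean_def mean_shift by blast

lemma mean_cnj: "mean N x (\<lambda>x. cnj (g x)) = cnj (mean N x g)"
proof -
  have "(LINT u:cbx N|lborel. cnj (g (u + x))) = cnj (LINT u:cbx N|lborel. g (u + x))"
    unfolding set_lebesgue_integral_def using Bochner_Integration.integral_cnj[of lborel "\<lambda>u. indicator (cbx N) u *\<^sub>R g (u + x)"] by simp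
  thus ?thesis by (simp add: mean_def)
qed

lemma has_mean_cnj: 
  assumes "has_mean g c" shows "has_mean (\<lambda>x. cnj (g x)) (cnj c)"
  unfolding has_mean_def mean_cnj using assms unfolding has_mean_def 
  by (simp flip: complex_cnj_diff)

lemma has_mean_norm_le:
  assumes "has_mean g c" "g \<in> borel_measurable borel" "\<And>x. norm (g x) \<le> B"
  shows "norm c \<le> B"
proof (rule tendsto_upperbound[OF tendsto_norm[OF has_mean_tendsto[OF assms(1), of 0]]])
  show "\<forall>\<^sub>F N in at_top. norm (mean N 0 g) \<le> B"
    using eventually_gt_at_top[of 0] by eventually_elim (use assms in \<open>auto intro: norm_mean_le_const\<close>)
qed simp

lemma mean_nonneg:
  assumes "\<And>x. r x \<ge> 0" "N > 0" shows "Re (mean N x (\<lambda>x. complex_of_real (r x))) \<ge> 0"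
proof -
  have "(LINT u:cbx N|lborel. complex_of_real (r (u + x))) = of_real (LINT u:cbx N|lborel. r (u + x))"
    unfolding set_lebesgue_integral_def by (simp add: scaleR_conv_of_real flip: of_real_mult)
  moreover have "(LINT u:cbx N|lborel. r (u + x)) \<ge> 0"
    unfolding set_lebesgue_integral_def using assms by (intro integral_nonneg_AE) auto
  ultimately show ?thesis using assms(2) unfolding mean_def by (simp flip: of_real_mult of_real_inverse)
qed

lemma has_mean_nonneg:
  assumes "has_mean (\<lambda>x. complex_of_real (r x)) c" "\<And>x. r x \<ge> 0"
  shows "c = of_real (Re c)" "Re c \<ge> 0"
proof -
  have lim: "((\<lambda>N. mean N 0 (\<lambda>x. complex_of_real (r x))) \<longlongrightarrow> c) at_top" by (rule has_mean_tendsto) fact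
  have "((\<lambda>N. Im (mean N 0 (\<lambda>x. complex_of_real (r x)))) \<longlongrightarrow> Im c) at_top" by (intro tendsto_Im lim)
  hence "((\<lambda>N::real. 0::real) \<longlongrightarrow> Im c) at_top" using arg_cong[OF mean_of_real, of Im _ 0 r] by simp
  hence "Im c = 0" by (simp add: tendsto_const_iff)
  thus "c = of_real (Re c)" by (simp add: complex_eq_iff)
  show "Re c \<ge> 0"
  proof (rule tendsto_lowerbound[OF tendsto_Re[OF lim]])
    show "\<forall>\<^sub>F N in at_top. Re (mean N 0 (\<lambda>x. complex_of_real (r x))) \<ge> 0"
      using eventually_gt_at_top[of 0] by eventually_elim (use assms in \<open>auto intro: mean_nonneg\<close>)
  qed simp
qed

definition Mean :: "(real ^ 'm \<Rightarrow> complex) \<Rightarrow> complex" where "Mean g = (THE c. has_mean g c)"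

lemma Mean_eqI: "has_mean g c \<Longrightarrow> Mean g = c"
  unfolding Mean_def using has_mean_unique by blast

section \<open>Stepanoff and Bohr almost periodic functions\<close>

text \<open>The translation distance is only majorised by a gauge: nonnegative combinations of
  gauges are gauges, which gives closure under multiplication by \<open>bap\<close>
  functions.\<close>

definition sap :: "(real ^ 'm \<Rightarrow> complex) \<Rightarrow> bool" where
  "sap f \<longleftrightarrow> sbounded f \<and> (\<exists>D. ap_gauge D \<and> (\<forall>t. snorm (\<lambda>x. f (x + t) - f x) \<le> ennreal (D t)))"

lemma sap_sbounded: "sap f \<Longrightarrow> sbounded f" by (simp add: sap_def)

lemma sap_has_mean: "sap f \<Longrightarrow> has_mean f (Mean f)"
  unfolding sap_def using has_mean_exists Mean_eqI by metis

text \<open>The gauge \<open>D\<close> serves at once as a uniform modulus of continuity and as a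
  measure of almost periods.\<close>

definition bap :: "(real ^ 'm \<Rightarrow> complex) \<Rightarrow> bool" where
  "bap \<phi> \<longleftrightarrow> (\<exists>D B. ap_gauge D \<and> (\<forall>x. norm (\<phi> x) \<le> B) \<and> (\<forall>x t. norm (\<phi> (x + t) - \<phi> x) \<le> D t))"

lemma bap_continuous: assumes "bap \<phi>" shows "continuous_on UNIV \<phi>"
proof -
  obtain D where D: "ap_gauge D" "\<And>x t. norm (\<phi> (x + t) - \<phi> x) \<le> D t" using assms unfolding bap_def by blast
  show ?thesis unfolding continuous_on_iff
  proof (intro ballI allI impI)
    fix x :: "real^'a" and e :: real assume "e > 0"
    then obtain d where d: "d > 0" "\<And>t. norm t < d \<Longrightarrow> D t < e" using ap_gaugeD(5)[OF D(1)] by blast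
    show "\<exists>d>0. \<forall>x'\<in>UNIV. dist x' x < d \<longrightarrow> dist (\<phi> x') (\<phi> x) < e"
      using d D(2)[of x] by (intro exI[of _ d]) (force simp: dist_norm intro: order.strict_trans1 dest: spec[of _ "_ - x"])
  qed
qed

lemma bap_measurable [measurable_dest]: "bap \<phi> \<Longrightarrow> \<phi> \<in> borel_measurable borel"
  by (intro borel_measurable_continuous_onI bap_continuous)

lemma bapE:
  assumes "bap \<phi>"
  obtains D B where "ap_gauge D" "B \<ge> 0" "\<And>x. norm (\<phi> x) \<le> B" "\<And>x t. norm (\<phi> (x + t) - \<phi> x) \<le> D t"
  using assms unfolding bap_def by (metis norm_ge_zero order_trans)

lemma bap_mult:
  assumes "bap f" "bap g" shows "bap (\<lambda>x. f x * g x)"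
proof -
  obtain D B where D: "ap_gauge D" "B \<ge> 0" "\<And>x. norm (f x) \<le> B" "\<And>x t. norm (f (x + t) - f x) \<le> D t"
    using assms(1) by (rule bapE) blast
  obtain E C where E: "ap_gauge E" "C \<ge> 0" "\<And>x. norm (g x) \<le> C" "\<And>x t. norm (g (x + t) - g x) \<le> E t"
    using assms(2) by (rule bapE) blast
  show ?thesis unfolding bap_def
  proof (intro exI conjI allI)
    show "ap_gauge (\<lambda>t. C * D t + B * E t)" by (intro ap_gauge_add ap_gauge_cmult D E)
    show "norm (f x * g x) \<le> B * C" for x using D E by (auto simp: norm_mult intro!: mult_mono)
    fix x t
    have "f (x + t) * g (x + t) - f x * g x = g (x + t) * (f (x + t) - f x) + f x * (g (x + t) - g x)"
      by (simp add: algebra_simps)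
    also have "norm \<dots> \<le> C * D t + B * E t" using D E
      by (intro order_trans[OF norm_triangle_ineq] add_mono) (auto simp: norm_mult intro!: mult_mono)
    finally show "norm (f (x + t) * g (x + t) - f x * g x) \<le> C * D t + B * E t" .
  qed
qed

lemma bap_add:
  assumes "bap f" "bap g" shows "bap (\<lambda>x. f x + g x)"
proof -
  obtain D B where D: "ap_gauge D" "B \<ge> 0" "\<And>x. norm (f x) \<le> B" "\<And>x t. norm (f (x + t) - f x) \<le> D t"
    using assms(1) by (rule bapE) blast
  obtain E C where E: "ap_gauge E" "C \<ge> 0" "\<And>x. norm (g x) \<le> C" "\<And>x t. norm (g (x + t) - g x) \<le> E t"
    using assms(2) by (rule bapE) blast
  show ?thesis unfolding bap_def
  proof (intro exI conjI allI)
    show "ap_gauge (\<lambda>t. D t + E t)" by (intro ap_gauge_add D E)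
    show "norm (f x + g x) \<le> B + C" for x using D E by (intro order_trans[OF norm_triangle_ineq] add_mono)
    fix x t
    have "f (x + t) + g (x + t) - (f x + g x) = (f (x + t) - f x) + (g (x + t) - g x)" by simp
    also have "norm \<dots> \<le> D t + E t" by (intro order_trans[OF norm_triangle_ineq] add_mono D E)
    finally show "norm (f (x + t) + g (x + t) - (f x + g x)) \<le> D t + E t" .
  qed
qed

lemma bap_const: "bap (\<lambda>_. c)"
  unfolding bap_def by (intro exI[of _ "\<lambda>_. 0"] exI[of _ "norm c"]) (simp add: ap_gauge_zero)

lemma bap_cmult: "bap f \<Longrightarrow> bap (\<lambda>x. c * f x)" by (intro bap_mult bap_const)

lemma bap_diff: "bap f \<Longrightarrow> bap g \<Longrightarrow> bap (\<lambda>x. f x - g x)"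
  using bap_add[of f "\<lambda>x. (-1) * g x"] bap_cmult[of g "-1"] by simp

lemma bap_sum: "(\<And>i. i \<in> I \<Longrightarrow> bap (f i)) \<Longrightarrow> bap (\<lambda>x. \<Sum>i\<in>I. f i x)"
  by (induction I rule: infinite_finite_induct) (auto intro: bap_const bap_add)

lemma bap_cnj: "bap f \<Longrightarrow> bap (\<lambda>x. cnj (f x))"
  unfolding bap_def by (simp flip: complex_cnj_diff)

text \<open>The increment of the product is split so that each term pairs a Stepanoff norm with a
  supremum. One factor has to be bounded, since a product of two Stepanoff functions of order 1 need
  not even be locally integrable.\<close>

lemma sap_mult_bap:
  assumes f: "sap f" and g: "bap g" shows "sap (\<lambda>x. f x * g x)"
proof -
  obtain D where D: "ap_gauge D" "\<And>t. snorm (\<lambda>x. f (x + t) - f x) \<le> ennreal (D t)" and sf: "sbounded f"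
    using f unfolding sap_def by blast
  obtain E C where E: "ap_gauge E" "C \<ge> 0" "\<And>x. norm (g x) \<le> C" "\<And>x t. norm (g (x + t) - g x) \<le> E t"
    using g by (rule bapE) blast
  have [measurable]: "f \<in> borel_measurable borel" "g \<in> borel_measurable borel"
    using sf g by (auto dest: bap_measurable simp: sbounded_def)
  define S where "S = enn2real (snorm f)"
  have S: "S \<ge> 0" "snorm f = ennreal S" using sf by (auto simp: S_def sbounded_def)
  show ?thesis unfolding sap_def
  proof (intro conjI exI allI)
    show "sbounded (\<lambda>x. f x * g x)" using sf E by (intro sbounded_mult[where B=C]) auto
    show "ap_gauge (\<lambda>t. C * D t + S * E t)" by (intro ap_gauge_add ap_gauge_cmult D E S)
    fix t
    have nn: "D t \<ge> 0" "E t \<ge> 0" using ap_gaugeD(2) D E by blast+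
    have "snorm (\<lambda>x. f (x + t) * g (x + t) - f x * g x) = 
       snorm (\<lambda>x. (f (x + t) - f x) * g (x + t) + f x * (g (x + t) - g x))"
      by (simp add: algebra_simps)
    also have "\<dots> \<le> snorm (\<lambda>x. (f (x + t) - f x) * g (x + t)) + snorm (\<lambda>x. f x * (g (x + t) - g x))"
      by (rule snorm_triangle) auto
    also have "snorm (\<lambda>x. (f (x + t) - f x) * g (x + t)) \<le> snorm (\<lambda>x. of_real C * (f (x + t) - f x))"
      using E by (intro snorm_mono) (auto simp: norm_mult mult.commute[of C] intro!: mult_left_mono)
    also have "\<dots> \<le> ennreal C * snorm (\<lambda>x. f (x + t) - f x)"
      using snorm_cmult[of "\<lambda>x. f (x + t) - f x" "of_real C"] E by simp
    also have "\<dots> \<le> ennreal C * ennreal (D t)" by (intro mult_left_mono D) auto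
    also have "snorm (\<lambda>x. f x * (g (x + t) - g x)) \<le> snorm (\<lambda>x. of_real (E t) * f x)"
      using E nn by (intro snorm_mono) (auto simp: norm_mult mult.commute[of "E t"] intro!: mult_left_mono)
    also have "\<dots> \<le> ennreal (E t) * snorm f"
      using snorm_cmult[of f "of_real (E t)"] nn by simp
    finally show "snorm (\<lambda>x. f (x + t) * g (x + t) - f x * g x) \<le> ennreal (C * D t + S * E t)"
      using S nn E by (simp add: ennreal_mult mult.commute add_mono)
  qed
qed

lemma bap_sap: assumes "bap g" shows "sap g"
proof -
  have "ap_gauge (\<lambda>_::real^'a. 0)" by (rule ap_gauge_zero)
  moreover have "sbounded (\<lambda>_::real^'a. 1)" by (rule sbounded_bounded[where B=1]) auto
  moreover have "snorm (\<lambda>_::real^'a. 0) \<le> ennreal 0" by (rule snorm_bounded) simp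
  ultimately have "sap (\<lambda>_::real^'a. 1)" unfolding sap_def by auto
  from sap_mult_bap[OF this assms] show ?thesis by simp
qed

lemma bap_sbounded: "bap g \<Longrightarrow> sbounded g" by (intro sap_sbounded bap_sap)

lemma bap_has_mean: "bap g \<Longrightarrow> has_mean g (Mean g)" by (intro sap_has_mean bap_sap)

section \<open>Characters, Fourier coefficients and Bessel's inequality\<close>

definition ch :: "real ^ 'm \<Rightarrow> real ^ 'm \<Rightarrow> complex" where
  "ch l x = exp (\<i> * of_real (l \<bullet> x))"

lemma norm_ch [simp]: "norm (ch l x) = 1" by (simp add: ch_def)
lemma ch_add: "ch l (x + t) = ch l x * ch l t" by (simp add: ch_def inner_add_right distrib_left exp_add)
lemma ch_add_left: "ch (k + l) x = ch k x * ch l x" by (simp add: ch_def inner_add_left distrib_left exp_add)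
lemma cnj_ch: "cnj (ch l x) = ch (- l) x" by (simp add: ch_def exp_cnj)
lemma ch_zero [simp]: "ch 0 x = 1" "ch l 0 = 1" by (auto simp: ch_def)
lemma ch_minus_right: "ch l (- x) = ch (- l) x" by (simp add: ch_def)
lemma ch_mult_minus: "ch l x * ch (- l) x = 1" by (simp flip: ch_add_left)
lemma continuous_on_ch: "continuous_on S (ch l)" unfolding ch_def[abs_def] by (intro continuous_intros)
lemma borel_measurable_ch [measurable]: "ch l \<in> borel_measurable borel"
  by (intro borel_measurable_continuous_onI continuous_on_ch)

text \<open>For relative density only the component of \<open>t\<close> along \<open>l\<close>
  matters: \<open>l \<bullet> t\<close> is reduced modulo \<open>2 * pi\<close>, and the remainder
  is realised by a multiple \<open>s\<close> of \<open>l\<close> of norm at most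
  \<open>2 * pi / norm l\<close>.\<close>

lemma ap_gauge_ch: "ap_gauge (\<lambda>t. norm (ch l t - 1))"
proof (rule ap_gaugeI_relatively_dense)
  fix t s :: "real^'a"
  have "norm (ch l (- t) - 1) = norm (ch l (- t) * (1 - ch l t))"
    by (simp add: algebra_simps ch_minus_right mult.commute[of "ch (- l) t"] ch_mult_minus)
  thus "norm (ch l (- t) - 1) = norm (ch l t - 1)" by (simp add: norm_mult norm_minus_commute)
  have "norm (ch l (s + t) - 1) = norm (ch l s * (ch l t - 1) + (ch l s - 1))" by (simp add: ch_add algebra_simps)
  also have "\<dots> \<le> norm (ch l s * (ch l t - 1)) + norm (ch l s - 1)" by (rule norm_triangle_ineq)
  finally show "norm (ch l (s + t) - 1) \<le> norm (ch l s - 1) + norm (ch l t - 1)" by (simp add: norm_mult)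
next
  fix \<epsilon> :: real assume e: "\<epsilon> > 0"
  have "isCont (ch l) 0" using continuous_on_ch[of UNIV l] by (simp add: continuous_on_eq_continuous_at)
  thus "\<exists>\<delta>>0. \<forall>t. norm t < \<delta> \<longrightarrow> norm (ch l t - 1) < \<epsilon>"
    using e unfolding continuous_at_eps_delta by (auto simp: dist_norm)
next
  fix \<epsilon> :: real assume e: "\<epsilon> > 0"
  show "\<exists>L. \<forall>t. \<exists>s. norm s \<le> L \<and> norm (ch l (t - s) - 1) < \<epsilon>"
  proof (rule exI, rule allI)
    fix t
    define k where "k = \<lfloor>(l \<bullet> t) / (2 * pi)\<rfloor>"
    \<comment> \<open>For \<open>l = 0\<close> division by zero gives \<open>s = 0\<close>, and the
      bound \<open>2 * pi / norm l\<close> is 0 as well.\<close>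
    define s where "s = ((l \<bullet> t - 2 * pi * k) / (l \<bullet> l)) *\<^sub>R l"
    have k: "0 \<le> l \<bullet> t - 2 * pi * k" "l \<bullet> t - 2 * pi * k \<le> 2 * pi"
    proof -
      have "of_int k \<le> (l \<bullet> t) / (2 * pi)" "(l \<bullet> t) / (2 * pi) \<le> of_int k + 1" unfolding k_def by linarith+
      thus "0 \<le> l \<bullet> t - 2 * pi * k" "l \<bullet> t - 2 * pi * k \<le> 2 * pi" by (simp_all add: field_simps)
    qed
    show "\<exists>s. norm s \<le> 2 * pi / norm l \<and> norm (ch l (t - s) - 1) < \<epsilon>"
    proof (intro exI[of _ s] conjI)
      show "norm s \<le> 2 * pi / norm l"
      proof (cases "l = 0")
        case False
        have "norm s = (l \<bullet> t - 2 * pi * k) / norm l" using k False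
          by (simp add: s_def power2_norm_eq_inner[symmetric] power2_eq_square)
        thus ?thesis using k by (simp add: divide_right_mono)
      qed (simp add: s_def)
      have "ch l (t - s) = 1"
      proof (cases "l = 0")
        case False
        hence "l \<bullet> (t - s) = 2 * pi * k" by (simp add: s_def inner_diff_right)
        hence "ch l (t - s) = exp (\<i> * (of_int k * (of_real pi * 2)))" by (simp add: ch_def mult_ac)
        also have "\<dots> = 1" using exp_integer_2pi[of "of_int k"] by (simp add: mult_ac)
        finally show ?thesis .
      qed simp
      thus "norm (ch l (t - s) - 1) < \<epsilon>" using e by simp
    qed
  qed
qed auto

lemma bap_ch: "bap (ch l)"
  unfolding bap_def
proof (intro exI conjI allI)
  show "ap_gauge (\<lambda>t. norm (ch l t - 1))" by (rule ap_gauge_ch)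
  show "norm (ch l x) \<le> 1" for x by simp
  fix x t
  have "ch l (x + t) - ch l x = ch l x * (ch l t - 1)" by (simp add: ch_add algebra_simps)
  thus "norm (ch l (x + t) - ch l x) \<le> norm (ch l t - 1)" by (simp add: norm_mult)
qed

text \<open>Translation by the half period \<open>t\<close>, where \<open>ch l t = -1\<close>,
  preserves the mean and reverses the sign of the character.\<close>

lemma Mean_ch: "Mean (ch l) = (if l = 0 then 1 else 0)"
proof (cases "l = 0")
  case True
  hence "ch l = (\<lambda>_. 1)" by auto
  thus ?thesis using True Mean_eqI[OF has_mean_const] by simp
next
  case False
  define t where "t = (pi / (l \<bullet> l)) *\<^sub>R l"
  have "ch l t = -1" using False by (simp add: ch_def t_def)
  hence "(\<lambda>x. ch l (x + t)) = (\<lambda>x. (-1) * ch l x)" by (simp add: ch_add fun_eq_iff)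
  moreover have "has_mean (\<lambda>x. ch l (x + t)) (Mean (ch l))" by (intro has_mean_shift bap_has_mean bap_ch)
  moreover have "has_mean (\<lambda>x. (-1) * ch l x) ((-1) * Mean (ch l))" by (intro has_mean_cmult bap_has_mean bap_ch)
  ultimately have "Mean (ch l) = (-1) * Mean (ch l)" using has_mean_unique by metis
  thus ?thesis using False by simp
qed

lemma Mean_add: "sap f \<Longrightarrow> sap g \<Longrightarrow> Mean (\<lambda>x. f x + g x) = Mean f + Mean g"
  by (intro Mean_eqI has_mean_add sap_sbounded sap_has_mean)
lemma Mean_diff: "sap f \<Longrightarrow> sap g \<Longrightarrow> Mean (\<lambda>x. f x - g x) = Mean f - Mean g"
  by (intro Mean_eqI has_mean_diff sap_sbounded sap_has_mean)
lemma Mean_cmult: "sap f \<Longrightarrow> Mean (\<lambda>x. c * f x) = c * Mean f"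
  by (intro Mean_eqI has_mean_cmult sap_has_mean)
lemma Mean_sum: "(\<And>i. i \<in> I \<Longrightarrow> sap (f i)) \<Longrightarrow> Mean (\<lambda>x. \<Sum>i\<in>I. f i x) = (\<Sum>i\<in>I. Mean (f i))"
  by (intro Mean_eqI has_mean_sum sap_sbounded sap_has_mean)
lemma Mean_cnj: "sap f \<Longrightarrow> Mean (\<lambda>x. cnj (f x)) = cnj (Mean f)"
  by (intro Mean_eqI has_mean_cnj sap_has_mean)

definition fc :: "(real ^ 'm \<Rightarrow> complex) \<Rightarrow> real ^ 'm \<Rightarrow> complex" where
  "fc f l = Mean (\<lambda>x. f x * ch (- l) x)"

definition residual :: "(real ^ 'm \<Rightarrow> complex) \<Rightarrow> (real ^ 'm) set \<Rightarrow> real ^ 'm \<Rightarrow> complex" where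
  "residual \<phi> \<Lambda> x = \<phi> x - (\<Sum>l\<in>\<Lambda>. fc \<phi> l * ch l x)"

lemma bap_residual: "bap \<phi> \<Longrightarrow> bap (residual \<phi> \<Lambda>)"
  unfolding residual_def[abs_def] by (intro bap_diff bap_sum bap_cmult bap_ch)

lemma fc_residual:
  assumes \<phi>: "bap \<phi>" and fin: "finite \<Lambda>"
  shows "fc (residual \<phi> \<Lambda>) k = (if k \<in> \<Lambda> then 0 else fc \<phi> k)"
proof -
  have "fc (residual \<phi> \<Lambda>) k = Mean (\<lambda>x. \<phi> x * ch (- k) x - (\<Sum>l\<in>\<Lambda>. fc \<phi> l * ch (l - k) x))"
    unfolding fc_def[of "residual \<phi> \<Lambda>"] residual_def
    by (simp add: algebra_simps sum_distrib_left diff_conv_add_uminus ch_add_left del: add_uminus_conv_diff)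
  also have "\<dots> = fc \<phi> k - (\<Sum>l\<in>\<Lambda>. fc \<phi> l * Mean (ch (l - k)))"
    unfolding fc_def[of \<phi> k]
    by (subst Mean_diff Mean_sum Mean_cmult; (intro bap_sap bap_mult bap_sum bap_cmult bap_ch \<phi>)?)+ simp
  also have "(\<Sum>l\<in>\<Lambda>. fc \<phi> l * Mean (ch (l - k))) = (if k \<in> \<Lambda> then fc \<phi> k else 0)"
    using fin by (simp add: Mean_ch if_distrib cong: if_cong)
  finally show ?thesis by simp
qed

text \<open>The coefficients of the residual at the exponents in \<open>\<Lambda>\<close> vanish, so
  it is orthogonal to the partial sum that was subtracted. A mean square thereby becomes a
  correlation with \<open>\<phi>\<close>, the form in which it can be estimated.\<close>

lemma Mean_residual_self:
  assumes \<phi>: "bap \<phi>" and fin: "finite \<Lambda>"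
  shows "Mean (\<lambda>x. residual \<phi> \<Lambda> x * cnj (residual \<phi> \<Lambda> x)) = Mean (\<lambda>x. residual \<phi> \<Lambda> x * cnj (\<phi> x))"
proof -
  let ?r = "residual \<phi> \<Lambda>"
  have "(\<lambda>x. ?r x * cnj (?r x)) = (\<lambda>x. ?r x * cnj (\<phi> x) - (\<Sum>l\<in>\<Lambda>. cnj (fc \<phi> l) * (?r x * ch (- l) x)))"
    by (rule ext, subst (2) residual_def) (simp add: cnj_ch right_diff_distrib sum_distrib_left mult_ac)
  moreover have "Mean \<dots> = Mean (\<lambda>x. ?r x * cnj (\<phi> x)) - (\<Sum>l\<in>\<Lambda>. cnj (fc \<phi> l) * Mean (\<lambda>x. ?r x * ch (- l) x))"
    by (subst Mean_diff Mean_sum Mean_cmult; (intro bap_sap bap_mult bap_sum bap_cmult bap_cnj bap_ch bap_residual \<phi>)?)+ simp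
  moreover have "(\<Sum>l\<in>\<Lambda>. cnj (fc \<phi> l) * Mean (\<lambda>x. ?r x * ch (- l) x)) = 0"
    using fc_residual[OF \<phi> fin] by (intro sum.neutral) (auto simp: fc_def)
  ultimately show ?thesis by simp
qed

lemma bessel_identity:
  assumes \<phi>: "bap \<phi>" and fin: "finite \<Lambda>"
  shows "Mean (\<lambda>x. residual \<phi> \<Lambda> x * cnj (\<phi> x)) = Mean (\<lambda>x. \<phi> x * cnj (\<phi> x)) - of_real (\<Sum>l\<in>\<Lambda>. (norm (fc \<phi> l))\<^sup>2)"
proof -
  have "(\<lambda>x. residual \<phi> \<Lambda> x * cnj (\<phi> x)) = (\<lambda>x. \<phi> x * cnj (\<phi> x) - (\<Sum>l\<in>\<Lambda>. fc \<phi> l * cnj (\<phi> x * ch (- l) x)))"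
    unfolding residual_def left_diff_distrib sum_distrib_right by (simp add: cnj_ch mult_ac)
  moreover have "Mean \<dots> = Mean (\<lambda>x. \<phi> x * cnj (\<phi> x)) - (\<Sum>l\<in>\<Lambda>. fc \<phi> l * Mean (\<lambda>x. cnj (\<phi> x * ch (- l) x)))"
    by (subst Mean_diff Mean_sum Mean_cmult; (intro bap_sap bap_mult bap_sum bap_cmult bap_cnj bap_ch \<phi>)?)+ simp
  moreover have "Mean (\<lambda>x. cnj (\<phi> x * ch (- l) x)) = cnj (fc \<phi> l)" for l
    unfolding fc_def by (intro Mean_cnj bap_sap bap_mult bap_ch \<phi>)
  ultimately show ?thesis unfolding of_real_sum complex_norm_square by simp
qed

lemma Mean_norm_square_nonneg:
  assumes "bap g" shows "Mean (\<lambda>x. g x * cnj (g x)) = of_real (Re (Mean (\<lambda>x. g x * cnj (g x))))"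
    "Re (Mean (\<lambda>x. g x * cnj (g x))) \<ge> 0"
proof -
  have "has_mean (\<lambda>x. g x * cnj (g x)) (Mean (\<lambda>x. g x * cnj (g x)))"
    by (intro bap_has_mean bap_mult bap_cnj assms)
  hence "has_mean (\<lambda>x. complex_of_real ((norm (g x))\<^sup>2)) (Mean (\<lambda>x. g x * cnj (g x)))"
    by (simp only: complex_norm_square)
  from has_mean_nonneg[OF this] show "Mean (\<lambda>x. g x * cnj (g x)) = of_real (Re (Mean (\<lambda>x. g x * cnj (g x))))"
    "Re (Mean (\<lambda>x. g x * cnj (g x))) \<ge> 0" by auto
qed

lemma bessel_inequality:
  assumes \<phi>: "bap \<phi>" and fin: "finite \<Lambda>"
  shows "(\<Sum>l\<in>\<Lambda>. (norm (fc \<phi> l))\<^sup>2) \<le> Re (Mean (\<lambda>x. \<phi> x * cnj (\<phi> x)))"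
  using Mean_norm_square_nonneg(2)[OF bap_residual[OF \<phi>], of \<Lambda>] Mean_residual_self[OF \<phi> fin] 
    bessel_identity[OF \<phi> fin] by simp

section \<open>Windowed Fourier coefficients, uniformly in the frequency\<close>

lemma mean_cong: "(\<And>u. u \<in> cbx N \<Longrightarrow> f (u + x) = g (u + x)) \<Longrightarrow> mean N x f = mean N x g"
  by (auto simp: mean_def set_lebesgue_integral_def indicator_def intro!: Bochner_Integration.integral_cong)

lemma mean_near_const_on:
  fixes k :: "real ^ 'm \<Rightarrow> complex"
  assumes [measurable]: "k \<in> borel_measurable borel" and le: "\<And>u. u \<in> cbx N \<Longrightarrow> norm (k (u + x) - c) \<le> \<epsilon>" 
    and N: "N > 0"
  shows "norm (mean N x k - c) \<le> \<epsilon>"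
proof -
  \<comment> \<open>Outside the window \<open>k\<close> is replaced by \<open>c\<close>, which the
    mean does not see, and the global estimate applies.\<close>
  define k' where "k' = (\<lambda>z. if z - x \<in> cbx N then k z else c)"
  have "norm (k (0 + x) - c) \<le> \<epsilon>" using N by (intro le) (simp add: mem_cbx)
  hence e: "\<epsilon> \<ge> 0" using norm_ge_zero order_trans by blast
  have "mean N x k = mean N x k'" by (rule mean_cong) (simp add: k'_def)
  moreover have "norm (mean N x k' - c) \<le> \<epsilon>"
  proof (rule mean_near_const)
    have "{z. z - x \<in> cbx N} \<in> sets borel" by (intro borel_closed closed_vimage[of "cbx N" "\<lambda>z. z - x", unfolded vimage_def]) (auto intro!: continuous_intros)
    thus "k' \<in> borel_measurable borel" unfolding k'_def by (intro measurable_If) auto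
    fix z show "norm (k' z - c) \<le> \<epsilon>" using le[of "z - x"] e by (simp add: k'_def)
  qed fact
  ultimately show ?thesis by simp
qed

lemma norm_ch_minus_one_le: "norm (ch l x - 1) \<le> norm l * norm x"
proof -
  have "norm (exp (\<i> * of_real (l \<bullet> x)) - 1) \<le> \<bar>l \<bullet> x\<bar>"
    using abs_sin_x_le_abs_x[of "(l \<bullet> x) / 2"] by (simp add: dist_exp_i_1)
  thus ?thesis using Cauchy_Schwarz_ineq2[of l x] by (simp add: ch_def)
qed

lemma ch_twist_sbounded:
  assumes r: "bap r" and B: "\<And>x. norm (r x) \<le> B"
  shows "sbounded (\<lambda>x. r x * ch l x)" "snorm (\<lambda>x. r x * ch l x) \<le> ennreal B"
proof -
  show "sbounded (\<lambda>x. r x * ch l x)" by (intro bap_sbounded bap_mult r bap_ch)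
  show "snorm (\<lambda>x. r x * ch l x) \<le> ennreal B" using B by (intro snorm_bounded) (simp add: norm_mult)
qed

lemma mean_twist_shift_le:
  fixes r :: "real ^ 'm \<Rightarrow> complex" and h :: "real ^ 'm"
  assumes r: "bap r" and B: "\<And>x. norm (r x) \<le> B"
    and h: "\<And>i. \<bar>h $ i\<bar> \<le> L" and N: "N \<ge> L + 1"
  shows "norm (mean N (x + h) (\<lambda>x. r x * ch l x) - mean N x (\<lambda>x. r x * ch l x)) \<le> max 0 (B * edge CARD('m) L N)"
proof -
  have B0: "B \<ge> 0" using B norm_ge_zero order_trans by blast
  have "ennreal (norm (mean N (x + h) (\<lambda>x. r x * ch l x) - mean N x (\<lambda>x. r x * ch l x)))
     \<le> snorm (\<lambda>x. r x * ch l x) * ennreal (edge CARD('m) L N)"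
    using ch_twist_sbounded(1)[OF r B] by (intro mean_shift_bound h N) (auto simp: sbounded_def)
  also have "\<dots> \<le> ennreal B * ennreal (edge CARD('m) L N)" by (intro mult_right_mono ch_twist_sbounded r B) auto
  also have "\<dots> = ennreal (B * edge CARD('m) L N)" using B0 by (simp add: ennreal_mult')
  finally show ?thesis by (auto simp: ennreal_le_iff2 max_def)
qed

lemma eventually_edge_small:
  assumes "\<eta> > (0::real)" obtains N0 where "N0 \<ge> L + 1" "\<And>N. N \<ge> N0 \<Longrightarrow> max 0 (B * edge m L N) \<le> \<eta>"
proof -
  have "((\<lambda>N. B * edge m L N) \<longlongrightarrow> B * 0) at_top" by (intro tendsto_intros edge_tendsto)
  hence "\<forall>\<^sub>F N in at_top. B * edge m L N < \<eta>" using assms by (intro order_tendstoD(2)[where y="B * 0"]) auto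
  then obtain N1 where "\<And>N. N \<ge> N1 \<Longrightarrow> B * edge m L N < \<eta>" unfolding eventually_at_top_linorder by blast
  thus ?thesis using that[of "max N1 (L + 1)"] assms by (force intro: less_imp_le)
qed

text \<open>For \<open>h\<close> of length \<open>pi / norm l\<close> along \<open>l\<close> one has
  \<open>ch l h = -1\<close>. The sum of the means over the windows centred at 0 and at
  \<open>h\<close> is then small by uniform continuity of \<open>r\<close>, their difference by the
  edge estimate, and hence each of them.\<close>

lemma mean_twist_high_frequency:
  fixes r :: "real ^ 'm \<Rightarrow> complex"
  assumes r: "bap r" and \<eta>: "\<eta> > 0"
  obtains \<Lambda> N0 where "\<And>N l. N \<ge> N0 \<Longrightarrow> norm l \<ge> \<Lambda> \<Longrightarrow> norm (mean N 0 (\<lambda>x. r x * ch l x)) \<le> \<eta>"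
proof -
  obtain E B where E: "ap_gauge E" "B \<ge> 0" "\<And>x. norm (r x) \<le> B" "\<And>x t. norm (r (x + t) - r x) \<le> E t"
    using r by (rule bapE) blast
  obtain d where d: "d > 0" "\<And>t. norm t < d \<Longrightarrow> E t < \<eta>" using ap_gaugeD(5)[OF E(1) \<eta>] by blast
  obtain N0 where N0: "N0 \<ge> 1 + 1" "\<And>N. N \<ge> N0 \<Longrightarrow> max 0 (B * edge CARD('m) 1 N) \<le> \<eta>" 
    using eventually_edge_small[OF \<eta>] by blast
  \<comment> \<open>From this frequency on the half period is shorter than \<open>d\<close>, the
    modulus of continuity for \<open>\<eta>\<close>, and at most 1, as the edge estimate with
    \<open>L = 1\<close> requires.\<close>
  define \<Lambda> where "\<Lambda> = pi / min (d/2) 1"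
  have L0: "\<Lambda> > 0" using d by (simp add: \<Lambda>_def)
  show ?thesis
  proof (rule that[of N0 \<Lambda>])
    fix N and l :: "real^'m" assume N: "N \<ge> N0" and l: "norm l \<ge> \<Lambda>"
    have l0: "norm l > 0" "l \<noteq> 0" using l L0 by auto
    define h where "h = (pi / (l \<bullet> l)) *\<^sub>R l"
    have nh: "norm h = pi / norm l" using l0 by (simp add: h_def power2_norm_eq_inner[symmetric] power2_eq_square)
    also have "\<dots> \<le> pi / \<Lambda>" using l L0 l0 by (intro divide_left_mono mult_pos_pos) auto
    also have "\<dots> = min (d/2) 1" using d by (simp add: \<Lambda>_def)
    finally have h: "norm h \<le> min (d/2) 1" .
    have chh: "ch l h = -1" using l0 by (simp add: ch_def h_def)
    let ?g = "\<lambda>x. r x * ch l x"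
    have "norm (mean N (0 + h) ?g - mean N 0 ?g) \<le> max 0 (B * edge CARD('m) 1 N)"
    proof (rule mean_twist_shift_le[OF r E(3)])
      show "\<bar>h $ i\<bar> \<le> 1" for i using component_le_norm_cart[of h i] h by simp
    qed (use N N0 in auto)
    from order_trans[OF this N0(2)[OF N]] have 1: "norm (mean N h ?g - mean N 0 ?g) \<le> \<eta>" by simp
    have bs: "sbounded ?g" "sbounded (\<lambda>x. ?g (x + h))" 
      using ch_twist_sbounded(1)[OF r E(3)] sbounded_shift by blast+
    have "mean N 0 ?g + mean N h ?g = mean N 0 (\<lambda>x. ?g x + ?g (x + h))"
      using mean_add[OF bs, of N 0] mean_shift[of N 0 ?g h] by simp
    also have "(\<lambda>x. ?g x + ?g (x + h)) = (\<lambda>x. - ((r (x + h) - r x) * ch l x))"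
      by (simp add: ch_add chh algebra_simps fun_eq_iff)
    also have "norm (mean N 0 \<dots>) \<le> \<eta>"
    proof (rule norm_mean_le_const)
      show "(\<lambda>x. - ((r (x + h) - r x) * ch l x)) \<in> borel_measurable borel" using bap_measurable[OF r] by measurable
      show "norm (- ((r (x + h) - r x) * ch l x)) \<le> \<eta>" for x
        using E(4)[of x h] d(2)[of h] h d(1) by (simp add: norm_mult)
    qed (use N N0 in auto)
    finally have 2: "norm (mean N 0 ?g + mean N h ?g) \<le> \<eta>" .
    have "2 * mean N 0 ?g = (mean N 0 ?g + mean N h ?g) - (mean N h ?g - mean N 0 ?g)" by simp
    hence "norm (2 * mean N 0 ?g) \<le> \<eta> + \<eta>"
      using 1 2 norm_triangle_ineq4[of "mean N 0 ?g + mean N h ?g" "mean N h ?g - mean N 0 ?g"] by simp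
    thus "norm (mean N 0 ?g) \<le> \<eta>" by (simp add: norm_mult)
  qed
qed

lemma norm_cbx_le: 
  fixes u :: "real ^ 'm" and T :: real assumes "u \<in> cbx T" shows "norm u \<le> CARD('m) * T"
proof -
  have "norm u \<le> (\<Sum>i\<in>UNIV. \<bar>u $ i\<bar>)" by (rule norm_le_l1_cart)
  also have "\<dots> \<le> (\<Sum>i\<in>(UNIV::'m set). T)" using assms by (intro sum_mono) (auto simp: mem_cbx)
  finally show ?thesis by simp
qed

text \<open>On a window of fixed size \<open>T\<close>, where the mean at \<open>k\<close> has
  settled, \<open>ch l\<close> is nearly a constant phase times \<open>ch k\<close> once
  \<open>l\<close> is close to \<open>k\<close>. A large window is averaged from such small ones by
  \<open>mean_mean_commute\<close>, so one \<open>\<rho>\<close> serves all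
  \<open>N \<ge> N0\<close>. The three \<open>\<eta>\<close> pay for the settling, for the phase and
  for the edge of the large window.\<close>

lemma mean_twist_near_frequency:
  fixes r :: "real ^ 'm \<Rightarrow> complex"
  assumes r: "bap r" and c: "norm (Mean (\<lambda>x. r x * ch k x)) \<le> c" and \<eta>: "\<eta> > 0"
  shows "\<exists>\<rho>>0. \<exists>N0. \<forall>N\<ge>N0. \<forall>l. norm (l - k) < \<rho> \<longrightarrow> norm (mean N 0 (\<lambda>x. r x * ch l x)) \<le> c + 3 * \<eta>"
proof -
  obtain B where B: "B \<ge> 0" "\<And>x. norm (r x) \<le> B"
    using r by (rule bapE) blast
  have rm [measurable]: "r \<in> borel_measurable borel" by (rule bap_measurable) fact
  have "has_mean (\<lambda>x. r x * ch k x) (Mean (\<lambda>x. r x * ch k x))" by (intro bap_has_mean bap_mult r bap_ch)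
  then obtain T0 where T0: "\<And>N x. N \<ge> T0 \<Longrightarrow> norm (mean N x (\<lambda>x. r x * ch k x) - Mean (\<lambda>x. r x * ch k x)) < \<eta>"
    unfolding has_mean_def using \<eta> by meson
  define T where "T = max T0 1"
  have T: "T \<ge> 1" "T \<ge> T0" by (auto simp: T_def)
  have mk: "norm (mean T x (\<lambda>x. r x * ch k x)) \<le> c + \<eta>" for x
    using T0[OF T(2), of x] c norm_triangle_sub[of "mean T x (\<lambda>x. r x * ch k x)" "Mean (\<lambda>x. r x * ch k x)"] by simp
  \<comment> \<open>Makes the phase error \<open>B * (norm (l - k) * norm u)\<close> at most
    \<open>\<eta>\<close> for \<open>u\<close> in the small window; \<open>B + 1\<close> keeps the
    denominator positive.\<close>
  define \<rho> where "\<rho> = \<eta> / ((B + 1) * (CARD('m) * T))"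
  have \<rho>: "\<rho> > 0" using \<eta> B T by (simp add: \<rho>_def)
  obtain N0 where N0: "N0 \<ge> T + 1" "\<And>N. N \<ge> N0 \<Longrightarrow> max 0 (B * edge CARD('m) T N) \<le> \<eta>" 
    using eventually_edge_small[OF \<eta>] by blast
  show ?thesis
  proof (rule exI[of _ \<rho>], rule conjI[OF \<rho>], rule exI[of _ N0], intro allI impI)
    fix N and l :: "real^'m" assume N: "N \<ge> N0" and l: "norm (l - k) < \<rho>"
    let ?g = "\<lambda>x. r x * ch l x"
    have sg: "sbounded ?g" using ch_twist_sbounded(1)[OF r B(2)] .
    have mT: "norm (mean T x ?g) \<le> c + 2 * \<eta>" for x
    proof -
      have "mean T x ?g - ch (l - k) x * mean T x (\<lambda>y. r y * ch k y) = mean T x (\<lambda>y. ?g y - ch (l - k) x * (r y * ch k y))"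
        by (subst mean_diff) (auto simp: mean_cmult sg intro!: sbounded_cmult ch_twist_sbounded(1)[OF r B(2)])
      also have "norm (\<dots> - 0) \<le> \<eta>"
      proof (rule mean_near_const_on)
        fix u :: "real^'m" assume u: "u \<in> cbx T"
        have "ch l (u + x) = ch k (u + x) * (ch (l - k) u * ch (l - k) x)"
          by (simp flip: ch_add ch_add_left)
        hence "?g (u + x) - ch (l - k) x * (r (u + x) * ch k (u + x)) = r (u + x) * ch k (u + x) * ch (l - k) x * (ch (l - k) u - 1)"
          by (simp add: algebra_simps)
        hence "norm (?g (u + x) - ch (l - k) x * (r (u + x) * ch k (u + x)) - 0) = norm (r (u + x)) * norm (ch (l - k) u - 1)"
          by (simp add: norm_mult)
        also have "\<dots> \<le> B * (norm (l - k) * norm u)" by (intro mult_mono B norm_ch_minus_one_le) (auto simp: B)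
        also have "\<dots> \<le> (B + 1) * (\<rho> * (CARD('m) * T))"
          using l B norm_cbx_le[OF u] T \<rho> by (intro mult_mono) auto
        also have "\<dots> = \<eta>" using B T by (simp add: \<rho>_def)
        finally show "norm (?g (u + x) - ch (l - k) x * (r (u + x) * ch k (u + x)) - 0) \<le> \<eta>" .
      qed (use T in auto)
      finally have "norm (mean T x ?g - ch (l - k) x * mean T x (\<lambda>y. r y * ch k y)) \<le> \<eta>" by simp
      moreover have "norm (ch (l - k) x * mean T x (\<lambda>y. r y * ch k y)) \<le> c + \<eta>" using mk[of x] by (simp add: norm_mult)
      ultimately show ?thesis 
        using norm_triangle_sub[of "mean T x ?g" "ch (l - k) x * mean T x (\<lambda>y. r y * ch k y)"] by simp
    qed
    have near: "norm (mean N (u + 0) ?g - mean N 0 ?g) \<le> \<eta>" if u: "u \<in> cbx T" for u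
    proof -
      have "norm (mean N (0 + u) ?g - mean N 0 ?g) \<le> max 0 (B * edge CARD('m) T N)"
        by (rule mean_twist_shift_le[OF r B(2)]) (use u N N0 in \<open>auto simp: mem_cbx\<close>)
      from order_trans[OF this N0(2)[OF N]] show ?thesis by simp
    qed
    have "norm (mean T 0 (\<lambda>z. mean N z ?g) - mean N 0 ?g) \<le> \<eta>"
      by (rule mean_near_const_on[OF borel_measurable_mean[OF sg] near]) (use T in auto)
    moreover have "norm (mean T 0 (\<lambda>z. mean N z ?g)) \<le> c + 2 * \<eta>"
      unfolding mean_mean_commute[OF sg, of T 0 N]
      by (rule norm_mean_le_const[OF borel_measurable_mean[OF sg] mT]) (use N N0 T in linarith)
    ultimately show "norm (mean N 0 ?g) \<le> c + 3 * \<eta>"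
      using norm_triangle_sub[of "mean N 0 ?g" "mean T 0 (\<lambda>z. mean N z ?g)"] by (simp add: norm_minus_commute)
  qed
qed

text \<open>Bounds on Fourier coefficients are inherited by finite windows, uniformly in the frequency:
  Riemann--Lebesgue for high frequencies and compactness for the remaining ones.\<close>

lemma mean_twist_uniform:
  fixes r :: "real ^ 'm \<Rightarrow> complex"
  assumes r: "bap r" and c: "\<And>k. norm (fc r k) \<le> c" and c': "c < c'"
  shows "\<exists>N0. \<forall>N\<ge>N0. \<forall>l. norm (mean N 0 (\<lambda>x. r x * ch l x)) \<le> c'"
proof -
  have c0: "c \<ge> 0" using c norm_ge_zero order_trans by blast
  define \<eta> where "\<eta> = (c' - c) / 3"
  have \<eta>: "\<eta> > 0" using c' by (simp add: \<eta>_def)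
  have e3: "c + 3 * \<eta> = c'" by (simp add: \<eta>_def field_simps)
  have "c' > 0" using c0 c' by simp
  then obtain \<Lambda> N1 where N1: "\<And>N l. N \<ge> N1 \<Longrightarrow> norm l \<ge> \<Lambda> \<Longrightarrow> norm (mean N 0 (\<lambda>x. r x * ch l x)) \<le> c'"
    using mean_twist_high_frequency[OF r] by metis
  have "\<exists>\<rho>>0. \<exists>N0. \<forall>N\<ge>N0. \<forall>l. norm (l - k) < \<rho> \<longrightarrow> norm (mean N 0 (\<lambda>x. r x * ch l x)) \<le> c + 3 * \<eta>" for k
    by (rule mean_twist_near_frequency[OF r _ \<eta>]) (use c[of "- k"] in \<open>simp add: fc_def\<close>)
  hence "\<forall>k. \<exists>\<rho>. \<exists>N0. \<rho> > 0 \<and> (\<forall>N\<ge>N0. \<forall>l. norm (l - k) < \<rho> \<longrightarrow> norm (mean N 0 (\<lambda>x. r x * ch l x)) \<le> c + 3 * \<eta>)"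
    by blast
  from this[unfolded choice_iff] obtain \<rho> N0 where N0: "\<And>k. \<rho> k > 0" 
    "\<And>k N l. N \<ge> N0 k \<Longrightarrow> norm (l - k) < \<rho> k \<Longrightarrow> norm (mean N 0 (\<lambda>x. r x * ch l x)) \<le> c + 3 * \<eta>"
    by blast
  have "cball 0 \<Lambda> \<subseteq> (\<Union>k\<in>cball 0 \<Lambda>. ball k (\<rho> k))" by (intro subsetI UN_I) (auto simp: N0(1))
  hence "\<exists>C. finite C \<and> cball 0 \<Lambda> \<subseteq> (\<Union>k\<in>C. ball k (\<rho> k))"
    by - (rule compactE_image[of "cball 0 \<Lambda>" "cball 0 \<Lambda>" "\<lambda>k. ball k (\<rho> k)"], auto)
  then obtain C where C: "finite C" "cball 0 \<Lambda> \<subseteq> (\<Union>k\<in>C. ball k (\<rho> k))" by blast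
  define M where "M = Max (insert N1 (N0 ` C))"
  show ?thesis
  proof (intro exI[of _ M] allI impI)
    fix N l assume N: "N \<ge> M"
    have M: "N \<ge> N1" "\<And>k. k \<in> C \<Longrightarrow> N \<ge> N0 k" using N C(1) by (auto simp: M_def)
    show "norm (mean N 0 (\<lambda>x. r x * ch l x)) \<le> c'"
    proof (cases "norm l \<ge> \<Lambda>")
      case True thus ?thesis by (rule N1[OF M(1)])
    next
      case False
      hence "l \<in> cball 0 \<Lambda>" by simp
      then obtain k where k: "k \<in> C" "l \<in> ball k (\<rho> k)" using C(2) by blast
      have "norm (l - k) < \<rho> k" using k(2) by (simp add: dist_norm norm_minus_commute)
      from N0(2)[OF M(2)[OF k(1)] this] have "norm (mean N 0 (\<lambda>x. r x * ch l x)) \<le> c + 3 * \<eta>" .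
      thus ?thesis by (simp only: e3)
    qed
  qed
qed

section \<open>Window measures, the kernel \<open>lap\<close> and transforms of windows\<close>

lemma norm_integral_le_AE:
  fixes f :: "'a \<Rightarrow> 'b::{banach,second_countable_topology}"
  assumes g: "integrable M g" and f: "f \<in> borel_measurable M" and le: "AE x in M. norm (f x) \<le> g x"
  shows "norm (integral\<^sup>L M f) \<le> integral\<^sup>L M g"
proof -
  have "integrable M f" using le by (intro Bochner_Integration.integrable_bound[OF g f]) auto
  hence "integral\<^sup>L M (\<lambda>x. norm (f x)) \<le> integral\<^sup>L M g" using le g by (intro integral_mono_AE) auto
  thus ?thesis using integral_norm_bound[of M f] by linarith
qed

lemma (in prob_space) norm_expectation_le:
  fixes f :: "'a \<Rightarrow> complex"
  assumes "f \<in> borel_measurable M" "AE x in M. norm (f x) \<le> B"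
  shows "norm (integral\<^sup>L M f) \<le> B"
  using norm_integral_le_AE[of M "\<lambda>_. B" f] assms by (simp add: prob_space)

text \<open>Normalised Lebesgue measure on a cube: means centred at 0 become expectations, to which
  Fubini's theorem for probability measures applies.\<close>

definition cubem :: "real \<Rightarrow> (real ^ 'm) measure" where
  "cubem N = density lborel (\<lambda>u. ennreal (indicator (cbx N) u * inverse ((2 * N) ^ CARD('m))))"

lemma sets_cubem [simp, measurable_cong]: "sets (cubem N) = sets borel"
  and space_cubem [simp]: "space (cubem N) = UNIV"
  by (auto simp: cubem_def)

lemma integral_cubem:
  fixes g :: "real ^ 'm \<Rightarrow> 'b::{banach,second_countable_topology}"
  assumes "N > 0" and [measurable]: "g \<in> borel_measurable borel"
  shows "integral\<^sup>L (cubem N) g = inverse ((2 * N) ^ CARD('m)) *\<^sub>R (LINT u:cbx N|lborel. g u)"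
proof -
  let ?c = "inverse ((2 * N) ^ CARD('m))"
  have "integral\<^sup>L (cubem N) g = (LINT u|lborel. (indicator (cbx N) u * ?c) *\<^sub>R g u)"
    unfolding cubem_def using assms(1) by (subst integral_density) auto
  also have "(\<lambda>u. (indicator (cbx N) u * ?c) *\<^sub>R g u) = (\<lambda>u. ?c *\<^sub>R (indicator (cbx N) u *\<^sub>R g u))"
    by (simp only: scaleR_scaleR mult.commute)
  finally show ?thesis unfolding set_lebesgue_integral_def by (simp only: integral_scaleR_right)
qed

lemma mean_eq_integral_cubem:
  assumes "N > 0" "g \<in> borel_measurable borel"
  shows "mean N 0 g = integral\<^sup>L (cubem N) g"
  unfolding integral_cubem[OF assms] mean_def by (simp add: scaleR_conv_of_real)

lemma prob_space_cubem: assumes N: "N > 0" shows "prob_space (cubem N :: (real ^ 'm) measure)"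
proof
  have "emeasure (cubem N :: (real ^ 'm) measure) (space (cubem N)) = 
      (\<integral>\<^sup>+u. ennreal (inverse ((2 * N) ^ CARD('m))) * indicator (cbx N :: (real^'m) set) u \<partial>lborel)"
    unfolding cubem_def by (subst emeasure_density) (auto intro!: nn_integral_cong simp: indicator_def)
  also have "\<dots> = ennreal (inverse ((2 * N) ^ CARD('m))) * ennreal ((2 * N) ^ CARD('m))"
    using N by (subst nn_integral_cmult_indicator) (auto simp: emeasure_cbx)
  also have "\<dots> = ennreal (inverse ((2 * N) ^ CARD('m)) * (2 * N) ^ CARD('m))"
    using N by (intro ennreal_mult[symmetric]) auto
  also have "\<dots> = 1" using N by (simp add: field_simps)
  finally show "emeasure (cubem N :: (real ^ 'm) measure) (space (cubem N)) = 1" .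
qed

lemma AE_cubem: "AE u in cubem N. u \<in> cbx N"
  unfolding cubem_def by (subst AE_density) (auto simp: indicator_def intro!: AE_I2)

text \<open>Up to normalisation a Laplace density for the l1 norm, and at the same time the
  characteristic function of the product Cauchy law scaled by \<open>R\<close>. It is a
  concentrating kernel in space and comes from a positive measure in frequency, which takes the
  place of general Fourier inversion.\<close>

definition lap :: "real \<Rightarrow> real ^ 'm \<Rightarrow> real" where
  "lap R x = exp (- R * (\<Sum>i\<in>UNIV. \<bar>x $ i\<bar>))"

lemma lap_pos: "lap R x > 0" by (simp add: lap_def)
lemma lap_nonneg [simp]: "lap R x \<ge> 0" using lap_pos[of R x] by simp
lemma lap_minus [simp]: "lap R (- x) = lap R x" by (simp add: lap_def)
lemma borel_measurable_lap [measurable]: "lap R \<in> borel_measurable borel"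
  unfolding lap_def[abs_def] by measurable

lemma integral_ch_cauchyn: "(LINT l|cauchyn. ch (\<sigma> *\<^sub>R l) x) = of_real (lap \<bar>\<sigma>\<bar> x)"
proof -
  have "(LINT l|cauchyn. ch (\<sigma> *\<^sub>R l) x) = (LINT l|cauchyn. exp (\<i> * of_real ((\<sigma> *\<^sub>R x) \<bullet> l)))"
    by (simp add: ch_def inner_commute)
  also have "\<dots> = exp (- complex_of_real (\<Sum>i\<in>UNIV. \<bar>(\<sigma> *\<^sub>R x) $ i\<bar>))" by (rule integral_exp_cauchyn)
  also have "(\<Sum>i\<in>UNIV. \<bar>(\<sigma> *\<^sub>R x) $ i\<bar>) = \<bar>\<sigma>\<bar> * (\<Sum>i\<in>UNIV. \<bar>x $ i\<bar>)"
    by (simp add: abs_mult sum_distrib_left)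
  also have "exp (- complex_of_real (\<bar>\<sigma>\<bar> * (\<Sum>i\<in>UNIV. \<bar>x $ i\<bar>))) = of_real (lap \<bar>\<sigma>\<bar> x)"
    unfolding lap_def by (metis exp_of_real mult_minus_left of_real_minus)
  finally show ?thesis .
qed

text \<open>The Cauchy density dominates, because
  \<open>(1 + t\<^sup>2) / 2 \<le> exp \<bar>t\<bar>\<close>.\<close>

lemma integrable_exp_abs: 
  assumes R: "R > 0" shows "integrable lborel (\<lambda>t::real. exp (- R * \<bar>t\<bar>))"
proof -
  have "integrable lborel (\<lambda>t. 2 * pi * cauchy_density t)"
    using has_bochner_integral_cauchy_density by (simp add: has_bochner_integral_iff)
  hence "integrable lborel (\<lambda>t::real. exp (- \<bar>t\<bar>))"
  proof (rule Bochner_Integration.integrable_bound)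
    show "AE t in lborel. norm (exp (- \<bar>t\<bar>)) \<le> norm (2 * pi * cauchy_density t)"
    proof (rule AE_I2)
      fix t :: real
      have "1 + \<bar>t\<bar> + \<bar>t\<bar>\<^sup>2 / 2 \<le> exp \<bar>t\<bar>" by (rule exp_lower_Taylor_quadratic) simp
      hence "(1 + t\<^sup>2) / 2 \<le> exp \<bar>t\<bar>" by (simp add: power2_eq_square)
      moreover have "1 + t\<^sup>2 > 0" by (simp add: add_pos_nonneg)
      ultimately have "inverse (exp \<bar>t\<bar>) \<le> inverse ((1 + t\<^sup>2) / 2)" by (intro le_imp_inverse_le) auto
      thus "norm (exp (- \<bar>t\<bar>)) \<le> norm (2 * pi * cauchy_density t)"
        by (simp add: exp_minus cauchy_density_def)
    qed
  qed auto
  hence "integrable lborel (\<lambda>t::real. exp (- \<bar>0 + R * t\<bar>))" using R by (intro lborel_integrable_real_affine) auto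
  thus ?thesis using R by (simp add: abs_mult)
qed

lemma integral_exp_abs_scale:
  assumes R: "R > 0" shows "(LINT t|lborel. exp (- R * \<bar>t\<bar>)) = (LINT t|lborel. exp (- \<bar>t::real\<bar>)) / R"
  using lborel_integral_real_affine[of R "\<lambda>t. exp (- \<bar>t\<bar>)" 0] R by (simp add: abs_mult)

lemma integral_exp_abs_pos: "(LINT t|lborel. exp (- \<bar>t::real\<bar>)) > 0"
proof -
  have "exp (-1) = (LINT t|lborel. exp (-1) * indicat_real {0..1::real} t)" by simp
  also have "\<dots> \<le> (LINT t|lborel. exp (- \<bar>t\<bar>))"
  proof (rule integral_mono)
    show "integrable lborel (\<lambda>t. exp (-1) * indicat_real {0..1::real} t)"
      by (intro integrable_mult_right integrable_real_indicator) auto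
    show "integrable lborel (\<lambda>t::real. exp (- \<bar>t\<bar>))" using integrable_exp_abs[of 1] by simp
  qed (auto simp: indicator_def)
  finally show ?thesis using exp_gt_zero[of "-1::real"] by linarith
qed

definition lap_mass :: "nat \<Rightarrow> real \<Rightarrow> real" where
  "lap_mass m R = ((LINT t|lborel. exp (- \<bar>t::real\<bar>)) / R) ^ m"

lemma
  assumes R: "R > 0"
  shows integrable_lap: "integrable lborel (lap R :: real ^ 'm \<Rightarrow> real)"
    and integral_lap: "integral\<^sup>L lborel (lap R :: real ^ 'm \<Rightarrow> real) = lap_mass CARD('m) R"
proof -
  have eq: "lap R = (\<lambda>x::real^'m. \<Prod>i\<in>UNIV. exp (- R * \<bar>x $ i\<bar>))"
    by (simp add: lap_def exp_sum[symmetric] sum_distrib_left fun_eq_iff)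
  show "integrable lborel (lap R :: real ^ 'm \<Rightarrow> real)" 
    unfolding eq by (rule integrable_prod_vec) (rule integrable_exp_abs[OF R])
  show "integral\<^sup>L lborel (lap R :: real ^ 'm \<Rightarrow> real) = lap_mass CARD('m) R"
    unfolding eq using integrable_exp_abs[OF R]
    by (subst integral_prod_vec) (auto simp: lap_mass_def integral_exp_abs_scale[OF R, simplified])
qed

lemma lap_mass_pos: "R > 0 \<Longrightarrow> lap_mass m R > 0"
  using integral_exp_abs_pos by (simp add: lap_mass_def)

lemma lap_mass_half: "lap_mass m (R / 2) = 2 ^ m * lap_mass m R"
  by (simp add: lap_mass_def power_mult_distrib[symmetric] mult_ac)

text \<open>One half of the exponent supplies the decay, the other half keeps an integrable
  kernel.\<close>

lemma lap_tail_le: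
  fixes u :: "real ^ 'm"
  assumes "R > 0" "d \<le> (\<Sum>i\<in>UNIV. \<bar>u $ i\<bar>)"
  shows "lap R u \<le> exp (- R * d / 2) * lap (R / 2) u"
proof -
  have "lap R u = exp (- (R / 2) * (\<Sum>i\<in>UNIV. \<bar>u $ i\<bar>)) * lap (R / 2) u"
    by (simp add: lap_def flip: exp_add)
  also have "\<dots> \<le> exp (- R * d / 2) * lap (R / 2) u"
    using assms by (intro mult_right_mono) auto
  finally show ?thesis .
qed

text \<open>Divided by its mass, \<open>lap R\<close> is an approximate identity for large
  \<open>R\<close>. Within distance \<open>d\<close> of 0 the gauge is below
  \<open>\<delta> / 2\<close>; beyond it, \<open>exp (- R * d / 2)\<close> beats the ratio
  \<open>2 ^ m\<close> between the masses of \<open>lap (R / 2)\<close> and \<open>lap R\<close>.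
  The indicator charges the mass that escapes from the window, and \<open>N \<ge> d\<close> keeps
  the ball of radius \<open>d\<close> inside.\<close>

lemma lap_concentration:
  fixes D :: "real ^ 'm \<Rightarrow> real"
  assumes D: "ap_gauge D" and \<delta>: "\<delta> > 0"
  obtains R d where "R > 0" "d > 0"
    "\<And>N. N \<ge> d \<Longrightarrow> integrable lborel (\<lambda>u. (D u + indicator (- cbx N) u) * lap R u)"
    "\<And>N. N \<ge> d \<Longrightarrow> (LINT u|lborel. (D u + indicator (- cbx N) u) * lap R u) \<le> \<delta> * lap_mass CARD('m) R"
proof -
  have [measurable]: "D \<in> borel_measurable borel" by (rule borel_measurable_ap_gauge) fact
  obtain B where B: "B \<ge> 0" "\<And>t. D t \<le> B" by (rule ap_gauge_bounded[OF D]) blast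
  obtain d where d: "d > 0" "\<And>t. norm t < d \<Longrightarrow> D t < \<delta> / 2" using ap_gaugeD(5)[OF D, of "\<delta>/2"] \<delta> by auto
  have "((\<lambda>R. (B + 1) * 2 ^ CARD('m) * exp (- R * d / 2)) \<longlongrightarrow> 0) at_top"
    using d(1) by real_asymp
  hence "\<forall>\<^sub>F R in at_top. (B + 1) * 2 ^ CARD('m) * exp (- R * d / 2) < \<delta> / 2" using \<delta> by (intro order_tendstoD(2)) auto
  hence "\<forall>\<^sub>F R in at_top. (B + 1) * 2 ^ CARD('m) * exp (- R * d / 2) < \<delta> / 2 \<and> R > 0" 
    using eventually_gt_at_top[of 0] by eventually_elim auto
  then obtain R where R: "R > 0" "(B + 1) * 2 ^ CARD('m) * exp (- R * d / 2) < \<delta> / 2"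
    using eventually_happens'[OF trivial_limit_at_top_linorder] by blast
  have nonneg: "0 \<le> D u" for u using ap_gaugeD(2)[OF D] .
  have int: "integrable lborel (\<lambda>u. (D u + indicator (- cbx N) u) * lap R u)" for N
  proof (rule Bochner_Integration.integrable_bound[where f="\<lambda>u. (B + 1) * lap R u"])
    show "AE u in lborel. norm ((D u + indicator (- cbx N) u) * lap R u) \<le> norm ((B + 1) * lap R u)"
    proof (rule AE_I2)
      fix u :: "real^'m"
      have "0 \<le> D u + indicator (- cbx N) u" "D u + indicator (- cbx N) u \<le> B + 1"
        using B(2)[of u] nonneg[of u] by (auto simp: indicator_def)
      thus "norm ((D u + indicator (- cbx N) u) * lap R u) \<le> norm ((B + 1) * lap R u)"
        using B(1) by (auto simp: abs_mult intro!: mult_right_mono)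
    qed
  qed (use integrable_lap[OF R(1)] in auto)
  show ?thesis
  proof (rule that[OF R(1) d(1) int])
    fix N :: real assume N: "N \<ge> d"
    let ?f = "\<lambda>u::real^'m. (\<delta> / 2) * lap R u + (B + 1) * exp (- R * d / 2) * lap (R / 2) u"
    have "(LINT u|lborel. (D u + indicator (- cbx N) u) * lap R u) \<le> (LINT u|lborel. ?f u)"
    proof (rule integral_mono[OF int])
      show "integrable lborel ?f" using R(1)
        by (intro Bochner_Integration.integrable_add integrable_mult_right integrable_lap) auto
      fix u :: "real^'m"
      show "(D u + indicator (- cbx N) u) * lap R u \<le> ?f u"
      proof (cases "norm u < d")
        case True
        have "\<bar>u $ i\<bar> \<le> N" for i using component_le_norm_cart[of u i] True N by linarith
        hence "u \<in> cbx N" by (simp add: mem_cbx)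
        hence "(D u + indicator (- cbx N) u) * lap R u \<le> \<delta> / 2 * lap R u" 
          using d(2)[OF True] by (intro mult_right_mono) auto
        moreover have "0 \<le> (B + 1) * exp (- R * d / 2) * lap (R / 2) u" using B by simp
        ultimately show ?thesis by linarith
      next
        case False
        hence "d \<le> (\<Sum>i\<in>UNIV. \<bar>u $ i\<bar>)" using norm_le_l1_cart[of u] by linarith
        hence "lap R u \<le> exp (- R * d / 2) * lap (R / 2) u" by (rule lap_tail_le[OF R(1)])
        hence "(D u + indicator (- cbx N) u) * lap R u \<le> (B + 1) * (exp (- R * d / 2) * lap (R / 2) u)"
          using B(1) B(2)[of u] by (intro mult_mono) (auto simp: indicator_def)
        moreover have "0 \<le> \<delta> / 2 * lap R u" using \<delta> by simp
        ultimately show ?thesis unfolding mult.assoc by linarith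
      qed
    qed
    also have "\<dots> = (\<delta> / 2) * lap_mass CARD('m) R + (B + 1) * exp (- R * d / 2) * lap_mass CARD('m) (R / 2)"
      using integrable_lap[OF R(1), where 'm='m] integrable_lap[of "R/2", where 'm='m] R(1) 
      by (simp add: integral_lap)
    also have "\<dots> = (\<delta> / 2 + (B + 1) * 2 ^ CARD('m) * exp (- R * d / 2)) * lap_mass CARD('m) R"
      by (simp add: lap_mass_half algebra_simps)
    also have "\<dots> \<le> \<delta> * lap_mass CARD('m) R"
      using R(2) lap_mass_pos[OF R(1), of "CARD('m)"] by (intro mult_right_mono) auto
    finally show "(LINT u|lborel. (D u + indicator (- cbx N) u) * lap R u) \<le> \<delta> * lap_mass CARD('m) R" .
  qed
qed

lemma borel_measurable_cnj [measurable (raw)]: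
  "f \<in> borel_measurable M \<Longrightarrow> (\<lambda>x. cnj (f x)) \<in> borel_measurable M"
  by (rule measurable_compose[OF _ borel_measurable_continuous_onI[OF continuous_on_cnj[OF continuous_on_id]]])

lemma borel_measurable_ch_pair [measurable]:
  "(\<lambda>z. ch (\<sigma> *\<^sub>R fst z) (snd z)) \<in> borel_measurable (borel \<Otimes>\<^sub>M borel)"
  "(\<lambda>z. ch (\<sigma> *\<^sub>R snd z) (fst z)) \<in> borel_measurable (borel \<Otimes>\<^sub>M borel)"
  unfolding ch_def by measurable

text \<open>The exchange of a spatial average with the Cauchy average over frequencies, on which the
  spectral formulas below rest.\<close>

lemma integral_twist_swap:
  fixes M :: "(real ^ 'm) measure"
  assumes "prob_space M" and M [measurable_cong]: "sets M = sets borel"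
    and [measurable]: "g \<in> borel_measurable borel" "A \<in> borel_measurable borel"
    and B: "\<And>x. norm (g x) \<le> B" and C: "\<And>l. norm (A l) \<le> C"
  shows "(LINT x|M. g x * (LINT l|cauchyn. A l * ch (\<sigma> *\<^sub>R l) x)) = (LINT l|cauchyn. A l * (LINT x|M. g x * ch (\<sigma> *\<^sub>R l) x))"
proof -
  interpret M: prob_space M by fact
  interpret C: prob_space "cauchyn :: (real ^ 'm) measure" by (rule prob_space_cauchyn)
  interpret P: pair_prob_space M "cauchyn :: (real ^ 'm) measure" ..
  have B0: "B \<ge> 0" using B norm_ge_zero order_trans by blast
  have [measurable]: "(\<lambda>z. g (fst z) * A (snd z) * ch (\<sigma> *\<^sub>R snd z) (fst z)) \<in> borel_measurable (M \<Otimes>\<^sub>M cauchyn)"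
    by measurable
  have int: "integrable (M \<Otimes>\<^sub>M cauchyn) (\<lambda>(x, l). g x * A l * ch (\<sigma> *\<^sub>R l) x)"
    by (rule P.integrable_const_bound[where B="B * C"])
       (use B C B0 in \<open>auto simp: norm_mult case_prod_beta intro!: AE_I2 mult_mono\<close>)
  have "(LINT x|M. g x * (LINT l|cauchyn. A l * ch (\<sigma> *\<^sub>R l) x)) = (LINT x|M. (LINT l|cauchyn. g x * A l * ch (\<sigma> *\<^sub>R l) x))"
    by (simp add: mult.assoc)
  also have "\<dots> = (LINT l|cauchyn. (LINT x|M. g x * A l * ch (\<sigma> *\<^sub>R l) x))"
    by (rule P.Fubini_integral[symmetric, OF int])
  also have "\<dots> = (LINT l|cauchyn. A l * (LINT x|M. g x * ch (\<sigma> *\<^sub>R l) x))"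
    by (simp add: mult_ac)
  finally show ?thesis .
qed

text \<open>Sign and scale of the frequency sit in \<open>\<sigma>\<close>, so that transforms at
  \<open>R\<close> and at \<open>- R\<close> can be integrated against one and the same Cauchy
  law.\<close>

definition ft :: "(real ^ 'm) measure \<Rightarrow> (real ^ 'm \<Rightarrow> complex) \<Rightarrow> real \<Rightarrow> real ^ 'm \<Rightarrow> complex" where
  "ft M g \<sigma> l = (LINT x|M. g x * ch (\<sigma> *\<^sub>R l) x)"

lemma
  fixes M :: "(real ^ 'm) measure"
  assumes "prob_space M" and M [measurable_cong]: "sets M = sets borel"
    and [measurable]: "g \<in> borel_measurable borel" and B: "\<And>x. norm (g x) \<le> B"
  shows borel_measurable_ft: "ft M g \<sigma> \<in> borel_measurable borel"
    and norm_ft_le: "norm (ft M g \<sigma> l) \<le> B"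
proof -
  interpret M: prob_space M by fact
  have "(\<lambda>z. g (snd z) * ch (\<sigma> *\<^sub>R fst z) (snd z)) \<in> borel_measurable (borel \<Otimes>\<^sub>M M)" by measurable
  thus "ft M g \<sigma> \<in> borel_measurable borel"
    unfolding ft_def[abs_def] by (intro M.borel_measurable_lebesgue_integral) (simp add: case_prod_beta)
  show "norm (ft M g \<sigma> l) \<le> B"
    unfolding ft_def by (rule M.norm_expectation_le) (auto simp: norm_mult B)
qed

lemma cnj_ft: "cnj (ft M g \<sigma> l) = ft M (\<lambda>x. cnj (g x)) (- \<sigma>) l"
  unfolding ft_def using Bochner_Integration.integral_cnj[of M "\<lambda>x. g x * ch (\<sigma> *\<^sub>R l) x"] by (simp add: cnj_ch)

lemma integral_lap_shift:
  fixes x :: "real ^ 'm"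
  assumes "R > 0"
  shows "integrable lborel (\<lambda>y. lap R (x - y))" "(LINT y|lborel. lap R (x - y)) = lap_mass CARD('m) R"
proof -
  have eq: "lap R (x - y) = lap R (y + (- x))" for y using lap_minus[of R "x - y"] by simp
  have "integrable (distr lborel borel ((+) (- x))) (lap R)"
    unfolding lborel_distr_plus by (rule integrable_lap[OF assms])
  thus "integrable lborel (\<lambda>y. lap R (x - y))"
    unfolding eq by (subst (asm) integrable_distr_eq) (auto simp: add.commute)
  show "(LINT y|lborel. lap R (x - y)) = lap_mass CARD('m) R"
    unfolding eq by (subst integral_lborel_shift) (auto simp: integral_lap[OF assms])
qed

lemma integral_cubem_lap_le:
  fixes x :: "real ^ 'm"
  assumes R: "R > 0" and N: "N > 0"
  shows "(LINT y|cubem N. lap R (x - y)) \<le> inverse ((2 * N) ^ CARD('m)) * lap_mass CARD('m) R"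
proof -
  have "(LINT y:cbx N|lborel. lap R (x - y)) \<le> (LINT y|lborel. lap R (x - y))"
    unfolding set_lebesgue_integral_def using integral_lap_shift(1)[OF R]
    by (intro integral_mono integrable_mult_indicator) (auto simp: indicator_def)
  thus ?thesis using N integral_lap_shift(2)[OF R, of x]
    by (subst integral_cubem) (auto intro!: mult_left_mono)
qed

lemma lap_le_1: "R > 0 \<Longrightarrow> lap R x \<le> 1"
  by (auto simp: lap_def intro!: mult_nonneg_nonneg sum_nonneg)

text \<open>A Plancherel bound with the Cauchy law in place of Lebesgue measure. Expanding the
  square gives the quadratic form of the kernel \<open>lap R (x - y)\<close> on the window. It is
  bounded by the supremum over \<open>x\<close> of the integral in \<open>y\<close>, that is, by the
  kernel mass divided by the volume of the window.\<close>

lemma integral_norm_ft_square_le: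
  fixes g :: "real ^ 'm \<Rightarrow> complex"
  assumes R: "R > 0" and s: "\<bar>\<sigma>\<bar> = R" and N: "N > 0" and gm[measurable]: "g \<in> borel_measurable borel" and g: "\<And>x. norm (g x) \<le> 1"
  shows "(LINT l|cauchyn. (norm (ft (cubem N) g \<sigma> l))\<^sup>2) \<le> inverse ((2 * N) ^ CARD('m)) * lap_mass CARD('m) R"
proof -
  let ?K = "inverse ((2 * N) ^ CARD('m)) * lap_mass CARD('m) R"
  let ?W = "ft (cubem N) g \<sigma>"
  interpret U: prob_space "cubem N :: (real ^ 'm) measure" by (rule prob_space_cubem[OF N])
  have Wm: "?W \<in> borel_measurable borel" and Wle: "\<And>l. norm (?W l) \<le> 1"
    by (rule borel_measurable_ft norm_ft_le, rule U.prob_space_axioms, simp, fact, fact)+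
  have "of_real (LINT l|cauchyn. (norm (?W l))\<^sup>2) = (LINT l|cauchyn. ?W l * ft (cubem N) (\<lambda>x. cnj (g x)) (- \<sigma>) l)"
    by (simp only: integral_complex_of_real[symmetric] complex_norm_square cnj_ft)
  also have "\<dots> = (LINT x|cubem N. cnj (g x) * (LINT l|cauchyn. ?W l * ch ((- \<sigma>) *\<^sub>R l) x))"
    unfolding ft_def[of _ "\<lambda>x. cnj (g x)"]
    by (rule integral_twist_swap[symmetric, where B=1 and C=1]) (use Wm Wle g in \<open>auto simp: U.prob_space_axioms\<close>)
  also have "norm \<dots> \<le> ?K"
  proof (rule U.norm_expectation_le)
    show "(\<lambda>x. cnj (g x) * (LINT l|cauchyn. ?W l * ch ((- \<sigma>) *\<^sub>R l) x)) \<in> borel_measurable (cubem N)"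
    proof -
      interpret C: prob_space "cauchyn :: (real ^ 'm) measure" by (rule prob_space_cauchyn)
      note Wm[measurable]
      have "(\<lambda>z. ?W (snd z) * ch ((- \<sigma>) *\<^sub>R snd z) (fst z)) \<in> borel_measurable (borel \<Otimes>\<^sub>M cauchyn)" by measurable
      hence "(\<lambda>x. LINT l|cauchyn. ?W l * ch ((- \<sigma>) *\<^sub>R l) x) \<in> borel_measurable borel"
        by (intro C.borel_measurable_lebesgue_integral) (simp add: case_prod_beta)
      thus ?thesis by measurable
    qed
    have "norm (LINT l|cauchyn. ?W l * ch ((- \<sigma>) *\<^sub>R l) x) \<le> ?K" for x
    proof -
      have "(LINT l|cauchyn. ?W l * ch ((- \<sigma>) *\<^sub>R l) x) = (LINT l|cauchyn. ch ((- \<sigma>) *\<^sub>R l) x * (LINT y|cubem N. g y * ch (\<sigma> *\<^sub>R l) y))"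
        by (simp add: ft_def mult.commute)
      also have "\<dots> = (LINT y|cubem N. g y * (LINT l|cauchyn. ch ((- \<sigma>) *\<^sub>R l) x * ch (\<sigma> *\<^sub>R l) y))"
        by (rule integral_twist_swap[symmetric, where B=1 and C=1])
          (use g in \<open>auto simp: U.prob_space_axioms ch_def\<close>)
      also have "(\<lambda>y. LINT l|cauchyn. ch ((- \<sigma>) *\<^sub>R l) x * ch (\<sigma> *\<^sub>R l) y) = (\<lambda>y. of_real (lap R (y - x)))"
      proof
        fix y
        have "ch ((- \<sigma>) *\<^sub>R l) x * ch (\<sigma> *\<^sub>R l) y = ch (\<sigma> *\<^sub>R l) (y - x)" for l
          using ch_add[of "\<sigma> *\<^sub>R l" y "- x"] by (simp add: ch_minus_right mult.commute)
        thus "(LINT l|cauchyn. ch ((- \<sigma>) *\<^sub>R l) x * ch (\<sigma> *\<^sub>R l) y) = of_real (lap R (y - x))"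
          by (simp add: integral_ch_cauchyn s)
      qed
      also have "norm (LINT y|cubem N. g y * of_real (lap R (y - x))) \<le> (LINT y|cubem N. lap R (x - y))"
      proof (rule norm_integral_le_AE)
        show "integrable (cubem N) (\<lambda>y. lap R (x - y))"
          by (rule U.integrable_const_bound[where B=1]) (auto simp: lap_le_1[OF R])
        have "lap R (y - x) = lap R (x - y)" for y using lap_minus[of R "x - y"] by simp
        thus "AE y in cubem N. norm (g y * of_real (lap R (y - x))) \<le> lap R (x - y)"
          using g by (intro AE_I2) (auto simp: norm_mult intro!: mult_left_le_one_le)
      qed simp
      also have "\<dots> \<le> ?K" by (rule integral_cubem_lap_le[OF R N])
      finally show ?thesis .
    qed
    hence "norm (cnj (g x) * (LINT l|cauchyn. ?W l * ch ((- \<sigma>) *\<^sub>R l) x)) \<le> 1 * ?K" for x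
      unfolding norm_mult using g by (intro mult_mono) auto
    thus "AE x in cubem N. norm (cnj (g x) * (LINT l|cauchyn. ?W l * ch ((- \<sigma>) *\<^sub>R l) x)) \<le> ?K"
      by (intro AE_I2) simp
  qed
  finally have "norm (complex_of_real (LINT l|cauchyn. (norm (?W l))\<^sup>2)) \<le> ?K" .
  thus ?thesis unfolding norm_of_real by linarith
qed

section \<open>Triple correlations over windows\<close>

text \<open>Convolution with the concentrated kernel nearly reproduces
  \<open>\<phi> (x + t)\<close>, which is within \<open>D t\<close> of \<open>\<phi> x\<close>. The
  window \<open>3 * N\<close> contains \<open>u + x + t\<close> for all \<open>u\<close>,
  \<open>x\<close>, \<open>t\<close> in \<open>cbx N\<close>, so truncation costs no more than the
  kernel mass outside \<open>cbx N\<close>.\<close>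

lemma window_kernel_approx:
  fixes \<phi> :: "real ^ 'm \<Rightarrow> real"
  assumes D: "ap_gauge D" and [measurable]: "\<phi> \<in> borel_measurable borel"
    and \<phi>01: "\<And>x. 0 \<le> \<phi> x" "\<And>x. \<phi> x \<le> 1" and \<phi>D: "\<And>x t. \<bar>\<phi> (x + t) - \<phi> x\<bar> \<le> D t"
    and R: "R > 0" and N: "N > 0"
    and int: "integrable lborel (\<lambda>u. (D u + indicator (- cbx N) u) * lap R u)"
    and small: "(LINT u|lborel. (D u + indicator (- cbx N) u) * lap R u) \<le> \<delta> * lap_mass CARD('m) R"
    and x: "x \<in> cbx N" and t: "t \<in> cbx N"
  shows "\<bar>(2 * (3 * N)) ^ CARD('m) * (LINT y|cubem (3 * N). \<phi> y * lap R (x + t - y)) - lap_mass CARD('m) R * \<phi> x\<bar>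
     \<le> lap_mass CARD('m) R * (D t + \<delta>)"
proof -
  let ?k = "lap_mass CARD('m) R" and ?c = "cbx (3 * N) :: (real ^ 'm) set"
  define s where "s = x + t"
  have iL: "integrable lborel (lap R :: real ^ 'm \<Rightarrow> real)" by (rule integrable_lap[OF R])
  have DL: "integrable lborel (\<lambda>u::real^'m. D t * lap R u)" using iL by simp
  have "(2 * (3 * N)) ^ CARD('m) * (LINT y|cubem (3 * N). \<phi> y * lap R (s - y)) = (LINT y:?c|lborel. \<phi> y * lap R (s - y))"
    using N by (subst integral_cubem) (auto simp: field_simps)
  also have "\<dots> = (LINT u|lborel. indicator ?c (u + s) * \<phi> (u + s) * lap R u)"
    unfolding set_lebesgue_integral_def
    by (subst integral_lborel_shift[where a=s, symmetric]) (auto simp: mult.assoc)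
  finally have eq: "(2 * (3 * N)) ^ CARD('m) * (LINT y|cubem (3 * N). \<phi> y * lap R (s - y)) = \<dots>" .
  have i1: "integrable lborel (\<lambda>u. indicator ?c (u + s) * \<phi> (u + s) * lap R u)"
    by (rule Bochner_Integration.integrable_bound[OF iL]) 
       (use \<phi>01 in \<open>auto simp: abs_mult indicator_def intro!: mult_left_le_one_le AE_I2\<close>)
  have i2: "integrable lborel (\<lambda>u::real^'m. \<phi> x * lap R u)" using iL by simp
  have "\<bar>(LINT u|lborel. indicator ?c (u + s) * \<phi> (u + s) * lap R u) - ?k * \<phi> x\<bar>
     = norm (LINT u|lborel. indicator ?c (u + s) * \<phi> (u + s) * lap R u - \<phi> x * lap R u)"
    using i1 i2 by (subst Bochner_Integration.integral_diff) (auto simp: integral_lap[OF R] mult.commute)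
  also have "\<dots> \<le> (LINT u|lborel. (D u + indicator (- cbx N) u) * lap R u + D t * lap R u)"
  proof (rule norm_integral_le_AE)
    show "integrable lborel (\<lambda>u. (D u + indicator (- cbx N) u) * lap R u + D t * lap R u)"
      using int DL by (rule Bochner_Integration.integrable_add)
    show "AE u in lborel. norm (indicator ?c (u + s) * \<phi> (u + s) * lap R u - \<phi> x * lap R u)
       \<le> (D u + indicator (- cbx N) u) * lap R u + D t * lap R u"
    proof (rule AE_I2)
      fix u :: "real ^ 'm"
      have nn: "D u \<ge> 0" "D t \<ge> 0" using ap_gaugeD(2)[OF D] by auto
      have "\<bar>indicator ?c (u + s) * \<phi> (u + s) - \<phi> x\<bar> \<le> D u + indicator (- cbx N) u + D t"
      proof (cases "u \<in> cbx N")
        case True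
        have "\<bar>(u + s) $ i\<bar> \<le> 3 * N" for i
        proof -
          have "\<bar>u $ i\<bar> \<le> N" "\<bar>x $ i\<bar> \<le> N" "\<bar>t $ i\<bar> \<le> N" using True x t by (auto simp: mem_cbx)
          thus ?thesis by (simp add: s_def)
        qed
        hence "u + s \<in> ?c" unfolding mem_cbx by blast
        moreover have "\<bar>\<phi> (u + s) - \<phi> x\<bar> \<le> D (t + u)" using \<phi>D[of x "t + u"] by (simp add: s_def add_ac)
        moreover have "D (t + u) \<le> D t + D u" by (rule ap_gaugeD(4)[OF D])
        ultimately show ?thesis using True by simp
      next
        case False
        have "\<bar>indicator ?c (u + s) * \<phi> (u + s) - \<phi> x\<bar> \<le> 1"
          using \<phi>01[of x] \<phi>01[of "u + s"] by (auto simp: indicator_def abs_le_iff)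
        thus ?thesis using False nn by simp
      qed
      hence "\<bar>indicator ?c (u + s) * \<phi> (u + s) - \<phi> x\<bar> * lap R u \<le> (D u + indicator (- cbx N) u + D t) * lap R u"
        by (intro mult_right_mono) auto
      moreover have "norm (indicator ?c (u + s) * \<phi> (u + s) * lap R u - \<phi> x * lap R u) = \<bar>indicator ?c (u + s) * \<phi> (u + s) - \<phi> x\<bar> * lap R u"
        by (simp add: abs_mult flip: left_diff_distrib)
      ultimately show "norm (indicator ?c (u + s) * \<phi> (u + s) * lap R u - \<phi> x * lap R u)
       \<le> (D u + indicator (- cbx N) u) * lap R u + D t * lap R u" by (simp add: distrib_right)
    qed
  qed measurable
  also have "\<dots> = (LINT u|lborel. (D u + indicator (- cbx N) u) * lap R u) + D t * ?k"
    using int DL by (subst Bochner_Integration.integral_add) (auto simp: integral_lap[OF R])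
  also have "\<dots> \<le> ?k * (D t + \<delta>)" using small by (simp add: algebra_simps)
  finally show ?thesis by (simp only: s_def[symmetric] eq)
qed

text \<open>The spectral form of the triple correlation: all three integrals factor after averaging
  over frequencies against the product Cauchy law.\<close>

lemma triple_correlation_spectral:
  fixes r \<phi> h :: "real ^ 'm \<Rightarrow> complex"
  assumes R: "R > 0" and N: "N > 0" "N' > 0"
    and rm [measurable]: "r \<in> borel_measurable borel" and \<phi>m [measurable]: "\<phi> \<in> borel_measurable borel"
    and hm [measurable]: "h \<in> borel_measurable borel"
    and B: "\<And>x. norm (r x) \<le> B" and \<phi>1: "\<And>x. norm (\<phi> x) \<le> 1" and h1: "\<And>x. norm (h x) \<le> 1"
  shows "(LINT t|cubem N. h t * (LINT x|cubem N. r x * (LINT y|cubem N'. \<phi> y * of_real (lap R (x + t - y)))))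
     = (LINT l|cauchyn. ft (cubem N') \<phi> (- R) l * ft (cubem N) r R l * ft (cubem N) h R l)"
proof -
  interpret U: prob_space "cubem N :: (real ^ 'm) measure" by (rule prob_space_cubem[OF N(1)])
  interpret U': prob_space "cubem N' :: (real ^ 'm) measure" by (rule prob_space_cubem[OF N(2)])
  have B0: "B \<ge> 0" using B norm_ge_zero order_trans by blast
  let ?V = "ft (cubem N') \<phi> (- R)" and ?W = "ft (cubem N) r R"
  have Vm [measurable]: "?V \<in> borel_measurable borel" and V1: "\<And>l. norm (?V l) \<le> 1"
    by (rule borel_measurable_ft norm_ft_le, rule U'.prob_space_axioms, simp, fact, fact)+
  have Wm [measurable]: "?W \<in> borel_measurable borel" and WB: "\<And>l. norm (?W l) \<le> B"
    by (rule borel_measurable_ft norm_ft_le, rule U.prob_space_axioms, simp, fact, fact)+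
  have chm [measurable]: "(\<lambda>l. ch (R *\<^sub>R l) z) \<in> borel_measurable borel" for z :: "real ^ 'm" unfolding ch_def by measurable
  have 1: "(LINT y|cubem N'. \<phi> y * of_real (lap R (x + t - y))) = (LINT l|cauchyn. (?V l * ch (R *\<^sub>R l) t) * ch (R *\<^sub>R l) x)" for x t
  proof -
    have "ch (R *\<^sub>R l) (x + t) * ch ((- R) *\<^sub>R l) y = ch (R *\<^sub>R l) (x + t - y)" for l y :: "real ^ 'm"
      using ch_add[of "R *\<^sub>R l" "x + t" "- y"] by (simp add: ch_minus_right)
    hence "of_real (lap R (x + t - y)) = (LINT l|cauchyn. ch (R *\<^sub>R l) (x + t) * ch ((- R) *\<^sub>R l) y)" for y
      using R by (simp add: integral_ch_cauchyn)
    hence "(LINT y|cubem N'. \<phi> y * of_real (lap R (x + t - y))) = 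
        (LINT y|cubem N'. \<phi> y * (LINT l|cauchyn. ch (R *\<^sub>R l) (x + t) * ch ((- R) *\<^sub>R l) y))" by simp
    also have "\<dots> = (LINT l|cauchyn. ch (R *\<^sub>R l) (x + t) * (LINT y|cubem N'. \<phi> y * ch ((- R) *\<^sub>R l) y))"
      by (rule integral_twist_swap[where B=1 and C=1]) (use \<phi>1 in \<open>auto simp: U'.prob_space_axioms\<close>)
    also have "\<dots> = (LINT l|cauchyn. (?V l * ch (R *\<^sub>R l) t) * ch (R *\<^sub>R l) x)"
      by (simp add: ft_def ch_add mult_ac)
    finally show ?thesis .
  qed
  have 2: "(LINT x|cubem N. r x * (LINT l|cauchyn. (?V l * ch (R *\<^sub>R l) t) * ch (R *\<^sub>R l) x)) = 
      (LINT l|cauchyn. (?V l * ?W l) * ch (R *\<^sub>R l) t)" for t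
  proof -
    have "(LINT x|cubem N. r x * (LINT l|cauchyn. (?V l * ch (R *\<^sub>R l) t) * ch (R *\<^sub>R l) x)) = 
      (LINT l|cauchyn. (?V l * ch (R *\<^sub>R l) t) * (LINT x|cubem N. r x * ch (R *\<^sub>R l) x))"
      by (rule integral_twist_swap[where B=B and C=1]) (use B V1 in \<open>auto simp: U.prob_space_axioms norm_mult\<close>)
    thus ?thesis unfolding ft_def[of "cubem N" r] by (simp add: mult_ac)
  qed
  have VW: "norm (?V l * ?W l) \<le> B" for l 
    using mult_mono[OF V1[of l] WB[of l]] B0 by (simp add: norm_mult)
  have "(LINT t|cubem N. h t * (LINT l|cauchyn. (?V l * ?W l) * ch (R *\<^sub>R l) t)) = 
      (LINT l|cauchyn. (?V l * ?W l) * (LINT t|cubem N. h t * ch (R *\<^sub>R l) t))"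
    by (rule integral_twist_swap[where B=1 and C=B]) (use h1 VW in \<open>auto simp: U.prob_space_axioms\<close>)
  thus ?thesis unfolding 1 2 ft_def[of "cubem N" h] .
qed

text \<open>In spectral form the factor coming from \<open>r\<close> is at most \<open>w\<close> at
  every frequency, and the product of the other two is at most half the sum of their squares, to
  which the Plancherel bound applies. Small windowed coefficients of \<open>r\<close> therefore
  force a small correlation.\<close>

lemma triple_correlation_bound:
  fixes r \<phi> h :: "real ^ 'm \<Rightarrow> complex"
  assumes R: "R > 0" and N: "N > 0" "N' \<ge> N"
    and rm [measurable]: "r \<in> borel_measurable borel" and \<phi>m [measurable]: "\<phi> \<in> borel_measurable borel"
    and hm [measurable]: "h \<in> borel_measurable borel"
    and B: "\<And>x. norm (r x) \<le> B" and \<phi>1: "\<And>x. norm (\<phi> x) \<le> 1" and h1: "\<And>x. norm (h x) \<le> 1"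
    and w: "\<And>l. norm (mean N 0 (\<lambda>x. r x * ch l x)) \<le> w"
  shows "norm (LINT t|cubem N. h t * (LINT x|cubem N. r x * (LINT y|cubem N'. \<phi> y * of_real (lap R (x + t - y)))))
     \<le> w * (inverse ((2 * N) ^ CARD('m)) * lap_mass CARD('m) R)"
proof -
  interpret U: prob_space "cubem N :: (real ^ 'm) measure" by (rule prob_space_cubem[OF N(1)])
  have N': "N' > 0" using N by simp
  interpret U': prob_space "cubem N' :: (real ^ 'm) measure" by (rule prob_space_cubem[OF N'])
  interpret C: prob_space "cauchyn :: (real ^ 'm) measure" by (rule prob_space_cauchyn)
  let ?V = "ft (cubem N') \<phi> (- R)" and ?W = "ft (cubem N) r R" and ?H = "ft (cubem N) h R"
  let ?k = "lap_mass CARD('m) R"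
  have Vm [measurable]: "?V \<in> borel_measurable borel" and V1: "\<And>l. norm (?V l) \<le> 1"
    by (rule borel_measurable_ft norm_ft_le, rule U'.prob_space_axioms, simp, fact, fact)+
  have Hm [measurable]: "?H \<in> borel_measurable borel" and H1: "\<And>l. norm (?H l) \<le> 1"
    by (rule borel_measurable_ft norm_ft_le, rule U.prob_space_axioms, simp, fact, fact)+
  have Wm [measurable]: "?W \<in> borel_measurable borel"
    by (rule borel_measurable_ft, rule U.prob_space_axioms, simp, fact, fact)
  have Ww: "norm (?W l) \<le> w" for l
    using w[of "R *\<^sub>R l"] N(1) by (simp add: mean_eq_integral_cubem ft_def)
  have w0: "w \<ge> 0" using w norm_ge_zero order_trans by blast
  have iV: "integrable cauchyn (\<lambda>l. (norm (?V l))\<^sup>2)"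
    by (rule C.integrable_const_bound[where B=1]) (use V1 in \<open>auto intro!: power_le_one\<close>)
  have iH: "integrable cauchyn (\<lambda>l. (norm (?H l))\<^sup>2)"
    by (rule C.integrable_const_bound[where B=1]) (use H1 in \<open>auto intro!: power_le_one\<close>)
  have "norm (LINT l|cauchyn. ?V l * ?W l * ?H l) \<le> (LINT l|cauchyn. w / 2 * ((norm (?V l))\<^sup>2 + (norm (?H l))\<^sup>2))"
  proof (rule norm_integral_le_AE)
    show "AE l in cauchyn. norm (?V l * ?W l * ?H l) \<le> w / 2 * ((norm (?V l))\<^sup>2 + (norm (?H l))\<^sup>2)"
    proof (rule AE_I2)
      fix l
      have "norm (?V l) * norm (?H l) \<le> ((norm (?V l))\<^sup>2 + (norm (?H l))\<^sup>2) / 2"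
        using sum_squares_bound[of "norm (?V l)" "norm (?H l)"] by simp
      hence "norm (?W l) * (norm (?V l) * norm (?H l)) \<le> w * (((norm (?V l))\<^sup>2 + (norm (?H l))\<^sup>2) / 2)"
        using Ww[of l] w0 by (intro mult_mono) auto
      thus "norm (?V l * ?W l * ?H l) \<le> w / 2 * ((norm (?V l))\<^sup>2 + (norm (?H l))\<^sup>2)"
        by (simp add: norm_mult mult_ac)
    qed
  qed (use iV iH in auto)
  also have "\<dots> = w / 2 * ((LINT l|cauchyn. (norm (?V l))\<^sup>2) + (LINT l|cauchyn. (norm (?H l))\<^sup>2))"
    using iV iH by simp
  also have "\<dots> \<le> w / 2 * (inverse ((2 * N) ^ CARD('m)) * ?k + inverse ((2 * N) ^ CARD('m)) * ?k)"
  proof (intro mult_left_mono add_mono)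
    show "(LINT l|cauchyn. (norm (?H l))\<^sup>2) \<le> inverse ((2 * N) ^ CARD('m)) * ?k"
      by (rule integral_norm_ft_square_le) (use R N h1 in auto)
    have "(LINT l|cauchyn. (norm (?V l))\<^sup>2) \<le> inverse ((2 * N') ^ CARD('m)) * ?k"
      by (rule integral_norm_ft_square_le) (use R N' \<phi>1 in auto)
    also have "\<dots> \<le> inverse ((2 * N) ^ CARD('m)) * ?k"
      using N lap_mass_pos[OF R, of "CARD('m)"]
      by (intro mult_right_mono le_imp_inverse_le power_mono) auto
    finally show "(LINT l|cauchyn. (norm (?V l))\<^sup>2) \<le> inverse ((2 * N) ^ CARD('m)) * ?k" .
  qed (use w0 in auto)
  also have "\<dots> = w * (inverse ((2 * N) ^ CARD('m)) * ?k)" by (simp only: mult_2[symmetric])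
  finally have "norm (LINT l|cauchyn. ?V l * ?W l * ?H l) \<le> w * (inverse ((2 * N) ^ CARD('m)) * ?k)" .
  thus ?thesis using triple_correlation_spectral[OF R N(1) N' rm \<phi>m hm B \<phi>1 h1] by simp
qed

text \<open>The condition on \<open>h\<close> lets it live only where
  \<open>D t \<le> \<epsilon>\<close>. Averaged over such \<open>t\<close>, the kernel approximation
  trades \<open>\<phi> x\<close> for a convolution evaluated at \<open>x + t\<close> at the cost
  \<open>\<epsilon> + \<delta>\<close>, and a triple correlation is left. Its factor
  \<open>3 ^ m\<close> is the ratio of the volumes of the two windows.\<close>

lemma window_correlation_bound:
  fixes r :: "real ^ 'm \<Rightarrow> complex" and \<phi> h :: "real ^ 'm \<Rightarrow> real"
  assumes D: "ap_gauge D" and \<phi>m [measurable]: "\<phi> \<in> borel_measurable borel"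
    and \<phi>01: "\<And>x. 0 \<le> \<phi> x" "\<And>x. \<phi> x \<le> 1" and \<phi>D: "\<And>x t. \<bar>\<phi> (x + t) - \<phi> x\<bar> \<le> D t"
    and hm [measurable]: "h \<in> borel_measurable borel" and h01: "\<And>x. 0 \<le> h x" "\<And>x. h x \<le> 1"
    and hD: "\<And>t. h t * D t \<le> \<epsilon> * h t"
    and rm [measurable]: "r \<in> borel_measurable borel" and B: "\<And>x. norm (r x) \<le> B"
    and R: "R > 0" and N: "N > 0"
    and int: "integrable lborel (\<lambda>u. (D u + indicator (- cbx N) u) * lap R u)"
    and small: "(LINT u|lborel. (D u + indicator (- cbx N) u) * lap R u) \<le> \<delta> * lap_mass CARD('m) R"
    and w: "\<And>l. norm (mean N 0 (\<lambda>x. r x * ch l x)) \<le> w"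
  shows "(LINT t|cubem N. h t) * norm (mean N 0 (\<lambda>x. r x * of_real (\<phi> x)))
     \<le> (\<epsilon> + \<delta>) * (LINT t|cubem N. h t) * (LINT x|cubem N. norm (r x)) + 3 ^ CARD('m) * w"
proof -
  interpret U: prob_space "cubem N :: (real ^ 'm) measure" by (rule prob_space_cubem[OF N])
  have N3: "3 * N > 0" using N by simp
  interpret U': prob_space "cubem (3 * N) :: (real ^ 'm) measure" by (rule prob_space_cubem[OF N3])
  let ?k = "lap_mass CARD('m) R" and ?V = "(2 * N) ^ CARD('m)" and ?V3 = "(2 * (3 * N)) ^ CARD('m)"
  have k: "?k > 0" by (rule lap_mass_pos[OF R])
  have [measurable]: "D \<in> borel_measurable borel" by (rule borel_measurable_ap_gauge) fact
  \<comment> \<open>\<open>I\<close> is the truncated convolution at \<open>x + t\<close> in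
    normalised form; \<open>G\<close>, after undoing the normalisation by \<open>?V3\<close>, is its
    error as an approximation of \<open>?k * \<phi> x\<close>.\<close>
  define I where "I = (\<lambda>x t. LINT y|cubem (3 * N). \<phi> y * lap R (x + t - y))"
  define G where "G = (\<lambda>x t. ?V3 * I x t - ?k * \<phi> x)"
  have Ile: "\<bar>I x t\<bar> \<le> 1" for x t
  proof -
    have "norm (I x t) \<le> (LINT y|(cubem (3 * N) :: (real ^ 'm) measure). (1 :: real))"
      unfolding I_def 
    proof (rule norm_integral_le_AE)
      show "AE y in cubem (3 * N). norm (\<phi> y * lap R (x + t - y)) \<le> 1"
        using \<phi>01 lap_le_1[OF R] by (intro AE_I2) (auto simp: abs_mult intro!: mult_le_one)
    qed (auto simp: U'.prob_space_axioms)
    thus ?thesis using U'.prob_space by simp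
  qed
  have Gm [measurable]: "(\<lambda>x. G x t) \<in> borel_measurable borel" for t unfolding G_def I_def by measurable
  have Gm2 [measurable]: "(\<lambda>z. G (snd z) (fst z)) \<in> borel_measurable (borel \<Otimes>\<^sub>M borel)" unfolding G_def I_def by measurable
  have Glem: "\<bar>G x t\<bar> \<le> ?k * (D t + \<delta>)" if "x \<in> cbx N" "t \<in> cbx N" for x t
    unfolding G_def I_def by (rule window_kernel_approx[OF D \<phi>m \<phi>01 \<phi>D R N int small that])
  have ir: "integrable (cubem N) r" by (rule U.integrable_const_bound[where B=B]) (use B in auto)
  have irn: "integrable (cubem N) (\<lambda>x. norm (r x))" using ir by simp
  have ih: "integrable (cubem N) h" by (rule U.integrable_const_bound[where B=1]) (use h01 in auto)
  have irp: "integrable (cubem N) (\<lambda>x. r x * of_real (\<phi> x))"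
    by (rule Bochner_Integration.integrable_bound[OF irn]) (use \<phi>01 in \<open>auto simp: norm_mult intro!: AE_I2 mult_left_le\<close>)
  have irI: "integrable (cubem N) (\<lambda>x. r x * of_real (I x t))" for t
  proof (rule Bochner_Integration.integrable_bound[OF irn])
    show "(\<lambda>x. r x * of_real (I x t)) \<in> borel_measurable (cubem N)" unfolding I_def by measurable
    show "AE x in cubem N. norm (r x * of_real (I x t)) \<le> norm (norm (r x))"
      using Ile by (intro AE_I2) (auto simp: norm_mult intro!: mult_left_le)
  qed
  let ?J = "LINT t|cubem N. of_real (h t) * (LINT x|cubem N. r x * of_real (I x t))"
  have J: "norm ?J \<le> w * (inverse ?V * ?k)"
  proof -
    have "of_real (I x t) = (LINT y|cubem (3 * N). of_real (\<phi> y) * complex_of_real (lap R (x + t - y)))" for x t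
      unfolding I_def by (simp flip: of_real_mult)
    thus ?thesis using N h01 \<phi>01 w B R
      by (simp only:) (rule triple_correlation_bound, auto)
  qed
  let ?P = "LINT x|cubem N. r x * of_real (\<phi> x)"
  have inner: "(LINT x|cubem N. r x * of_real (G x t)) = ?V3 * (LINT x|cubem N. r x * of_real (I x t)) - ?k * ?P" for t
  proof -
    have "(LINT x|cubem N. r x * of_real (G x t)) = (LINT x|cubem N. of_real ?V3 * (r x * of_real (I x t)) - of_real ?k * (r x * of_real (\<phi> x)))"
      by (intro Bochner_Integration.integral_cong) (auto simp: G_def algebra_simps)
    also have "\<dots> = of_real ?V3 * (LINT x|cubem N. r x * of_real (I x t)) - of_real ?k * ?P"
      using irI irp by (subst Bochner_Integration.integral_diff) auto
    finally show ?thesis .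
  qed
  have innerle: "norm (LINT x|cubem N. r x * of_real (G x t)) \<le> ?k * (D t + \<delta>) * (LINT x|cubem N. norm (r x))" if "t \<in> cbx N" for t
  proof -
    have "norm (LINT x|cubem N. r x * of_real (G x t)) \<le> (LINT x|cubem N. ?k * (D t + \<delta>) * norm (r x))"
    proof (rule norm_integral_le_AE)
      show "AE x in cubem N. norm (r x * of_real (G x t)) \<le> ?k * (D t + \<delta>) * norm (r x)"
        using AE_cubem[of N] by eventually_elim (use Glem that in \<open>auto simp: norm_mult mult.commute intro!: mult_left_mono\<close>)
    qed (use irn in auto)
    thus ?thesis by simp
  qed
  let ?h = "LINT t|cubem N. h t" and ?n = "LINT x|cubem N. norm (r x)"
  have n0: "?n \<ge> 0" by simp
  have innermeas: "(\<lambda>t. LINT x|cubem N. r x * of_real (I x t)) \<in> borel_measurable borel"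
    unfolding I_def by measurable
  have iJ: "integrable (cubem N) (\<lambda>t. of_real (h t) * (LINT x|cubem N. r x * of_real (I x t)))"
  proof (rule U.integrable_const_bound[where B="?n"])
    show "AE t in cubem N. norm (of_real (h t) * (LINT x|cubem N. r x * of_real (I x t))) \<le> ?n"
    proof (rule AE_I2)
      fix t
      have "norm (LINT x|cubem N. r x * of_real (I x t)) \<le> ?n"
        by (rule norm_integral_le_AE[OF irn]) (use irI[of t] Ile in \<open>auto simp: norm_mult intro!: AE_I2 mult_left_le\<close>)
      thus "norm (of_real (h t) * (LINT x|cubem N. r x * of_real (I x t))) \<le> ?n"
        unfolding norm_mult using h01[of t] n0 mult_mono[of "norm (complex_of_real (h t))" 1 "norm (LINT x|cubem N. r x * of_real (I x t))" ?n] by simp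
    qed
  qed (use innermeas in auto)
  have ihP: "integrable (cubem N) (\<lambda>t. of_real (h t) * ?P)" using ih by auto
  \<comment> \<open>Integrating the error \<open>G\<close> against \<open>r\<close> and
    \<open>h\<close> separates the triple correlation \<open>?J\<close> from the product
    \<open>?h * ?P\<close> that is to be bounded.\<close>
  have eqJ: "of_real ?V3 * ?J - of_real (?k * ?h) * ?P = (LINT t|cubem N. of_real (h t) * (LINT x|cubem N. r x * of_real (G x t)))"
  proof -
    have "(LINT t|cubem N. of_real (h t) * (LINT x|cubem N. r x * of_real (G x t))) 
      = (LINT t|cubem N. of_real ?V3 * (of_real (h t) * (LINT x|cubem N. r x * of_real (I x t))) - of_real ?k * (of_real (h t) * ?P))"
      unfolding inner by (simp add: algebra_simps)
    also have "\<dots> = of_real ?V3 * ?J - of_real ?k * (of_real ?h * ?P)"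
      using iJ ihP ih by (subst Bochner_Integration.integral_diff) auto
    finally show ?thesis by (simp add: mult.assoc)
  qed
  have "norm (of_real ?V3 * ?J - of_real (?k * ?h) * ?P) \<le> (LINT t|cubem N. ?k * (\<epsilon> + \<delta>) * ?n * h t)"
    unfolding eqJ
  proof (rule norm_integral_le_AE)
    show "AE t in cubem N. norm (of_real (h t) * (LINT x|cubem N. r x * of_real (G x t))) \<le> ?k * (\<epsilon> + \<delta>) * ?n * h t"
      using AE_cubem[of N]
    proof eventually_elim
      case (elim t)
      have "norm (of_real (h t) * (LINT x|cubem N. r x * of_real (G x t))) \<le> h t * (?k * (D t + \<delta>) * ?n)"
        using innerle[OF elim] h01[of t] by (simp only: norm_mult norm_of_real abs_of_nonneg) (rule mult_left_mono, auto)
      also have "\<dots> = (h t * D t + \<delta> * h t) * (?k * ?n)" by (simp add: algebra_simps)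
      also have "\<dots> \<le> (\<epsilon> * h t + \<delta> * h t) * (?k * ?n)" using hD[of t] k n0 by (intro mult_right_mono add_mono order_refl) auto
      also have "\<dots> = ?k * (\<epsilon> + \<delta>) * ?n * h t" by (simp add: algebra_simps)
      finally show ?case .
    qed
    show "(\<lambda>t. of_real (h t) * (LINT x|cubem N. r x * of_real (G x t))) \<in> borel_measurable (cubem N)"
      unfolding inner using innermeas by auto
  qed (use ih in auto)
  hence "norm (of_real (?k * ?h) * ?P) \<le> ?k * (\<epsilon> + \<delta>) * ?n * ?h + norm (of_real ?V3 * ?J)"
    using norm_triangle_sub[of "of_real (?k * ?h) * ?P" "of_real ?V3 * ?J"] by (simp add: norm_minus_commute)
  also have "norm (of_real ?V3 * ?J) \<le> ?V3 * (w * (inverse ?V * ?k))"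
    using J N by (simp only: norm_mult norm_of_real) (intro mult_mono, auto)
  also have "?V3 * (w * (inverse ?V * ?k)) = ?k * (3 ^ CARD('m) * w)"
  proof -
    have V0: "?V \<noteq> 0" using N by simp
    have "?V3 = 3 ^ CARD('m) * ?V" by (metis power_mult_distrib mult.left_commute)
    hence "?V3 * (w * (inverse ?V * ?k)) = (?V * inverse ?V) * (?k * (3 ^ CARD('m) * w))" by (simp only: mult_ac)
    thus ?thesis by (simp only: right_inverse[OF V0] mult_1_left)
  qed
  finally have "?k * (?h * norm ?P) \<le> ?k * ((\<epsilon> + \<delta>) * ?h * ?n + 3 ^ CARD('m) * w)"
    using k h01 by (simp add: norm_mult algebra_simps)
  hence "?h * norm ?P \<le> (\<epsilon> + \<delta>) * ?h * ?n + 3 ^ CARD('m) * w"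
    using k by (simp only: mult_le_cancel_left_pos)
  thus ?thesis using N by (simp add: mean_eq_integral_cubem)
qed

section \<open>Parseval's identity for the tent weight\<close>

text \<open>A Lipschitz cut-off in place of the indicator of a set of almost periods: it inherits
  \<open>D\<close> as its modulus and so is Bohr almost periodic.\<close>

definition tent :: "(real ^ 'm \<Rightarrow> real) \<Rightarrow> real ^ 'm \<Rightarrow> real" where
  "tent D t = max 0 (1 - D t)"

lemma tent_nonneg: "0 \<le> tent D t" by (simp add: tent_def)

lemma tent_le_1: "ap_gauge D \<Longrightarrow> tent D t \<le> 1"
  using ap_gaugeD(2)[of D t] by (simp add: tent_def)

lemma tent_lipschitz: "ap_gauge D \<Longrightarrow> \<bar>tent D (x + t) - tent D x\<bar> \<le> D t"
proof -
  assume D: "ap_gauge D"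
  have "\<bar>D (x + t) - D x\<bar> \<le> D t" using ap_gauge_diff_le[OF D, of "x + t" x] by simp
  thus ?thesis unfolding tent_def by linarith
qed

lemma borel_measurable_tent: "ap_gauge D \<Longrightarrow> tent D \<in> borel_measurable borel"
  using borel_measurable_ap_gauge[of D] unfolding tent_def[abs_def] by measurable

lemma bap_tent: assumes D: "ap_gauge D" shows "bap (\<lambda>x. complex_of_real (tent D x))"
  unfolding bap_def
proof (intro exI conjI allI)
  show "norm (complex_of_real (tent D x)) \<le> 1" for x using tent_nonneg[of D x] tent_le_1[OF D, of x] by simp
  show "norm (complex_of_real (tent D (x + t)) - complex_of_real (tent D x)) \<le> D t" for x t
    using tent_lipschitz[OF D, of x t] by (simp flip: of_real_diff)
qed fact

text \<open>Translates of the tent to the finitely many points of a net for \<open>1/2\<close> add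
  up to at least \<open>1/2\<close> everywhere, and all of them have the same mean.\<close>

lemma Mean_tent_pos:
  assumes D: "ap_gauge D" shows "Re (Mean (\<lambda>x. complex_of_real (tent D x))) > 0"
proof -
  obtain T where T: "finite T" "\<And>t. \<exists>s\<in>T. D (t - s) < 1/2" using ap_gaugeD(6)[OF D, of "1/2"] by auto
  let ?k = "Mean (\<lambda>x. complex_of_real (tent D x))"
  have hm: "has_mean (\<lambda>x. complex_of_real (tent D x)) ?k" by (intro bap_has_mean bap_tent D)
  have sb: "sbounded (\<lambda>x. complex_of_real (tent D x))" by (intro bap_sbounded bap_tent D)
  have "has_mean (\<lambda>x. \<Sum>s\<in>T. complex_of_real (tent D (x + - s))) (\<Sum>s\<in>T. ?k)"
    by (intro has_mean_sum has_mean_shift[OF hm] sbounded_shift[OF sb])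
  hence "has_mean (\<lambda>x. (\<Sum>s\<in>T. complex_of_real (tent D (x + - s))) - 1/2) ((\<Sum>s\<in>T. ?k) - 1/2)"
    by (intro has_mean_diff has_mean_const sbounded_sum sbounded_shift[OF sb]) (auto intro: sbounded_bounded[where B="1/2"])
  hence "has_mean (\<lambda>x. complex_of_real ((\<Sum>s\<in>T. tent D (x + - s)) - 1/2)) ((\<Sum>s\<in>T. ?k) - 1/2)" by simp
  moreover have "(\<Sum>s\<in>T. tent D (x + - s)) - 1/2 \<ge> 0" for x
  proof -
    obtain s where s: "s \<in> T" "D (x - s) < 1/2" using T(2) by blast
    have "1/2 \<le> tent D (x + - s)" using s(2) by (simp add: tent_def)
    also have "\<dots> \<le> (\<Sum>s\<in>T. tent D (x + - s))" using s(1) T(1) tent_nonneg by (intro member_le_sum) auto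
    finally show ?thesis by simp
  qed
  ultimately have "Re ((\<Sum>s\<in>T. ?k) - 1/2) \<ge> 0" by (rule has_mean_nonneg(2))
  hence "real (card T) * Re ?k \<ge> 1/2" by simp
  thus ?thesis by (metis half_gt_zero_iff less_numeral_extra(1) linorder_not_le mult_nonneg_nonpos of_nat_0_le_iff order.strict_trans2)
qed

text \<open>By Bessel's inequality the number of coefficients of size at least \<open>c\<close> is
  at most the mean square of \<open>\<phi>\<close> divided by \<open>c\<^sup>2\<close>.\<close>

lemma finite_large_fc:
  assumes \<phi>: "bap \<phi>" and c: "c > 0" shows "finite {l. norm (fc \<phi> l) \<ge> c}"
proof (rule conjunct1[OF finite_if_finite_subsets_card_bdd])
  let ?M = "Re (Mean (\<lambda>x. \<phi> x * cnj (\<phi> x)))"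
  show "card F \<le> nat \<lceil>?M / c\<^sup>2\<rceil>" if F: "F \<subseteq> {l. norm (fc \<phi> l) \<ge> c}" "finite F" for F
  proof -
    have "real (card F) * c\<^sup>2 = (\<Sum>l\<in>F. c\<^sup>2)" by simp
    also have "\<dots> \<le> (\<Sum>l\<in>F. (norm (fc \<phi> l))\<^sup>2)" using F c by (intro sum_mono power_mono) auto
    also have "\<dots> \<le> ?M" by (rule bessel_inequality[OF \<phi> F(2)])
    finally have "real (card F) \<le> ?M / c\<^sup>2" using c by (simp add: pos_le_divide_eq)
    thus ?thesis by linarith
  qed
qed

text \<open>\<open>\<Lambda>\<close> collects the large coefficients, so every coefficient of the
  residual \<open>r\<close> is at most \<open>c\<close> and its windowed means are eventually at
  most \<open>2 * c\<close>. Its mean square \<open>q\<close> is its correlation with the tent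
  \<open>P\<close>. The correlation bound, localised by a second and narrower tent \<open>h\<close>,
  yields \<open>k * q \<le> k * \<eta>\<close> as the windows grow, where \<open>k\<close> is the
  positive mean of \<open>h\<close>.\<close>

lemma tent_parseval:
  fixes D :: "real ^ 'm \<Rightarrow> real"
  assumes D: "ap_gauge D" and \<eta>: "\<eta> > 0"
  defines "P \<equiv> \<lambda>x. complex_of_real (tent D x)"
  obtains \<Lambda> where "finite \<Lambda>" "0 \<in> \<Lambda>" "Re (Mean (\<lambda>x. residual P \<Lambda> x * cnj (residual P \<Lambda> x))) \<le> \<eta>"
proof -
  have P: "bap P" unfolding P_def by (rule bap_tent[OF D])
  define \<epsilon> where "\<epsilon> = \<eta> / 4"
  have e: "\<epsilon> > 0" using \<eta> by (simp add: \<epsilon>_def)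
  define D1 where "D1 = (\<lambda>t. (1 / \<epsilon>) * D t)"
  have D1: "ap_gauge D1" unfolding D1_def using e by (intro ap_gauge_cmult D) auto
  define h where "h = tent D1"
  define H where "H = (\<lambda>x. complex_of_real (h x))"
  have H: "bap H" unfolding H_def h_def by (rule bap_tent[OF D1])
  define k where "k = Re (Mean H)"
  have k: "k > 0" unfolding k_def H_def h_def by (rule Mean_tent_pos[OF D1])
  \<comment> \<open>The term \<open>3 ^ m * (2 * c)\<close> becomes \<open>k * \<eta> / 2\<close>;
    the other half of the budget is \<open>2 * \<epsilon> * k\<close> with
    \<open>\<epsilon> = \<eta> / 4\<close>, using \<open>q \<le> 1\<close>.\<close>
  define c where "c = \<eta> * k / (4 * 3 ^ CARD('m))"
  have c: "c > 0" using \<eta> k by (simp add: c_def)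
  \<comment> \<open>The exponent 0 is forced into \<open>\<Lambda>\<close> so that the partial sum
    has the same mean as the tent, by which averages are normalised later.\<close>
  define \<Lambda> where "\<Lambda> = insert 0 {l. norm (fc P l) \<ge> c}"
  have fin: "finite \<Lambda>" unfolding \<Lambda>_def using finite_large_fc[OF P c] by simp
  define r where "r = residual P \<Lambda>"
  have r: "bap r" unfolding r_def by (rule bap_residual[OF P])
  have rc: "norm (fc r l) \<le> c" for l
    unfolding r_def fc_residual[OF P fin] using c by (auto simp: \<Lambda>_def)
  define q where "q = Re (Mean (\<lambda>x. r x * cnj (r x)))"
  have q: "Mean (\<lambda>x. r x * cnj (r x)) = of_real q" "q \<ge> 0"
    using Mean_norm_square_nonneg[OF r] by (auto simp: q_def)
  have Pc: "cnj (P x) = P x" for x by (simp add: P_def)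
  have rP: "Mean (\<lambda>x. r x * P x) = of_real q"
    using Mean_residual_self[OF P fin] q(1) unfolding r_def[symmetric] Pc by simp
  have q1: "q \<le> 1"
  proof -
    have "Mean (\<lambda>x. r x * P x) = Mean (\<lambda>x. P x * cnj (P x)) - of_real (\<Sum>l\<in>\<Lambda>. (norm (fc P l))\<^sup>2)"
      using bessel_identity[OF P fin] unfolding r_def[symmetric] Pc .
    hence "q = Re (Mean (\<lambda>x. P x * cnj (P x))) - (\<Sum>l\<in>\<Lambda>. (norm (fc P l))\<^sup>2)"
      unfolding rP by (metis Re_complex_of_real minus_complex.simps(1))
    moreover have "(\<Sum>l\<in>\<Lambda>. (norm (fc P l))\<^sup>2) \<ge> 0" by (simp add: sum_nonneg)
    moreover have "norm (Mean (\<lambda>x. P x * cnj (P x))) \<le> 1"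
    proof (rule has_mean_norm_le)
      show "has_mean (\<lambda>x. P x * cnj (P x)) (Mean (\<lambda>x. P x * cnj (P x)))" by (intro bap_has_mean bap_mult bap_cnj P)
      show "(\<lambda>x. P x * cnj (P x)) \<in> borel_measurable borel" by (intro bap_measurable bap_mult bap_cnj P)
      show "norm (P x * cnj (P x)) \<le> 1" for x
        using tent_nonneg[of D x] tent_le_1[OF D, of x] by (simp add: P_def norm_mult mult_le_one)
    qed
    ultimately show ?thesis using complex_Re_le_cmod[of "Mean (\<lambda>x. P x * cnj (P x))"] by linarith
  qed
  obtain B where B: "\<And>x. norm (r x) \<le> B" using r by (rule bapE) blast
  \<comment> \<open>The passage from coefficients to windows needs a strict gap, here from
    \<open>c\<close> to \<open>2 * c\<close>.\<close>
  obtain N0 where N0: "\<And>N l. N \<ge> N0 \<Longrightarrow> norm (mean N 0 (\<lambda>x. r x * ch l x)) \<le> 2 * c"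
    using mean_twist_uniform[OF r rc, of "2 * c"] c by auto
  obtain R d where R: "R > 0" "d > 0"
    "\<And>N. N \<ge> d \<Longrightarrow> integrable lborel (\<lambda>u. (D u + indicator (- cbx N) u) * lap R u)"
    "\<And>N. N \<ge> d \<Longrightarrow> (LINT u|lborel. (D u + indicator (- cbx N) u) * lap R u) \<le> \<epsilon> * lap_mass CARD('m) R"
    by (rule lap_concentration[OF D e]) blast
  have rm: "r \<in> borel_measurable borel" by (rule bap_measurable[OF r])
  have hm: "h \<in> borel_measurable borel" unfolding h_def by (rule borel_measurable_tent[OF D1])
  have ev: "Re (mean N 0 H) * norm (mean N 0 (\<lambda>x. r x * P x))
       \<le> 2 * \<epsilon> * Re (mean N 0 H) * ((1 + Re (mean N 0 (\<lambda>x. r x * cnj (r x)))) / 2) + 3 ^ CARD('m) * (2 * c)"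
    if N: "N \<ge> max N0 d" for N
  proof -
    have Npos: "N > 0" and Nd: "N \<ge> d" and NN: "N \<ge> N0" using N R(2) by auto
    interpret U: prob_space "cubem N :: (real ^ 'm) measure" by (rule prob_space_cubem[OF Npos])
    have h01: "0 \<le> h x" "h x \<le> 1" for x unfolding h_def using tent_nonneg tent_le_1[OF D1] by auto
    have mH: "Re (mean N 0 H) = (LINT t|cubem N. h t)"
      unfolding H_def using Npos hm by (subst mean_eq_integral_cubem) auto
    \<comment> \<open>The bound \<open>norm (r x) \<le> (1 + (norm (r x))\<^sup>2) / 2\<close>
      stands in for Cauchy-Schwarz; the mean of its right side is known to converge.\<close>
    have mr: "(LINT x|cubem N. norm (r x)) \<le> (1 + Re (mean N 0 (\<lambda>x. r x * cnj (r x)))) / 2"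
    proof -
      have i: "integrable (cubem N) (\<lambda>x. (norm (r x))\<^sup>2)"
        by (rule U.integrable_const_bound[where B="B\<^sup>2"]) (use B rm in \<open>auto intro!: power_mono\<close>)
      have i2: "integrable (cubem N) (\<lambda>x. norm (r x))"
        by (rule U.integrable_const_bound[where B=B]) (use B rm in auto)
      have "mean N 0 (\<lambda>x. r x * cnj (r x)) = of_real (LINT x|cubem N. (norm (r x))\<^sup>2)"
        using Npos rm by (subst mean_eq_integral_cubem) (auto simp flip: complex_norm_square integral_complex_of_real)
      moreover have "(LINT x|cubem N. norm (r x)) \<le> (LINT x|cubem N. (1 + (norm (r x))\<^sup>2) / 2)"
      proof (rule integral_mono)
        show "norm (r x) \<le> (1 + (norm (r x))\<^sup>2) / 2" for x using sum_squares_bound[of 1 "norm (r x)"] by simp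
      qed (use i i2 in auto)
      ultimately show ?thesis using i U.prob_space by simp
    qed
    have "(LINT t|cubem N. h t) * norm (mean N 0 (\<lambda>x. r x * of_real (tent D x)))
       \<le> (\<epsilon> + \<epsilon>) * (LINT t|cubem N. h t) * (LINT x|cubem N. norm (r x)) + 3 ^ CARD('m) * (2 * c)"
    proof (rule window_correlation_bound[OF D borel_measurable_tent[OF D] tent_nonneg tent_le_1[OF D] tent_lipschitz[OF D] hm h01 _ rm B R(1) Npos R(3)[OF Nd] R(4)[OF Nd] N0[OF NN]])
      show "h t * D t \<le> \<epsilon> * h t" for t
      proof (cases "D t \<le> \<epsilon>")
        case True
        thus ?thesis using h01(1)[of t] by (simp add: mult.commute[of \<epsilon>] mult_left_mono)
      next
        case False
        hence "h t = 0" using e by (simp add: h_def tent_def D1_def max_def)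
        thus ?thesis by simp
      qed
    qed
    moreover have "(LINT t|cubem N. h t) \<ge> 0" using h01 by simp
    hence "2 * \<epsilon> * (LINT t|cubem N. h t) * (LINT x|cubem N. norm (r x)) 
        \<le> 2 * \<epsilon> * (LINT t|cubem N. h t) * ((1 + Re (mean N 0 (\<lambda>x. r x * cnj (r x)))) / 2)"
      using mr e by (intro mult_left_mono) auto
    ultimately show ?thesis unfolding mH P_def by simp
  qed
  have l1: "((\<lambda>N. Re (mean N 0 H)) \<longlongrightarrow> k) at_top" unfolding k_def by (intro tendsto_Re has_mean_tendsto bap_has_mean H)
  have l2: "((\<lambda>N. norm (mean N 0 (\<lambda>x. r x * P x))) \<longlongrightarrow> norm (complex_of_real q)) at_top"
    unfolding rP[symmetric] by (intro tendsto_norm has_mean_tendsto bap_has_mean bap_mult r P)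
  have l3: "((\<lambda>N. Re (mean N 0 (\<lambda>x. r x * cnj (r x)))) \<longlongrightarrow> q) at_top"
    unfolding q_def by (intro tendsto_Re has_mean_tendsto bap_has_mean bap_mult bap_cnj r)
  have "k * norm (complex_of_real q) \<le> 2 * \<epsilon> * k * ((1 + q) / 2) + 3 ^ CARD('m) * (2 * c)"
  proof (rule tendsto_le[OF trivial_limit_at_top_linorder])
    show "((\<lambda>N. Re (mean N 0 H) * norm (mean N 0 (\<lambda>x. r x * P x))) \<longlongrightarrow> k * norm (complex_of_real q)) at_top"
      by (intro tendsto_intros l1 l2)
    show "((\<lambda>N. 2 * \<epsilon> * Re (mean N 0 H) * ((1 + Re (mean N 0 (\<lambda>x. r x * cnj (r x)))) / 2) + 3 ^ CARD('m) * (2 * c))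
       \<longlongrightarrow> 2 * \<epsilon> * k * ((1 + q) / 2) + 3 ^ CARD('m) * (2 * c)) at_top"
      by (intro tendsto_intros l1 l3) auto
    show "\<forall>\<^sub>F N in at_top. Re (mean N 0 H) * norm (mean N 0 (\<lambda>x. r x * P x))
       \<le> 2 * \<epsilon> * Re (mean N 0 H) * ((1 + Re (mean N 0 (\<lambda>x. r x * cnj (r x)))) / 2) + 3 ^ CARD('m) * (2 * c)"
      using eventually_ge_at_top[of "max N0 d"] by eventually_elim (rule ev)
  qed
  also have "3 ^ CARD('m) * (2 * c) = k * (\<eta> / 2)" by (simp add: c_def)
  also have "2 * \<epsilon> * k * ((1 + q) / 2) \<le> 2 * \<epsilon> * k * 1" using q1 e k by (intro mult_left_mono) auto
  also have "2 * \<epsilon> * k * 1 + k * (\<eta> / 2) = k * \<eta>" by (simp add: \<epsilon>_def algebra_simps)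
  finally have "q \<le> \<eta>" using q(2) k by simp
  thus ?thesis using that[OF fin] unfolding q_def r_def by (simp add: \<Lambda>_def)
qed

section \<open>Continuity of translation in L1\<close>

text \<open>By translation invariance the positive and the negative part of the difference have
  equal integrals, so only points that leave \<open>U\<close> count, twice. A point of an open set
  stays inside under small translations, and \<open>indicat_real U\<close> dominates.\<close>

lemma integral_open_translate:
  fixes U :: "'a::euclidean_space set" and T :: "nat \<Rightarrow> 'a"
  assumes U: "open U" and fin: "emeasure lborel U < \<infinity>" and T: "T \<longlonglongrightarrow> 0"
  shows "(\<lambda>n. LINT x|lborel. \<bar>indicat_real U (x + T n) - indicat_real U x\<bar>) \<longlonglongrightarrow> 0"
proof -
  have [measurable]: "U \<in> sets borel" using U by simp
  have i: "integrable lborel (indicat_real U)" using fin by (intro integrable_real_indicator) auto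
  have it: "integrable lborel (\<lambda>x. indicat_real U (x + t))" for t
  proof -
    have "integrable (distr lborel borel ((+) t)) (indicat_real U)" unfolding lborel_distr_plus by (rule i)
    thus ?thesis by (subst (asm) integrable_distr_eq) (auto simp: add.commute)
  qed
  have eq: "(LINT x|lborel. indicat_real U (x + t)) = (LINT x|lborel. indicat_real U x)" for t
    by (rule integral_lborel_shift) measurable
  let ?p = "\<lambda>n x. max 0 (indicat_real U x - indicat_real U (x + T n))"
  have ip: "integrable lborel (?p n)" for n using i it by auto
  have "(\<lambda>n. LINT x|lborel. ?p n x) \<longlonglongrightarrow> (LINT x|(lborel :: 'a measure). (0::real))"
  proof (rule integral_dominated_convergence[where w="indicat_real U"])
    show "AE x in lborel. (\<lambda>n. ?p n x) \<longlonglongrightarrow> 0"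
    proof (rule AE_I2)
      fix x
      show "(\<lambda>n. ?p n x) \<longlonglongrightarrow> 0"
      proof (cases "x \<in> U")
        case True
        have "(\<lambda>n. x + T n) \<longlonglongrightarrow> x + 0" by (intro tendsto_intros T)
        hence "\<forall>\<^sub>F n in sequentially. x + T n \<in> U" using U True by (simp add: topological_tendstoD)
        hence "\<forall>\<^sub>F n in sequentially. ?p n x = 0" by eventually_elim simp
        thus ?thesis by (rule tendsto_eventually)
      next
        case False
        hence "?p n x = 0" for n by (simp add: max_def indicator_def)
        thus ?thesis by simp
      qed
    qed
  qed (use i in \<open>auto simp: indicator_def\<close>)
  hence lim: "(\<lambda>n. 2 * (LINT x|lborel. ?p n x)) \<longlonglongrightarrow> 2 * 0" by (intro tendsto_intros) simp
  have "(LINT x|lborel. \<bar>indicat_real U (x + T n) - indicat_real U x\<bar>) = 2 * (LINT x|lborel. ?p n x)" for n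
  proof -
    have "(\<lambda>x. \<bar>indicat_real U (x + T n) - indicat_real U x\<bar>) = (\<lambda>x. 2 * ?p n x + (indicat_real U (x + T n) - indicat_real U x))"
      by (auto simp: fun_eq_iff max_def)
    hence "(LINT x|lborel. \<bar>indicat_real U (x + T n) - indicat_real U x\<bar>) = 
        (LINT x|lborel. 2 * ?p n x + (indicat_real U (x + T n) - indicat_real U x))" by (rule arg_cong)
    also have "\<dots> = (LINT x|lborel. 2 * ?p n x) + (LINT x|lborel. (indicat_real U (x + T n) - indicat_real U x))"
      using i it ip by (intro Bochner_Integration.integral_add) auto
    also have "(LINT x|lborel. (indicat_real U (x + T n) - indicat_real U x)) = 0"
      using i it by (subst Bochner_Integration.integral_diff) (auto simp: eq)
    finally show ?thesis by simp
  qed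
  thus ?thesis using lim by simp
qed

lemma integrable_lborel_shift:
  fixes f :: "'a::euclidean_space \<Rightarrow> 'b::{banach,second_countable_topology}"
  assumes "integrable lborel f" shows "integrable lborel (\<lambda>x. f (x + t))"
proof -
  have "integrable (distr lborel borel ((+) t)) f" unfolding lborel_distr_plus by (rule assms)
  thus ?thesis using borel_measurable_integrable[OF assms]
    by (subst (asm) integrable_distr_eq) (auto simp: add.commute)
qed

lemma L1_translation_continuous_approx:
  fixes f :: "'a::euclidean_space \<Rightarrow> 'b::{banach,second_countable_topology}"
  assumes f: "integrable lborel f"
    and approx: "\<And>e. e > 0 \<Longrightarrow> \<exists>g. integrable lborel g \<and> (LINT x|lborel. norm (f x - g x)) \<le> e \<and>
        (\<lambda>n. LINT x|lborel. norm (g (x + T n) - g x)) \<longlonglongrightarrow> 0"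
  shows "(\<lambda>n. LINT x|lborel. norm (f (x + T n) - f x)) \<longlonglongrightarrow> 0"
proof (rule LIMSEQ_I)
  fix e :: real assume e: "e > 0"
  obtain g where g: "integrable lborel g" "(LINT x|lborel. norm (f x - g x)) \<le> e / 4"
    "(\<lambda>n. LINT x|lborel. norm (g (x + T n) - g x)) \<longlonglongrightarrow> 0" using approx[of "e/4"] e by auto
  obtain n0 where n0: "\<And>n. n \<ge> n0 \<Longrightarrow> (LINT x|lborel. norm (g (x + T n) - g x)) < e / 4"
    using LIMSEQ_D[OF g(3), of "e/4"] e by auto
  have fm [measurable]: "f \<in> borel_measurable borel" "g \<in> borel_measurable borel"
    using f g by (auto dest: borel_measurable_integrable)
  have "norm ((LINT x|lborel. norm (f (x + T n) - f x)) - 0) < e" if n: "n \<ge> n0" for n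
  proof -
    have sh: "(LINT x|lborel. norm (f (x + T n) - g (x + T n))) = (LINT x|lborel. norm (f x - g x))"
      by (rule integral_lborel_shift[where f="\<lambda>x. norm (f x - g x)"]) measurable
    have i: "integrable lborel (\<lambda>x. norm (f (x + T n) - g (x + T n)))" "integrable lborel (\<lambda>x. norm (g (x + T n) - g x))"
      "integrable lborel (\<lambda>x. norm (f x - g x))" "integrable lborel (\<lambda>x. norm (f (x + T n) - f x))"
      using f g integrable_lborel_shift[OF f] integrable_lborel_shift[OF g(1)] by auto
    have "(LINT x|lborel. norm (f (x + T n) - f x)) \<le> 
       (LINT x|lborel. norm (f (x + T n) - g (x + T n)) + norm (g (x + T n) - g x) + norm (f x - g x))"
    proof (rule integral_mono[OF i(4)])
      show "integrable lborel (\<lambda>x. norm (f (x + T n) - g (x + T n)) + norm (g (x + T n) - g x) + norm (f x - g x))"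
        using i by auto
      fix x
      have "f (x + T n) - f x = (f (x + T n) - g (x + T n)) + (g (x + T n) - g x) + (g x - f x)" by simp
      thus "norm (f (x + T n) - f x) \<le> norm (f (x + T n) - g (x + T n)) + norm (g (x + T n) - g x) + norm (f x - g x)"
        using norm_triangle_ineq[of "(f (x + T n) - g (x + T n)) + (g (x + T n) - g x)" "g x - f x"]
          norm_triangle_ineq[of "f (x + T n) - g (x + T n)" "g (x + T n) - g x"] norm_minus_commute[of "g x" "f x"] by simp
    qed
    also have "\<dots> = (LINT x|lborel. norm (f x - g x)) + (LINT x|lborel. norm (g (x + T n) - g x)) + (LINT x|lborel. norm (f x - g x))"
      using i by (simp add: sh)
    also have "\<dots> < e" using g(2) n0[OF n] e by linarith
    finally show ?thesis by simp
  qed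
  thus "\<exists>no. \<forall>n\<ge>no. norm ((LINT x|lborel. norm (f (x + T n) - f x)) - 0) < e" by blast
qed

lemma L1_translation_continuous:
  fixes f :: "'a::euclidean_space \<Rightarrow> 'b::{banach,second_countable_topology}"
  assumes f: "integrable lborel f" and T: "T \<longlonglongrightarrow> 0"
  shows "(\<lambda>n. LINT x|lborel. norm (f (x + T n) - f x)) \<longlonglongrightarrow> 0"
  using f
proof (induction rule: integrable_induct)
  case (base A c)
  have Ab [measurable]: "A \<in> sets borel" using base by simp
  have iA: "integrable lborel (\<lambda>x. indicat_real A x *\<^sub>R c)" using base by (intro integrable_scaleR_left integrable_real_indicator) auto
  show ?case
  proof (rule L1_translation_continuous_approx[OF iA])
    fix e :: real assume e: "e > 0"
    have pos: "e / (norm c + 1) > 0" using e by (simp add: add_nonneg_pos)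
    \<comment> \<open>Outer regularity encloses \<open>A\<close> in an open \<open>U\<close> of
      nearly the same measure, for which the claim is already known; \<open>norm c + 1\<close>
      avoids division by zero.\<close>
    have "A \<in> sets lebesgue" using Ab by (simp add: sets_completionI_sets)
    then obtain U where U: "open U" "A \<subseteq> U" "emeasure lebesgue (U - A) < ennreal (e / (norm c + 1))"
      using sets_lebesgue_outer_open[OF _ pos] by metis
    have [measurable]: "U \<in> sets borel" using U by simp
    have UA: "emeasure lborel (U - A) < ennreal (e / (norm c + 1))"
      using U(3) by (subst (asm) emeasure_completion) (auto simp: main_part_sets)
    have "emeasure lborel U = emeasure lborel A + emeasure lborel (U - A)"
      using U(2) by (subst plus_emeasure) (auto simp: Un_absorb1)
    also have "\<dots> < \<infinity>" using base UA by (auto simp: less_top intro: order.strict_trans)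
    finally have Ufin: "emeasure lborel U < \<infinity>" .
    show "\<exists>g. integrable lborel g \<and> (LINT x|lborel. norm (indicat_real A x *\<^sub>R c - g x)) \<le> e \<and>
        (\<lambda>n. LINT x|lborel. norm (g (x + T n) - g x)) \<longlonglongrightarrow> 0"
    proof (intro exI[of _ "\<lambda>x. indicat_real U x *\<^sub>R c"] conjI)
      show "integrable lborel (\<lambda>x. indicat_real U x *\<^sub>R c)" using Ufin by (intro integrable_scaleR_left integrable_real_indicator) auto
      have "(\<lambda>n. (LINT x|lborel. \<bar>indicat_real U (x + T n) - indicat_real U x\<bar>) * norm c) \<longlonglongrightarrow> 0 * norm c"
        by (intro tendsto_mult tendsto_const integral_open_translate U Ufin T)
      thus "(\<lambda>n. LINT x|lborel. norm (indicat_real U (x + T n) *\<^sub>R c - indicat_real U x *\<^sub>R c)) \<longlonglongrightarrow> 0"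
        by (simp flip: scaleR_diff_left)
      have "(\<lambda>x. norm (indicat_real A x *\<^sub>R c - indicat_real U x *\<^sub>R c)) = (\<lambda>x. indicat_real (U - A) x * norm c)"
        using U(2) by (auto simp: fun_eq_iff indicator_def)
      moreover have "(LINT x|lborel. indicat_real (U - A) x * norm c) = measure lborel (U - A) * norm c" by simp
      moreover have "measure lborel (U - A) \<le> e / (norm c + 1)"
        using UA pos unfolding measure_def by (intro enn2real_leI) auto
      hence "measure lborel (U - A) * norm c \<le> e / (norm c + 1) * (norm c + 1)"
        using pos by (intro mult_mono) auto
      moreover have "norm c + 1 \<noteq> 0" using norm_ge_zero[of c] by linarith
      ultimately show "(LINT x|lborel. norm (indicat_real A x *\<^sub>R c - indicat_real U x *\<^sub>R c)) \<le> e" by simp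
    qed
  qed
next
  case (add f g)
  have i: "integrable lborel (\<lambda>x. norm (f (x + T n) - f x))" "integrable lborel (\<lambda>x. norm (g (x + T n) - g x))" for n
    using add.hyps integrable_lborel_shift[of f] integrable_lborel_shift[of g] by auto
  have "(\<lambda>n. (LINT x|lborel. norm (f (x + T n) - f x)) + (LINT x|lborel. norm (g (x + T n) - g x))) \<longlonglongrightarrow> 0 + 0"
    by (intro tendsto_add add.IH)
  hence lim: "(\<lambda>n. LINT x|lborel. norm (f (x + T n) - f x) + norm (g (x + T n) - g x)) \<longlonglongrightarrow> 0" using i by simp
  show ?case
  proof (rule tendsto_sandwich[OF _ _ tendsto_const lim])
    show "\<forall>\<^sub>F n in sequentially. (LINT x|lborel. norm (f (x + T n) + g (x + T n) - (f x + g x)))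
       \<le> (LINT x|lborel. norm (f (x + T n) - f x) + norm (g (x + T n) - g x))"
      using i by (intro always_eventually allI integral_mono_AE' AE_I2) 
        (auto intro: norm_diff_triangle_ineq)
  qed auto
next
  case (lim f s)
  show ?case
  proof (rule L1_translation_continuous_approx[OF lim.hyps(4)])
    fix e :: real assume e: "e > 0"
    have "(\<lambda>i. LINT x|lborel. norm (s i x - f x)) \<longlonglongrightarrow> (LINT x|(lborel :: 'a measure). (0::real))"
    proof (rule integral_dominated_convergence[where w="\<lambda>x. 3 * norm (f x)"])
      show "AE x in lborel. (\<lambda>i. norm (s i x - f x)) \<longlonglongrightarrow> 0"
      proof (rule AE_I2)
        fix x :: 'a
        have "(\<lambda>i. s i x) \<longlonglongrightarrow> f x" by (rule lim.hyps(2)) simp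
        hence "(\<lambda>i. norm (s i x - f x)) \<longlonglongrightarrow> norm (f x - f x)" by (intro tendsto_intros)
        thus "(\<lambda>i. norm (s i x - f x)) \<longlonglongrightarrow> 0" by simp
      qed
      show "AE x in lborel. norm (norm (s i x - f x)) \<le> 3 * norm (f x)" for i
      proof (rule AE_I2)
        fix x :: 'a
        have le: "norm (s i x) \<le> 2 * norm (f x)" by (rule lim.hyps(3)) simp
        show "norm (norm (s i x - f x)) \<le> 3 * norm (f x)"
          using order_trans[OF norm_triangle_ineq4[of "s i x" "f x"] add_right_mono[OF le]] by simp
      qed
      show "integrable lborel (\<lambda>x. 3 * norm (f x))" using lim.hyps(4) by simp
      show "(\<lambda>x. norm (s i x - f x)) \<in> borel_measurable lborel" for i
        using borel_measurable_integrable[OF lim.hyps(1)[of i]] borel_measurable_integrable[OF lim.hyps(4)] by simp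
    qed simp
    hence "(\<lambda>i. LINT x|lborel. norm (s i x - f x)) \<longlonglongrightarrow> 0" by simp
    from LIMSEQ_D[OF this e] obtain i where "norm ((LINT x|lborel. norm (s i x - f x)) - 0) < e" by blast
    hence "(LINT x|lborel. norm (s i x - f x)) < e" by simp
    thus "\<exists>g. integrable lborel g \<and> (LINT x|lborel. norm (f x - g x)) \<le> e \<and>
        (\<lambda>n. LINT x|lborel. norm (g (x + T n) - g x)) \<longlonglongrightarrow> 0"
      using lim.IH[of i] lim.hyps(1)[of i] by (intro exI[of _ "s i"] conjI) (simp_all add: norm_minus_commute less_imp_le)
  qed
qed

section \<open>From relatively dense almost periods to a gauge\<close>

lemma mem_cube: "x \<in> cube a l \<longleftrightarrow> (\<forall>i. a $ i \<le> x $ i \<and> x $ i \<le> a $ i + l)"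
  by (simp add: cube_def mem_box_cart)

lemma unit_integral_le_window:
  fixes g :: "real ^ 'm \<Rightarrow> complex" and x :: "real ^ 'm"
  assumes [measurable]: "g \<in> borel_measurable borel" and x: "\<And>i. 0 \<le> x $ i \<and> x $ i \<le> (l::real)"
  shows "(\<integral>\<^sup>+u\<in>ucube. ennreal (norm (g (x + u))) \<partial>lborel) \<le> (\<integral>\<^sup>+v\<in>cbx (l + 1). ennreal (norm (g v)) \<partial>lborel)"
proof -
  have "(\<integral>\<^sup>+u\<in>ucube. ennreal (norm (g (x + u))) \<partial>lborel) \<le> (\<integral>\<^sup>+u. ennreal (norm (g (u + x))) * indicator (cbx (l + 1)) (u + x) \<partial>lborel)"
  proof (intro nn_integral_mono)
    fix u :: "real ^ 'm"
    have "u + x \<in> cbx (l + 1)" if "u \<in> ucube"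
      unfolding mem_cbx
    proof
      fix i
      have "0 \<le> u $ i" "u $ i \<le> 1" using that by (auto simp: mem_box_cart)
      thus "\<bar>(u + x) $ i\<bar> \<le> l + 1" using x[of i] by simp
    qed
    thus "ennreal (norm (g (x + u))) * indicator ucube u \<le> ennreal (norm (g (u + x))) * indicator (cbx (l + 1)) (u + x)"
      by (auto simp: indicator_def add.commute)
  qed
  also have "\<dots> = (\<integral>\<^sup>+v\<in>cbx (l + 1). ennreal (norm (g v)) \<partial>lborel)"
    by (rule nn_integral_lborel_shift[where f="\<lambda>v. ennreal (norm (g v)) * indicator (cbx (l + 1)) v"]) measurable
  finally show ?thesis .
qed

text \<open>An almost period from the cube with corner \<open>- x\<close> carries the unit cube at
  \<open>x\<close> into the fixed window \<open>cbx (l + 1)\<close>. The supremum over all positions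
  is thus reduced to one bounded region.\<close>

lemma snorm_le_window:
  fixes g :: "real ^ 'm \<Rightarrow> complex"
  assumes gm [measurable]: "g \<in> borel_measurable borel" 
    and \<tau>: "\<And>a. \<exists>\<tau>\<in>cube a l. snorm (\<lambda>x. g (x + \<tau>) - g x) \<le> e"
  shows "snorm g \<le> e + (\<integral>\<^sup>+v\<in>cbx (l + 1). ennreal (norm (g v)) \<partial>lborel)"
proof (rule snorm_least)
  fix x
  obtain \<tau> where t: "\<tau> \<in> cube (- x) l" "snorm (\<lambda>x. g (x + \<tau>) - g x) \<le> e" using \<tau> by blast
  have "0 \<le> (x + \<tau>) $ i \<and> (x + \<tau>) $ i \<le> l" for i 
  proof -
    have "- x $ i \<le> \<tau> $ i \<and> \<tau> $ i \<le> - x $ i + l" using t(1) unfolding mem_cube by (simp only: vector_uminus_component)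
    thus ?thesis by simp
  qed
  hence w: "(\<integral>\<^sup>+u\<in>ucube. ennreal (norm (g (x + \<tau> + u))) \<partial>lborel) \<le> (\<integral>\<^sup>+v\<in>cbx (l + 1). ennreal (norm (g v)) \<partial>lborel)"
    by (intro unit_integral_le_window) auto
  have "(\<integral>\<^sup>+u\<in>ucube. ennreal (norm (g (x + u))) \<partial>lborel) \<le> 
    (\<integral>\<^sup>+u. ennreal (norm (g (x + u + \<tau>) - g (x + u))) * indicator ucube u + ennreal (norm (g (x + \<tau> + u))) * indicator ucube u \<partial>lborel)"
  proof (intro nn_integral_mono)
    fix u
    have "norm (g (x + u)) \<le> norm (g (x + u + \<tau>) - g (x + u)) + norm (g (x + \<tau> + u))"
      using norm_triangle_sub[of "g (x + u)" "g (x + u + \<tau>)"] by (simp add: add_ac norm_minus_commute)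
    hence "ennreal (norm (g (x + u))) \<le> ennreal (norm (g (x + u + \<tau>) - g (x + u))) + ennreal (norm (g (x + \<tau> + u)))"
      by (subst ennreal_plus[symmetric]) (auto intro!: ennreal_leI simp del: ennreal_plus)
    thus "ennreal (norm (g (x + u))) * indicator ucube u \<le> ennreal (norm (g (x + u + \<tau>) - g (x + u))) * indicator ucube u + ennreal (norm (g (x + \<tau> + u))) * indicator ucube u"
      by (auto simp: indicator_def)
  qed
  also have "\<dots> = (\<integral>\<^sup>+u\<in>ucube. ennreal (norm (g (x + u + \<tau>) - g (x + u))) \<partial>lborel) + (\<integral>\<^sup>+u\<in>ucube. ennreal (norm (g (x + \<tau> + u))) \<partial>lborel)"
    by (rule nn_integral_add) auto
  also have "\<dots> \<le> e + (\<integral>\<^sup>+v\<in>cbx (l + 1). ennreal (norm (g v)) \<partial>lborel)"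
    using snorm_upper[of "\<lambda>x. g (x + \<tau>) - g x" x] t(2) w by (intro add_mono) auto
  finally show "(\<integral>\<^sup>+u\<in>ucube. ennreal (norm (g (x + u))) \<partial>lborel) \<le> e + (\<integral>\<^sup>+v\<in>cbx (l + 1). ennreal (norm (g v)) \<partial>lborel)" .
qed

text \<open>Almost periods are kept as relatively dense sets, the form in which the
  order-\<open>p\<close> definition provides them; \<open>ap_gauge_dist1\<close> converts them to a
  gauge.\<close>

definition S1ap :: "(real ^ 'm \<Rightarrow> complex) \<Rightarrow> bool" where
  "S1ap f \<longleftrightarrow> f \<in> borel_measurable borel \<and> (\<forall>N. set_integrable lborel (cbx N) f) \<and>
     (\<forall>\<epsilon>>0. \<exists>l>0. \<forall>a. \<exists>\<tau>\<in>cube a l. snorm (\<lambda>x. f (x + \<tau>) - f x) < ennreal \<epsilon>)"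

definition dist1 :: "(real ^ 'm \<Rightarrow> complex) \<Rightarrow> real ^ 'm \<Rightarrow> real" where
  "dist1 f t = enn2real (snorm (\<lambda>x. f (x + t) - f x))"

lemma S1ap_sbounded: assumes f: "S1ap f" shows "sbounded f"
proof -
  have fm [measurable]: "f \<in> borel_measurable borel" and fi: "\<And>N. set_integrable lborel (cbx N) f"
    using f by (auto simp: S1ap_def)
  obtain l where l: "l > 0" "\<And>a. \<exists>\<tau>\<in>cube a l. snorm (\<lambda>x. f (x + \<tau>) - f x) < ennreal 1"
    using f unfolding S1ap_def by (meson zero_less_one)
  have "snorm f \<le> ennreal 1 + (\<integral>\<^sup>+v\<in>cbx (l + 1). ennreal (norm (f v)) \<partial>lborel)"
  proof (rule snorm_le_window[OF fm])
    fix a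
    obtain \<tau> where "\<tau> \<in> cube a l" "snorm (\<lambda>x. f (x + \<tau>) - f x) < ennreal 1" using l(2) by blast
    thus "\<exists>\<tau>\<in>cube a l. snorm (\<lambda>x. f (x + \<tau>) - f x) \<le> ennreal 1" by (intro bexI[of _ \<tau>]) auto
  qed
  also have "(\<integral>\<^sup>+v\<in>cbx (l + 1). ennreal (norm (f v)) \<partial>lborel) = (\<integral>\<^sup>+v. ennreal (norm (indicator (cbx (l + 1)) v *\<^sub>R f v)) \<partial>lborel)"
    by (intro nn_integral_cong) (auto simp: indicator_def)
  also have "ennreal 1 + \<dots> < top"
    using fi[of "l + 1"] by (auto simp: set_integrable_def integrable_iff_bounded less_top ennreal_add_eq_top)
  finally show ?thesis by (simp add: sbounded_def)
qed

lemma snorm_dist1: assumes f: "sbounded f" shows "snorm (\<lambda>x. f (x + t) - f x) = ennreal (dist1 f t)"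
  using sbounded_diff[OF sbounded_shift[OF f] f] unfolding dist1_def by (simp add: sbounded_def)

lemma dist1_le: assumes "sbounded f" "snorm (\<lambda>x. f (x + t) - f x) < ennreal e" shows "dist1 f t < e"
  using assms(2) unfolding snorm_dist1[OF assms(1)] by (rule ennreal_less_iff[THEN iffD1, rotated]) (simp add: dist1_def)

text \<open>Symmetry and subadditivity follow from translation invariance of \<open>snorm\<close>.
  The substance is continuity at 0: almost periods confine the supremum to a bounded window, and
  there translation is continuous in L1.\<close>

lemma ap_gauge_dist1:
  fixes f :: "real ^ 'm \<Rightarrow> complex"
  assumes f: "S1ap f" shows "ap_gauge (dist1 f)"
proof -
  have sb: "sbounded f" by (rule S1ap_sbounded[OF f])
  have fm [measurable]: "f \<in> borel_measurable borel" and fi: "\<And>N. set_integrable lborel (cbx N) f"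
    using f by (auto simp: S1ap_def)
  have ap: "\<exists>l>0. \<forall>a. \<exists>\<tau>\<in>cube a l. snorm (\<lambda>x. f (x + \<tau>) - f x) < ennreal \<epsilon>" if "\<epsilon> > 0" for \<epsilon>
    using f that unfolding S1ap_def by blast
  have nn: "0 \<le> dist1 f t" for t by (simp add: dist1_def)
  show ?thesis
  proof (rule ap_gaugeI_relatively_dense)
    show "dist1 f 0 = 0"
    proof -
      have "snorm (\<lambda>x. f (x + 0) - f x) \<le> ennreal 0" by (rule snorm_bounded) simp
      thus ?thesis by (simp add: dist1_def)
    qed
    show "0 \<le> dist1 f t" for t by (rule nn)
    show "dist1 f (- t) = dist1 f t" for t
    proof -
      have "snorm (\<lambda>x. f (x + - t) - f x) = snorm (\<lambda>x. f (x + t + - t) - f (x + t))"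
        by (rule snorm_shift[symmetric, of "\<lambda>x. f (x + - t) - f x"])
      also have "\<dots> = snorm (\<lambda>x. f x - f (x + t))" by simp
      also have "\<dots> = snorm (\<lambda>x. f (x + t) - f x)" by (rule snorm_minus)
      finally show ?thesis by (simp add: dist1_def)
    qed
    show "dist1 f (s + t) \<le> dist1 f s + dist1 f t" for s t
    proof -
      have "ennreal (dist1 f (s + t)) = snorm (\<lambda>x. (f (x + t + s) - f (x + t)) + (f (x + t) - f x))"
        by (simp add: snorm_dist1[OF sb, symmetric] add_ac)
      also have "\<dots> \<le> snorm (\<lambda>x. f (x + t + s) - f (x + t)) + snorm (\<lambda>x. f (x + t) - f x)"
        by (rule snorm_triangle) auto
      also have "snorm (\<lambda>x. f (x + t + s) - f (x + t)) = snorm (\<lambda>x. f (x + s) - f x)"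
        by (rule snorm_shift[of "\<lambda>x. f (x + s) - f x"])
      also have "\<dots> + snorm (\<lambda>x. f (x + t) - f x) = ennreal (dist1 f s + dist1 f t)"
        by (simp add: snorm_dist1[OF sb] nn ennreal_plus)
      finally show ?thesis by (subst (asm) ennreal_le_iff) (auto simp: nn)
    qed
    show "\<exists>L. \<forall>t. \<exists>s. norm s \<le> L \<and> dist1 f (t - s) < \<epsilon>" if e: "\<epsilon> > 0" for \<epsilon>
    proof -
      obtain l where l: "l > 0" "\<And>a. \<exists>\<tau>\<in>cube a l. snorm (\<lambda>x. f (x + \<tau>) - f x) < ennreal \<epsilon>" using ap[OF e] by blast
      show ?thesis
      proof (rule exI[of _ "CARD('m) * l"], rule allI)
        fix t
        obtain \<tau> where t: "\<tau> \<in> cube t l" "snorm (\<lambda>x. f (x + \<tau>) - f x) < ennreal \<epsilon>" using l(2) by blast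
        have "\<bar>(t - \<tau>) $ i\<bar> \<le> l" for i
        proof -
          have "t $ i \<le> \<tau> $ i \<and> \<tau> $ i \<le> t $ i + l" using t(1) unfolding mem_cube by blast
          thus ?thesis by (simp add: abs_le_iff)
        qed
        hence "t - \<tau> \<in> cbx l" unfolding mem_cbx by blast
        hence "norm (t - \<tau>) \<le> CARD('m) * l" by (rule norm_cbx_le)
        moreover have "dist1 f (t - (t - \<tau>)) < \<epsilon>" using dist1_le[OF sb t(2)] by simp
        ultimately show "\<exists>s. norm s \<le> CARD('m) * l \<and> dist1 f (t - s) < \<epsilon>" by blast
      qed
    qed
    show "\<exists>\<delta>>0. \<forall>t. norm t < \<delta> \<longrightarrow> dist1 f t < \<epsilon>" if e: "\<epsilon> > 0" for \<epsilon>
    proof (rule ccontr)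
      assume neg: "\<not> ?thesis"
      have "\<exists>t. norm t < inverse (real (Suc n)) \<and> dist1 f t \<ge> \<epsilon>" for n
        using neg by (metis inverse_positive_iff_positive linorder_not_le of_nat_0_less_iff zero_less_Suc)
      then obtain T where T: "\<And>n. norm (T n) < inverse (real (Suc n))" "\<And>n. dist1 f (T n) \<ge> \<epsilon>" by metis
      have T0: "T \<longlonglongrightarrow> 0"
        by (rule Lim_null_comparison[OF _ LIMSEQ_inverse_real_of_nat]) (use T(1) in \<open>auto intro!: always_eventually less_imp_le\<close>)
      \<comment> \<open>Translating the difference \<open>f (x + T n) - f x\<close> by
        \<open>\<tau>\<close> moves two copies of \<open>f\<close>, at a total cost of
        \<open>\<epsilon> / 3\<close>; the L1 term adds less than another
        \<open>\<epsilon> / 3\<close>, which contradicts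
        \<open>dist1 f (T n) \<ge> \<epsilon>\<close>.\<close>
      have "\<epsilon> / 6 > 0" using e by simp
      from ap[OF this] obtain l where l: "l > 0" "\<And>a. \<exists>\<tau>\<in>cube a l. snorm (\<lambda>x. f (x + \<tau>) - f x) < ennreal (\<epsilon> / 6)" by blast
      \<comment> \<open>The margin makes \<open>cbx (l + 2)\<close> contain both
        \<open>cbx (l + 1)\<close> and its translate by \<open>T n\<close>, a vector of norm at most
        1.\<close>
      define k where "k = (\<lambda>v. indicat_real (cbx (l + 2)) v *\<^sub>R f v)"
      have ik: "integrable lborel k" using fi[of "l + 2"] by (simp add: k_def set_integrable_def)
      have le: "dist1 f (T n) \<le> \<epsilon> / 3 + (LINT v|lborel. norm (k (v + T n) - k v))" for n
      proof -
        let ?g = "\<lambda>x. f (x + T n) - f x"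
        have first: "snorm ?g \<le> ennreal (\<epsilon> / 3) + (\<integral>\<^sup>+v\<in>cbx (l + 1). ennreal (norm (?g v)) \<partial>lborel)"
        proof (rule snorm_le_window)
          fix a
          obtain \<tau> where t: "\<tau> \<in> cube a l" "snorm (\<lambda>x. f (x + \<tau>) - f x) < ennreal (\<epsilon> / 6)" using l(2) by blast
          have "snorm (\<lambda>x. ?g (x + \<tau>) - ?g x) = snorm (\<lambda>x. (f (x + T n + \<tau>) - f (x + T n)) + (f x - f (x + \<tau>)))"
            by (simp add: add_ac diff_diff_eq2 algebra_simps)
          also have "\<dots> \<le> snorm (\<lambda>x. f (x + T n + \<tau>) - f (x + T n)) + snorm (\<lambda>x. f x - f (x + \<tau>))"
            by (rule snorm_triangle) auto
          also have "snorm (\<lambda>x. f (x + T n + \<tau>) - f (x + T n)) = snorm (\<lambda>x. f (x + \<tau>) - f x)"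
            by (rule snorm_shift[of "\<lambda>x. f (x + \<tau>) - f x"])
          also have "snorm (\<lambda>x. f x - f (x + \<tau>)) = snorm (\<lambda>x. f (x + \<tau>) - f x)" by (rule snorm_minus)
          also have "snorm (\<lambda>x. f (x + \<tau>) - f x) + snorm (\<lambda>x. f (x + \<tau>) - f x) \<le> ennreal (\<epsilon> / 6) + ennreal (\<epsilon> / 6)"
            using t(2) by (intro add_mono) auto
          also have "\<dots> = ennreal (\<epsilon> / 3)" using e by (subst ennreal_plus[symmetric]) auto
          finally show "\<exists>\<tau>\<in>cube a l. snorm (\<lambda>x. ?g (x + \<tau>) - ?g x) \<le> ennreal (\<epsilon> / 3)" using t(1) by blast
        qed measurable
        have "(\<integral>\<^sup>+v\<in>cbx (l + 1). ennreal (norm (?g v)) \<partial>lborel) \<le> (\<integral>\<^sup>+v. ennreal (norm (k (v + T n) - k v)) \<partial>lborel)"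
        proof (intro nn_integral_mono)
          fix v :: "real ^ 'm"
          have "v \<in> cbx (l + 2) \<and> v + T n \<in> cbx (l + 2)" if "v \<in> cbx (l + 1)"
          proof -
            have "\<bar>v $ i\<bar> \<le> l + 2 \<and> \<bar>(v + T n) $ i\<bar> \<le> l + 2" for i
            proof -
              have "norm (T n) \<le> 1" using T(1)[of n] by (rule order_trans[OF less_imp_le]) (simp add: inverse_le_1_iff)
              hence "\<bar>T n $ i\<bar> \<le> 1" using component_le_norm_cart[of "T n" i] by linarith
              moreover have "\<bar>v $ i\<bar> \<le> l + 1" using that unfolding mem_cbx by blast
              ultimately show ?thesis by simp
            qed
            thus ?thesis unfolding mem_cbx by blast
          qed
          thus "ennreal (norm (?g v)) * indicator (cbx (l + 1)) v \<le> ennreal (norm (k (v + T n) - k v))"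
            by (auto simp: indicator_def k_def)
        qed
        also have "\<dots> = ennreal (LINT v|lborel. norm (k (v + T n) - k v))"
          using ik integrable_lborel_shift[OF ik] by (intro nn_integral_eq_integral) auto
        finally have "snorm ?g \<le> ennreal (\<epsilon> / 3) + ennreal (LINT v|lborel. norm (k (v + T n) - k v))"
          using order_trans[OF first add_left_mono] by blast
        also have "\<dots> = ennreal (\<epsilon> / 3 + (LINT v|lborel. norm (k (v + T n) - k v)))"
          using e by (intro ennreal_plus[symmetric]) auto
        finally show ?thesis unfolding snorm_dist1[OF sb] using e by (subst (asm) ennreal_le_iff) auto
      qed
      have "(\<lambda>n. LINT v|lborel. norm (k (v + T n) - k v)) \<longlonglongrightarrow> 0" by (rule L1_translation_continuous[OF ik T0])
      from LIMSEQ_D[OF this, of "\<epsilon> / 3"] e obtain n where "norm ((LINT v|lborel. norm (k (v + T n) - k v)) - 0) < \<epsilon> / 3" by auto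
      with le[of n] T(2)[of n] e show False by simp
    qed
  qed
qed

lemma S1ap_sap: assumes f: "S1ap f" shows "sap f"
  unfolding sap_def using S1ap_sbounded[OF f] ap_gauge_dist1[OF f] snorm_dist1[OF S1ap_sbounded[OF f]] by (metis order_refl)

section \<open>Approximation by trigonometric polynomials with exponents in the spectrum\<close>

text \<open>Averaging over the shift \<open>t\<close> reverses the sign of the exponent, so the
  polynomials below carry the negatives of the exponents of the weight.\<close>

lemma mean_translate_ch:
  "mean N 0 (\<lambda>t. f (x + t) * ch l t) = ch (- l) x * mean N x (\<lambda>u. f u * ch l u)"
proof -
  have "f (x + t) * ch l t = ch (- l) x * (f (t + x) * ch l (t + x))" for t
    using ch_mult_minus[of l x] by (simp add: ch_add mult_ac add.commute)
  hence "mean N 0 (\<lambda>t. f (x + t) * ch l t) = mean N 0 (\<lambda>t. ch (- l) x * (f (t + x) * ch l (t + x)))" by simp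
  also have "\<dots> = ch (- l) x * mean N 0 (\<lambda>t. f (t + x) * ch l (t + x))" by (rule mean_cmult)
  also have "mean N 0 (\<lambda>t. f (t + x) * ch l (t + x)) = mean N x (\<lambda>u. f u * ch l u)"
    using mean_shift[of N 0 "\<lambda>u. f u * ch l u" x] by simp
  finally show ?thesis .
qed

lemma has_mean_fc: assumes "sap f" shows "has_mean (\<lambda>u. f u * ch l u) (fc f (- l))"
  unfolding fc_def minus_minus by (intro sap_has_mean sap_mult_bap assms bap_ch)

text \<open>Averaging \<open>f\<close> against the trigonometric polynomial \<open>K\<close> over a large window is uniformly
  close to a trigonometric polynomial whose exponents belong to the spectrum of \<open>f\<close>.\<close>

lemma window_average_trig_poly:
  fixes f :: "real ^ 'm \<Rightarrow> complex" and a :: "real ^ 'm \<Rightarrow> complex"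
  assumes f: "sap f" and fin: "finite \<Lambda>" and e: "e > 0"
  shows "\<forall>\<^sub>F N in at_top. \<forall>x. norm (mean N 0 (\<lambda>t. f (x + t) * (\<Sum>l\<in>\<Lambda>. a l * ch l t)) - (\<Sum>l\<in>\<Lambda>. a l * fc f (- l) * ch (- l) x)) \<le> e"
proof -
  define A where "A = (\<Sum>l\<in>\<Lambda>. norm (a l)) + 1"
  have A: "A > 0" unfolding A_def by (simp add: sum_nonneg add_nonneg_pos)
  have "\<forall>\<^sub>F N in at_top. \<forall>x. norm (mean N x (\<lambda>u. f u * ch l u) - fc f (- l)) < e / A" for l
    using has_mean_fc[OF f, of l] A e unfolding has_mean_def eventually_at_top_linorder by simp
  hence "\<forall>\<^sub>F N in at_top. \<forall>l\<in>\<Lambda>. \<forall>x. norm (mean N x (\<lambda>u. f u * ch l u) - fc f (- l)) < e / A"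
    using fin by (intro eventually_ball_finite) auto
  thus ?thesis
  proof eventually_elim
    case (elim N)
    show ?case
    proof
      fix x
      have sb: "sbounded (\<lambda>t. f (x + t) * ch l t)" for l
        using sap_sbounded[OF f] sbounded_mult[OF sbounded_shift[of f x], of "ch l" 1] by (simp add: add.commute)
      have "mean N 0 (\<lambda>t. f (x + t) * (\<Sum>l\<in>\<Lambda>. a l * ch l t)) = mean N 0 (\<lambda>t. \<Sum>l\<in>\<Lambda>. a l * (f (x + t) * ch l t))"
        by (simp add: sum_distrib_left mult_ac)
      also have "\<dots> = (\<Sum>l\<in>\<Lambda>. a l * (ch (- l) x * mean N x (\<lambda>u. f u * ch l u)))"
        using sb by (subst mean_sum) (auto simp: mean_cmult mean_translate_ch sbounded_cmult)
      finally have "mean N 0 (\<lambda>t. f (x + t) * (\<Sum>l\<in>\<Lambda>. a l * ch l t)) - (\<Sum>l\<in>\<Lambda>. a l * fc f (- l) * ch (- l) x)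
        = (\<Sum>l\<in>\<Lambda>. a l * ch (- l) x * (mean N x (\<lambda>u. f u * ch l u) - fc f (- l)))"
        by (simp add: sum_subtractf[symmetric] algebra_simps)
      also have "norm \<dots> \<le> (\<Sum>l\<in>\<Lambda>. norm (a l) * (e / A))"
      proof (intro order_trans[OF norm_sum] sum_mono)
        fix l assume "l \<in> \<Lambda>"
        hence "norm (mean N x (\<lambda>u. f u * ch l u) - fc f (- l)) \<le> e / A" using elim by (auto intro: less_imp_le)
        thus "norm (a l * ch (- l) x * (mean N x (\<lambda>u. f u * ch l u) - fc f (- l))) \<le> norm (a l) * (e / A)"
          by (simp only: norm_mult norm_ch mult_1_right) (rule mult_left_mono, auto)
      qed
      also have "\<dots> = (\<Sum>l\<in>\<Lambda>. norm (a l)) * (e / A)" by (rule sum_distrib_right[symmetric])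
      also have "\<dots> \<le> A * (e / A)" using A e by (intro mult_right_mono) (auto simp: A_def)
      finally show "norm (mean N 0 (\<lambda>t. f (x + t) * (\<Sum>l\<in>\<Lambda>. a l * ch l t)) - (\<Sum>l\<in>\<Lambda>. a l * fc f (- l) * ch (- l) x)) \<le> e"
        using A by simp
    qed
  qed
qed

text \<open>The difference, times \<open>k\<close>, splits into the normalisation error
  \<open>(k - mean N 0 K) * f x\<close> and an average of \<open>(f (x + t) - f x) * K t\<close>; by
  Minkowski's inequality the latter costs the average of \<open>dist1 f t * norm (K t)\<close>. The
  majorant \<open>w\<close> is required to be Bohr almost periodic so that the limit of its averages
  exists.\<close>

lemma snorm_window_average_le:
  fixes f K :: "real ^ 'm \<Rightarrow> complex"
  assumes f: "sbounded f" and K: "bap K" and N: "N > 0" and k: "k > 0"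
    and S: "snorm f \<le> ennreal S" "S \<ge> 0"
    and w: "\<And>t. 0 \<le> w t" "bap (\<lambda>t. complex_of_real (w t))" "\<And>t. dist1 f t * norm (K t) \<le> w t"
  shows "snorm (\<lambda>x. f x - of_real (inverse k) * mean N 0 (\<lambda>t. f (x + t) * K t)) \<le>
    ennreal (inverse k * (norm (of_real k - mean N 0 K) * S + Re (mean N 0 (\<lambda>t. complex_of_real (w t)))))"
proof -
  interpret U: prob_space "cubem N :: (real ^ 'm) measure" by (rule prob_space_cubem[OF N])
  have [measurable]: "f \<in> borel_measurable borel" "K \<in> borel_measurable borel"
    using f bap_measurable[OF K] by (auto simp: sbounded_def)
  have sbK: "sbounded (\<lambda>t. f (x + t) * K t)" "sbounded K" "sbounded (\<lambda>t. f x * K t)" for x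
  proof -
    obtain B where B: "\<And>x. norm (K x) \<le> B" using K by (rule bapE) blast
    show "sbounded (\<lambda>t. f (x + t) * K t)" 
      using sbounded_mult[OF sbounded_shift[OF f, of x], of K B] B by (simp add: add.commute)
    show "sbounded K" "sbounded (\<lambda>t. f x * K t)" using bap_sbounded[OF K] sbounded_cmult by auto
  qed
  let ?g = "\<lambda>t x. (f (x + t) - f x) * K t"
  have eq: "f x - of_real (inverse k) * mean N 0 (\<lambda>t. f (x + t) * K t) =
     of_real (inverse k) * (of_real k - mean N 0 K) * f x + (- of_real (inverse k)) * (LINT t|cubem N. ?g t x)" for x
  proof -
    have "(LINT t|cubem N. ?g t x) = mean N 0 (\<lambda>t. f (x + t) * K t - f x * K t)"
      using N by (subst mean_eq_integral_cubem) (auto simp: left_diff_distrib)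
    also have "\<dots> = mean N 0 (\<lambda>t. f (x + t) * K t) - f x * mean N 0 K"
      by (simp add: mean_diff[OF sbK(1) sbK(3)] mean_cmult)
    finally have E: "(LINT t|cubem N. ?g t x) = mean N 0 (\<lambda>t. f (x + t) * K t) - f x * mean N 0 K" .
    have alg: "a * (b - m0) * F + (- a) * (m1 - F * m0) = (a * b) * F - a * m1" for a b F m0 m1 :: complex
      by (simp add: algebra_simps)
    have "complex_of_real (inverse k) * of_real k = 1" using k by (simp flip: of_real_mult)
    thus ?thesis unfolding E alg by simp
  qed
  have m1: "(\<lambda>x. LINT t|cubem N. ?g t x) \<in> borel_measurable borel" by measurable
  have c: "snorm (\<lambda>x. of_real (inverse k) * (of_real k - mean N 0 K) * f x) \<le> ennreal (inverse k * (norm (of_real k - mean N 0 K) * S))"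
  proof -
    have "snorm (\<lambda>x. of_real (inverse k) * (of_real k - mean N 0 K) * f x) \<le> ennreal (norm (of_real (inverse k) * (of_real k - mean N 0 K))) * snorm f"
      by (rule snorm_cmult) simp
    also have "\<dots> \<le> ennreal (norm (of_real (inverse k) * (of_real k - mean N 0 K))) * ennreal S" by (intro mult_left_mono S) auto
    also have "\<dots> = ennreal (inverse k * (norm (of_real k - mean N 0 K) * S))"
      using k S(2) by (simp add: norm_mult norm_inverse mult.assoc flip: ennreal_mult)
    finally show ?thesis .
  qed
  have wm: "(\<lambda>t. w t) \<in> borel_measurable borel"
    using borel_measurable_continuous_onI[OF continuous_on_Re] measurable_compose[OF bap_measurable[OF w(2)], of Re borel] by simp
  obtain B where B: "\<And>x. norm (complex_of_real (w x)) \<le> B" using w(2) by (rule bapE) blast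
  have iw: "integrable (cubem N) w" by (rule U.integrable_const_bound[where B=B]) (use B wm in auto)
  have d: "snorm (\<lambda>x. LINT t|cubem N. ?g t x) \<le> ennreal (Re (mean N 0 (\<lambda>t. complex_of_real (w t))))"
  proof -
    have "snorm (\<lambda>x. LINT t|cubem N. ?g t x) \<le> (\<integral>\<^sup>+t. snorm (?g t) \<partial>cubem N)"
      by (rule snorm_integral[OF U.sigma_finite_measure_axioms]) measurable
    also have "\<dots> \<le> (\<integral>\<^sup>+t. ennreal (w t) \<partial>cubem N)"
    proof (rule nn_integral_mono)
      fix t
      have "snorm (?g t) = snorm (\<lambda>x. K t * (f (x + t) - f x))" by (simp add: mult.commute)
      also have "\<dots> \<le> ennreal (norm (K t)) * snorm (\<lambda>x. f (x + t) - f x)" by (rule snorm_cmult) simp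
      also have "\<dots> = ennreal (dist1 f t * norm (K t))"
      proof -
        have "dist1 f t \<ge> 0" by (simp add: dist1_def)
        thus ?thesis unfolding snorm_dist1[OF f] by (simp add: ennreal_mult mult.commute)
      qed
      also have "\<dots> \<le> ennreal (w t)" by (intro ennreal_leI w)
      finally show "snorm (?g t) \<le> ennreal (w t)" .
    qed
    also have "\<dots> = ennreal (LINT t|cubem N. w t)" by (rule nn_integral_eq_integral[OF iw]) (use w in auto)
    also have "(LINT t|cubem N. w t) = Re (mean N 0 (\<lambda>t. complex_of_real (w t)))"
      using N wm by (subst mean_eq_integral_cubem) auto
    finally show ?thesis .
  qed
  have n0: "Re (mean N 0 (\<lambda>t. complex_of_real (w t))) \<ge> 0" by (rule mean_nonneg[OF w(1) N])
  have "snorm (\<lambda>x. f x - of_real (inverse k) * mean N 0 (\<lambda>t. f (x + t) * K t)) \<le>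
     snorm (\<lambda>x. of_real (inverse k) * (of_real k - mean N 0 K) * f x) + snorm (\<lambda>x. (- of_real (inverse k)) * (LINT t|cubem N. ?g t x))"
    unfolding eq using m1 by (intro snorm_triangle) auto
  also have "\<dots> \<le> ennreal (inverse k * (norm (of_real k - mean N 0 K) * S)) + ennreal (inverse k) * ennreal (Re (mean N 0 (\<lambda>t. complex_of_real (w t))))"
  proof (rule add_mono[OF c])
    have "snorm (\<lambda>x. (- of_real (inverse k)) * (LINT t|cubem N. ?g t x)) \<le> ennreal (norm (- complex_of_real (inverse k))) * snorm (\<lambda>x. LINT t|cubem N. ?g t x)"
      by (rule snorm_cmult[OF m1])
    also have "norm (- complex_of_real (inverse k)) = inverse k" using k by (simp add: norm_inverse)
    also have "ennreal (inverse k) * snorm (\<lambda>x. LINT t|cubem N. ?g t x) \<le> ennreal (inverse k) * ennreal (Re (mean N 0 (\<lambda>t. complex_of_real (w t))))"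
      by (rule mult_left_mono[OF d]) simp
    finally show "snorm (\<lambda>x. (- of_real (inverse k)) * (LINT t|cubem N. ?g t x)) \<le> ennreal (inverse k) * ennreal (Re (mean N 0 (\<lambda>t. complex_of_real (w t))))" .
  qed
  also have "\<dots> = ennreal (inverse k * (norm (of_real k - mean N 0 K) * S + Re (mean N 0 (\<lambda>t. complex_of_real (w t)))))"
    using k S(2) n0 by (simp add: distrib_left flip: ennreal_mult ennreal_plus)
  finally show ?thesis .
qed

text \<open>Arithmetic-geometric mean inequality with a free scale \<open>s\<close>: it trades a
  mean of \<open>norm r\<close> for the mean square that Parseval controls.\<close>

lemma real_of_norm_bound:
  fixes s :: real assumes "s > 0" shows "norm z \<le> (s + inverse s * (norm z)\<^sup>2) / 2"
proof -
  have "0 \<le> inverse s * (s - norm z)\<^sup>2" using assms by simp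
  also have "\<dots> = s - 2 * norm z + inverse s * (norm z)\<^sup>2" using assms by (simp add: power2_eq_square field_simps)
  finally show ?thesis by simp
qed

lemma dist1_upper:
  assumes f: "sbounded f" and S: "snorm f \<le> ennreal S" "S \<ge> 0" shows "dist1 f t \<le> 2 * S"
proof -
  have [measurable]: "f \<in> borel_measurable borel" using f by (simp add: sbounded_def)
  have "ennreal (dist1 f t) = snorm (\<lambda>x. f (x + t) + (-1) * f x)" by (simp add: snorm_dist1[OF f, symmetric])
  also have "\<dots> \<le> snorm (\<lambda>x. f (x + t)) + snorm (\<lambda>x. (-1) * f x)" by (rule snorm_triangle) auto
  also have "\<dots> \<le> ennreal S + ennreal S"
    using snorm_cmult[of f "-1"] S by (intro add_mono) (auto simp: snorm_shift intro: order_trans)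
  also have "\<dots> = ennreal (2 * S)" using S by (simp flip: ennreal_plus)
  finally show ?thesis using S by (subst (asm) ennreal_le_iff) auto
qed

text \<open>The partial sum \<open>K\<close> of the weight need not be nonnegative or vanish off the
  almost periods; this costs at most \<open>2 * S\<close> times the mean of the absolute residual,
  which Parseval makes small. Averaging \<open>f\<close> against \<open>K\<close> multiplies the
  coefficients of \<open>f\<close> by those of the weight, so no new exponent can arise. The clauses
  about 0 fix the constant term exactly, as the limit at infinity requires.\<close>

theorem S1ap_approximation:
  fixes f :: "real ^ 'm \<Rightarrow> complex"
  assumes f: "S1ap f" and e: "e > 0"
  obtains \<Lambda> c where "finite \<Lambda>" "\<And>l. l \<in> \<Lambda> \<Longrightarrow> fc f l \<noteq> 0" "fc f 0 \<noteq> 0 \<Longrightarrow> 0 \<in> \<Lambda>" "c 0 = fc f 0"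
    "snorm (\<lambda>x. f x - (\<Sum>l\<in>\<Lambda>. c l * ch l x)) \<le> ennreal e"
proof -
  have fs: "sap f" by (rule S1ap_sap[OF f])
  have sb: "sbounded f" by (rule sap_sbounded[OF fs])
  have fm [measurable]: "f \<in> borel_measurable borel" using sb by (simp add: sbounded_def)
  define S where "S = enn2real (snorm f) + 1"
  have S: "S > 0" "snorm f \<le> ennreal S"
  proof -
    have "snorm f = ennreal (enn2real (snorm f))" using sb by (simp add: sbounded_def)
    also have "\<dots> \<le> ennreal S" unfolding S_def by (intro ennreal_leI) simp
    finally show "snorm f \<le> ennreal S" .
    show "S > 0" by (simp add: S_def add_nonneg_pos)
  qed
  \<comment> \<open>Of the five shares one goes to the normalisation error, three to the mean of the
    majorant \<open>w\<close>, and one to replacing the window average by a trigonometric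
    polynomial.\<close>
  define \<epsilon> where "\<epsilon> = e / 5"
  have eps: "\<epsilon> > 0" using e by (simp add: \<epsilon>_def)
  have G: "ap_gauge (dist1 f)" by (rule ap_gauge_dist1[OF f])
  define D where "D = (\<lambda>t. (1 / \<epsilon>) * dist1 f t)"
  have D: "ap_gauge D" unfolding D_def using eps by (intro ap_gauge_cmult G) auto
  define P where "P = (\<lambda>x. complex_of_real (tent D x))"
  have P: "bap P" unfolding P_def by (rule bap_tent[OF D])
  define k where "k = Re (Mean P)"
  have k: "k > 0" unfolding k_def P_def by (rule Mean_tent_pos[OF D])
  have MP: "Mean P = of_real k"
    unfolding k_def P_def using has_mean_nonneg(1)[OF bap_has_mean[OF bap_tent[OF D]]] tent_nonneg by blast
  \<comment> \<open>If the residual has mean square at most \<open>s\<^sup>2\<close>, the residual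
    part of \<open>w\<close> has mean at most \<open>2 * S * s\<close>, which is
    \<open>\<epsilon> * k\<close>.\<close>
  define s where "s = \<epsilon> * k / (2 * S)"
  have s: "s > 0" using eps k S by (simp add: s_def)
  obtain \<Lambda> where L: "finite \<Lambda>" "0 \<in> \<Lambda>" "Re (Mean (\<lambda>x. residual P \<Lambda> x * cnj (residual P \<Lambda> x))) \<le> s\<^sup>2"
    using tent_parseval[OF D, of "s\<^sup>2"] s unfolding P_def by auto
  define r where "r = residual P \<Lambda>"
  have r: "bap r" unfolding r_def by (rule bap_residual[OF P])
  define K where "K = (\<lambda>t. \<Sum>l\<in>\<Lambda>. fc P l * ch l t)"
  have Kr: "K t = P t - r t" for t by (simp add: K_def r_def residual_def)
  have K: "bap K" unfolding K_def by (intro bap_sum bap_cmult bap_ch)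
  have MK: "Mean K = of_real k"
  proof -
    have "Mean K = (\<Sum>l\<in>\<Lambda>. fc P l * Mean (ch l))"
      unfolding K_def by (subst Mean_sum Mean_cmult; (intro bap_sap bap_cmult bap_ch)?)+ simp
    also have "\<dots> = fc P 0" using L by (simp add: Mean_ch if_distrib cong: if_cong)
    also have "\<dots> = Mean P" by (simp add: fc_def)
    finally show ?thesis using MP by simp
  qed
  \<comment> \<open>The first term majorises \<open>dist1 f t * tent D t\<close>, since the tent
    vanishes where \<open>dist1 f t > \<epsilon>\<close>; the second majorises
    \<open>dist1 f t * norm (r t)\<close> through \<open>dist1 f t \<le> 2 * S\<close>.\<close>
  define w where "w = (\<lambda>t. \<epsilon> * tent D t + 2 * S * ((s + inverse s * (norm (r t))\<^sup>2) / 2))"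
  have w0: "0 \<le> w t" for t unfolding w_def using eps S s tent_nonneg by (intro add_nonneg_nonneg mult_nonneg_nonneg) auto
  define W where "W = (\<lambda>t. complex_of_real \<epsilon> * P t + (complex_of_real (S * s) + complex_of_real (S * inverse s) * (r t * cnj (r t))))"
  have wW: "complex_of_real (w t) = W t" for t
    unfolding w_def W_def P_def complex_norm_square[symmetric] using s by (simp add: field_simps)
  have W: "bap W" unfolding W_def by (intro bap_add bap_cmult bap_const bap_mult bap_cnj P r)
  have wle: "dist1 f t * norm (K t) \<le> w t" for t
  proof -
    have d0: "dist1 f t \<ge> 0" by (simp add: dist1_def)
    have "norm (K t) \<le> tent D t + norm (r t)"
      unfolding Kr P_def using norm_triangle_ineq4[of "complex_of_real (tent D t)" "r t"] tent_nonneg[of D t] by simp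
    hence "dist1 f t * norm (K t) \<le> dist1 f t * tent D t + dist1 f t * norm (r t)"
      using d0 by (metis distrib_left mult_left_mono)
    also have "dist1 f t * tent D t \<le> \<epsilon> * tent D t"
    proof (cases "dist1 f t \<le> \<epsilon>")
      case True thus ?thesis using tent_nonneg by (intro mult_right_mono) auto
    next
      case False
      hence "tent D t = 0" using eps by (simp add: tent_def D_def max_def)
      thus ?thesis by simp
    qed
    also have "dist1 f t * norm (r t) \<le> 2 * S * ((s + inverse s * (norm (r t))\<^sup>2) / 2)"
      using dist1_upper[OF sb S(2)] S real_of_norm_bound[OF s, of "r t"] d0 by (intro mult_mono) auto
    finally show ?thesis by (simp add: w_def)
  qed
  have MW: "Re (Mean W) \<le> 2 * (\<epsilon> * k)"
  proof -
    have "Mean W = complex_of_real \<epsilon> * Mean P + (complex_of_real (S * s) + complex_of_real (S * inverse s) * Mean (\<lambda>t. r t * cnj (r t)))"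
      unfolding W_def using Mean_eqI[OF has_mean_const]
      by (subst Mean_add Mean_cmult; (intro bap_sap bap_add bap_cmult bap_const bap_mult bap_cnj P r)?)+ simp
    also have "\<dots> = complex_of_real (\<epsilon> * k + (S * s + S * inverse s * Re (Mean (\<lambda>t. r t * cnj (r t)))))"
    proof -
      have "Mean (\<lambda>t. r t * cnj (r t)) = complex_of_real (Re (Mean (\<lambda>t. r t * cnj (r t))))"
        by (rule Mean_norm_square_nonneg(1)[OF r])
      thus ?thesis unfolding MP of_real_add of_real_mult by metis
    qed
    finally have "Re (Mean W) = \<epsilon> * k + (S * s + S * inverse s * Re (Mean (\<lambda>t. r t * cnj (r t))))"
      by (simp only: Re_complex_of_real)
    also have "\<dots> \<le> \<epsilon> * k + (S * s + S * inverse s * s\<^sup>2)"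
      using L(3) S s unfolding r_def[symmetric] by (intro add_left_mono mult_left_mono) auto
    also have "\<dots> = 2 * (\<epsilon> * k)" using s S by (simp add: power2_eq_square s_def field_simps)
    finally show ?thesis .
  qed
  let ?Q = "\<lambda>x. of_real (inverse k) * (\<Sum>l\<in>\<Lambda>. fc P l * fc f (- l) * ch (- l) x)"
  have ek: "\<epsilon> * k > 0" using eps k by simp
  have ev1: "\<forall>\<^sub>F N in at_top. \<forall>x. norm (mean N 0 (\<lambda>t. f (x + t) * K t) - (\<Sum>l\<in>\<Lambda>. fc P l * fc f (- l) * ch (- l) x)) \<le> \<epsilon> * k"
    unfolding K_def by (rule window_average_trig_poly[OF fs L(1) ek])
  have "((\<lambda>N. norm (of_real k - mean N 0 K) * S) \<longlongrightarrow> norm (of_real k - Mean K) * S) at_top"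
    by (intro tendsto_intros has_mean_tendsto bap_has_mean K)
  hence ev2: "\<forall>\<^sub>F N in at_top. norm (of_real k - mean N 0 K) * S < \<epsilon> * k"
    using ek by (intro order_tendstoD(2)) (auto simp: MK)
  have "((\<lambda>N. Re (mean N 0 W)) \<longlongrightarrow> Re (Mean W)) at_top" by (intro tendsto_Re has_mean_tendsto bap_has_mean W)
  hence ev3: "\<forall>\<^sub>F N in at_top. Re (mean N 0 W) < 3 * (\<epsilon> * k)"
    using MW ek by (intro order_tendstoD(2)) auto
  have "\<forall>\<^sub>F N in at_top. N > 0 \<and> (\<forall>x. norm (mean N 0 (\<lambda>t. f (x + t) * K t) - (\<Sum>l\<in>\<Lambda>. fc P l * fc f (- l) * ch (- l) x)) \<le> \<epsilon> * k)
      \<and> norm (of_real k - mean N 0 K) * S < \<epsilon> * k \<and> Re (mean N 0 W) < 3 * (\<epsilon> * k)"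
    using ev1 ev2 ev3 eventually_gt_at_top[of 0] by eventually_elim blast
  then obtain N where N: "N > 0" "\<And>x. norm (mean N 0 (\<lambda>t. f (x + t) * K t) - (\<Sum>l\<in>\<Lambda>. fc P l * fc f (- l) * ch (- l) x)) \<le> \<epsilon> * k"
      "norm (of_real k - mean N 0 K) * S < \<epsilon> * k" "Re (mean N 0 W) < 3 * (\<epsilon> * k)"
    using eventually_happens'[OF trivial_limit_at_top_linorder] by blast
  let ?A = "\<lambda>x. of_real (inverse k) * mean N 0 (\<lambda>t. f (x + t) * K t)"
  interpret U: prob_space "cubem N :: (real ^ 'm) measure" by (rule prob_space_cubem[OF N(1)])
  have Am: "?A \<in> borel_measurable borel"
  proof -
    have [measurable]: "K \<in> borel_measurable borel" by (rule bap_measurable[OF K])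
    have "mean N 0 (\<lambda>t. f (x + t) * K t) = (LINT t|cubem N. f (x + t) * K t)" for x
      using N(1) by (intro mean_eq_integral_cubem) auto
    thus ?thesis by (simp only:) measurable
  qed
  have Qm: "?Q \<in> borel_measurable borel" by measurable
  have b1: "snorm (\<lambda>x. f x - ?A x) \<le> ennreal (4 * \<epsilon>)"
  proof -
    have "snorm (\<lambda>x. f x - ?A x) \<le> ennreal (inverse k * (norm (of_real k - mean N 0 K) * S + Re (mean N 0 (\<lambda>t. complex_of_real (w t)))))"
      by (rule snorm_window_average_le[OF sb K N(1) k S(2) _ w0 _ wle]) (use S W wW in auto)
    also have "\<dots> \<le> ennreal (inverse k * (\<epsilon> * k + 3 * (\<epsilon> * k)))"
      unfolding wW using N(3,4) k by (intro ennreal_leI mult_left_mono add_mono) auto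
    also have "inverse k * (\<epsilon> * k + 3 * (\<epsilon> * k)) = 4 * \<epsilon>" using k by (simp add: field_simps)
    finally show ?thesis .
  qed
  have b2: "snorm (\<lambda>x. ?A x - ?Q x) \<le> ennreal \<epsilon>"
  proof (rule snorm_bounded)
    fix x
    have "norm (?A x - ?Q x) = inverse k * norm (mean N 0 (\<lambda>t. f (x + t) * K t) - (\<Sum>l\<in>\<Lambda>. fc P l * fc f (- l) * ch (- l) x))"
      using k by (simp add: norm_mult norm_inverse flip: right_diff_distrib)
    also have "\<dots> \<le> inverse k * (\<epsilon> * k)" using N(2) k by (intro mult_left_mono) auto
    finally show "norm (?A x - ?Q x) \<le> \<epsilon>" using k by (simp add: field_simps)
  qed
  have "snorm (\<lambda>x. (f x - ?A x) + (?A x - ?Q x)) \<le> snorm (\<lambda>x. f x - ?A x) + snorm (\<lambda>x. ?A x - ?Q x)"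
    using Am Qm by (intro snorm_triangle) auto
  also have "\<dots> \<le> ennreal (4 * \<epsilon>) + ennreal \<epsilon>" by (intro add_mono b1 b2)
  also have "\<dots> = ennreal e" using eps by (simp add: \<epsilon>_def flip: ennreal_plus)
  finally have fin: "snorm (\<lambda>x. f x - ?Q x) \<le> ennreal e" by simp
  \<comment> \<open>The sign reversal is undone, and exponents at which \<open>f\<close> has
    coefficient 0 are dropped because their terms vanish.\<close>
  define \<Lambda>' where "\<Lambda>' = {l \<in> uminus ` \<Lambda>. fc f l \<noteq> 0}"
  define c where "c = (\<lambda>l. of_real (inverse k) * fc P (- l) * fc f l)"
  have Qeq: "?Q x = (\<Sum>l\<in>\<Lambda>'. c l * ch l x)" for x
  proof -
    have "?Q x = (\<Sum>l\<in>\<Lambda>. c (- l) * ch (- l) x)" by (simp add: c_def sum_distrib_left mult_ac)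
    also have "\<dots> = (\<Sum>l\<in>uminus ` \<Lambda>. c l * ch l x)" by (subst sum.reindex) (auto simp: inj_on_def)
    also have "\<dots> = (\<Sum>l\<in>\<Lambda>'. c l * ch l x)"
      using L(1) by (intro sum.mono_neutral_right) (auto simp: \<Lambda>'_def c_def)
    finally show ?thesis .
  qed
  show ?thesis
  proof (rule that[of \<Lambda>' c])
    show "finite \<Lambda>'" using L(1) by (simp add: \<Lambda>'_def)
    show "fc f l \<noteq> 0" if "l \<in> \<Lambda>'" for l using that by (simp add: \<Lambda>'_def)
    show "0 \<in> \<Lambda>'" if "fc f 0 \<noteq> 0" using that L(2) by (force simp: \<Lambda>'_def)
    \<comment> \<open>The tent has mean \<open>k\<close>, so the normalised multiplier at the
      exponent 0 equals 1.\<close>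
    have "fc P 0 = of_real k" using MP by (simp add: fc_def)
    thus "c 0 = fc f 0" using k by (simp add: c_def)
    show "snorm (\<lambda>x. f x - (\<Sum>l\<in>\<Lambda>'. c l * ch l x)) \<le> ennreal e" using fin by (simp only: Qeq)
  qed
qed

section \<open>Null sets and Poisson integrals along a direction\<close>

lemma AE_lborel_shift:
  fixes a :: "'a::euclidean_space"
  assumes "AE x in lborel. P x" shows "AE x in lborel. P (x + a)"
proof -
  have "AE x in distr lborel borel ((+) a). P x" unfolding lborel_distr_plus by (rule assms)
  hence "AE x in lborel. P (a + x)" by (rule AE_distrD[rotated]) measurable
  thus ?thesis by (simp add: add.commute)
qed

lemma snorm_mono_AE:
  assumes "AE x in lborel. norm (f x) \<le> norm (g x)" shows "snorm f \<le> snorm g"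
proof (rule snorm_least)
  fix x
  have "AE u in lborel. norm (f (x + u)) \<le> norm (g (x + u))"
    using AE_lborel_shift[OF assms, of x] by (simp add: add.commute)
  hence "(\<integral>\<^sup>+u\<in>ucube. ennreal (norm (f (x + u))) \<partial>lborel) \<le> (\<integral>\<^sup>+u\<in>ucube. ennreal (norm (g (x + u))) \<partial>lborel)"
    by (intro nn_integral_mono_AE) (auto simp: indicator_def intro!: ennreal_leI elim!: eventually_mono)
  also have "\<dots> \<le> snorm g" by (rule snorm_upper)
  finally show "(\<integral>\<^sup>+u\<in>ucube. ennreal (norm (f (x + u))) \<partial>lborel) \<le> snorm g" .
qed

lemma snorm_cong_AE: "AE x in lborel. f x = g x \<Longrightarrow> snorm f = snorm g"
  by (intro antisym snorm_mono_AE) (auto elim!: eventually_mono)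

lemma AE_of_cbx:
  assumes "\<And>n::nat. AE x in lborel. x \<in> cbx (real n) \<longrightarrow> P x" shows "AE x in lborel. P (x :: real ^ 'm)"
proof -
  have "AE x in lborel. \<forall>n::nat. x \<in> cbx (real n) \<longrightarrow> P x" unfolding AE_all_countable using assms by blast
  thus ?thesis
  proof eventually_elim
    case (elim x)
    obtain n :: nat where "norm x \<le> real n" using real_arch_simple by blast
    hence "x \<in> cbx (real n)" unfolding mem_cbx using component_le_norm_cart order_trans by blast
    thus ?case using elim by blast
  qed
qed

lemma snorm_zero_AE:
  fixes g :: "real ^ 'm \<Rightarrow> complex"
  assumes [measurable]: "g \<in> borel_measurable borel" and z: "snorm g = 0" shows "AE x in lborel. g x = 0"
proof (rule AE_of_cbx)
  fix n :: nat
  have "(\<integral>\<^sup>+u\<in>cbx (real n). ennreal (norm (g (u + 0))) \<partial>lborel) \<le> 0"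
    using nn_integral_cbx_le_snorm[of g "real n" 0] z by simp
  hence "AE x in lborel. ennreal (norm (g x)) * indicator (cbx (real n)) x = 0"
    by (subst (asm) le_zero_eq, subst (asm) nn_integral_0_iff_AE) auto
  thus "AE x in lborel. x \<in> cbx (real n) \<longrightarrow> g x = 0" by eventually_elim (auto simp: indicator_def)
qed

text \<open>Multiplying \<open>t\<close> by \<open>y\<close> absorbs the height of the Poisson
  kernel, so one Cauchy law serves all planes and \<open>y = 0\<close> returns \<open>f\<close>
  itself.\<close>

definition poi :: "(real ^ 'm \<Rightarrow> complex) \<Rightarrow> real ^ 'm \<Rightarrow> real ^ 'm \<Rightarrow> complex" where
  "poi f y x = (LINT t|cauchy1. f (x + t *\<^sub>R y))"

lemma borel_measurable_poi_pair:
  fixes f :: "real ^ 'm \<Rightarrow> complex"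
  assumes [measurable]: "f \<in> borel_measurable borel"
  shows "(\<lambda>(t, x). f (x + t *\<^sub>R y)) \<in> borel_measurable (cauchy1 \<Otimes>\<^sub>M borel)"
  by measurable

lemma borel_measurable_poi:
  fixes f :: "real ^ 'm \<Rightarrow> complex"
  assumes [measurable]: "f \<in> borel_measurable borel" shows "poi f y \<in> borel_measurable borel"
proof -
  interpret C: prob_space cauchy1 by (rule prob_space_cauchy1)
  show ?thesis unfolding poi_def[abs_def] by measurable
qed

lemma snorm_poi_le:
  assumes [measurable]: "f \<in> borel_measurable borel" shows "snorm (poi f y) \<le> snorm f"
proof -
  interpret C: prob_space cauchy1 by (rule prob_space_cauchy1)
  have "snorm (poi f y) \<le> (\<integral>\<^sup>+t. snorm (\<lambda>x. f (x + t *\<^sub>R y)) \<partial>cauchy1)"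
    unfolding poi_def[abs_def] 
    by (rule snorm_integral[OF C.sigma_finite_measure_axioms borel_measurable_poi_pair]) measurable
  also have "\<dots> = snorm f" by (simp add: snorm_shift C.emeasure_space_1[simplified])
  finally show ?thesis .
qed

text \<open>The integral of \<open>f\<close> along a single line against the heavy-tailed Cauchy law
  may diverge. Tonelli on each box excludes this for almost every starting point.\<close>

lemma AE_integrable_poi:
  fixes f :: "real ^ 'm \<Rightarrow> complex"
  assumes f: "sbounded f" shows "AE x in lborel. integrable cauchy1 (\<lambda>t. f (x + t *\<^sub>R y))"
proof (rule AE_of_cbx)
  interpret C: prob_space cauchy1 by (rule prob_space_cauchy1)
  interpret P: pair_sigma_finite cauchy1 "lborel :: (real ^ 'm) measure" by standard
  have [measurable]: "f \<in> borel_measurable borel" using f by (simp add: sbounded_def)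
  fix n :: nat
  have "(\<integral>\<^sup>+x. (\<integral>\<^sup>+t. ennreal (norm (f (x + t *\<^sub>R y))) * indicator (cbx (real n)) x \<partial>cauchy1) \<partial>lborel)
     = (\<integral>\<^sup>+t. (\<integral>\<^sup>+x. ennreal (norm (f (x + t *\<^sub>R y))) * indicator (cbx (real n)) x \<partial>lborel) \<partial>cauchy1)"
    by (rule P.Fubini') measurable
  also have "\<dots> \<le> (\<integral>\<^sup>+t. snorm f * ennreal ((2 * (real n + 1)) ^ CARD('m)) \<partial>cauchy1)"
    by (intro nn_integral_mono nn_integral_cbx_le_snorm) auto
  also have "\<dots> < top" using f by (simp add: C.emeasure_space_1[simplified] sbounded_def ennreal_mult_less_top)
  finally have "AE x in lborel. (\<integral>\<^sup>+t. ennreal (norm (f (x + t *\<^sub>R y))) * indicator (cbx (real n)) x \<partial>cauchy1) \<noteq> \<infinity>"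
    by (intro nn_integral_PInf_AE) auto
  thus "AE x in lborel. x \<in> cbx (real n) \<longrightarrow> integrable cauchy1 (\<lambda>t. f (x + t *\<^sub>R y))"
    by eventually_elim (auto simp: integrable_iff_bounded less_top)
qed

text \<open>Additivity may fail on lines where an integral diverges and the Bochner integral is 0 by
  convention, hence the almost everywhere form.\<close>

lemma AE_poi_diff:
  assumes f: "sbounded f" and g: "sbounded g"
  shows "AE x in lborel. poi (\<lambda>x. f x - g x) y x = poi f y x - poi g y x"
  using AE_integrable_poi[OF f, of y] AE_integrable_poi[OF g, of y]
  by eventually_elim (simp add: poi_def)

lemma snorm_poi_diff_le:
  assumes f: "sbounded f" and g: "sbounded g"
  shows "snorm (\<lambda>x. poi f y x - poi g y x) \<le> snorm (\<lambda>x. f x - g x)"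
proof -
  have "snorm (\<lambda>x. poi f y x - poi g y x) = snorm (poi (\<lambda>x. f x - g x) y)"
    by (rule snorm_cong_AE) (use AE_poi_diff[OF f g, of y] in \<open>auto elim!: eventually_mono\<close>)
  also have "\<dots> \<le> snorm (\<lambda>x. f x - g x)"
    using sbounded_diff[OF f g] by (intro snorm_poi_le) (simp add: sbounded_def)
  finally show ?thesis .
qed

lemma poi_zero: "poi f 0 x = f x"
proof -
  interpret C: prob_space cauchy1 by (rule prob_space_cauchy1)
  show ?thesis using C.prob_space by (simp add: poi_def)
qed

section \<open>Trigonometric polynomials on the tube\<close>

definition tpoly :: "(real ^ 'm) set \<Rightarrow> (real ^ 'm \<Rightarrow> complex) \<Rightarrow> complex ^ 'm \<Rightarrow> complex" where
  "tpoly \<Lambda> c z = (\<Sum>l\<in>\<Lambda>. c l * exp (\<i> * cinner z l))"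

text \<open>Exponents and coefficients are hidden so that translates and differences belong to the
  same class, with one bound for all of them.\<close>

definition tp :: "(real ^ 'm) set \<Rightarrow> (complex ^ 'm \<Rightarrow> complex) \<Rightarrow> bool" where
  "tp G Q \<longleftrightarrow> (\<exists>\<Lambda> c. finite \<Lambda> \<and> \<Lambda> \<subseteq> G \<and> Q = tpoly \<Lambda> c)"

lemma cvec_add: "cvec (x + u) (y + v) = cvec x y + cvec u v"
  by (simp add: cvec_def vec_eq_iff complex_eq_iff)

lemma cinner_add: "cinner (z + w) l = cinner z l + cinner w l"
  by (simp add: cinner_def distrib_right sum.distrib)

lemma cinner_cvec: "cinner (cvec x y) l = of_real (l \<bullet> x) + \<i> * of_real (y \<bullet> l)"
  by (simp add: cinner_def cvec_def inner_vec_def complex_eq_iff mult.commute)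

lemma exp_cinner_cvec: "exp (\<i> * cinner (cvec x y) l) = ch l x * exp (- of_real (y \<bullet> l))"
proof -
  have "\<i> * cinner (cvec x y) l = \<i> * of_real (l \<bullet> x) + - of_real (y \<bullet> l)"
    by (simp add: cinner_cvec algebra_simps)
  thus ?thesis by (simp only: ch_def exp_add)
qed

lemma tpoly_cvec: "tpoly \<Lambda> c (cvec x y) = (\<Sum>l\<in>\<Lambda>. c l * exp (- of_real (y \<bullet> l)) * ch l x)"
  by (simp add: tpoly_def exp_cinner_cvec mult_ac)

lemma tp_shift: assumes "tp G Q" shows "tp G (\<lambda>z. Q (z + w))"
proof -
  obtain \<Lambda> c where "finite \<Lambda>" "\<Lambda> \<subseteq> G" "Q = tpoly \<Lambda> c" using assms unfolding tp_def by blast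
  moreover have "tpoly \<Lambda> c (z + w) = tpoly \<Lambda> (\<lambda>l. c l * exp (\<i> * cinner w l)) z" for z
    by (simp add: tpoly_def cinner_add distrib_left exp_add mult_ac)
  ultimately show ?thesis unfolding tp_def by blast
qed

lemma tp_diff: assumes "tp G Q" "tp G Q'" shows "tp G (\<lambda>z. Q z - Q' z)"
proof -
  obtain \<Lambda> c where 1: "finite \<Lambda>" "\<Lambda> \<subseteq> G" "Q = tpoly \<Lambda> c" using assms(1) unfolding tp_def by blast
  obtain \<Lambda>' c' where 2: "finite \<Lambda>'" "\<Lambda>' \<subseteq> G" "Q' = tpoly \<Lambda>' c'" using assms(2) unfolding tp_def by blast
  have "Q z - Q' z = tpoly (\<Lambda> \<union> \<Lambda>') (\<lambda>l. (if l \<in> \<Lambda> then c l else 0) - (if l \<in> \<Lambda>' then c' l else 0)) z" for z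
  proof -
    have "tpoly (\<Lambda> \<union> \<Lambda>') (\<lambda>l. (if l \<in> \<Lambda> then c l else 0) - (if l \<in> \<Lambda>' then c' l else 0)) z =
       (\<Sum>l\<in>\<Lambda> \<union> \<Lambda>'. (if l \<in> \<Lambda> then c l else 0) * exp (\<i> * cinner z l)) - (\<Sum>l\<in>\<Lambda> \<union> \<Lambda>'. (if l \<in> \<Lambda>' then c' l else 0) * exp (\<i> * cinner z l))"
      by (simp add: tpoly_def left_diff_distrib sum_subtractf)
    also have "(\<Sum>l\<in>\<Lambda> \<union> \<Lambda>'. (if l \<in> \<Lambda> then c l else 0) * exp (\<i> * cinner z l)) = tpoly \<Lambda> c z"
      unfolding tpoly_def using 1 2 by (intro sum.mono_neutral_cong_right) auto
    also have "(\<Sum>l\<in>\<Lambda> \<union> \<Lambda>'. (if l \<in> \<Lambda>' then c' l else 0) * exp (\<i> * cinner z l)) = tpoly \<Lambda>' c' z"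
      unfolding tpoly_def using 1 2 by (intro sum.mono_neutral_cong_right) auto
    finally show ?thesis using 1 2 by simp
  qed
  hence "(\<lambda>z. Q z - Q' z) = tpoly (\<Lambda> \<union> \<Lambda>') (\<lambda>l. (if l \<in> \<Lambda> then c l else 0) - (if l \<in> \<Lambda>' then c' l else 0))" by blast
  moreover have "finite (\<Lambda> \<union> \<Lambda>')" "\<Lambda> \<union> \<Lambda>' \<subseteq> G" using 1 2 by auto
  ultimately show ?thesis unfolding tp_def by blast
qed

lemma tp_sbounded: assumes "tp G Q" shows "sbounded (\<lambda>x. Q (cvec x y))" "continuous_on UNIV (\<lambda>x. Q (cvec x y))"
proof -
  obtain \<Lambda> c where 1: "finite \<Lambda>" "\<Lambda> \<subseteq> G" "Q = tpoly \<Lambda> c" using assms(1) unfolding tp_def by blast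
  have "bap (\<lambda>x. Q (cvec x y))" unfolding 1(3) tpoly_cvec by (intro bap_sum bap_cmult bap_ch)
  thus "sbounded (\<lambda>x. Q (cvec x y))" "continuous_on UNIV (\<lambda>x. Q (cvec x y))"
    by (rule bap_sbounded, rule bap_continuous)
qed

text \<open>The Cauchy law damps each exponential by
  \<open>exp (- \<bar>l \<bullet> y'\<bar>)\<close>. This is the factor of the holomorphic
  continuation precisely when \<open>l \<bullet> y' \<ge> 0\<close>, and here the cone condition
  enters.\<close>

lemma tp_poi:
  assumes Q: "tp G Q" and y': "\<And>l. l \<in> G \<Longrightarrow> 0 \<le> y' \<bullet> l"
  shows "Q (cvec x (y + y')) = poi (\<lambda>x. Q (cvec x y)) y' x"
proof -
  interpret C: prob_space cauchy1 by (rule prob_space_cauchy1)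
  obtain \<Lambda> c where 1: "finite \<Lambda>" "\<Lambda> \<subseteq> G" "Q = tpoly \<Lambda> c" using Q unfolding tp_def by blast
  have "poi (\<lambda>x. Q (cvec x y)) y' x = (LINT t|cauchy1. (\<Sum>l\<in>\<Lambda>. c l * exp (- of_real (y \<bullet> l)) * ch l x * exp (\<i> * of_real ((l \<bullet> y') * t))))"
  proof -
    have "ch l (x + t *\<^sub>R y') = ch l x * exp (\<i> * of_real ((l \<bullet> y') * t))" for l t
      by (simp add: ch_def inner_add_right distrib_left exp_add mult_ac)
    thus ?thesis unfolding poi_def 1(3) tpoly_cvec by (simp only: mult.assoc)
  qed
  also have "\<dots> = (\<Sum>l\<in>\<Lambda>. LINT t|cauchy1. c l * exp (- of_real (y \<bullet> l)) * ch l x * exp (\<i> * of_real ((l \<bullet> y') * t)))"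
    by (rule Bochner_Integration.integral_sum)
      (intro integrable_mult_right C.integrable_const_bound[where B=1], auto)
  also have "\<dots> = (\<Sum>l\<in>\<Lambda>. c l * exp (- of_real (y \<bullet> l)) * ch l x * exp (- of_real \<bar>l \<bullet> y'\<bar>))"
    by (simp only: integral_mult_right_zero integral_exp_cauchy1)
  also have "\<dots> = Q (cvec x (y + y'))"
    unfolding 1(3) tpoly_cvec
  proof (rule sum.cong[OF refl])
    fix l assume "l \<in> \<Lambda>"
    hence "\<bar>l \<bullet> y'\<bar> = y' \<bullet> l" using y' 1(2) by (auto simp: inner_commute)
    thus "c l * exp (- of_real (y \<bullet> l)) * ch l x * exp (- of_real \<bar>l \<bullet> y'\<bar>) = c l * exp (- of_real ((y + y') \<bullet> l)) * ch l x"
      by (simp add: inner_add_left exp_diff exp_minus field_simps)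
  qed
  finally show ?thesis by simp
qed

lemma tp_snorm_decreasing:
  assumes Q: "tp G Q" and y': "\<And>l. l \<in> G \<Longrightarrow> 0 \<le> y' \<bullet> l"
  shows "snorm (\<lambda>x. Q (cvec x y')) \<le> snorm (\<lambda>x. Q (cvec x 0))"
proof -
  have "(\<lambda>x. Q (cvec x y')) = poi (\<lambda>x. Q (cvec x 0)) y'" using tp_poi[OF Q y', of _ 0] by simp
  thus ?thesis using snorm_poi_le[of "\<lambda>x. Q (cvec x 0)" y'] tp_sbounded(1)[OF Q, of 0] by (simp add: sbounded_def)
qed

text \<open>One independent Cauchy variable for each direction \<open>Y j\<close>. As every
  \<open>Y j\<close> pairs nonnegatively with the exponents, the absolute values add up to the
  pairing with the sum of the directions.\<close>

lemma tp_cauchyn: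
  fixes Y :: "'m \<Rightarrow> real ^ 'm"
  assumes Q: "tp G Q" and Y: "\<And>l j. l \<in> G \<Longrightarrow> 0 \<le> Y j \<bullet> l"
  shows "Q (cvec x (y + (\<Sum>j\<in>UNIV. Y j))) = (LINT t|cauchyn. Q (cvec (x + (\<Sum>j\<in>UNIV. t $ j *\<^sub>R Y j)) y))"
proof -
  interpret C: prob_space "cauchyn :: (real ^ 'm) measure" by (rule prob_space_cauchyn)
  obtain \<Lambda> c where 1: "finite \<Lambda>" "\<Lambda> \<subseteq> G" "Q = tpoly \<Lambda> c" using Q unfolding tp_def by blast
  have chA: "ch l (\<Sum>j\<in>UNIV. t $ j *\<^sub>R Y j) = exp (\<i> * of_real ((\<chi> j. Y j \<bullet> l) \<bullet> t))" for l t
    by (simp add: ch_def inner_vec_def[of "\<chi> j. Y j \<bullet> l"] inner_sum_right inner_commute[of l] mult.commute)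
  have "(LINT t|cauchyn. Q (cvec (x + (\<Sum>j\<in>UNIV. t $ j *\<^sub>R Y j)) y)) = 
     (LINT t|cauchyn. (\<Sum>l\<in>\<Lambda>. c l * exp (- of_real (y \<bullet> l)) * ch l x * exp (\<i> * of_real ((\<chi> j. Y j \<bullet> l) \<bullet> t))))"
    unfolding 1(3) tpoly_cvec by (simp add: ch_add chA mult.assoc)
  also have "\<dots> = (\<Sum>l\<in>\<Lambda>. LINT t|cauchyn. c l * exp (- of_real (y \<bullet> l)) * ch l x * exp (\<i> * of_real ((\<chi> j. Y j \<bullet> l) \<bullet> t)))"
    by (rule Bochner_Integration.integral_sum)
      (intro integrable_mult_right C.integrable_const_bound[where B=1], auto)
  also have "\<dots> = (\<Sum>l\<in>\<Lambda>. c l * exp (- of_real (y \<bullet> l)) * ch l x * exp (- of_real (\<Sum>j\<in>UNIV. \<bar>(\<chi> j. Y j \<bullet> l) $ j\<bar>)))"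
    by (simp only: integral_mult_right_zero integral_exp_cauchyn)
  also have "\<dots> = Q (cvec x (y + (\<Sum>j\<in>UNIV. Y j)))"
    unfolding 1(3) tpoly_cvec
  proof (rule sum.cong[OF refl])
    fix l assume "l \<in> \<Lambda>"
    hence "(\<Sum>j\<in>UNIV. \<bar>(\<chi> j. Y j \<bullet> l) $ j\<bar>) = (\<Sum>j\<in>UNIV. Y j) \<bullet> l" using Y 1(2) by (auto simp: inner_sum_left)
    thus "c l * exp (- of_real (y \<bullet> l)) * ch l x * exp (- of_real (\<Sum>j\<in>UNIV. \<bar>(\<chi> j. Y j \<bullet> l) $ j\<bar>)) = c l * exp (- of_real ((y + (\<Sum>j\<in>UNIV. Y j)) \<bullet> l)) * ch l x"
      by (simp only: inner_add_left of_real_add minus_add_distrib exp_add mult_ac)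
  qed
  finally show ?thesis by simp
qed

text \<open>Harnack's inequality for the Cauchy kernel converts the pointwise value of the Poisson integral
  into an average over unit cubes.\<close>

lemma norm_cauchyn_integral_le_snorm:
  fixes g :: "real ^ 'm \<Rightarrow> complex" and A B :: "real ^ 'm \<Rightarrow> real ^ 'm"
  assumes [measurable]: "g \<in> borel_measurable borel" and lin: "linear A"
    and AB: "\<And>v. A (B v) = v" and M: "\<And>v j. v \<in> ucube \<Longrightarrow> \<bar>B v $ j\<bar> \<le> M"
  shows "ennreal (norm (LINT t|cauchyn. g (x + A t))) \<le> ennreal ((2 + 2 * M\<^sup>2) ^ CARD('m)) * snorm g"
proof -
  interpret C: prob_space "cauchyn :: (real ^ 'm) measure" by (rule prob_space_cauchyn)
  let ?C = "ennreal ((2 + 2 * M\<^sup>2) ^ CARD('m))"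
  let ?u = "ucube :: (real ^ 'm) set"
  have [measurable]: "A \<in> borel_measurable borel" 
    using lin by (intro borel_measurable_continuous_onI linear_continuous_on) (simp add: linear_conv_bounded_linear)
  define I where "I = (\<integral>\<^sup>+t. ennreal (cauchy_prod t) * ennreal (norm (g (x + A t))) \<partial>lborel)"
  have "ennreal (norm (LINT t|cauchyn. g (x + A t))) \<le> (\<integral>\<^sup>+t. ennreal (norm (g (x + A t))) \<partial>cauchyn)"
  proof (cases "integrable cauchyn (\<lambda>t. g (x + A t))")
    case True thus ?thesis by (rule integral_norm_bound_ennreal)
  qed (simp add: not_integrable_integral_eq)
  also have "\<dots> = I" unfolding I_def cauchyn_def by (subst nn_integral_density) auto
  also have "I = (\<integral>\<^sup>+v. I * indicator ?u v \<partial>lborel)" by (subst nn_integral_cmult_indicator) auto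
  also have "\<dots> \<le> (\<integral>\<^sup>+v. (\<integral>\<^sup>+t. ?C * (ennreal (cauchy_prod t) * (ennreal (norm (g (x + A t + v))) * indicator ?u v)) \<partial>lborel) \<partial>lborel)"
  proof (rule nn_integral_mono)
    fix v :: "real ^ 'm"
    have "I \<le> (\<integral>\<^sup>+t. ?C * (ennreal (cauchy_prod t) * ennreal (norm (g (x + A t + v)))) \<partial>lborel)" if v: "v \<in> ?u"
    proof -
      have "I \<le> (\<integral>\<^sup>+t. ?C * (ennreal (cauchy_prod (t - B v)) * ennreal (norm (g (x + A t)))) \<partial>lborel)"
        unfolding I_def
      proof (rule nn_integral_mono)
        fix t
        have "ennreal (cauchy_prod t) \<le> ?C * ennreal (cauchy_prod (t - B v))"
          using cauchy_prod_harnack[of "B v" M t] M[OF v] by (simp add: ennreal_leI flip: ennreal_mult)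
        thus "ennreal (cauchy_prod t) * ennreal (norm (g (x + A t))) \<le> ?C * (ennreal (cauchy_prod (t - B v)) * ennreal (norm (g (x + A t))))"
          by (simp only: mult.assoc[symmetric]) (rule mult_right_mono, auto)
      qed
      also have "\<dots> = (\<integral>\<^sup>+t. ?C * (ennreal (cauchy_prod (t + B v - B v)) * ennreal (norm (g (x + A (t + B v))))) \<partial>lborel)"
        by (rule nn_integral_lborel_shift[symmetric]) measurable
      also have "\<dots> = (\<integral>\<^sup>+t. ?C * (ennreal (cauchy_prod t) * ennreal (norm (g (x + A t + v)))) \<partial>lborel)"
        using linear_add[OF lin] by (simp add: AB add.assoc)
      finally show ?thesis .
    qed
    thus "I * indicator ?u v \<le> (\<integral>\<^sup>+t. ?C * (ennreal (cauchy_prod t) * (ennreal (norm (g (x + A t + v))) * indicator ?u v)) \<partial>lborel)"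
      by (auto simp: indicator_def)
  qed
  also have "\<dots> = (\<integral>\<^sup>+t. (\<integral>\<^sup>+v. ?C * (ennreal (cauchy_prod t) * (ennreal (norm (g (x + A t + v))) * indicator ?u v)) \<partial>lborel) \<partial>lborel)"
    by (rule lborel_pair.Fubini') measurable
  also have "\<dots> = (\<integral>\<^sup>+t. ?C * (ennreal (cauchy_prod t) * (\<integral>\<^sup>+v\<in>?u. ennreal (norm (g (x + A t + v))) \<partial>lborel)) \<partial>lborel)"
    by (simp add: nn_integral_cmult)
  also have "\<dots> \<le> (\<integral>\<^sup>+t. ?C * (ennreal (cauchy_prod t) * snorm g) \<partial>(lborel :: (real ^ 'm) measure))"
    by (intro nn_integral_mono mult_left_mono snorm_upper) auto
  also have "\<dots> = ?C * ((\<integral>\<^sup>+t. ennreal (cauchy_prod t) \<partial>(lborel :: (real ^ 'm) measure)) * snorm g)"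
    by (simp add: nn_integral_cmult nn_integral_multc)
  also have "(\<integral>\<^sup>+t. ennreal (cauchy_prod t) \<partial>(lborel :: (real ^ 'm) measure)) = 1"
    by (subst nn_integral_eq_integral) (auto simp: integrable_cauchy_prod integral_cauchy_prod)
  finally show ?thesis by simp
qed

section \<open>The dual cone and the uniform bound in the interior of the tube\<close>

lemma dual_cone_add: "x \<in> dual_cone G \<Longrightarrow> y \<in> dual_cone G \<Longrightarrow> x + y \<in> dual_cone G"
  by (simp add: dual_cone_def inner_add_left)

lemma dual_cone_scaleR: "c \<ge> 0 \<Longrightarrow> x \<in> dual_cone G \<Longrightarrow> c *\<^sub>R x \<in> dual_cone G"
  by (simp add: dual_cone_def)

lemma dual_cone_inner: "y \<in> dual_cone G \<Longrightarrow> l \<in> G \<Longrightarrow> 0 \<le> y \<bullet> l"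
  by (simp add: dual_cone_def)

text \<open>All directions \<open>\<beta> + \<delta> *\<^sub>R axis j 1\<close> are small
  perturbations of one multiple of \<open>b\<close>, hence in the cone. The two inequations say that
  the rank-one perturbation \<open>t \<mapsto> (\<Sum>i\<in>UNIV. t $ i) *\<^sub>R \<beta> +
  \<delta> *\<^sub>R t\<close> is invertible, so the directions form a basis. Their sum is close to
  \<open>b / 2\<close>, and the rest of \<open>b\<close> stays in the cone.\<close>

lemma dual_cone_frame:
  fixes b :: "real ^ 'm"
  assumes "b \<in> interior (dual_cone G)"
  obtains \<beta> :: "real ^ 'm" and \<delta> where "\<delta> \<noteq> 0" "\<delta> + (\<Sum>i\<in>UNIV. \<beta> $ i) \<noteq> 0" "\<And>j. \<beta> + \<delta> *\<^sub>R axis j 1 \<in> dual_cone G"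
    "b - (\<Sum>j\<in>UNIV. \<beta> + \<delta> *\<^sub>R axis j 1) \<in> dual_cone G"
proof -
  let ?K = "dual_cone G" and ?m = "real CARD('m)"
  obtain \<rho> where \<rho>: "\<rho> > 0" "ball b \<rho> \<subseteq> ?K" using assms mem_interior by blast
  have m: "?m > 0" by simp
  define \<beta> where "\<beta> = (1 / (2 * ?m)) *\<^sub>R b"
  \<comment> \<open>Giving \<open>\<delta>\<close> the sign of the coordinate sum of
    \<open>\<beta>\<close> prevents cancellation. Its size keeps both perturbations of
    \<open>b\<close>, by \<open>2 * ?m * \<delta>\<close> along one axis and by
    \<open>2 * \<delta>\<close> along the sum of all axes, within \<open>\<rho> / 2\<close>.\<close>
  define \<delta> where "\<delta> = (if (\<Sum>i\<in>UNIV. \<beta> $ i) \<ge> 0 then \<rho> / (4 * ?m) else - \<rho> / (4 * ?m))"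
  have pos: "\<rho> / (4 * ?m) > 0" using \<rho> m by simp
  have d: "\<bar>\<delta>\<bar> = \<rho> / (4 * ?m)" using pos by (auto simp: \<delta>_def abs_if)
  show ?thesis
  proof (rule that)
    show "\<delta> \<noteq> 0" using pos d by auto
    show "\<delta> + (\<Sum>i\<in>UNIV. \<beta> $ i) \<noteq> 0" using pos by (auto simp: \<delta>_def)
    show "\<beta> + \<delta> *\<^sub>R axis j 1 \<in> ?K" for j
    proof -
      have "norm ((2 * ?m * \<delta>) *\<^sub>R (axis j 1 :: real ^ 'm)) = \<rho> / 2" using d m by (simp add: abs_mult)
      hence "b + (2 * ?m * \<delta>) *\<^sub>R axis j 1 \<in> ball b \<rho>" using \<rho>(1) by (simp add: dist_norm)
      hence "(1 / (2 * ?m)) *\<^sub>R (b + (2 * ?m * \<delta>) *\<^sub>R axis j 1) \<in> ?K" using \<rho>(2) by (intro dual_cone_scaleR) auto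
      thus ?thesis using m by (simp add: \<beta>_def scaleR_add_right)
    qed
    let ?one = "\<Sum>j\<in>UNIV. axis j 1 :: real ^ 'm"
    have "norm ?one \<le> (\<Sum>j\<in>(UNIV::'m set). 1)" by (rule order_trans[OF norm_sum]) simp
    hence "norm ((2 * \<delta>) *\<^sub>R ?one) \<le> 2 * \<bar>\<delta>\<bar> * ?m" by (simp add: mult_left_mono abs_mult)
    also have "\<dots> = \<rho> / 2" using d m by simp
    finally have "b - (2 * \<delta>) *\<^sub>R ?one \<in> ball b \<rho>" using \<rho>(1) by (simp add: dist_norm)
    hence "(1 / 2) *\<^sub>R (b - (2 * \<delta>) *\<^sub>R ?one) \<in> ?K" using \<rho>(2) by (intro dual_cone_scaleR) auto
    moreover have "b - (\<Sum>j\<in>UNIV. \<beta> + \<delta> *\<^sub>R axis j 1) = (1 / 2) *\<^sub>R (b - (2 * \<delta>) *\<^sub>R ?one)"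
    proof -
      have "(\<Sum>j\<in>(UNIV::'m set). \<beta> + \<delta> *\<^sub>R axis j 1) = ?m *\<^sub>R \<beta> + \<delta> *\<^sub>R ?one"
        by (simp add: sum.distrib scaleR_sum_right sum_constant_scaleR del: sum_constant)
      also have "?m *\<^sub>R \<beta> = (1 / 2) *\<^sub>R b" using m by (simp add: \<beta>_def)
      finally have "b - (\<Sum>j\<in>UNIV. \<beta> + \<delta> *\<^sub>R axis j 1) = b - ((1 / 2) *\<^sub>R b + \<delta> *\<^sub>R ?one)" by simp
      also have "\<dots> = (1 / 2) *\<^sub>R (b - (2 * \<delta>) *\<^sub>R ?one)" by (simp add: vec_eq_iff field_simps)
      finally show ?thesis .
    qed
    ultimately show "b - (\<Sum>j\<in>UNIV. \<beta> + \<delta> *\<^sub>R axis j 1) \<in> ?K" by simp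
  qed
qed

text \<open>Subtracting the basis directions from \<open>y\<close> leaves a point \<open>y'\<close>
  of the cone. The value over \<open>y\<close> is a full-dimensional Cauchy average over the plane
  at \<open>y'\<close>, to which Harnack's inequality applies, and the Stepanoff norm on that plane
  is at most the one on the real plane. The constant depends on \<open>b\<close> and the cone, not
  on the polynomial.\<close>

lemma tp_sup_bound:
  fixes b :: "real ^ 'm"
  assumes b: "b \<in> interior (dual_cone G)"
  obtains C where "C \<ge> 0" "\<And>Q x y. tp G Q \<Longrightarrow> y - b \<in> dual_cone G \<Longrightarrow> ennreal (norm (Q (cvec x y))) \<le> ennreal C * snorm (\<lambda>x. Q (cvec x 0))"
proof -
  let ?K = "dual_cone G"
  obtain \<beta> :: "real ^ 'm" and \<delta> where fr: "\<delta> \<noteq> 0" "\<delta> + (\<Sum>i\<in>UNIV. \<beta> $ i) \<noteq> 0" "\<And>j. \<beta> + \<delta> *\<^sub>R axis j 1 \<in> ?K"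
    "b - (\<Sum>j\<in>UNIV. \<beta> + \<delta> *\<^sub>R axis j 1) \<in> ?K" using dual_cone_frame[OF b] by blast
  define Y where "Y = (\<lambda>j. \<beta> + \<delta> *\<^sub>R axis j (1::real))"
  define A where "A = (\<lambda>t::real^'m. \<Sum>j\<in>UNIV. t $ j *\<^sub>R Y j)"
  have A: "A t = (\<Sum>j\<in>UNIV. t $ j) *\<^sub>R \<beta> + \<delta> *\<^sub>R t" for t
  proof -
    have "t = (\<Sum>j\<in>UNIV. t $ j *\<^sub>R axis j 1)" by (simp add: vec_eq_iff axis_def if_distrib cong: if_cong)
    hence "\<delta> *\<^sub>R t = (\<Sum>j\<in>UNIV. t $ j *\<^sub>R \<delta> *\<^sub>R axis j 1)" by (metis (no_types, lifting) scaleR_left_commute scaleR_sum_right sum.cong)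
    thus ?thesis by (simp add: A_def Y_def scaleR_add_right sum.distrib scaleR_sum_left)
  qed
  have lin: "linear A" unfolding A_def
    by (intro linear_compose_sum ballI) (simp add: linear_iff scaleR_left.add)
  \<comment> \<open>\<open>T v\<close> is the coordinate sum of the preimage \<open>B v\<close>; it
    is found by adding up the coordinates of the equation \<open>A (B v) = v\<close>.\<close>
  define T where "T = (\<lambda>v::real^'m. (\<Sum>i\<in>UNIV. v $ i) / (\<delta> + (\<Sum>i\<in>UNIV. \<beta> $ i)))"
  define B where "B = (\<lambda>v. (1 / \<delta>) *\<^sub>R (v - T v *\<^sub>R \<beta>))"
  have AB: "A (B v) = v" for v
  proof -
    have "(\<Sum>j\<in>UNIV. B v $ j) = ((\<Sum>i\<in>UNIV. v $ i) - T v * (\<Sum>i\<in>UNIV. \<beta> $ i)) / \<delta>"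
      by (simp add: B_def sum_subtractf sum_distrib_left flip: sum_divide_distrib)
    also have "(\<Sum>i\<in>UNIV. v $ i) = T v * (\<delta> + (\<Sum>i\<in>UNIV. \<beta> $ i))" using fr(2) by (simp add: T_def)
    also have "(T v * (\<delta> + (\<Sum>i\<in>UNIV. \<beta> $ i)) - T v * (\<Sum>i\<in>UNIV. \<beta> $ i)) / \<delta> = T v" using fr(1) by (simp add: field_simps)
    finally have s: "(\<Sum>j\<in>UNIV. B v $ j) = T v" .
    show ?thesis unfolding A s using fr(1) by (simp add: B_def)
  qed
  define M where "M = (1 / \<bar>\<delta>\<bar>) * (1 + (CARD('m) / \<bar>\<delta> + (\<Sum>i\<in>UNIV. \<beta> $ i)\<bar>) * norm \<beta>)"
  have M: "\<bar>B v $ j\<bar> \<le> M" if v: "v \<in> ucube" for v j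
  proof -
    have v01: "0 \<le> v $ i \<and> v $ i \<le> 1" for i using v by (auto simp: mem_box_cart)
    have "\<bar>\<Sum>i\<in>UNIV. v $ i\<bar> \<le> (\<Sum>i\<in>(UNIV::'m set). 1)"
      by (rule order_trans[OF sum_abs]) (intro sum_mono, use v01 in auto)
    hence "\<bar>T v\<bar> \<le> CARD('m) / \<bar>\<delta> + (\<Sum>i\<in>UNIV. \<beta> $ i)\<bar>" by (simp add: T_def divide_right_mono)
    hence "\<bar>T v\<bar> * \<bar>\<beta> $ j\<bar> \<le> (CARD('m) / \<bar>\<delta> + (\<Sum>i\<in>UNIV. \<beta> $ i)\<bar>) * norm \<beta>"
      by (intro mult_mono component_le_norm_cart) auto
    moreover have "\<bar>v $ j - T v * \<beta> $ j\<bar> \<le> 1 + \<bar>T v\<bar> * \<bar>\<beta> $ j\<bar>"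
      using v01[of j] abs_triangle_ineq4[of "v $ j" "T v * \<beta> $ j"] by (simp add: abs_mult)
    ultimately have "\<bar>v $ j - T v * \<beta> $ j\<bar> \<le> 1 + (CARD('m) / \<bar>\<delta> + (\<Sum>i\<in>UNIV. \<beta> $ i)\<bar>) * norm \<beta>" by linarith
    hence "(1 / \<bar>\<delta>\<bar>) * \<bar>v $ j - T v * \<beta> $ j\<bar> \<le> M" unfolding M_def by (intro mult_left_mono) auto
    thus ?thesis by (simp add: B_def abs_mult)
  qed
  show ?thesis
  proof (rule that)
    fix Q x and y :: "real ^ 'm" assume Q: "tp G Q" and y: "y - b \<in> ?K"
    define y' where "y' = y - (\<Sum>j\<in>UNIV. Y j)"
    have y': "y' \<in> ?K" using dual_cone_add[OF y fr(4)] by (simp add: y'_def Y_def)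
    have gm: "(\<lambda>x. Q (cvec x y')) \<in> borel_measurable borel" using tp_sbounded(1)[OF Q] by (simp add: sbounded_def)
    have "Q (cvec x (y' + (\<Sum>j\<in>UNIV. Y j))) = (LINT t|cauchyn. Q (cvec (x + A t) y'))"
      unfolding A_def by (rule tp_cauchyn[OF Q]) (use fr(3) dual_cone_inner in \<open>auto simp: Y_def\<close>)
    hence "ennreal (norm (Q (cvec x y))) = ennreal (norm (LINT t|cauchyn. Q (cvec (x + A t) y')))" by (simp add: y'_def)
    also have "\<dots> \<le> ennreal ((2 + 2 * M\<^sup>2) ^ CARD('m)) * snorm (\<lambda>x. Q (cvec x y'))"
      by (rule norm_cauchyn_integral_le_snorm[OF gm lin AB M])
    also have "\<dots> \<le> ennreal ((2 + 2 * M\<^sup>2) ^ CARD('m)) * snorm (\<lambda>x. Q (cvec x 0))"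
      by (intro mult_left_mono tp_snorm_decreasing[OF Q] dual_cone_inner[OF y']) auto
    finally show "ennreal (norm (Q (cvec x y))) \<le> ennreal ((2 + 2 * M\<^sup>2) ^ CARD('m)) * snorm (\<lambda>x. Q (cvec x 0))" .
  qed simp
qed

section \<open>Locally uniform limits of holomorphic functions of several variables\<close>

definition has_gradient :: "(complex ^ 'm \<Rightarrow> complex) \<Rightarrow> complex ^ 'm \<Rightarrow> complex ^ 'm \<Rightarrow> bool" where
  "has_gradient Q c z \<longleftrightarrow> (Q has_derivative (\<lambda>h. \<Sum>i\<in>UNIV. c $ i * h $ i)) (at z)"

lemma bounded_linear_cinner: "bounded_linear (\<lambda>z. cinner z l)"
  unfolding cinner_def
  by (intro bounded_linear_sum bounded_linear_mult_const bounded_linear_vec_nth)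

lemma tp_has_gradient: assumes "tp G Q" shows "\<exists>g. \<forall>z. has_gradient Q (g z) z"
proof -
  obtain \<Lambda> c where 1: "finite \<Lambda>" "\<Lambda> \<subseteq> G" "Q = tpoly \<Lambda> c" using assms unfolding tp_def by blast
  define g where "g = (\<lambda>z::complex^'a. \<chi> i. \<Sum>l\<in>\<Lambda>. c l * (exp (\<i> * cinner z l) * (\<i> * of_real (l $ i))))"
  have "has_gradient Q (g z) z" for z
  proof -
    have "((\<lambda>z. cinner z l) has_derivative (\<lambda>h. cinner h l)) (at z)" for l
      by (rule bounded_linear_imp_has_derivative[OF bounded_linear_cinner])
    hence "((\<lambda>z. \<i> * cinner z l) has_derivative (\<lambda>h. \<i> * cinner h l)) (at z)" for l
      by (rule has_derivative_mult_right)
    hence "((\<lambda>z. exp (\<i> * cinner z l)) has_derivative (\<lambda>h. exp (\<i> * cinner z l) * (\<i> * cinner h l))) (at z)" for l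
      by (rule has_derivative_compose[OF _ DERIV_exp[unfolded has_field_derivative_def]])
    hence "(tpoly \<Lambda> c has_derivative (\<lambda>h. \<Sum>l\<in>\<Lambda>. c l * (exp (\<i> * cinner z l) * (\<i> * cinner h l)))) (at z)"
      unfolding tpoly_def by (intro has_derivative_sum has_derivative_mult_right)
    moreover have "(\<Sum>l\<in>\<Lambda>. c l * (exp (\<i> * cinner z l) * (\<i> * cinner h l))) = (\<Sum>i\<in>UNIV. g z $ i * h $ i)" for h
    proof -
      have "(\<Sum>i\<in>UNIV. g z $ i * h $ i) = (\<Sum>i\<in>UNIV. \<Sum>l\<in>\<Lambda>. c l * (exp (\<i> * cinner z l) * (\<i> * of_real (l $ i))) * h $ i)"
        by (simp add: g_def sum_distrib_right)
      also have "\<dots> = (\<Sum>l\<in>\<Lambda>. \<Sum>i\<in>UNIV. c l * (exp (\<i> * cinner z l) * (\<i> * of_real (l $ i))) * h $ i)" by (rule sum.swap)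
      also have "\<dots> = (\<Sum>l\<in>\<Lambda>. c l * (exp (\<i> * cinner z l) * (\<i> * cinner h l)))"
        by (simp add: cinner_def[of h] sum_distrib_left mult_ac)
      finally show ?thesis by simp
    qed
    ultimately show ?thesis unfolding has_gradient_def 1(3) by simp
  qed
  thus ?thesis by blast
qed

lemma linear_axis: "bounded_linear (axis i :: complex \<Rightarrow> complex ^ 'm)"
  unfolding linear_conv_bounded_linear[symmetric]
  by (auto simp: linear_iff vec_eq_iff axis_def)

text \<open>Cauchy's inequality for the one-variable function obtained by moving coordinate
  \<open>i\<close> alone.\<close>

lemma gradient_bound:
  fixes Q :: "complex ^ 'm \<Rightarrow> complex" and g :: "complex ^ 'm \<Rightarrow> complex ^ 'm"
  assumes g: "\<And>z. has_gradient Q (g z) z" and \<rho>: "\<rho> > 0"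
    and B: "\<And>\<zeta>. norm \<zeta> = \<rho> \<Longrightarrow> norm (Q (z + axis i \<zeta>)) \<le> B"
  shows "norm (g z $ i) \<le> B / \<rho>"
proof -
  define \<phi> where "\<phi> = (\<lambda>\<zeta>. Q (z + axis i \<zeta>))"
  have d: "(\<phi> has_field_derivative g (z + axis i \<zeta>) $ i) (at \<zeta>)" for \<zeta>
  proof -
    have 1: "((\<lambda>\<zeta>. z + axis i \<zeta>) has_derivative (\<lambda>h. axis i h)) (at \<zeta>)"
      by (auto intro!: derivative_eq_intros bounded_linear_imp_has_derivative linear_axis)
    have "(\<phi> has_derivative (\<lambda>h. \<Sum>j\<in>UNIV. g (z + axis i \<zeta>) $ j * axis i h $ j)) (at \<zeta>)"
      unfolding \<phi>_def by (rule has_derivative_compose[OF 1 g[unfolded has_gradient_def]])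
    moreover have "(\<Sum>j\<in>UNIV. g (z + axis i \<zeta>) $ j * axis i h $ j) = g (z + axis i \<zeta>) $ i * h" for h
      by (simp add: axis_def if_distrib cong: if_cong)
    ultimately show ?thesis by (simp add: has_field_derivative_def)
  qed
  have hol: "\<phi> holomorphic_on UNIV" using d by (auto simp: holomorphic_on_open)
  have "norm ((deriv ^^ 1) \<phi> 0) \<le> fact 1 * B / \<rho> ^ 1"
  proof (rule Cauchy_inequality)
    show "\<phi> holomorphic_on ball 0 \<rho>" "continuous_on (cball 0 \<rho>) \<phi>"
      using hol by (auto intro: holomorphic_on_subset holomorphic_on_imp_continuous_on)
    show "norm (\<phi> x) \<le> B" if "norm (0 - x) = \<rho>" for x using B that by (simp add: \<phi>_def)
  qed fact
  moreover have "deriv \<phi> 0 = g (z + axis i 0) $ i" by (rule DERIV_imp_deriv[OF d])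
  moreover have "axis i 0 = (0 :: complex ^ 'm)" by (simp add: vec_eq_iff axis_def)
  ultimately show ?thesis by simp
qed

lemma has_gradient_diff: "has_gradient P p z \<Longrightarrow> has_gradient Q q z \<Longrightarrow> has_gradient (\<lambda>z. P z - Q z) (p - q) z"
  unfolding has_gradient_def 
  using has_derivative_diff[of P "\<lambda>h. \<Sum>i\<in>UNIV. p $ i * h $ i" "at z" Q "\<lambda>h. \<Sum>i\<in>UNIV. q $ i * h $ i"]
  by (simp add: left_diff_distrib sum_subtractf)

lemma Im_v_add: "Im_v (z + w) = Im_v z + Im_v w" by (simp add: Im_v_def vec_eq_iff)
lemma Im_v_cvec [simp]: "Im_v (cvec x y) = y" by (simp add: Im_v_def cvec_def vec_eq_iff)

lemma norm_Im_v_axis: "norm (Im_v (axis i \<zeta>)) \<le> norm \<zeta>"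
proof -
  have "Im_v (axis i \<zeta>) = Im \<zeta> *\<^sub>R axis i 1" by (simp add: Im_v_def axis_def vec_eq_iff)
  thus ?thesis using abs_Im_le_cmod[of \<zeta>] by simp
qed

lemma bounded_linear_Im_v: "bounded_linear Im_v"
  unfolding linear_conv_bounded_linear[symmetric] by (auto simp: linear_iff Im_v_def vec_eq_iff)

text \<open>Cauchy's estimate turns uniform closeness of the functions over the larger ball into
  uniform closeness of their gradients over the smaller one; the gap between
  \<open>2 * \<rho>\<close> and \<open>\<rho>\<close> makes room for discs of radius
  \<open>\<rho>\<close>. The theorem on differentiating sequences then passes to the limit.\<close>

lemma holo_limit:
  fixes Q :: "nat \<Rightarrow> complex ^ 'm \<Rightarrow> complex"
  assumes grad: "\<And>k. \<exists>g. \<forall>z. has_gradient (Q k) (g z) z" and \<rho>: "\<rho> > 0" and e: "e \<longlonglongrightarrow> (0::real)"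
    and cauchy: "\<And>k n z. Im_v z \<in> ball y0 (2 * \<rho>) \<Longrightarrow> norm (Q k z - Q n z) \<le> e k + e n"
    and lim: "\<And>z. Im_v z \<in> ball y0 \<rho> \<Longrightarrow> (\<lambda>k. Q k z) \<longlonglongrightarrow> F z"
    and z0: "Im_v z0 = y0"
  shows "\<exists>c. has_gradient F c z0"
proof -
  obtain g :: "nat \<Rightarrow> complex ^ 'm \<Rightarrow> complex ^ 'm" where g: "\<And>k z. has_gradient (Q k) (g k z) z" using grad by metis
  define U where "U = Im_v -` ball y0 \<rho>"
  have U: "open U" "convex U" "z0 \<in> U"
  proof -
    have "linear Im_v" using bounded_linear_Im_v by (simp add: linear_conv_bounded_linear)
    thus "convex U" unfolding U_def by (rule convex_linear_vimage) simp
    show "open U" unfolding U_def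
      by (rule open_vimage[OF open_ball linear_continuous_on[OF bounded_linear_Im_v]])
    show "z0 \<in> U" using z0 \<rho> by (simp add: U_def)
  qed
  have gb: "norm (g k z $ i - g n z $ i) \<le> (e k + e n) / \<rho>" if z: "z \<in> U" for k n z i
  proof -
    have "norm ((g k z - g n z) $ i) \<le> (e k + e n) / \<rho>"
    proof (rule gradient_bound[OF has_gradient_diff[OF g g] \<rho>])
      fix \<zeta> :: complex assume "norm \<zeta> = \<rho>"
      hence "norm (Im_v (axis i \<zeta> :: complex ^ 'm)) \<le> \<rho>" using norm_Im_v_axis[of i \<zeta>] by simp
      hence "Im_v (z + axis i \<zeta>) \<in> ball y0 (2 * \<rho>)"
        using z norm_triangle_ineq4[of "y0 - Im_v z" "Im_v (axis i \<zeta>)"]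
        by (simp add: U_def dist_norm Im_v_add diff_diff_eq)
      thus "norm (Q k (z + axis i \<zeta>) - Q n (z + axis i \<zeta>)) \<le> e k + e n" by (rule cauchy)
    qed
    thus ?thesis by simp
  qed
  define \<gamma> where "\<gamma> = (\<lambda>z. \<chi> i. lim (\<lambda>k. g k z $ i))"
  have gl: "(\<lambda>k. g k z $ i) \<longlonglongrightarrow> \<gamma> z $ i" if z: "z \<in> U" for z i
  proof -
    have "Cauchy (\<lambda>k. g k z $ i)"
    proof (rule metric_CauchyI)
      fix \<epsilon> :: real assume "\<epsilon> > 0"
      hence "\<epsilon> * \<rho> / 2 > 0" using \<rho> by simp
      then obtain n0 where n0: "\<And>n. n \<ge> n0 \<Longrightarrow> norm (e n - 0) < \<epsilon> * \<rho> / 2" using LIMSEQ_D[OF e] by blast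
      show "\<exists>M. \<forall>m\<ge>M. \<forall>n\<ge>M. dist (g m z $ i) (g n z $ i) < \<epsilon>"
      proof (intro exI[of _ n0] allI impI)
        fix m n assume mn: "m \<ge> n0" "n \<ge> n0"
        have "dist (g m z $ i) (g n z $ i) \<le> (e m + e n) / \<rho>" using gb[OF z] by (simp add: dist_norm)
        also have "\<dots> < \<epsilon>" using n0[OF mn(1)] n0[OF mn(2)] \<rho> by (simp add: pos_divide_less_eq) 
        finally show "dist (g m z $ i) (g n z $ i) < \<epsilon>" .
      qed
    qed
    thus ?thesis by (simp add: \<gamma>_def Cauchy_convergent_iff convergent_LIMSEQ_iff)
  qed
  have gb2: "norm (g k z $ i - \<gamma> z $ i) \<le> e k / \<rho>" if z: "z \<in> U" for k z i
  proof (rule LIMSEQ_le)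
    show "(\<lambda>n. norm (g k z $ i - g n z $ i)) \<longlonglongrightarrow> norm (g k z $ i - \<gamma> z $ i)" by (intro tendsto_intros gl[OF z])
    have "(\<lambda>n. (e k + e n) / \<rho>) \<longlonglongrightarrow> (e k + 0) / \<rho>" using \<rho> by (intro tendsto_intros e) auto
    thus "(\<lambda>n. (e k + e n) / \<rho>) \<longlonglongrightarrow> e k / \<rho>" by simp
    show "\<exists>N. \<forall>n\<ge>N. norm (g k z $ i - g n z $ i) \<le> (e k + e n) / \<rho>" using gb[OF z] by blast
  qed
  have "\<exists>H. \<forall>x\<in>U. (\<lambda>n. Q n x) \<longlonglongrightarrow> H x \<and> (H has_derivative (\<lambda>h. \<Sum>i\<in>UNIV. \<gamma> x $ i * h $ i)) (at x within U)"
  proof (rule has_derivative_sequence[OF U(2)])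
    show "(Q n has_derivative (\<lambda>h. \<Sum>i\<in>UNIV. g n x $ i * h $ i)) (at x within U)" for n x
      using g[of n x] unfolding has_gradient_def by (rule has_derivative_at_withinI)
    show "z0 \<in> U" by (rule U(3))
    show "(\<lambda>n. Q n z0) \<longlonglongrightarrow> F z0" using z0 \<rho> by (intro lim) simp
    fix \<epsilon> :: real assume "\<epsilon> > 0"
    hence "\<epsilon> * \<rho> / CARD('m) > 0" using \<rho> by simp
    then obtain n0 where n0: "\<And>n. n \<ge> n0 \<Longrightarrow> norm (e n - 0) < \<epsilon> * \<rho> / CARD('m)" using LIMSEQ_D[OF e] by blast
    have "norm ((\<Sum>i\<in>UNIV. g n x $ i * h $ i) - (\<Sum>i\<in>UNIV. \<gamma> x $ i * h $ i)) \<le> \<epsilon> * norm h" if n: "n \<ge> n0" and x: "x \<in> U" for n x h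
    proof -
      have "norm ((\<Sum>i\<in>UNIV. g n x $ i * h $ i) - (\<Sum>i\<in>UNIV. \<gamma> x $ i * h $ i)) = norm (\<Sum>i\<in>UNIV. (g n x $ i - \<gamma> x $ i) * h $ i)"
        by (simp add: left_diff_distrib sum_subtractf)
      also have "\<dots> \<le> (\<Sum>i\<in>(UNIV::'m set). (\<epsilon> / CARD('m)) * norm h)"
      proof (intro order_trans[OF norm_sum] sum_mono)
        fix i
        have "e n \<le> \<epsilon> * \<rho> / CARD('m)" using n0[OF n] by simp
        hence "e n / \<rho> \<le> \<epsilon> / CARD('m)" using \<rho> by (simp add: field_simps)
        hence "norm (g n x $ i - \<gamma> x $ i) \<le> \<epsilon> / CARD('m)" using gb2[OF x] order_trans by blast
        thus "norm ((g n x $ i - \<gamma> x $ i) * h $ i) \<le> (\<epsilon> / CARD('m)) * norm h"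
          unfolding norm_mult by (intro mult_mono Finite_Cartesian_Product.norm_nth_le) (use \<open>\<epsilon> > 0\<close> in auto)
      qed
      also have "\<dots> = \<epsilon> * norm h" by simp
      finally show ?thesis .
    qed
    thus "\<forall>\<^sub>F n in sequentially. \<forall>x\<in>U. \<forall>h. norm ((\<Sum>i\<in>UNIV. g n x $ i * h $ i) - (\<Sum>i\<in>UNIV. \<gamma> x $ i * h $ i)) \<le> \<epsilon> * norm h"
      unfolding eventually_sequentially by blast
  qed
  then obtain H where H: "\<And>x. x \<in> U \<Longrightarrow> (\<lambda>n. Q n x) \<longlonglongrightarrow> H x" 
    "\<And>x. x \<in> U \<Longrightarrow> (H has_derivative (\<lambda>h. \<Sum>i\<in>UNIV. \<gamma> x $ i * h $ i)) (at x within U)" by blast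
  have HF: "F x = H x" if "x \<in> U" for x
    using H(1)[OF that] lim[of x] that LIMSEQ_unique unfolding U_def by blast
  have "(F has_derivative (\<lambda>h. \<Sum>i\<in>UNIV. \<gamma> z0 $ i * h $ i)) (at z0 within U)"
    by (rule has_derivative_transform[OF U(3) HF H(2)[OF U(3)]])
  hence "(F has_derivative (\<lambda>h. \<Sum>i\<in>UNIV. \<gamma> z0 $ i * h $ i)) (at z0)"
    using at_within_open[OF U(3) U(1)] by simp
  thus ?thesis unfolding has_gradient_def by blast
qed

section \<open>Stepanoff distances of order \<open>p\<close>\<close>

text \<open>The tangent inequality from convexity is applied on the open half line; the endpoint
  \<open>a = 0\<close> is computed directly.\<close>

lemma powr_above_tangent:
  fixes a c p :: real
  assumes p: "p \<ge> 1" and c: "c > 0" and a: "a \<ge> 0"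
  shows "c powr p + p * c powr (p - 1) * (a - c) \<le> a powr p"
proof (cases "a = 0")
  case True
  have "c powr (p - 1) * c = c powr p" using c by (simp add: powr_diff)
  hence "c powr p + p * c powr (p - 1) * (a - c) = (1 - p) * c powr p" using True by (simp add: algebra_simps)
  thus ?thesis using True p by (simp add: mult_nonpos_nonneg)
next
  case False
  have "((\<lambda>x. x powr p) has_real_derivative p * c powr (p - 1)) (at c)"
    using c by (auto intro!: derivative_eq_intros)
  hence "((\<lambda>x. x powr p) has_real_derivative p * c powr (p - 1)) (at c within {0<..})"
    by (rule DERIV_subset) simp
  hence "a powr p - c powr p \<ge> p * c powr (p - 1) * (a - c)"
    using False a c by (intro convex_on_imp_above_tangent[OF powr_convex[OF p]]) (auto simp: interior_open)
  thus ?thesis by simp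
qed

text \<open>Jensen by the tangent line at the mean \<open>c\<close> of \<open>norm f\<close>. The
  right side may be infinite, because order-\<open>p\<close> integrability along lines is not known
  in advance.\<close>

lemma (in prob_space) norm_expectation_powr_le:
  fixes f :: "'a \<Rightarrow> complex"
  assumes f: "integrable M f" and p: "p \<ge> 1"
  shows "ennreal (norm (expectation f) powr p) \<le> (\<integral>\<^sup>+x. ennreal (norm (f x) powr p) \<partial>M)"
proof -
  define c where "c = expectation (\<lambda>x. norm (f x))"
  have c0: "c \<ge> 0" by (simp add: c_def)
  have fm [measurable]: "f \<in> borel_measurable M" by (rule borel_measurable_integrable[OF f])
  have nc: "norm (expectation f) \<le> c" unfolding c_def by (rule integral_norm_bound)
  show ?thesis
  proof (cases "c = 0 \<or> (\<integral>\<^sup>+x. ennreal (norm (f x) powr p) \<partial>M) = \<infinity>")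
    case True
    thus ?thesis
    proof
      assume "c = 0"
      hence "norm (expectation f) = 0" using nc norm_ge_zero[of "expectation f"] by linarith
      thus ?thesis using p by simp
    qed simp
  next
    case False
    hence c: "c > 0" using c0 by simp
    have ip: "integrable M (\<lambda>x. norm (f x) powr p)"
      using False by (intro integrableI_bounded) (auto simp: less_top)
    have "c powr p = expectation (\<lambda>x. c powr p + p * c powr (p - 1) * (norm (f x) - c))"
      using f prob_space by (simp add: c_def)
    also have "\<dots> \<le> expectation (\<lambda>x. norm (f x) powr p)"
      using f ip by (intro integral_mono powr_above_tangent[OF p c]) auto
    finally have "ennreal (c powr p) \<le> ennreal (expectation (\<lambda>x. norm (f x) powr p))" by (rule ennreal_leI)
    also have "\<dots> = (\<integral>\<^sup>+x. ennreal (norm (f x) powr p) \<partial>M)" by (rule nn_integral_eq_integral[OF ip, symmetric]) simp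
    finally have "ennreal (c powr p) \<le> (\<integral>\<^sup>+x. ennreal (norm (f x) powr p) \<partial>M)" .
    moreover have "ennreal (norm (expectation f) powr p) \<le> ennreal (c powr p)"
      using nc p by (intro ennreal_leI powr_mono2) simp_all
    ultimately show ?thesis by (rule order_trans[rotated])
  qed
qed

text \<open>The supremum before the root is taken, so that comparisons of distances reduce to
  inequalities between integrals.\<close>

definition sp_sup :: "real \<Rightarrow> (real ^ 'm) set \<Rightarrow> (complex ^ 'm \<Rightarrow> complex) \<Rightarrow> (complex ^ 'm \<Rightarrow> complex) \<Rightarrow> ennreal" where
  "sp_sup p K f g = (SUP z\<in>tube K. \<integral>\<^sup>+ u\<in>ucube. ennreal (norm (f (z + cvec u 0) - g (z + cvec u 0)) powr p) \<partial>lborel)"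

lemma stepanoff_dist_sp_sup:
  "stepanoff_dist p K f g = (if sp_sup p K f g = top then top else ennreal (enn2real (sp_sup p K f g) powr (1 / p)))"
  by (simp add: stepanoff_dist_def sp_sup_def Let_def)

lemma stepanoff_dist_mono:
  assumes "sp_sup p K f g \<le> sp_sup p K' f' g'" "p \<ge> 1"
  shows "stepanoff_dist p K f g \<le> stepanoff_dist p K' f' g'"
proof (cases "sp_sup p K' f' g' = top")
  case False
  hence "sp_sup p K f g \<noteq> top" using assms(1) by (auto simp: top_unique)
  moreover have "enn2real (sp_sup p K f g) \<le> enn2real (sp_sup p K' f' g')"
    using assms(1) False by (intro enn2real_mono) (auto simp: less_top)
  ultimately show ?thesis using False assms(2) unfolding stepanoff_dist_sp_sup
    by (auto intro!: ennreal_leI powr_mono2)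
qed (simp add: stepanoff_dist_sp_sup)

lemma cvec_shift: "cvec x y + cvec u 0 = cvec (x + u) y" using cvec_add[of x u y 0] by simp

lemma real_ext_cvec [simp]: "real_ext f (cvec x y) = f x" by (simp add: real_ext_def cvec_def)

definition Re_v :: "complex ^ 'm \<Rightarrow> real ^ 'm" where "Re_v z = (\<chi> i. Re (z $ i))"

lemma Re_v_cvec [simp]: "Re_v (cvec x y) = x" by (simp add: Re_v_def cvec_def)

lemma cvec_Re_Im [simp]: "cvec (Re_v z) (Im_v z) = z" by (simp add: cvec_def Re_v_def Im_v_def vec_eq_iff)

lemma sp_sup_translate:
  fixes f :: "real ^ 'm \<Rightarrow> complex"
  shows "sp_sup p {0} (real_ext f) (\<lambda>z. real_ext f (z + cvec \<tau> 0)) = 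
    (SUP x. \<integral>\<^sup>+ u\<in>ucube. ennreal (norm (f (x + u) - f (x + u + \<tau>)) powr p) \<partial>lborel)"
proof -
  have "z \<in> range (\<lambda>x :: real ^ 'm. cvec x 0)" if "Im_v z = 0" for z
    using cvec_Re_Im[of z] that by (metis rangeI)
  hence "tube {0} = range (\<lambda>x :: real ^ 'm. cvec x 0)" 
    unfolding tube_def by (auto simp: Im_v_cvec)
  thus ?thesis by (simp add: sp_sup_def image_image cvec_shift)
qed

text \<open>The unit cube has measure 1, so Jensen bounds order 1 by order \<open>p\<close>. It is
  applied to \<open>norm (k u)\<close> in place of \<open>k u\<close>, since the mean of the
  absolute value is needed.\<close>

lemma snorm_le_stepanoff_dist:
  fixes f :: "real ^ 'm \<Rightarrow> complex"
  assumes p: "p \<ge> 1" and fm [measurable]: "f \<in> borel_measurable borel" and fi: "\<And>x. set_integrable lborel ucube (\<lambda>u. f (x + u))"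
  shows "snorm (\<lambda>x. f (x + \<tau>) - f x) \<le> stepanoff_dist p {0} (real_ext f) (\<lambda>z. real_ext f (z + cvec \<tau> 0))"
proof (rule snorm_least)
  fix x
  let ?S = "sp_sup p {0} (real_ext f) (\<lambda>z. real_ext f (z + cvec \<tau> 0))"
  define k where "k = (\<lambda>u. f (x + u + \<tau>) - f (x + u))"
  show "(\<integral>\<^sup>+u\<in>ucube. ennreal (norm (f (x + u + \<tau>) - f (x + u))) \<partial>lborel) \<le> stepanoff_dist p {0} (real_ext f) (\<lambda>z. real_ext f (z + cvec \<tau> 0))"
  proof (cases "?S = top")
    case False
    define M where "M = density lborel (indicator (ucube :: (real ^ 'm) set) :: real ^ 'm \<Rightarrow> ennreal)"
    have "emeasure M (space M) = 1" by (simp add: M_def emeasure_density)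
    then interpret M: prob_space M by (rule prob_spaceI)
    have [measurable]: "k \<in> borel_measurable borel" unfolding k_def by measurable
    have dm: "(\<lambda>u. ennreal (norm (k u))) \<in> borel_measurable M" by (simp add: M_def)
    have nnM: "(\<integral>\<^sup>+u. g u \<partial>M) = (\<integral>\<^sup>+u\<in>ucube. g u \<partial>lborel)" if "g \<in> borel_measurable borel" for g
      unfolding M_def using that by (subst nn_integral_density) (auto simp: mult.commute)
    have "set_integrable lborel ucube k"
    proof -
      have "set_integrable lborel ucube (\<lambda>u. f ((x + \<tau>) + u) - f (x + u))" by (intro set_integral_diff fi)
      thus ?thesis by (simp add: k_def add_ac)
    qed
    hence "(\<integral>\<^sup>+u. ennreal (norm (indicator ucube u *\<^sub>R k u)) \<partial>lborel) < \<infinity>"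
      by (simp add: set_integrable_def integrable_iff_bounded)
    also have "(\<integral>\<^sup>+u. ennreal (norm (indicator ucube u *\<^sub>R k u)) \<partial>lborel) = (\<integral>\<^sup>+u\<in>ucube. ennreal (norm (k u)) \<partial>lborel)"
      by (intro nn_integral_cong) (auto simp: indicator_def)
    finally have fink: "(\<integral>\<^sup>+u. ennreal (norm (k u)) \<partial>M) < \<infinity>" by (subst nnM) auto
    hence ik: "integrable M (\<lambda>u. complex_of_real (norm (k u)))" by (intro integrableI_bounded) (auto simp: M_def)
    define a where "a = (LINT u|M. norm (k u))"
    have a0: "a \<ge> 0" by (simp add: a_def)
    have aeq: "(\<integral>\<^sup>+u. ennreal (norm (k u)) \<partial>M) = ennreal a"
      unfolding a_def using fink by (intro nn_integral_eq_integral integrableI_bounded) (auto simp: M_def)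
    have "ennreal (a powr p) = ennreal (norm (LINT u|M. complex_of_real (norm (k u))) powr p)" using a0 by (simp add: a_def)
    also have "\<dots> \<le> (\<integral>\<^sup>+u. ennreal (norm (complex_of_real (norm (k u))) powr p) \<partial>M)" by (rule M.norm_expectation_powr_le[OF ik p])
    also have "\<dots> = (\<integral>\<^sup>+u\<in>ucube. ennreal (norm (f (x + u) - f (x + u + \<tau>)) powr p) \<partial>lborel)"
      by (subst nnM) (auto simp: k_def norm_minus_commute)
    also have "\<dots> \<le> ?S" unfolding sp_sup_translate by (rule SUP_upper) simp
    finally have "enn2real (ennreal (a powr p)) \<le> enn2real ?S" using False by (intro enn2real_mono) (simp_all add: less_top)
    hence "a powr p \<le> enn2real ?S" by simp
    hence "(a powr p) powr (1 / p) \<le> enn2real ?S powr (1 / p)" using p by (intro powr_mono2) auto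
    hence "a \<le> enn2real ?S powr (1 / p)" using a0 p by (simp add: powr_powr)
    hence "ennreal a \<le> ennreal (enn2real ?S powr (1 / p))" by (rule ennreal_leI)
    moreover have "(\<integral>\<^sup>+u\<in>ucube. ennreal (norm (f (x + u + \<tau>) - f (x + u))) \<partial>lborel) = ennreal a"
      unfolding aeq[symmetric] by (subst nnM) (auto simp: k_def)
    ultimately show ?thesis using False by (simp add: stepanoff_dist_sp_sup)
  qed (simp add: stepanoff_dist_sp_sup)
qed

lemma S1ap_of_stepanoff_ap:
  fixes f :: "real ^ 'm \<Rightarrow> complex"
  assumes p: "p \<ge> 1" and f: "stepanoff_ap p {0} (real_ext f)"
  shows "S1ap f"
proof -
  have fi: "set_integrable lborel C f" if "compact C" for C
    using f that unfolding stepanoff_ap_def loc_int_planes_def by auto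
  \<comment> \<open>Only integrability on compact sets is given; global measurability comes from
    cutting off to growing boxes.\<close>
  have fm: "f \<in> borel_measurable borel"
  proof (rule borel_measurable_LIMSEQ_metric)
    show "(\<lambda>x. indicat_real (cbx (real n)) x *\<^sub>R f x) \<in> borel_measurable borel" for n :: nat
      using borel_measurable_integrable[OF fi[of "cbx (real n)", unfolded set_integrable_def]] by simp
    fix x :: "real ^ 'm"
    obtain n0 :: nat where n0: "norm x \<le> real n0" using real_arch_simple by blast
    have "x \<in> cbx (real n)" if "n \<ge> n0" for n
    proof -
      have "\<bar>x $ i\<bar> \<le> real n" for i using component_le_norm_cart[of x i] n0 that by linarith
      thus ?thesis unfolding mem_cbx by blast
    qed
    hence "\<forall>\<^sub>F n in sequentially. indicat_real (cbx (real n)) x *\<^sub>R f x = f x"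
      unfolding eventually_sequentially by (intro exI[of _ n0]) auto
    thus "(\<lambda>n. indicat_real (cbx (real n)) x *\<^sub>R f x) \<longlonglongrightarrow> f x" by (rule tendsto_eventually)
  qed
  have fiu: "set_integrable lborel ucube (\<lambda>u. f (x + u))" for x
  proof -
    have "integrable lborel (\<lambda>v. indicat_real ((+) x ` ucube) v *\<^sub>R f v)"
      using fi[of "(+) x ` ucube"] compact_translation[of ucube x] by (simp add: set_integrable_def)
    from integrable_lborel_shift[OF this, of x] 
    have "integrable lborel (\<lambda>u. indicat_real ((+) x ` ucube) (u + x) *\<^sub>R f (u + x))" .
    moreover have "indicat_real ((+) x ` ucube) (u + x) = indicat_real ucube u" for u by (auto simp: indicator_def)
    ultimately show ?thesis by (simp add: set_integrable_def add.commute)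
  qed
  show ?thesis unfolding S1ap_def
  proof (intro conjI allI impI fm fi)
    fix \<epsilon> :: real assume "\<epsilon> > 0"
    then obtain l where l: "l > 0" "\<And>a. \<exists>\<tau>\<in>cube a l. stepanoff_dist p {0} (real_ext f) (\<lambda>z. real_ext f (z + cvec \<tau> 0)) < ennreal \<epsilon>"
      using f unfolding stepanoff_ap_def by blast
    show "\<exists>l>0. \<forall>a. \<exists>\<tau>\<in>cube a l. snorm (\<lambda>x. f (x + \<tau>) - f x) < ennreal \<epsilon>"
    proof (intro exI[of _ l] conjI allI l(1))
      fix a
      obtain \<tau> where "\<tau> \<in> cube a l" "stepanoff_dist p {0} (real_ext f) (\<lambda>z. real_ext f (z + cvec \<tau> 0)) < ennreal \<epsilon>" using l(2) by blast
      thus "\<exists>\<tau>\<in>cube a l. snorm (\<lambda>x. f (x + \<tau>) - f x) < ennreal \<epsilon>"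
        using snorm_le_stepanoff_dist[OF p fm fiu, of \<tau>] by (intro bexI[of _ \<tau>]) (auto intro: order.strict_trans1)
    qed
  qed simp
qed

lemma has_fcoef_iff_has_mean: "has_fcoef F l y c \<longleftrightarrow> has_mean (\<lambda>x. F (cvec x y) * ch (- l) x) c"
proof -
  have "exp (- \<i> * cinner (cvec x 0) l) = ch (- l) x" for x by (simp add: cinner_cvec ch_def)
  hence e: "exp (- \<i> * cinner (cvec (x + x') 0) l) = ch (- l) (x + x')" for x x' by blast
  show ?thesis unfolding has_fcoef_def has_mean_def mean_def e ..
qed

lemma fcoef_eq_fc: 
  assumes "sap f" shows "fcoef (real_ext f) l 0 = fc f l"
proof -
  have "has_mean (\<lambda>x. f x * ch (- l) x) (fc f l)" using has_mean_fc[OF assms, of "- l"] by simp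
  thus ?thesis unfolding fcoef_def has_fcoef_iff_has_mean using has_mean_unique by (auto intro!: the_equality)
qed

text \<open>Jensen on almost every line, then Tonelli; the supremum on the right absorbs the
  translation by \<open>t *\<^sub>R y\<close>. The extension thereby has the almost periods of
  \<open>f\<close> in the original order \<open>p\<close>.\<close>

lemma poi_stepanoff_le:
  fixes f :: "real ^ 'm \<Rightarrow> complex"
  assumes f: "sbounded f" and p: "p \<ge> 1"
  shows "(\<integral>\<^sup>+u\<in>ucube. ennreal (norm (poi f y (x + u) - poi f y (x + u + \<tau>)) powr p) \<partial>lborel)
    \<le> (SUP x. \<integral>\<^sup>+ u\<in>ucube. ennreal (norm (f (x + u) - f (x + u + \<tau>)) powr p) \<partial>lborel)" (is "_ \<le> ?S")
proof -
  interpret C: prob_space cauchy1 by (rule prob_space_cauchy1)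
  interpret P: pair_sigma_finite cauchy1 "lborel :: (real ^ 'm) measure" by standard
  have fm [measurable]: "f \<in> borel_measurable borel" using f by (simp add: sbounded_def)
  define k where "k = (\<lambda>x. f x - f (x + \<tau>))"
  have [measurable]: "k \<in> borel_measurable borel" unfolding k_def by measurable
  have ae: "AE u in lborel. integrable cauchy1 (\<lambda>t. f (x + u + t *\<^sub>R y)) \<and> integrable cauchy1 (\<lambda>t. f (x + u + \<tau> + t *\<^sub>R y))"
    using AE_lborel_shift[OF AE_integrable_poi[OF f, of y], of x] AE_lborel_shift[OF AE_integrable_poi[OF f, of y], of "x + \<tau>"]
    by eventually_elim (simp add: add_ac)
  have "(\<integral>\<^sup>+u\<in>ucube. ennreal (norm (poi f y (x + u) - poi f y (x + u + \<tau>)) powr p) \<partial>lborel)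
    \<le> (\<integral>\<^sup>+u. (\<integral>\<^sup>+t. ennreal (norm (k (x + t *\<^sub>R y + u)) powr p) * indicator ucube u \<partial>cauchy1) \<partial>lborel)"
  proof (rule nn_integral_mono_AE)
    show "AE u in lborel. ennreal (norm (poi f y (x + u) - poi f y (x + u + \<tau>)) powr p) * indicator ucube u
       \<le> (\<integral>\<^sup>+t. ennreal (norm (k (x + t *\<^sub>R y + u)) powr p) * indicator ucube u \<partial>cauchy1)"
      using ae
    proof eventually_elim
      case (elim u)
      hence i: "integrable cauchy1 (\<lambda>t. f (x + u + t *\<^sub>R y))" "integrable cauchy1 (\<lambda>t. f (x + u + \<tau> + t *\<^sub>R y))" by auto
      have ik: "integrable cauchy1 (\<lambda>t. k (x + t *\<^sub>R y + u))"
        using Bochner_Integration.integrable_diff[OF i] by (simp add: k_def add_ac)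
      have "poi f y (x + u) - poi f y (x + u + \<tau>) = (LINT t|cauchy1. k (x + t *\<^sub>R y + u))"
        unfolding poi_def using Bochner_Integration.integral_diff[OF i] by (simp add: k_def add_ac)
      hence "ennreal (norm (poi f y (x + u) - poi f y (x + u + \<tau>)) powr p) \<le> (\<integral>\<^sup>+t. ennreal (norm (k (x + t *\<^sub>R y + u)) powr p) \<partial>cauchy1)"
        using C.norm_expectation_powr_le[OF ik p] by simp
      thus ?case by (auto simp: indicator_def)
    qed
  qed
  also have "\<dots> = (\<integral>\<^sup>+t. (\<integral>\<^sup>+u. ennreal (norm (k (x + t *\<^sub>R y + u)) powr p) * indicator ucube u \<partial>lborel) \<partial>cauchy1)"
    by (rule P.Fubini') measurable
  also have "\<dots> \<le> (\<integral>\<^sup>+t. ?S \<partial>cauchy1)"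
    unfolding k_def by (intro nn_integral_mono SUP_upper2[where i="x + _ *\<^sub>R y"]) auto
  also have "\<dots> = ?S" by (simp add: C.emeasure_space_1[simplified])
  finally show ?thesis .
qed

section \<open>Means and Fourier coefficients under Stepanoff limits\<close>

abbreviation vanishing :: "nat \<Rightarrow> real" where "vanishing k \<equiv> inverse (real (Suc k))"

text \<open>By \<open>norm_mean_le\<close> the error of approximation changes a mean by at most
  \<open>2 ^ m\<close> times its Stepanoff norm, whatever the centre, so uniformity in the centre
  survives the limit.\<close>

lemma has_mean_limit:
  fixes g :: "real ^ 'm \<Rightarrow> complex"
  assumes g: "sbounded g" and h: "\<And>k. sbounded (h k)" and m: "\<And>k. has_mean (h k) (a k)" and a: "a \<longlonglongrightarrow> c"
    and e: "\<And>k. snorm (\<lambda>x. g x - h k x) \<le> ennreal (vanishing k)"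
  shows "has_mean g c"
  unfolding has_mean_def
proof (intro allI impI)
  fix \<epsilon> :: real assume \<epsilon>: "\<epsilon> > 0"
  have "(\<lambda>k. 2 ^ CARD('m) * vanishing k + norm (a k - c)) \<longlonglongrightarrow> 2 ^ CARD('m) * 0 + 0"
    using a by (intro tendsto_add tendsto_mult tendsto_const LIMSEQ_inverse_real_of_nat) (simp add: LIM_zero tendsto_norm_zero)
  hence "\<forall>\<^sub>F k in sequentially. 2 ^ CARD('m) * vanishing k + norm (a k - c) < \<epsilon> / 2"
    using \<epsilon> by (intro order_tendstoD(2)) auto
  then obtain k where k: "2 ^ CARD('m) * vanishing k + norm (a k - c) < \<epsilon> / 2" using eventually_happens'[OF sequentially_bot] by blast
  obtain N0 where N0: "\<And>N x. N \<ge> N0 \<Longrightarrow> norm (mean N x (h k) - a k) < \<epsilon> / 2"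
    using m[of k] \<epsilon> unfolding has_mean_def by (meson half_gt_zero)
  show "\<exists>N0. \<forall>N\<ge>N0. \<forall>x. norm (mean N x g - c) < \<epsilon>"
  proof (intro exI[of _ "max N0 1"] allI impI)
    fix N x assume N: "max N0 1 \<le> N"
    have "ennreal (norm (mean N x g - mean N x (h k))) \<le> 2 ^ CARD('m) * snorm (\<lambda>x. g x - h k x)"
      unfolding mean_diff[OF g h, symmetric] using N sbounded_measurable[OF sbounded_diff[OF g h]] by (intro norm_mean_le) auto
    also have "\<dots> \<le> ennreal (2 ^ CARD('m)) * ennreal (vanishing k)"
      using mult_left_mono[OF e[of k], of "2 ^ CARD('m)"] by (simp add: ennreal_power[symmetric])
    finally have "norm (mean N x g - mean N x (h k)) \<le> 2 ^ CARD('m) * vanishing k" by (simp add: ennreal_mult[symmetric] del: of_nat_Suc)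
    moreover have "norm (mean N x (h k) - a k) < \<epsilon> / 2" using N by (intro N0) simp
    moreover have "norm (mean N x g - c) \<le> norm (mean N x g - mean N x (h k)) + norm (mean N x (h k) - a k) + norm (a k - c)"
      using norm_triangle_ineq[of "mean N x g - mean N x (h k)" "mean N x (h k) - a k"]
            norm_triangle_ineq[of "mean N x g - a k" "a k - c"] by simp
    ultimately show "norm (mean N x g - c) < \<epsilon>" using k by linarith
  qed
qed

lemma norm_has_mean_diff_le:
  fixes g :: "real ^ 'm \<Rightarrow> complex"
  assumes g: "sbounded g" and h: "sbounded h" and "has_mean g a" "has_mean h b" and e: "snorm (\<lambda>x. g x - h x) \<le> ennreal e" "e \<ge> 0"
  shows "norm (a - b) \<le> 2 ^ CARD('m) * e"
proof (rule field_le_epsilon)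
  fix \<epsilon> :: real assume \<epsilon>: "\<epsilon> > 0"
  obtain N0 where N0: "\<And>N x. N \<ge> N0 \<Longrightarrow> norm (mean N x g - a) < \<epsilon> / 2"
    using assms(3) \<epsilon> unfolding has_mean_def by (meson half_gt_zero)
  obtain N1 where N1: "\<And>N x. N \<ge> N1 \<Longrightarrow> norm (mean N x h - b) < \<epsilon> / 2"
    using assms(4) \<epsilon> unfolding has_mean_def by (meson half_gt_zero)
  define N where "N = max (max N0 N1) 1"
  have "ennreal (norm (mean N 0 g - mean N 0 h)) \<le> 2 ^ CARD('m) * snorm (\<lambda>x. g x - h x)"
    unfolding mean_diff[OF g h, symmetric] using sbounded_measurable[OF sbounded_diff[OF g h]] by (intro norm_mean_le) (auto simp: N_def)
  also have "\<dots> \<le> ennreal (2 ^ CARD('m)) * ennreal e"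
    using mult_left_mono[OF e(1), of "2 ^ CARD('m)"] by (simp add: ennreal_power[symmetric])
  finally have "norm (mean N 0 g - mean N 0 h) \<le> 2 ^ CARD('m) * e" using e(2) by (simp add: ennreal_mult[symmetric])
  moreover have "norm (mean N 0 g - a) < \<epsilon> / 2" "norm (mean N 0 h - b) < \<epsilon> / 2" by (rule N0, simp add: N_def, rule N1, simp add: N_def)
  moreover have "norm (a - b) \<le> norm (mean N 0 g - mean N 0 h) + norm (mean N 0 g - a) + norm (mean N 0 h - b)"
    using norm_triangle_ineq4[of "mean N 0 g - b" "mean N 0 g - a"] norm_triangle_ineq[of "mean N 0 g - mean N 0 h" "mean N 0 h - b"] by simp
  ultimately show "norm (a - b) \<le> 2 ^ CARD('m) * e + \<epsilon>" by linarith
qed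

lemma has_mean_ch_mult: "has_mean (\<lambda>x. ch i x * ch (- l) x) (if i = l then 1 else 0)"
proof -
  have "has_mean (ch (i - l)) (if i = l then 1 else 0)" using bap_has_mean[OF bap_ch[of "i - l"]] by (simp add: Mean_ch)
  thus ?thesis by (simp flip: ch_add_left)
qed

lemma has_mean_tpoly:
  assumes "finite \<Lambda>"
  shows "has_mean (\<lambda>x. tpoly \<Lambda> c (cvec x y) * ch (- l) x) (if l \<in> \<Lambda> then c l * exp (- of_real (y \<bullet> l)) else 0)"
proof -
  have "has_mean (\<lambda>x. \<Sum>i\<in>\<Lambda>. c i * exp (- of_real (y \<bullet> i)) * (ch i x * ch (- l) x)) 
          (\<Sum>i\<in>\<Lambda>. c i * exp (- of_real (y \<bullet> i)) * (if i = l then 1 else 0))"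
    by (intro has_mean_sum has_mean_cmult has_mean_ch_mult sbounded_cmult bap_sbounded bap_mult bap_ch)
  moreover have "(\<Sum>i\<in>\<Lambda>. c i * exp (- of_real (y \<bullet> i)) * (if i = l then 1 else 0)) = (if l \<in> \<Lambda> then c l * exp (- of_real (y \<bullet> l)) else 0)"
    using assms by (simp add: if_distrib sum.delta cong: if_cong)
  moreover have "(\<Sum>i\<in>\<Lambda>. c i * exp (- of_real (y \<bullet> i)) * (ch i x * ch (- l) x)) = tpoly \<Lambda> c (cvec x y) * ch (- l) x" for x
    by (simp add: tpoly_cvec sum_distrib_right mult.assoc)
  ultimately show ?thesis by simp
qed

lemma snorm_mult_ch: "snorm (\<lambda>x. g x * ch l x - h x * ch l x) = snorm (\<lambda>x. g x - h x)"
  by (rule antisym; rule snorm_mono) (simp_all flip: left_diff_distrib add: norm_mult)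

section \<open>Construction of the extension\<close>

lemma dual_cone_translate_interior:
  assumes "b \<in> interior (dual_cone G)" "y - b \<in> dual_cone G" shows "y \<in> interior (dual_cone G)"
proof -
  have "(+) (y - b) ` interior (dual_cone G) \<subseteq> interior (dual_cone G)"
    using assms(2) interior_subset by (intro interior_maximal open_translation open_interior) (auto intro!: dual_cone_add)
  moreover have "y = (y - b) + b" by simp
  ultimately show ?thesis using assms(1) by blast
qed

lemma dual_cone_interior_scaleR:
  assumes "b \<in> interior (dual_cone G)" "c > 0" shows "c *\<^sub>R b \<in> interior (dual_cone G)"
proof -
  have "(*\<^sub>R) c ` interior (dual_cone G) \<subseteq> interior (dual_cone G)"
    using assms(2) interior_subset by (intro interior_maximal open_scaling open_interior) (auto intro!: dual_cone_scaleR)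
  thus ?thesis using assms(1) by blast
qed

text \<open>Uniform estimates are available on translates of the cone by interior vectors; the
  translate by \<open>y / 2\<close> makes them applicable at any interior point
  \<open>y\<close>.\<close>

lemma dual_cone_interior_half:
  assumes "y \<in> interior (dual_cone G)"
  shows "y /\<^sub>R 2 \<in> interior (dual_cone G)" "y - y /\<^sub>R 2 \<in> dual_cone G"
proof -
  show i: "y /\<^sub>R 2 \<in> interior (dual_cone G)" by (rule dual_cone_interior_scaleR[OF assms]) simp
  have "y - y /\<^sub>R 2 = y /\<^sub>R 2" by (simp add: vec_eq_iff)
  thus "y - y /\<^sub>R 2 \<in> dual_cone G" using subsetD[OF interior_subset i] by (simp only:)
qed

text \<open>\<open>zero_in\<close> and \<open>c_zero\<close> together make the constant term of
  every approximating polynomial equal to \<open>fc f 0\<close>: if 0 is missing from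
  \<open>\<Lambda> k\<close>, that coefficient is 0.\<close>

locale tube_extension =
  fixes G :: "(real ^ 'm) set" and f :: "real ^ 'm \<Rightarrow> complex" and \<Lambda> :: "nat \<Rightarrow> (real ^ 'm) set" and c :: "nat \<Rightarrow> real ^ 'm \<Rightarrow> complex"
  assumes f: "S1ap f" and spec: "\<And>l. fc f l \<noteq> 0 \<Longrightarrow> l \<in> G"
    and fin: "\<And>k. finite (\<Lambda> k)" and \<Lambda>_spec: "\<And>k l. l \<in> \<Lambda> k \<Longrightarrow> fc f l \<noteq> 0"
    and zero_in: "\<And>k. fc f 0 \<noteq> 0 \<Longrightarrow> 0 \<in> \<Lambda> k" and c_zero: "\<And>k. c k 0 = fc f 0"
    and appr: "\<And>k. snorm (\<lambda>x. f x - (\<Sum>l\<in>\<Lambda> k. c k l * ch l x)) \<le> ennreal (vanishing k)"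
begin

abbreviation "K \<equiv> dual_cone G"

definition "Q k = tpoly (\<Lambda> k) (c k)"

text \<open>Over the boundary of the dual cone the polynomials converge only in the Stepanoff norm, so there
  the Poisson integral serves as the definition; inside, both agree almost everywhere on each plane.\<close>

definition "F z = (if Im_v z \<in> interior K then lim (\<lambda>k. Q k z) else poi f (Im_v z) (Re_v z))"

lemma fb: "sbounded f" by (rule S1ap_sbounded[OF f])

lemma tp_Q: "tp G (Q k)"
  unfolding tp_def Q_def
proof (intro exI conjI)
  show "\<Lambda> k \<subseteq> G"
  proof
    fix l assume "l \<in> \<Lambda> k"
    thus "l \<in> G" by (rule spec[OF \<Lambda>_spec])
  qed
qed (rule fin refl)+

lemma Q_sbounded: "sbounded (\<lambda>x. Q k (cvec x y))" by (rule tp_sbounded(1)[OF tp_Q])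

lemma Q_appr: "snorm (\<lambda>x. f x - Q k (cvec x 0)) \<le> ennreal (vanishing k)"
  using appr[of k] by (simp add: Q_def tpoly_cvec)

lemma Q_poi: "y \<in> K \<Longrightarrow> Q k (cvec x y) = poi (\<lambda>x. Q k (cvec x 0)) y x"
  using tp_poi[OF tp_Q, of y k x 0] by (simp add: dual_cone_inner)

lemma Q_diff: "snorm (\<lambda>x. Q k (cvec x 0) - Q n (cvec x 0)) \<le> ennreal (vanishing k + vanishing n)"
proof -
  note [measurable] = sbounded_measurable[OF fb] sbounded_measurable[OF Q_sbounded]
  have "snorm (\<lambda>x. (Q k (cvec x 0) - f x) + (f x - Q n (cvec x 0))) \<le> snorm (\<lambda>x. Q k (cvec x 0) - f x) + snorm (\<lambda>x. f x - Q n (cvec x 0))"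
    by (intro snorm_triangle) measurable
  also have "\<dots> \<le> ennreal (vanishing k) + ennreal (vanishing n)"
    by (intro add_mono Q_appr) (subst snorm_minus, rule Q_appr)
  also have "\<dots> = ennreal (vanishing k + vanishing n)" by (rule ennreal_plus[symmetric]) simp_all
  finally show ?thesis by simp
qed

lemma sup_bound:
  assumes "b \<in> interior K"
  obtains C where "C \<ge> 0" "\<And>P z B. tp G P \<Longrightarrow> Im_v z - b \<in> K \<Longrightarrow> snorm (\<lambda>x. P (cvec x 0)) \<le> ennreal B \<Longrightarrow> B \<ge> 0 \<Longrightarrow> norm (P z) \<le> C * B"
proof -
  obtain C where C: "C \<ge> 0" "\<And>P x y. tp G P \<Longrightarrow> y - b \<in> K \<Longrightarrow> ennreal (norm (P (cvec x y))) \<le> ennreal C * snorm (\<lambda>x. P (cvec x 0))"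
    using tp_sup_bound[OF assms] by blast
  have "norm (P z) \<le> C * B" if "tp G P" "Im_v z - b \<in> K" "snorm (\<lambda>x. P (cvec x 0)) \<le> ennreal B" "B \<ge> 0" for P z B
  proof -
    have "ennreal (norm (P z)) \<le> ennreal C * ennreal B"
      using C(2)[OF that(1,2), of "Re_v z"] mult_left_mono[OF that(3), of "ennreal C"] by simp
    thus ?thesis using C(1) that(4) by (simp add: ennreal_mult[symmetric])
  qed
  thus ?thesis using C(1) that by blast
qed

lemma Q_cauchy:
  assumes "b \<in> interior K"
  obtains C where "C \<ge> 0" "\<And>z k n. Im_v z - b \<in> K \<Longrightarrow> norm (Q k z - Q n z) \<le> C * vanishing k + C * vanishing n"
proof -
  obtain C where C: "C \<ge> 0" "\<And>P z B. tp G P \<Longrightarrow> Im_v z - b \<in> K \<Longrightarrow> snorm (\<lambda>x. P (cvec x 0)) \<le> ennreal B \<Longrightarrow> B \<ge> 0 \<Longrightarrow> norm (P z) \<le> C * B"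
    using sup_bound[OF assms] by blast
  show ?thesis
  proof (rule that[OF C(1)])
    fix z k n assume z: "Im_v z - b \<in> K"
    have "norm (Q k z - Q n z) \<le> C * (vanishing k + vanishing n)"
      by (rule C(2)[OF tp_diff[OF tp_Q tp_Q] z Q_diff]) simp
    thus "norm (Q k z - Q n z) \<le> C * vanishing k + C * vanishing n" by (simp only: distrib_left)
  qed
qed

lemma cmult_vanishing: "(\<lambda>k. C * vanishing k) \<longlonglongrightarrow> 0"
  using tendsto_mult[OF tendsto_const LIMSEQ_inverse_real_of_nat, of C] by simp

lemma Q_tendsto: assumes "Im_v z \<in> interior K" shows "(\<lambda>k. Q k z) \<longlonglongrightarrow> F z"
proof -
  obtain C where C: "C \<ge> 0" "\<And>z' k n. Im_v z' - Im_v z /\<^sub>R 2 \<in> K \<Longrightarrow> norm (Q k z' - Q n z') \<le> C * vanishing k + C * vanishing n"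
    using Q_cauchy[OF dual_cone_interior_half(1)[OF assms]] by blast
  have "Cauchy (\<lambda>k. Q k z)"
  proof (rule metric_CauchyI)
    fix \<epsilon> :: real assume "\<epsilon> > 0"
    hence "\<forall>\<^sub>F k in sequentially. C * vanishing k < \<epsilon> / 2" using cmult_vanishing[of C] by (intro order_tendstoD(2)) auto
    then obtain N where N: "\<And>k. k \<ge> N \<Longrightarrow> C * vanishing k < \<epsilon> / 2" unfolding eventually_sequentially by blast
    show "\<exists>M. \<forall>m\<ge>M. \<forall>n\<ge>M. dist (Q m z) (Q n z) < \<epsilon>"
    proof (intro exI[of _ N] allI impI)
      fix m n assume "m \<ge> N" "n \<ge> N"
      thus "dist (Q m z) (Q n z) < \<epsilon>" 
        using N[of m] N[of n] C(2)[OF dual_cone_interior_half(2)[OF assms], of m n] unfolding dist_norm by linarith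
    qed
  qed
  hence "convergent (\<lambda>k. Q k z)" by (simp add: Cauchy_convergent_iff)
  thus ?thesis using assms by (simp add: F_def convergent_LIMSEQ_iff)
qed

lemma F_appr:
  assumes "b \<in> interior K"
  obtains C where "C \<ge> 0" "\<And>z k. Im_v z - b \<in> K \<Longrightarrow> norm (F z - Q k z) \<le> C * vanishing k"
proof -
  obtain C where C: "C \<ge> 0" "\<And>z k n. Im_v z - b \<in> K \<Longrightarrow> norm (Q k z - Q n z) \<le> C * vanishing k + C * vanishing n"
    using Q_cauchy[OF assms] by blast
  show ?thesis
  proof (rule that[OF C(1)])
    fix z k assume z: "Im_v z - b \<in> K"
    have "(\<lambda>n. norm (Q n z - Q k z)) \<longlonglongrightarrow> norm (F z - Q k z)"
      by (intro tendsto_norm tendsto_diff tendsto_const Q_tendsto dual_cone_translate_interior[OF assms z])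
    moreover have "(\<lambda>n. C * vanishing n + C * vanishing k) \<longlonglongrightarrow> 0 + C * vanishing k"
      by (intro tendsto_add tendsto_const cmult_vanishing)
    ultimately have "norm (F z - Q k z) \<le> 0 + C * vanishing k"
      by (rule LIMSEQ_le) (use C(2)[OF z] in blast)
    thus "norm (F z - Q k z) \<le> C * vanishing k" by (simp only: add_0)
  qed
qed

lemma F_measurable: "(\<lambda>x. F (cvec x y)) \<in> borel_measurable borel"
proof (cases "y \<in> interior K")
  case True
  show ?thesis
  proof (rule borel_measurable_LIMSEQ_metric)
    show "(\<lambda>x. Q k (cvec x y)) \<in> borel_measurable borel" for k by (rule sbounded_measurable[OF Q_sbounded])
    show "(\<lambda>k. Q k (cvec x y)) \<longlonglongrightarrow> F (cvec x y)" for x using True by (intro Q_tendsto) simp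
  qed
next
  case False
  thus ?thesis using borel_measurable_poi[OF sbounded_measurable[OF fb], of y] by (simp add: F_def)
qed

text \<open>Over an interior \<open>y\<close> the polynomials converge uniformly to \<open>F\<close>
  and, being Poisson integrals of their real restrictions, converge to \<open>poi f y\<close> in the
  Stepanoff norm. The two limits then differ by a function of norm 0.\<close>

lemma F_poi: assumes y: "y \<in> K" shows "AE x in lborel. F (cvec x y) = poi f y x"
proof (cases "y \<in> interior K")
  case True
  note [measurable] = sbounded_measurable[OF Q_sbounded] borel_measurable_poi[OF sbounded_measurable[OF fb]] F_measurable
  obtain C where C: "C \<ge> 0" "\<And>z k. Im_v z - y /\<^sub>R 2 \<in> K \<Longrightarrow> norm (F z - Q k z) \<le> C * vanishing k"
    using F_appr[OF dual_cone_interior_half(1)[OF True]] by blast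
  have b: "snorm (\<lambda>x. F (cvec x y) - poi f y x) \<le> ennreal ((C + 1) * vanishing k)" for k
  proof -
    have "snorm (\<lambda>x. (F (cvec x y) - Q k (cvec x y)) + (Q k (cvec x y) - poi f y x))
       \<le> snorm (\<lambda>x. F (cvec x y) - Q k (cvec x y)) + snorm (\<lambda>x. Q k (cvec x y) - poi f y x)"
      by (intro snorm_triangle) measurable
    also have "\<dots> \<le> ennreal (C * vanishing k) + ennreal (vanishing k)"
    proof (rule add_mono)
      show "snorm (\<lambda>x. F (cvec x y) - Q k (cvec x y)) \<le> ennreal (C * vanishing k)"
        using dual_cone_interior_half(2)[OF True] by (intro snorm_bounded C(2)) simp
      have "snorm (\<lambda>x. Q k (cvec x y) - poi f y x) = snorm (\<lambda>x. poi f y x - poi (\<lambda>x. Q k (cvec x 0)) y x)"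
        by (subst snorm_minus) (simp add: Q_poi[OF y, symmetric])
      also have "\<dots> \<le> ennreal (vanishing k)" by (rule order_trans[OF snorm_poi_diff_le[OF fb Q_sbounded] Q_appr])
      finally show "snorm (\<lambda>x. Q k (cvec x y) - poi f y x) \<le> ennreal (vanishing k)" .
    qed
    also have "\<dots> = ennreal (C * vanishing k + vanishing k)" using C(1) by (intro ennreal_plus[symmetric]) simp_all
    finally show ?thesis by (simp add: distrib_right)
  qed
  have "(\<lambda>k. ennreal ((C + 1) * vanishing k)) \<longlonglongrightarrow> ennreal 0" by (intro tendsto_ennrealI cmult_vanishing)
  hence "snorm (\<lambda>x. F (cvec x y) - poi f y x) \<le> ennreal 0" by (rule LIMSEQ_le_const) (use b in blast)
  hence "AE x in lborel. F (cvec x y) - poi f y x = 0" by (intro snorm_zero_AE) auto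
  thus ?thesis by simp
qed (simp add: F_def)

lemma F_snorm_appr: assumes y: "y \<in> K" shows "snorm (\<lambda>x. F (cvec x y) - Q k (cvec x y)) \<le> ennreal (vanishing k)"
proof -
  have "snorm (\<lambda>x. F (cvec x y) - Q k (cvec x y)) = snorm (\<lambda>x. poi f y x - poi (\<lambda>x. Q k (cvec x 0)) y x)"
    using F_poi[OF y] by (intro snorm_cong_AE) (auto simp: Q_poi[OF y])
  also have "\<dots> \<le> ennreal (vanishing k)" by (rule order_trans[OF snorm_poi_diff_le[OF fb Q_sbounded] Q_appr])
  finally show ?thesis .
qed

lemma F_sbounded: assumes y: "y \<in> K" shows "sbounded (\<lambda>x. F (cvec x y))"
proof -
  have "snorm (\<lambda>x. F (cvec x y)) = snorm (poi f y)" using F_poi[OF y] by (intro snorm_cong_AE) auto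
  also have "\<dots> \<le> snorm f" by (rule snorm_poi_le[OF sbounded_measurable[OF fb]])
  finally show ?thesis using fb F_measurable by (auto simp: sbounded_def intro: le_less_trans)
qed

text \<open>If the dual cone is the whole space, 0 is one of its interior points and
  \<open>F\<close> is there a pointwise limit of polynomials; hence agreement almost everywhere and
  not at every point.\<close>

lemma F_real: "AE x in lborel. F (cvec x 0) = f x"
  using F_poi[of 0] by (simp add: poi_zero dual_cone_def)

lemma F_sp_sup_le:
  assumes p: "p \<ge> 1"
  shows "sp_sup p K F (\<lambda>z. F (z + cvec \<tau> 0)) \<le> sp_sup p {0} (real_ext f) (\<lambda>z. real_ext f (z + cvec \<tau> 0))"
  unfolding sp_sup_def[of p K]
proof (rule SUP_least)
  fix z :: "complex ^ 'm" assume "z \<in> tube K"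
  hence y: "Im_v z \<in> K" by (simp add: tube_def)
  define x where "x = Re_v z"
  define y where "y = Im_v z"
  have z: "z = cvec x y" by (simp add: x_def y_def)
  have "AE u in lborel. F (cvec (x + u) y) = poi f y (x + u)" "AE u in lborel. F (cvec (x + u + \<tau>) y) = poi f y (x + u + \<tau>)"
    using AE_lborel_shift[OF F_poi[OF y], of x] AE_lborel_shift[OF F_poi[OF y], of "x + \<tau>"] by (simp_all add: add_ac y_def)
  hence "(\<integral>\<^sup>+u\<in>ucube. ennreal (norm (F (z + cvec u 0) - F (z + cvec u 0 + cvec \<tau> 0)) powr p) \<partial>lborel) =
     (\<integral>\<^sup>+u\<in>ucube. ennreal (norm (poi f y (x + u) - poi f y (x + u + \<tau>)) powr p) \<partial>lborel)"
    by (intro nn_integral_cong_AE) (auto simp: z cvec_shift)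
  also have "\<dots> \<le> sp_sup p {0} (real_ext f) (\<lambda>z. real_ext f (z + cvec \<tau> 0))"
    unfolding sp_sup_translate by (rule poi_stepanoff_le[OF fb p])
  finally show "(\<integral>\<^sup>+u\<in>ucube. ennreal (norm (F (z + cvec u 0) - F (z + cvec u 0 + cvec \<tau> 0)) powr p) \<partial>lborel)
     \<le> sp_sup p {0} (real_ext f) (\<lambda>z. real_ext f (z + cvec \<tau> 0))" .
qed

lemma F_stepanoff_ap:
  assumes p: "p \<ge> 1" and ap: "stepanoff_ap p {0} (real_ext f)" shows "stepanoff_ap p K F"
  unfolding stepanoff_ap_def
proof (intro conjI allI impI)
  show "loc_int_planes K F" unfolding loc_int_planes_def
  proof (intro ballI allI impI)
    fix y and C :: "(real ^ 'm) set" assume y: "y \<in> K" and C: "compact C"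
    obtain N where N: "\<And>x. x \<in> C \<Longrightarrow> norm x \<le> N" using compact_imp_bounded[OF C] unfolding bounded_iff by blast
    have sub: "C \<subseteq> cbx N"
    proof
      fix x assume x: "x \<in> C"
      have "\<bar>x $ i\<bar> \<le> N" for i using component_le_norm_cart[of x i] N[OF x] by linarith
      thus "x \<in> cbx N" unfolding mem_cbx by blast
    qed
    have "set_integrable lborel (cbx N) (\<lambda>x. F (cvec (x + 0) y))" 
      using F_sbounded[OF y] by (intro set_integrable_cbx) (auto simp: sbounded_def)
    hence "set_integrable lborel (cbx N) (\<lambda>x. F (cvec x y))" by simp
    thus "set_integrable lborel C (\<lambda>x. F (cvec x y))" 
      by (rule set_integrable_subset) (use sub compact_imp_closed[OF C] in auto)
  qed
  fix \<epsilon> :: real assume "\<epsilon> > 0"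
  then obtain l where l: "l > 0" "\<And>a. \<exists>\<tau>\<in>cube a l. stepanoff_dist p {0} (real_ext f) (\<lambda>z. real_ext f (z + cvec \<tau> 0)) < ennreal \<epsilon>"
    using ap unfolding stepanoff_ap_def by blast
  have "\<exists>\<tau>\<in>cube a l. stepanoff_dist p K F (\<lambda>z. F (z + cvec \<tau> 0)) < ennreal \<epsilon>" for a
    using l(2)[of a] le_less_trans[OF stepanoff_dist_mono[OF F_sp_sup_le[OF p] p]] by blast
  thus "\<exists>l>0. \<forall>a. \<exists>\<tau>\<in>cube a l. stepanoff_dist p K F (\<lambda>z. F (z + cvec \<tau> 0)) < ennreal \<epsilon>" using l(1) by blast
qed

text \<open>Approximation multiplies the coefficients of \<open>f\<close> by factors depending on
  \<open>k\<close>, so for \<open>l \<noteq> 0\<close> they need not equal those of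
  \<open>f\<close>. They converge because a coefficient is a mean, and means are continuous in the
  Stepanoff norm.\<close>

lemma coefficients_tendsto: "(\<lambda>k. if l \<in> \<Lambda> k then c k l else 0) \<longlonglongrightarrow> fc f l"
proof -
  have m: "has_mean (\<lambda>x. f x * ch (- l) x) (fc f l)" using has_mean_fc[OF S1ap_sap[OF f], of "- l"] by simp
  have sm: "sbounded (\<lambda>x. g x * ch (- l) x)" if "sbounded g" for g by (rule sbounded_mult[OF that, of _ 1]) auto
  have "norm ((if l \<in> \<Lambda> k then c k l else 0) - fc f l) \<le> 2 ^ CARD('m) * vanishing k" for k
  proof -
    have "has_mean (\<lambda>x. Q k (cvec x 0) * ch (- l) x) (if l \<in> \<Lambda> k then c k l else 0)"
      using has_mean_tpoly[OF fin, of k "c k" 0 l] by (simp add: Q_def split: if_splits)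
    from norm_has_mean_diff_le[OF sm[OF fb] sm[OF Q_sbounded] m this, of "vanishing k"]
    have "norm (fc f l - (if l \<in> \<Lambda> k then c k l else 0)) \<le> 2 ^ CARD('m) * vanishing k"
      unfolding snorm_mult_ch using Q_appr[of k] by simp
    thus ?thesis by (simp only: norm_minus_commute)
  qed
  hence "\<forall>\<^sub>F k in sequentially. norm ((if l \<in> \<Lambda> k then c k l else 0) - fc f l) \<le> 2 ^ CARD('m) * vanishing k"
    by (intro always_eventually allI)
  from LIM_zero_cancel[OF Lim_null_comparison[OF this cmult_vanishing]] show ?thesis .
qed

lemma F_has_fcoef: assumes y: "y \<in> K" shows "has_fcoef F l y (fc f l * exp (- of_real (y \<bullet> l)))"
  unfolding has_fcoef_iff_has_mean
proof (rule has_mean_limit)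
  have sm: "sbounded (\<lambda>x. g x * ch (- l) x)" if "sbounded g" for g by (rule sbounded_mult[OF that, of _ 1]) auto
  show "sbounded (\<lambda>x. F (cvec x y) * ch (- l) x)" by (rule sm[OF F_sbounded[OF y]])
  show "sbounded (\<lambda>x. Q k (cvec x y) * ch (- l) x)" for k by (rule sm[OF Q_sbounded])
  show "has_mean (\<lambda>x. Q k (cvec x y) * ch (- l) x) ((if l \<in> \<Lambda> k then c k l else 0) * exp (- of_real (y \<bullet> l)))" for k
    using has_mean_tpoly[OF fin, of k "c k" y l] by (auto simp: Q_def split: if_splits)
  show "(\<lambda>k. (if l \<in> \<Lambda> k then c k l else 0) * exp (- complex_of_real (y \<bullet> l))) \<longlonglongrightarrow> fc f l * exp (- of_real (y \<bullet> l))"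
    by (intro tendsto_mult tendsto_const coefficients_tendsto)
  show "snorm (\<lambda>x. F (cvec x y) * ch (- l) x - Q k (cvec x y) * ch (- l) x) \<le> ennreal (vanishing k)" for k
    unfolding snorm_mult_ch by (rule F_snorm_appr[OF y])
qed

end

section \<open>Holomorphy, Bohr almost periodicity and behaviour at infinity\<close>

context tube_extension
begin

lemma F_has_gradient:
  assumes z0: "Im_v z0 \<in> interior K" shows "\<exists>g. has_gradient F g z0"
proof -
  define y0 where "y0 = Im_v z0"
  have y0: "y0 \<in> interior K" using z0 by (simp add: y0_def)
  \<comment> \<open>A ball of radius \<open>r\<close> around \<open>y0 / 2\<close> inside the cone
    shows that all of \<open>ball y0 r\<close> lies in the translate of the cone by
    \<open>b\<close>.\<close>
  define b where "b = y0 /\<^sub>R 2"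
  have b: "b \<in> interior K" unfolding b_def by (rule dual_cone_interior_half(1)[OF y0])
  then obtain r where r: "r > 0" "ball b r \<subseteq> K" using mem_interior by blast
  obtain C where C: "C \<ge> 0" "\<And>z k n. Im_v z - b \<in> K \<Longrightarrow> norm (Q k z - Q n z) \<le> C * vanishing k + C * vanishing n"
    using Q_cauchy[OF b] by blast
  have sub: "y - b \<in> K" if "y \<in> ball y0 r" for y
  proof -
    have "dist b (y - b) = dist y0 y"
      by (simp add: dist_norm b_def algebra_simps flip: scaleR_left.add) 
    thus ?thesis using that r(2) by auto
  qed
  show ?thesis
  proof (rule holo_limit[where Q=Q and \<rho>="r/2" and e="\<lambda>k. C * vanishing k" and ?y0.0=y0])
    show "\<exists>g. \<forall>z. has_gradient (Q k) (g z) z" for k by (rule tp_has_gradient[OF tp_Q])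
    show "r / 2 > 0" using r(1) by simp
    show "(\<lambda>k. C * vanishing k) \<longlonglongrightarrow> 0" by (rule cmult_vanishing)
    show "norm (Q k z - Q n z) \<le> C * vanishing k + C * vanishing n" if "Im_v z \<in> ball y0 (2 * (r / 2))" for k n z
      using that by (intro C(2) sub) simp
    show "(\<lambda>k. Q k z) \<longlonglongrightarrow> F z" if "Im_v z \<in> ball y0 (r / 2)" for z
    proof (intro Q_tendsto dual_cone_translate_interior[OF b] sub)
      show "Im_v z \<in> ball y0 r" using that r(1) by auto
    qed
  qed (simp add: y0_def)
qed

lemma translate_subset_interior: "b \<in> interior K \<Longrightarrow> y \<in> (+) b ` K \<Longrightarrow> y \<in> interior K"
  using dual_cone_translate_interior[of b G y] by auto

lemma F_holo_on: "b \<in> interior K \<Longrightarrow> holo_on F (tube ((+) b ` K))"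
  using F_has_gradient translate_subset_interior unfolding holo_on_def has_gradient_def tube_def by blast

text \<open>The uniform bound is applied to the polynomial
  \<open>Q k (z + cvec \<tau> 0) - Q k z\<close>, whose Stepanoff norm on the real plane is at most
  \<open>dist1 f \<tau>\<close> plus two errors that vanish with growing \<open>k\<close>. Stepanoff
  almost periods of \<open>f\<close> thus become Bohr almost periods of \<open>F\<close>.\<close>

lemma F_translation_le:
  assumes "b \<in> interior K"
  obtains C where "C \<ge> 0" "\<And>z \<tau>. Im_v z - b \<in> K \<Longrightarrow> norm (F (z + cvec \<tau> 0) - F z) \<le> C * dist1 f \<tau>"
proof -
  obtain C where C: "C \<ge> 0" "\<And>P z B. tp G P \<Longrightarrow> Im_v z - b \<in> K \<Longrightarrow> snorm (\<lambda>x. P (cvec x 0)) \<le> ennreal B \<Longrightarrow> B \<ge> 0 \<Longrightarrow> norm (P z) \<le> C * B"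
    using sup_bound[OF assms] by blast
  note [measurable] = sbounded_measurable[OF fb] sbounded_measurable[OF Q_sbounded]
  show ?thesis
  proof (rule that[OF C(1)])
    fix z and \<tau> :: "real ^ 'm" assume z: "Im_v z - b \<in> K"
    have d0: "0 \<le> dist1 f \<tau>" by (simp add: dist1_def)
    have "norm (Q k (z + cvec \<tau> 0) - Q k z) \<le> C * (vanishing k + dist1 f \<tau> + vanishing k)" for k
    proof (rule C(2)[OF tp_diff[OF tp_shift[OF tp_Q] tp_Q] z])
      have m: "(\<lambda>x. Q k (cvec (x + \<tau>) 0)) \<in> borel_measurable borel"
        using sbounded_measurable[OF sbounded_shift[OF Q_sbounded[of k 0], of \<tau>]] .
      have "snorm (\<lambda>x. (Q k (cvec (x + \<tau>) 0) - f (x + \<tau>)) + (f (x + \<tau>) - f x) + (f x - Q k (cvec x 0)))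
         \<le> snorm (\<lambda>x. (Q k (cvec (x + \<tau>) 0) - f (x + \<tau>)) + (f (x + \<tau>) - f x)) + snorm (\<lambda>x. f x - Q k (cvec x 0))"
        using m by (intro snorm_triangle) measurable
      also have "\<dots> \<le> snorm (\<lambda>x. Q k (cvec (x + \<tau>) 0) - f (x + \<tau>)) + snorm (\<lambda>x. f (x + \<tau>) - f x) + snorm (\<lambda>x. f x - Q k (cvec x 0))"
        using m by (intro add_right_mono snorm_triangle) measurable
      also have "snorm (\<lambda>x. Q k (cvec (x + \<tau>) 0) - f (x + \<tau>)) = snorm (\<lambda>x. f x - Q k (cvec x 0))"
        unfolding snorm_minus[of "\<lambda>x. f x"] by (rule snorm_shift[of "\<lambda>x. Q k (cvec x 0) - f x"])
      also have "snorm (\<lambda>x. f x - Q k (cvec x 0)) + snorm (\<lambda>x. f (x + \<tau>) - f x) + snorm (\<lambda>x. f x - Q k (cvec x 0))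
         \<le> ennreal (vanishing k) + ennreal (dist1 f \<tau>) + ennreal (vanishing k)"
        unfolding snorm_dist1[OF fb] by (intro add_mono Q_appr order_refl)
      also have "\<dots> = ennreal (vanishing k + dist1 f \<tau> + vanishing k)" 
        using d0 by (metis ennreal_plus add_nonneg_nonneg inverse_nonnegative_iff_nonnegative of_nat_0_le_iff)
      finally show "snorm (\<lambda>x. Q k (cvec x 0 + cvec \<tau> 0) - Q k (cvec x 0)) \<le> ennreal (vanishing k + dist1 f \<tau> + vanishing k)"
        by (simp add: cvec_shift)
      show "0 \<le> vanishing k + dist1 f \<tau> + vanishing k" using d0 by simp
    qed
    moreover have "(\<lambda>k. C * (vanishing k + dist1 f \<tau> + vanishing k)) \<longlonglongrightarrow> C * (0 + dist1 f \<tau> + 0)"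
      by (intro tendsto_mult tendsto_add tendsto_const LIMSEQ_inverse_real_of_nat)
    moreover have "(\<lambda>k. norm (Q k (z + cvec \<tau> 0) - Q k z)) \<longlonglongrightarrow> norm (F (z + cvec \<tau> 0) - F z)"
      using dual_cone_translate_interior[OF assms z] by (intro tendsto_norm tendsto_diff Q_tendsto) (simp_all add: Im_v_add)
    ultimately have "norm (F (z + cvec \<tau> 0) - F z) \<le> C * (0 + dist1 f \<tau> + 0)" by (intro LIMSEQ_le) auto
    thus "norm (F (z + cvec \<tau> 0) - F z) \<le> C * dist1 f \<tau>" by simp
  qed
qed

lemma F_bohr_ap:
  assumes b: "b \<in> interior K" shows "bohr_ap ((+) b ` K) F"
  unfolding bohr_ap_def
proof (intro conjI allI impI)
  show "continuous_on (tube ((+) b ` K)) F"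
    using F_has_gradient translate_subset_interior[OF b] unfolding has_gradient_def tube_def
    by (intro continuous_at_imp_continuous_on ballI) (blast dest: has_derivative_continuous)
  obtain C where C: "C \<ge> 0" "\<And>z \<tau>. Im_v z - b \<in> K \<Longrightarrow> norm (F (z + cvec \<tau> 0) - F z) \<le> C * dist1 f \<tau>"
    using F_translation_le[OF b] by blast
  fix \<epsilon> :: real assume \<epsilon>: "\<epsilon> > 0"
  hence "\<epsilon> / (C + 1) > 0" using C(1) by simp
  then obtain l where l: "l > 0" "\<And>a. \<exists>\<tau>\<in>cube a l. snorm (\<lambda>x. f (x + \<tau>) - f x) < ennreal (\<epsilon> / (C + 1))"
    using f unfolding S1ap_def by blast
  have "\<exists>\<tau>\<in>cube a l. (SUP z\<in>tube ((+) b ` K). ereal (norm (F (z + cvec \<tau> 0) - F z))) < ereal \<epsilon>" for a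
  proof -
    obtain \<tau> where \<tau>: "\<tau> \<in> cube a l" "snorm (\<lambda>x. f (x + \<tau>) - f x) < ennreal (\<epsilon> / (C + 1))" using l(2) by blast
    have "(C + 1) * dist1 f \<tau> < \<epsilon>" using dist1_le[OF fb \<tau>(2)] C(1) by (simp add: field_simps)
    moreover have "0 \<le> dist1 f \<tau>" by (simp add: dist1_def)
    ultimately have "C * dist1 f \<tau> < \<epsilon>" by (simp add: distrib_right)
    hence "ereal (C * dist1 f \<tau>) < ereal \<epsilon>" by simp
    moreover have "(SUP z\<in>tube ((+) b ` K). ereal (norm (F (z + cvec \<tau> 0) - F z))) \<le> ereal (C * dist1 f \<tau>)"
      by (rule SUP_least) (auto simp: tube_def intro!: C(2))
    ultimately have "(SUP z\<in>tube ((+) b ` K). ereal (norm (F (z + cvec \<tau> 0) - F z))) < ereal \<epsilon>" by (rule le_less_trans[rotated])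
    thus ?thesis by (rule bexI[OF _ \<tau>(1)])
  qed
  thus "\<exists>l>0. \<forall>a. \<exists>\<tau>\<in>cube a l. (SUP z\<in>tube ((+) b ` K). ereal (norm (F (z + cvec \<tau> 0) - F z))) < ereal \<epsilon>"
    using l(1) by blast
qed

lemma norm_exp_cinner: "norm (exp (\<i> * cinner z l)) = exp (- (Im_v z \<bullet> l))"
  using arg_cong[OF exp_cinner_cvec[of "Re_v z" "Im_v z" l], of norm] by (simp add: norm_mult)

text \<open>On \<open>S\<close> each of the finitely many terms with \<open>l \<noteq> 0\<close>
  decays exponentially in \<open>norm (Im_v z)\<close>, and the constant term is
  \<open>fc f 0\<close>. The condition on \<open>S\<close> is the common form of the two limits to
  be proved.\<close>

lemma Q_limit:
  assumes S: "\<And>l. fc f l \<noteq> 0 \<Longrightarrow> l \<noteq> 0 \<Longrightarrow> \<exists>\<delta>>0. \<forall>y\<in>S. \<delta> * norm y \<le> y \<bullet> l" and \<epsilon>: "\<epsilon> > 0"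
  shows "\<exists>R. \<forall>z. Im_v z \<in> S \<and> R \<le> norm (Im_v z) \<longrightarrow> norm (Q k z - fc f 0) < \<epsilon>"
proof -
  define L where "L = \<Lambda> k - {0}"
  have "\<forall>l\<in>L. \<exists>\<delta>. \<delta> > 0 \<and> (\<forall>y\<in>S. \<delta> * norm y \<le> y \<bullet> l)" using S \<Lambda>_spec unfolding L_def by blast
  then obtain \<delta> where \<delta>: "\<And>l. l \<in> L \<Longrightarrow> \<delta> l > 0" "\<And>l y. l \<in> L \<Longrightarrow> y \<in> S \<Longrightarrow> \<delta> l * norm y \<le> y \<bullet> l"
    unfolding bchoice_iff by blast
  have "((\<lambda>r. \<Sum>l\<in>L. norm (c k l) * exp (- (\<delta> l * r))) \<longlongrightarrow> 0) at_top"
  proof (rule tendsto_null_sum)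
    fix l assume "l \<in> L"
    hence "\<delta> l > 0" by (rule \<delta>(1))
    thus "((\<lambda>r. norm (c k l) * exp (- (\<delta> l * r))) \<longlongrightarrow> 0) at_top" by real_asymp
  qed
  hence "\<forall>\<^sub>F r in at_top. (\<Sum>l\<in>L. norm (c k l) * exp (- (\<delta> l * r))) < \<epsilon>" using \<epsilon> by (rule order_tendstoD)
  then obtain R where R: "\<And>r. r \<ge> R \<Longrightarrow> (\<Sum>l\<in>L. norm (c k l) * exp (- (\<delta> l * r))) < \<epsilon>"
    unfolding eventually_at_top_linorder by blast
  show ?thesis
  proof (intro exI[of _ R] allI impI, elim conjE)
    fix z assume z: "Im_v z \<in> S" "R \<le> norm (Im_v z)"
    have "Q k z = fc f 0 + (\<Sum>l\<in>L. c k l * exp (\<i> * cinner z l))"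
    proof (cases "0 \<in> \<Lambda> k")
      case True
      thus ?thesis using sum.remove[OF fin True, of "\<lambda>l. c k l * exp (\<i> * cinner z l)"]
        by (simp add: Q_def tpoly_def L_def c_zero cinner_def)
    next
      case False
      thus ?thesis using zero_in[of k] by (auto simp: Q_def tpoly_def L_def)
    qed
    hence "norm (Q k z - fc f 0) \<le> (\<Sum>l\<in>L. norm (c k l * exp (\<i> * cinner z l)))" by (simp add: norm_sum)
    also have "\<dots> \<le> (\<Sum>l\<in>L. norm (c k l) * exp (- (\<delta> l * norm (Im_v z))))"
      unfolding norm_mult norm_exp_cinner using \<delta>(2)[OF _ z(1)] by (intro sum_mono mult_left_mono) auto
    also have "\<dots> < \<epsilon>" by (rule R[OF z(2)])
    finally show "norm (Q k z - fc f 0) < \<epsilon>" .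
  qed
qed

text \<open>One polynomial that is within \<open>\<epsilon> / 2\<close> of \<open>F\<close> on the
  whole tube over the translate of \<open>K\<close> by \<open>b\<close> is enough. The bound
  \<open>R0\<close> says that the far points of \<open>S\<close> belong to this translate.\<close>

lemma F_limit:
  assumes S: "\<And>l. fc f l \<noteq> 0 \<Longrightarrow> l \<noteq> 0 \<Longrightarrow> \<exists>\<delta>>0. \<forall>y\<in>S. \<delta> * norm y \<le> y \<bullet> l" and \<epsilon>: "\<epsilon> > 0"
    and b: "b \<in> interior K" and R0: "\<And>y. y \<in> S \<Longrightarrow> norm y \<ge> R0 \<Longrightarrow> y - b \<in> K"
  shows "\<exists>R. \<forall>z. Im_v z \<in> S \<and> norm (Im_v z) \<ge> R \<longrightarrow> norm (F z - fc f 0) < \<epsilon>"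
proof -
  obtain C where C: "\<And>z k. Im_v z - b \<in> K \<Longrightarrow> norm (F z - Q k z) \<le> C * vanishing k" using F_appr[OF b] by blast
  have "\<forall>\<^sub>F k in sequentially. C * vanishing k < \<epsilon> / 2" using cmult_vanishing[of C] \<epsilon> by (intro order_tendstoD(2)) auto
  then obtain k where k: "C * vanishing k < \<epsilon> / 2" using eventually_happens'[OF sequentially_bot] by blast
  have "\<exists>R. \<forall>z. Im_v z \<in> S \<and> R \<le> norm (Im_v z) \<longrightarrow> norm (Q k z - fc f 0) < \<epsilon> / 2"
    by (rule Q_limit[OF S half_gt_zero[OF \<epsilon>]])
  then obtain R where R: "\<And>z. Im_v z \<in> S \<Longrightarrow> R \<le> norm (Im_v z) \<Longrightarrow> norm (Q k z - fc f 0) < \<epsilon> / 2" by blast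
  show ?thesis
  proof (intro exI[of _ "max R R0"] allI impI, elim conjE)
    fix z assume z: "Im_v z \<in> S" "norm (Im_v z) \<ge> max R R0"
    hence "norm (F z - Q k z) < \<epsilon> / 2" using C[of z k] R0[OF z(1)] k by simp
    moreover have "norm (Q k z - fc f 0) < \<epsilon> / 2" using z by (intro R) auto
    ultimately show "norm (F z - fc f 0) < \<epsilon>" using norm_triangle_ineq[of "F z - Q k z" "Q k z - fc f 0"] by simp
  qed
qed

end

section \<open>Geometry of cones and the limits at infinity\<close>

text \<open>Compact inclusion is a statement relative to the sphere. Radial projection turns
  relative interior points of the trace into interior points of the cone itself, and compactness
  then gives one radius for all unit vectors of \<open>G'\<close>.\<close>

lemma cone_cc_dual_cone_ball:
  fixes G :: "(real ^ 'm) set"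
  assumes "cone_cc G' (dual_cone G)"
  obtains \<delta> where "\<delta> > 0" "\<And>y. y \<in> G' \<Longrightarrow> norm y = 1 \<Longrightarrow> ball y \<delta> \<subseteq> dual_cone G"
proof -
  have sub: "closure (G' \<inter> sphere 0 1) \<subseteq> interior (dual_cone G)"
  proof
    fix y assume "y \<in> closure (G' \<inter> sphere 0 1)"
    hence "y \<in> (top_of_set (sphere 0 1)) interior_of (dual_cone G \<inter> sphere 0 1)" using assms by (auto simp: cone_cc_def)
    then obtain T where T: "open T" "y \<in> T" "norm y = 1" "sphere 0 1 \<inter> T \<subseteq> dual_cone G"
      unfolding interior_of_def openin_open by auto
    have "isCont (\<lambda>w. w /\<^sub>R norm w) y" using T(3) by (intro continuous_intros) auto
    hence "((\<lambda>w. w /\<^sub>R norm w) \<longlongrightarrow> y) (nhds y)" using T(3) by (simp add: continuous_at_imp_continuous_at_within isCont_def tendsto_nhds_iff)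
    hence "\<forall>\<^sub>F w in nhds y. w /\<^sub>R norm w \<in> T" using T(1,2) by (rule topological_tendstoD)
    moreover have "\<forall>\<^sub>F w in nhds y. w \<noteq> 0" using T(3) by (intro t1_space_nhds) auto
    ultimately have "\<forall>\<^sub>F w in nhds y. w \<in> dual_cone G"
    proof eventually_elim
      case (elim w)
      hence "w /\<^sub>R norm w \<in> dual_cone G" using T(4) by auto
      from dual_cone_scaleR[OF _ this, of "norm w"] show ?case using elim by simp
    qed
    thus "y \<in> interior (dual_cone G)" unfolding eventually_nhds by (auto intro: interiorI)
  qed
  have "compact (closure (G' \<inter> sphere 0 1))"
    by (simp add: bounded_Int compact_closure)
  then obtain \<delta> where "\<delta> > 0" "(\<Union>y\<in>closure (G' \<inter> sphere 0 1). ball y \<delta>) \<subseteq> interior (dual_cone G)"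
    using compact_subset_open_imp_ball_epsilon_subset[OF _ open_interior sub] by blast
  hence "ball y \<delta> \<subseteq> dual_cone G" if "y \<in> G'" "norm y = 1" for y
    using that closure_subset[of "G' \<inter> sphere 0 1"] interior_subset[of "dual_cone G"] by fastforce
  thus ?thesis using \<open>\<delta> > 0\<close> that by blast
qed

text \<open>Moving \<open>y\<close> by \<open>\<delta> / 2\<close> against the direction of
  \<open>l\<close> stays in the dual cone, where the pairing with \<open>l\<close> is still
  nonnegative; half the radius is taken because the ball is open.\<close>

lemma inner_ge_of_ball_dual_cone:
  assumes "\<delta> > 0" "ball y \<delta> \<subseteq> dual_cone G" "l \<in> G"
  shows "\<delta> / 2 * norm l \<le> y \<bullet> l"
proof (cases "l = 0")
  case False
  have "dist y (y - (\<delta> / 2) *\<^sub>R (l /\<^sub>R norm l)) < \<delta>" using assms(1) False by (simp add: dist_norm)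
  hence "0 \<le> (y - (\<delta> / 2) *\<^sub>R (l /\<^sub>R norm l)) \<bullet> l" using assms by (intro dual_cone_inner) auto
  thus ?thesis using False by (simp add: inner_diff_left dot_square_norm power2_eq_square field_simps)
qed simp

text \<open>With the roles exchanged: here \<open>l\<close> is moved against the direction of
  \<open>y\<close> without leaving \<open>G\<close>, so one constant serves the entire dual
  cone.\<close>

lemma inner_ge_of_interior:
  fixes l :: "real ^ 'm"
  assumes "l \<in> interior G"
  shows "\<exists>\<delta>>0. \<forall>y\<in>dual_cone G. \<delta> * norm y \<le> y \<bullet> l"
proof -
  obtain r where r: "r > 0" "ball l r \<subseteq> G" using assms mem_interior by blast
  have "r / 2 * norm y \<le> y \<bullet> l" if y: "y \<in> dual_cone G" for y
  proof (cases "y = 0")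
    case False
    have "dist l (l - (r / 2) *\<^sub>R (y /\<^sub>R norm y)) < r" using r(1) False by (simp add: dist_norm)
    hence "0 \<le> y \<bullet> (l - (r / 2) *\<^sub>R (y /\<^sub>R norm y))" using r y by (intro dual_cone_inner) auto
    thus ?thesis using False by (simp add: inner_diff_right dot_square_norm power2_eq_square field_simps)
  qed simp
  thus ?thesis using r(1) half_gt_zero by blast
qed

lemma (in tube_extension) F_limit_cone:
  assumes G': "cone G'" and cc: "cone_cc G' K" and \<epsilon>: "\<epsilon> > 0"
  shows "\<exists>R. \<forall>z. Im_v z \<in> G' \<and> norm (Im_v z) \<ge> R \<longrightarrow> norm (F z - fc f 0) < \<epsilon>"
proof -
  obtain \<delta> where \<delta>: "\<delta> > 0" "\<And>y. y \<in> G' \<Longrightarrow> norm y = 1 \<Longrightarrow> ball y \<delta> \<subseteq> K" using cone_cc_dual_cone_ball[OF cc] by blast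
  have unit: "ball (y /\<^sub>R norm y) \<delta> \<subseteq> K" if "y \<in> G'" "y \<noteq> 0" for y
    using that G' by (intro \<delta>(2)) (auto simp: cone_def)
  show ?thesis
  proof (cases "\<exists>y\<in>G'. y \<noteq> 0")
    case True
    then obtain y0 where "y0 \<in> G'" "y0 \<noteq> 0" by blast
    hence b: "y0 /\<^sub>R norm y0 \<in> interior K" using \<delta>(1) unit unfolding mem_interior by blast
    define b where "b = y0 /\<^sub>R norm y0"
    show ?thesis
    proof (rule F_limit[OF _ \<epsilon> b[folded b_def]])
      show "\<exists>d>0. \<forall>y\<in>G'. d * norm y \<le> y \<bullet> l" if l: "fc f l \<noteq> 0" "l \<noteq> 0" for l
      proof (intro exI[of _ "\<delta> / 2 * norm l"] conjI ballI)
        fix y assume y: "y \<in> G'"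
        show "\<delta> / 2 * norm l * norm y \<le> y \<bullet> l"
        proof (cases "y = 0")
          case False
          have "\<delta> / 2 * norm l \<le> (y /\<^sub>R norm y) \<bullet> l" by (rule inner_ge_of_ball_dual_cone[OF \<delta>(1) unit[OF y False] spec[OF l(1)]])
          thus ?thesis using False by (simp add: field_simps)
        qed simp
      qed (use \<delta>(1) l(2) in simp)
      \<comment> \<open>Beyond \<open>norm b / \<delta>\<close> the vector \<open>b\<close>, divided
        by \<open>norm y\<close>, is shorter than \<open>\<delta>\<close>, so subtracting it from
        the unit vector along \<open>y\<close> does not leave the cone. The summand 1 makes the
        inequality strict and \<open>norm y\<close> positive.\<close>
      fix y assume y: "y \<in> G'" "norm y \<ge> norm b / \<delta> + 1"
      have n: "norm y > 0" "norm b < \<delta> * norm y"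
      proof -
        show "norm y > 0" by (rule less_le_trans[OF _ y(2)]) (use \<delta>(1) in \<open>simp add: add_nonneg_pos\<close>)
        have "norm b / \<delta> < norm y" using y(2) by linarith
        thus "norm b < \<delta> * norm y" using \<delta>(1) by (simp add: field_simps)
      qed
      hence "norm (b /\<^sub>R norm y) < \<delta>" by (simp add: field_simps)
      hence "y /\<^sub>R norm y - b /\<^sub>R norm y \<in> ball (y /\<^sub>R norm y) \<delta>" by (simp add: dist_norm)
      hence "y /\<^sub>R norm y - b /\<^sub>R norm y \<in> K" using unit[OF y(1)] n(1) by auto
      from dual_cone_scaleR[OF _ this, of "norm y"] show "y - b \<in> K" using n(1) by (simp add: scaleR_diff_right)
    qed
  next
    case False
    \<comment> \<open>\<open>G'\<close> contains no vector of norm at least 1, so the claim is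
      vacuous.\<close>
    thus ?thesis by (intro exI[of _ 1]) auto
  qed
qed

lemma (in tube_extension) F_limit_interior:
  assumes int: "\<And>l. fc f l \<noteq> 0 \<Longrightarrow> l \<in> interior G" and b: "b \<in> interior K" and \<epsilon>: "\<epsilon> > 0"
  shows "\<exists>R. \<forall>z. Im_v z \<in> (+) b ` K \<and> norm (Im_v z) \<ge> R \<longrightarrow> norm (F z - fc f 0) < \<epsilon>"
proof (rule F_limit[OF _ \<epsilon> b, where ?R0.0=0])
  show "\<exists>\<delta>>0. \<forall>y\<in>(+) b ` K. \<delta> * norm y \<le> y \<bullet> l" if "fc f l \<noteq> 0" for l
    using inner_ge_of_interior[OF int[OF that]] translate_subset_interior[OF b] interior_subset by blast
qed auto

section \<open>Choice of the polynomials and conclusion\<close>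

lemma tube_extension_exists:
  assumes f: "S1ap f" and spec: "\<And>l. fc f l \<noteq> 0 \<Longrightarrow> l \<in> G"
  obtains \<Lambda> c where "tube_extension G f \<Lambda> c"
proof -
  define P where "P k \<Lambda> c \<longleftrightarrow> finite \<Lambda> \<and> (\<forall>l\<in>\<Lambda>. fc f l \<noteq> 0) \<and> (fc f 0 \<noteq> 0 \<longrightarrow> 0 \<in> \<Lambda>) \<and> c 0 = fc f 0 \<and>
      snorm (\<lambda>x. f x - (\<Sum>l\<in>\<Lambda>. c l * ch l x)) \<le> ennreal (vanishing k)" for k \<Lambda> c
  have "\<exists>\<Lambda> c. P k \<Lambda> c" for k
  proof -
    have "vanishing k > 0" by simp
    show ?thesis
    proof (rule S1ap_approximation[OF f \<open>vanishing k > 0\<close>])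
      fix \<Lambda> c
      assume "finite \<Lambda>" "\<And>l. l \<in> \<Lambda> \<Longrightarrow> fc f l \<noteq> 0" "fc f 0 \<noteq> 0 \<Longrightarrow> 0 \<in> \<Lambda>" "c 0 = fc f 0"
        "snorm (\<lambda>x. f x - (\<Sum>l\<in>\<Lambda>. c l * ch l x)) \<le> ennreal (vanishing k)"
      hence "P k \<Lambda> c" unfolding P_def by (intro conjI ballI impI)
      thus "\<exists>\<Lambda> c. P k \<Lambda> c" by (intro exI)
    qed
  qed
  then obtain \<Lambda> c where P: "\<And>k. P k (\<Lambda> k) (c k)" unfolding choice_iff by metis
  have "tube_extension G f \<Lambda> c"
  proof
    fix k l
    show "finite (\<Lambda> k)" "l \<in> \<Lambda> k \<Longrightarrow> fc f l \<noteq> 0" "fc f 0 \<noteq> 0 \<Longrightarrow> 0 \<in> \<Lambda> k" "c k 0 = fc f 0"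
      "snorm (\<lambda>x. f x - (\<Sum>l\<in>\<Lambda> k. c k l * ch l x)) \<le> ennreal (vanishing k)"
      using P[of k] unfolding P_def by (elim conjE, assumption | blast)+
  qed (rule f spec; assumption)+
  thus ?thesis by (rule that)
qed

theorem theorem2:
  fixes p :: real and \<Gamma> :: "(real ^ 'm) set" and f :: "real ^ 'm \<Rightarrow> complex"
  assumes "p \<ge> 1"
    and "convex \<Gamma>" and "closed \<Gamma>" and "cone \<Gamma>"
    and "stepanoff_ap p {0} (real_ext f)"
    and "\<forall>l. fcoef (real_ext f) l 0 \<noteq> 0 \<longrightarrow> l \<in> \<Gamma>"
  shows "\<exists>F :: complex ^ 'm \<Rightarrow> complex.
    stepanoff_ap p (dual_cone \<Gamma>) F
    \<and> (\<forall>l. \<forall>y\<in>dual_cone \<Gamma>.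
          has_fcoef F l y (fcoef (real_ext f) l 0 * exp (- complex_of_real (y \<bullet> l))))
    \<and> (AE x in lborel. F (cvec x 0) = f x)
    \<and> (\<forall>b\<in>interior (dual_cone \<Gamma>).
          holo_on F (tube ((+) b ` dual_cone \<Gamma>)) \<and> bohr_ap ((+) b ` dual_cone \<Gamma>) F)
    \<and> (\<forall>\<Gamma>'. cone \<Gamma>' \<and> cone_cc \<Gamma>' (dual_cone \<Gamma>) \<longrightarrow>
          (\<forall>\<epsilon>>0. \<exists>R. \<forall>z. Im_v z \<in> \<Gamma>' \<and> norm (Im_v z) \<ge> R \<longrightarrow>
              norm (F z - fcoef (real_ext f) 0 0) < \<epsilon>))
    \<and> ((\<forall>l. fcoef (real_ext f) l 0 \<noteq> 0 \<longrightarrow> l \<in> interior \<Gamma>) \<longrightarrow>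
        (\<forall>b\<in>interior (dual_cone \<Gamma>). \<forall>\<epsilon>>0. \<exists>R. \<forall>z.
            Im_v z \<in> (+) b ` dual_cone \<Gamma> \<and> norm (Im_v z) \<ge> R \<longrightarrow>
              norm (F z - fcoef (real_ext f) 0 0) < \<epsilon>))"
proof -
  \<comment> \<open>From here on order 1 suffices; the order \<open>p\<close> returns only for the
    almost periodicity of \<open>F\<close> by Stepanoff.\<close>
  have S1: "S1ap f" by (rule S1ap_of_stepanoff_ap[OF assms(1,5)])
  have fc: "fcoef (real_ext f) l 0 = fc f l" for l by (rule fcoef_eq_fc[OF S1ap_sap[OF S1]])
  obtain \<Lambda> c where "tube_extension \<Gamma> f \<Lambda> c" using tube_extension_exists[OF S1, of \<Gamma>] assms(6) unfolding fc by blast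
  then interpret tube_extension \<Gamma> f \<Lambda> c .
  show ?thesis unfolding fc
  proof (intro exI[of _ F] conjI allI ballI impI)
    show "stepanoff_ap p (dual_cone \<Gamma>) F" by (rule F_stepanoff_ap[OF assms(1,5)])
    show "AE x in lborel. F (cvec x 0) = f x" by (rule F_real)
  next
    fix l y assume "y \<in> dual_cone \<Gamma>"
    thus "has_fcoef F l y (fc f l * exp (- complex_of_real (y \<bullet> l)))" by (rule F_has_fcoef)
  next
    fix b assume b: "b \<in> interior (dual_cone \<Gamma>)"
    show "holo_on F (tube ((+) b ` dual_cone \<Gamma>))" by (rule F_holo_on[OF b])
    show "bohr_ap ((+) b ` dual_cone \<Gamma>) F" by (rule F_bohr_ap[OF b])
  next
    fix \<Gamma>' :: "(real ^ 'm) set" and \<epsilon> :: real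
    assume "cone \<Gamma>' \<and> cone_cc \<Gamma>' (dual_cone \<Gamma>)" "\<epsilon> > 0"
    thus "\<exists>R. \<forall>z. Im_v z \<in> \<Gamma>' \<and> norm (Im_v z) \<ge> R \<longrightarrow> norm (F z - fc f 0) < \<epsilon>" by (elim conjE) (rule F_limit_cone)
  next
    fix b and \<epsilon> :: real
    assume int: "\<forall>l. fc f l \<noteq> 0 \<longrightarrow> l \<in> interior \<Gamma>" and b: "b \<in> interior (dual_cone \<Gamma>)" and \<epsilon>: "\<epsilon> > 0"
    show "\<exists>R. \<forall>z. Im_v z \<in> (+) b ` dual_cone \<Gamma> \<and> norm (Im_v z) \<ge> R \<longrightarrow> norm (F z - fc f 0) < \<epsilon>"
      by (rule F_limit_interior[OF _ b \<epsilon>]) (use int in blast)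
  qed
qed

end
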